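(* Let $A$ be a connected non-simple quadri-biserial algebra with ${}_AA=P\oplus L$, where $P$ is a maximal injective direct summand of ${}_AA$. Then $\mathrm{soc}\,P$ is a two-sided ideal in $A$ such that $A/\mathrm{soc}\,P$ is a quadri-string algebra with radical cubed zero. Moreover, every indecomposable non-projective-injective module in $\mathrm{mod}\,A$ is a module over $A/\mathrm{soc}\,P$.
   Context: $A$ is an artin $R$-algebra, where $R$ is a commutative artinian ring; $\mathrm{mod}\,A$ is the category of finitely generated left $A$-modules; ${}_AA$ is the left regular module; $A^\circ$ is the opposite algebra, and $\mathrm{mod}\,A^\circ$ is identified with the category of finitely generated right $A$-modules. "Radical cubed zero" for an algebra means that the cube of its Jacobson radical is zero. For a module $M$, $\mathrm{top}\,M=M/\mathrm{rad}\,M$, and $I_M$ denotes an injective envelope of $M$ (in the module category over the relevant algebra or its opposite in which $M$ lies). A module is local if its top is simple, colocal if its socle is simple, and projective-injective if it is both projective and injective. A module is uniserial if any two of its submodules are comparable under inclusion. "Is a module over $A/\mathrm{soc}\,P$" means it is annihilated by $\mathrm{soc}\,P$. An indecomposable module $M$ is biserial if it has two non-comparable uniserial submodules $M_1,M_2$ such that (i) $M_1+M_2$ is $M$ or the largest proper submodule of $M$, and (ii) $M_1\cap M_2$ is zero or the smallest nonzero submodule of $M$. A biserial module is astride biserial if it is local and not colocal. An artin algebra $A$ is biserial (respectively, string) if every indecomposable non-uniserial projective module in $\mathrm{mod}\,A$ or $\mathrm{mod}\,A^\circ$ is biserial (respectively, astride biserial). A biserial (respectively, string) artin algebra $A$ is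 quadri-biserial (respectively, quadri-string) if every indecomposable projective module $Q$ in $\mathrm{mod}\,A$ and in $\mathrm{mod}\,A^\circ$ satisfies: (1) the length of $Q$ is at most four; (2) if $\mathrm{top}(\mathrm{rad}\,Q)=S_1\oplus S_2$ with $S_1,S_2$ simple, then $I_{S_1}$ or $I_{S_2}$ is uniserial; (3) if $\mathrm{rad}\,Q=S\oplus M$ with $S$ simple and $M$ uniserial of length two, then $I_S$ and $I_{\mathrm{soc}\,M}$ are uniserial. *)

theory Defs
  imports "HOL-Algebra.Module" "HOL-Algebra.Ideal_Product" "HOL-Algebra.Chinese_Remainder"
begin

section \<open>Modules over rings that need not be commutative\<close>

text \<open>The locale \<^locale>\<open>module\<close> of HOL-Algebra is restricted to commutative rings; the record type
  \<open>('a, 'b) module\<close> and the locale \<^locale>\<open>submodule\<close> are not and are used here. As in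
  HOL-Algebra, the multiplication and unit fields of a module record carry no meaning.\<close>

locale left_module = A?: ring A + M?: abelian_group M
  for A :: "('a, 'x) ring_scheme" (structure) and M :: "('a, 'b) module" (structure) +
  assumes smult_closed [simp, intro]:
      "\<lbrakk>a \<in> carrier A; x \<in> carrier M\<rbrakk> \<Longrightarrow> a \<odot>\<^bsub>M\<^esub> x \<in> carrier M"
    and smult_l_distr:
      "\<lbrakk>a \<in> carrier A; b \<in> carrier A; x \<in> carrier M\<rbrakk>
        \<Longrightarrow> (a \<oplus> b) \<odot>\<^bsub>M\<^esub> x = a \<odot>\<^bsub>M\<^esub> x \<oplus>\<^bsub>M\<^esub> b \<odot>\<^bsub>M\<^esub> x"
    and smult_r_distr:
      "\<lbrakk>a \<in> carrier A; x \<in> carrier M; y \<in> carrier M\<rbrakk>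
        \<Longrightarrow> a \<odot>\<^bsub>M\<^esub> (x \<oplus>\<^bsub>M\<^esub> y) = a \<odot>\<^bsub>M\<^esub> x \<oplus>\<^bsub>M\<^esub> a \<odot>\<^bsub>M\<^esub> y"
    and smult_assoc:
      "\<lbrakk>a \<in> carrier A; b \<in> carrier A; x \<in> carrier M\<rbrakk>
        \<Longrightarrow> (a \<otimes> b) \<odot>\<^bsub>M\<^esub> x = a \<odot>\<^bsub>M\<^esub> (b \<odot>\<^bsub>M\<^esub> x)"
    and smult_one [simp]: "x \<in> carrier M \<Longrightarrow> \<one> \<odot>\<^bsub>M\<^esub> x = x"

text \<open>A ring \<open>A\<close> as a module along a ring homomorphism \<open>f\<close> into \<open>A\<close>.\<close>

definition scalar_module :: "('r \<Rightarrow> 'a) \<Rightarrow> ('a, 'x) ring_scheme \<Rightarrow> ('r, 'a) module" where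
  "scalar_module f A =
    \<lparr>carrier = carrier A, mult = mult A, one = \<one>\<^bsub>A\<^esub>, zero = \<zero>\<^bsub>A\<^esub>, add = add A,
     smult = (\<lambda>r x. f r \<otimes>\<^bsub>A\<^esub> x)\<rparr>"

abbreviation regular_module :: "('a, 'x) ring_scheme \<Rightarrow> ('a, 'a) module" where
  "regular_module A \<equiv> scalar_module (\<lambda>a. a) A"

text \<open>Right \<open>A\<close>-modules are left modules over the opposite ring.\<close>

definition opposite_ring :: "('a, 'x) ring_scheme \<Rightarrow> ('a, 'x) ring_scheme" where
  "opposite_ring A = A\<lparr>mult := (\<lambda>x y. y \<otimes>\<^bsub>A\<^esub> x)\<rparr>"

abbreviation sub :: "('a, 'b) module \<Rightarrow> 'b set \<Rightarrow> ('a, 'b) module" where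
  "sub M N \<equiv> M\<lparr>carrier := N\<rparr>"

definition quotient_module :: "('a, 'b) module \<Rightarrow> 'b set \<Rightarrow> ('a, 'b set) module" where
  "quotient_module M N =
    \<lparr>carrier = a_rcosets\<^bsub>M\<^esub> N, mult = (\<lambda>_ _. N), one = N, zero = N, add = set_add M,
     smult = (\<lambda>a C. \<Union>x\<in>C. N +>\<^bsub>M\<^esub> (a \<odot>\<^bsub>M\<^esub> x))\<rparr>"

definition module_hom ::
  "('a, 'x) ring_scheme \<Rightarrow> ('a, 'b) module \<Rightarrow> ('a, 'c) module \<Rightarrow> ('b \<Rightarrow> 'c) set" where
  "module_hom A M N =
    {f \<in> carrier M \<rightarrow> carrier N.
      (\<forall>x\<in>carrier M. \<forall>y\<in>carrier M. f (x \<oplus>\<^bsub>M\<^esub> y) = f x \<oplus>\<^bsub>N\<^esub> f y) \<and>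
      (\<forall>a\<in>carrier A. \<forall>x\<in>carrier M. f (a \<odot>\<^bsub>M\<^esub> x) = a \<odot>\<^bsub>N\<^esub> f x)}"

definition generated_submodule ::
  "('a, 'x) ring_scheme \<Rightarrow> ('a, 'b) module \<Rightarrow> 'b set \<Rightarrow> 'b set" where
  "generated_submodule A M B = \<Inter>{N. submodule N A M \<and> B \<subseteq> N}"

definition finitely_generated :: "('a, 'x) ring_scheme \<Rightarrow> ('a, 'b) module \<Rightarrow> bool" where
  "finitely_generated A M \<longleftrightarrow>
    (\<exists>B. finite B \<and> B \<subseteq> carrier M \<and> generated_submodule A M B = carrier M)"

definition fg_module :: "('a, 'x) ring_scheme \<Rightarrow> ('a, 'b) module \<Rightarrow> bool" where
  "fg_module A M \<longleftrightarrow> left_module A M \<and> finitely_generated A M"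

definition internal_direct_sum ::
  "('a, 'x) ring_scheme \<Rightarrow> ('a, 'b) module \<Rightarrow> 'b set \<Rightarrow> 'b set \<Rightarrow> bool" where
  "internal_direct_sum A M N K \<longleftrightarrow>
    submodule N A M \<and> submodule K A M \<and> N <+>\<^bsub>M\<^esub> K = carrier M \<and> N \<inter> K = {\<zero>\<^bsub>M\<^esub>}"

definition indecomposable :: "('a, 'x) ring_scheme \<Rightarrow> ('a, 'b) module \<Rightarrow> bool" where
  "indecomposable A M \<longleftrightarrow>
    carrier M \<noteq> {\<zero>\<^bsub>M\<^esub>} \<and>
    (\<forall>N K. internal_direct_sum A M N K \<longrightarrow> N = {\<zero>\<^bsub>M\<^esub>} \<or> K = {\<zero>\<^bsub>M\<^esub>})"

definition simple_module :: "('a, 'x) ring_scheme \<Rightarrow> ('a, 'b) module \<Rightarrow> bool" where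
  "simple_module A M \<longleftrightarrow>
    left_module A M \<and> carrier M \<noteq> {\<zero>\<^bsub>M\<^esub>} \<and>
    (\<forall>N. submodule N A M \<longrightarrow> N = {\<zero>\<^bsub>M\<^esub>} \<or> N = carrier M)"

definition maximal_submodule :: "'b set \<Rightarrow> ('a, 'x) ring_scheme \<Rightarrow> ('a, 'b) module \<Rightarrow> bool" where
  "maximal_submodule N A M \<longleftrightarrow>
    submodule N A M \<and> N \<noteq> carrier M \<and>
    (\<forall>K. submodule K A M \<and> N \<subseteq> K \<longrightarrow> K = N \<or> K = carrier M)"

definition radical :: "('a, 'x) ring_scheme \<Rightarrow> ('a, 'b) module \<Rightarrow> 'b set" where
  "radical A M = {x \<in> carrier M. \<forall>N. maximal_submodule N A M \<longrightarrow> x \<in> N}"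

definition socle :: "('a, 'x) ring_scheme \<Rightarrow> ('a, 'b) module \<Rightarrow> 'b set" where
  "socle A M = generated_submodule A M (\<Union>{S. submodule S A M \<and> simple_module A (sub M S)})"

definition top_module :: "('a, 'x) ring_scheme \<Rightarrow> ('a, 'b) module \<Rightarrow> ('a, 'b set) module" where
  "top_module A M = quotient_module M (radical A M)"

definition local_module :: "('a, 'x) ring_scheme \<Rightarrow> ('a, 'b) module \<Rightarrow> bool" where
  "local_module A M \<longleftrightarrow> simple_module A (top_module A M)"

definition colocal_module :: "('a, 'x) ring_scheme \<Rightarrow> ('a, 'b) module \<Rightarrow> bool" where
  "colocal_module A M \<longleftrightarrow> simple_module A (sub M (socle A M))"

definition uniserial :: "('a, 'x) ring_scheme \<Rightarrow> ('a, 'b) module \<Rightarrow> bool" where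
  "uniserial A M \<longleftrightarrow> (\<forall>N K. submodule N A M \<and> submodule K A M \<longrightarrow> N \<subseteq> K \<or> K \<subseteq> N)"

definition has_length :: "('a, 'x) ring_scheme \<Rightarrow> ('a, 'b) module \<Rightarrow> nat \<Rightarrow> bool" where
  "has_length A M n \<longleftrightarrow>
    (\<exists>C. C 0 = {\<zero>\<^bsub>M\<^esub>} \<and> C n = carrier M \<and> (\<forall>i\<le>n. submodule (C i) A M) \<and>
      (\<forall>i<n. C i \<subseteq> C (Suc i) \<and> simple_module A (quotient_module (sub M (C (Suc i))) (C i))))"

text \<open>Every finitely generated \<open>A\<close>-module is a quotient of some \<open>A\<^sup>n\<close>, whose elements are
  functions from \<open>{0..<n}\<close> to \<open>A\<close>. So the following type of modules contains a copy of every
  finitely generated \<open>A\<close>-module, and it suffices to quantify over it in the definitions below.\<close>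

type_synonym 'a cmod = "('a, (nat \<Rightarrow> 'a) set) module"

definition projective :: "('a, 'x) ring_scheme \<Rightarrow> ('a, 'b) module \<Rightarrow> bool" where
  "projective A Q \<longleftrightarrow>
    fg_module A Q \<and>
    (\<forall>(X :: 'a cmod) (Y :: 'a cmod). fg_module A X \<and> fg_module A Y \<longrightarrow>
      (\<forall>g\<in>module_hom A X Y. g ` carrier X = carrier Y \<longrightarrow>
        (\<forall>h\<in>module_hom A Q Y. \<exists>k\<in>module_hom A Q X. \<forall>x\<in>carrier Q. g (k x) = h x)))"

definition injective :: "('a, 'x) ring_scheme \<Rightarrow> ('a, 'b) module \<Rightarrow> bool" where
  "injective A E \<longleftrightarrow>
    fg_module A E \<and>
    (\<forall>(X :: 'a cmod) (Y :: 'a cmod). fg_module A X \<and> fg_module A Y \<longrightarrow>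
      (\<forall>g\<in>module_hom A X Y. inj_on g (carrier X) \<longrightarrow>
        (\<forall>h\<in>module_hom A X E. \<exists>k\<in>module_hom A Y E. \<forall>x\<in>carrier X. k (g x) = h x)))"

definition injective_envelope ::
  "('a, 'x) ring_scheme \<Rightarrow> ('a, 'b) module \<Rightarrow> ('a, 'c) module \<Rightarrow> ('b \<Rightarrow> 'c) \<Rightarrow> bool" where
  "injective_envelope A M E f \<longleftrightarrow>
    injective A E \<and> f \<in> module_hom A M E \<and> inj_on f (carrier M) \<and>
    (\<forall>N. submodule N A E \<and> N \<inter> f ` carrier M = {\<zero>\<^bsub>E\<^esub>} \<longrightarrow> N = {\<zero>\<^bsub>E\<^esub>})"

text \<open>Injective envelopes are unique up to isomorphism, so it does not matter which one is taken.\<close>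

definition uniserial_envelope :: "('a, 'x) ring_scheme \<Rightarrow> ('a, 'b) module \<Rightarrow> bool" where
  "uniserial_envelope A M \<longleftrightarrow>
    (\<exists>(E :: 'a cmod) f. injective_envelope A M E f \<and> uniserial A E)"

section \<open>Biserial modules\<close>


definition largest_proper_submodule ::
  "'b set \<Rightarrow> ('a, 'x) ring_scheme \<Rightarrow> ('a, 'b) module \<Rightarrow> bool" where
  "largest_proper_submodule N A M \<longleftrightarrow>
    submodule N A M \<and> N \<noteq> carrier M \<and>
    (\<forall>K. submodule K A M \<and> K \<noteq> carrier M \<longrightarrow> K \<subseteq> N)"

definition smallest_nonzero_submodule ::
  "'b set \<Rightarrow> ('a, 'x) ring_scheme \<Rightarrow> ('a, 'b) module \<Rightarrow> bool" where
  "smallest_nonzero_submodule N A M \<longleftrightarrow>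
    submodule N A M \<and> N \<noteq> {\<zero>\<^bsub>M\<^esub>} \<and>
    (\<forall>K. submodule K A M \<and> K \<noteq> {\<zero>\<^bsub>M\<^esub>} \<longrightarrow> N \<subseteq> K)"

definition biserial_module :: "('a, 'x) ring_scheme \<Rightarrow> ('a, 'b) module \<Rightarrow> bool" where
  "biserial_module A M \<longleftrightarrow>
    indecomposable A M \<and>
    (\<exists>N K. submodule N A M \<and> submodule K A M \<and>
      uniserial A (sub M N) \<and> uniserial A (sub M K) \<and> \<not> N \<subseteq> K \<and> \<not> K \<subseteq> N \<and>
      (N <+>\<^bsub>M\<^esub> K = carrier M \<or> largest_proper_submodule (N <+>\<^bsub>M\<^esub> K) A M) \<and>
      (N \<inter> K = {\<zero>\<^bsub>M\<^esub>} \<or> smallest_nonzero_submodule (N \<inter> K) A M))"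

definition astride_biserial_module :: "('a, 'x) ring_scheme \<Rightarrow> ('a, 'b) module \<Rightarrow> bool" where
  "astride_biserial_module A M \<longleftrightarrow>
    biserial_module A M \<and> local_module A M \<and> \<not> colocal_module A M"

section \<open>Artin algebras\<close>

definition artinian_ring :: "('r, 'x) ring_scheme \<Rightarrow> bool" where
  "artinian_ring R \<longleftrightarrow>
    cring R \<and>
    (\<forall>I :: nat \<Rightarrow> 'r set. (\<forall>n. ideal (I n) R \<and> I (Suc n) \<subseteq> I n) \<longrightarrow> (\<exists>n. \<forall>m\<ge>n. I m = I n))"

text \<open>The algebra structure is given by its structure map \<open>\<phi> : R \<rightarrow> A\<close> into the center.\<close>

definition artin_algebra ::
  "('r, 'x) ring_scheme \<Rightarrow> ('r \<Rightarrow> 'a) \<Rightarrow> ('a, 'y) ring_scheme \<Rightarrow> bool" where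
  "artin_algebra R \<phi> A \<longleftrightarrow>
    artinian_ring R \<and> ring A \<and> \<phi> \<in> ring_hom R A \<and>
    (\<forall>r\<in>carrier R. \<forall>x\<in>carrier A. \<phi> r \<otimes>\<^bsub>A\<^esub> x = x \<otimes>\<^bsub>A\<^esub> \<phi> r) \<and>
    finitely_generated R (scalar_module \<phi> A)"

text \<open>The factors in a direct product decomposition of \<open>A\<close> are isomorphic to ideals of \<open>A\<close>, so it
  suffices to consider rings over the element type of \<open>A\<close>; they inherit the algebra structure.\<close>

definition connected_algebra :: "('a, 'x) ring_scheme \<Rightarrow> bool" where
  "connected_algebra A \<longleftrightarrow>
    carrier A \<noteq> {\<zero>\<^bsub>A\<^esub>} \<and>
    \<not> (\<exists>(B :: 'a ring) (C :: 'a ring). ring B \<and> ring C \<and>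
        carrier B \<noteq> {\<zero>\<^bsub>B\<^esub>} \<and> carrier C \<noteq> {\<zero>\<^bsub>C\<^esub>} \<and> ring_iso A (RDirProd B C) \<noteq> {})"

definition simple_algebra :: "('a, 'x) ring_scheme \<Rightarrow> bool" where
  "simple_algebra A \<longleftrightarrow>
    carrier A \<noteq> {\<zero>\<^bsub>A\<^esub>} \<and> (\<forall>I. ideal I A \<longrightarrow> I = {\<zero>\<^bsub>A\<^esub>} \<or> I = carrier A)"

definition radical_cubed_zero :: "('a, 'x) ring_scheme \<Rightarrow> bool" where
  "radical_cubed_zero A \<longleftrightarrow>
    (let J = radical A (regular_module A) in ideal_prod A (ideal_prod A J J) J = {\<zero>\<^bsub>A\<^esub>})"

definition biserial_algebra ::
  "('r, 'x) ring_scheme \<Rightarrow> ('r \<Rightarrow> 'a) \<Rightarrow> ('a, 'y) ring_scheme \<Rightarrow> bool" where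
  "biserial_algebra R \<phi> A \<longleftrightarrow>
    artin_algebra R \<phi> A \<and>
    (\<forall>B\<in>{A, opposite_ring A}. \<forall>Q :: 'a cmod.
      indecomposable B Q \<and> projective B Q \<and> \<not> uniserial B Q \<longrightarrow> biserial_module B Q)"

definition string_algebra ::
  "('r, 'x) ring_scheme \<Rightarrow> ('r \<Rightarrow> 'a) \<Rightarrow> ('a, 'y) ring_scheme \<Rightarrow> bool" where
  "string_algebra R \<phi> A \<longleftrightarrow>
    artin_algebra R \<phi> A \<and>
    (\<forall>B\<in>{A, opposite_ring A}. \<forall>Q :: 'a cmod.
      indecomposable B Q \<and> projective B Q \<and> \<not> uniserial B Q \<longrightarrow> astride_biserial_module B Q)"

definition quadri_condition :: "('a, 'x) ring_scheme \<Rightarrow> ('a, 'b) module \<Rightarrow> bool" where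
  "quadri_condition A Q \<longleftrightarrow>
    (let radQ = sub Q (radical A Q); T = top_module A radQ in
      (\<exists>n\<le>4. has_length A Q n) \<and>
      (\<forall>S\<^sub>1 S\<^sub>2. internal_direct_sum A T S\<^sub>1 S\<^sub>2 \<and>
          simple_module A (sub T S\<^sub>1) \<and> simple_module A (sub T S\<^sub>2) \<longrightarrow>
        uniserial_envelope A (sub T S\<^sub>1) \<or> uniserial_envelope A (sub T S\<^sub>2)) \<and>
      (\<forall>S M. internal_direct_sum A radQ S M \<and> simple_module A (sub Q S) \<and>
          uniserial A (sub Q M) \<and> has_length A (sub Q M) 2 \<longrightarrow>
        uniserial_envelope A (sub Q S) \<and> uniserial_envelope A (sub Q (socle A (sub Q M)))))"

definition quadri_biserial_algebra ::
  "('r, 'x) ring_scheme \<Rightarrow> ('r \<Rightarrow> 'a) \<Rightarrow> ('a, 'y) ring_scheme \<Rightarrow> bool" where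
  "quadri_biserial_algebra R \<phi> A \<longleftrightarrow>
    biserial_algebra R \<phi> A \<and>
    (\<forall>B\<in>{A, opposite_ring A}. \<forall>Q :: 'a cmod.
      indecomposable B Q \<and> projective B Q \<longrightarrow> quadri_condition B Q)"

definition quadri_string_algebra ::
  "('r, 'x) ring_scheme \<Rightarrow> ('r \<Rightarrow> 'a) \<Rightarrow> ('a, 'y) ring_scheme \<Rightarrow> bool" where
  "quadri_string_algebra R \<phi> A \<longleftrightarrow>
    string_algebra R \<phi> A \<and>
    (\<forall>B\<in>{A, opposite_ring A}. \<forall>Q :: 'a cmod.
      indecomposable B Q \<and> projective B Q \<longrightarrow> quadri_condition B Q)"

definition injective_summand :: "('a, 'x) ring_scheme \<Rightarrow> 'a set \<Rightarrow> bool" where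
  "injective_summand A P \<longleftrightarrow>
    (\<exists>L. internal_direct_sum A (regular_module A) P L) \<and> injective A (sub (regular_module A) P)"

definition maximal_injective_summand :: "('a, 'x) ring_scheme \<Rightarrow> 'a set \<Rightarrow> bool" where
  "maximal_injective_summand A P \<longleftrightarrow>
    injective_summand A P \<and> (\<forall>P'. injective_summand A P' \<and> P \<subseteq> P' \<longrightarrow> P' = P)"

definition annihilates :: "'a set \<Rightarrow> ('a, 'b) module \<Rightarrow> bool" where
  "annihilates I M \<longleftrightarrow> (\<forall>a\<in>I. \<forall>x\<in>carrier M. a \<odot>\<^bsub>M\<^esub> x = \<zero>\<^bsub>M\<^esub>)"

end

theory Submission
  imports Defs
begin

text \<open>Everything is read off from the left ideals \<open>A e\<close> and right ideals \<open>f A\<close> generated by primitive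
  idempotents. Say that \<open>(e, f)\<close> is a pair if \<open>f A e\<close> contains an element \<open>s\<close> such that \<open>A s\<close> and \<open>s A\<close>
  are the smallest nonzero one-sided ideals in \<open>A e\<close> and \<open>f A\<close>; by Fuller's theorem \<open>A e\<close> is then
  injective, and every injective \<open>A e\<close> arises in this way. As all \<open>A e\<close> and \<open>f A\<close> have length at most four,
  a nonzero element of \<open>f J\<^sup>3 e\<close> yields a pair, and so does every \<open>A e\<close> that has a simple socle and
  is not uniserial. Hence \<open>J\<^sup>3\<close> lies in \<open>soc P\<close>, and the second fact makes the projective modules over
  \<open>A/soc P\<close> astride.

  A simple \<open>S \<subseteq> P\<close> has an injective hull \<open>E\<close> among the left ideals, and a homomorphism from \<open>E\<close> that
  does not vanish on \<open>S\<close> is injective and splits. So \<open>soc P\<close> is a two-sided ideal, it annihilates the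
  indecomposable modules that are not projective-injective, and \<open>(soc P) e\<close> lies in every nonzero left
  ideal in \<open>A e\<close>, and similarly on the right. The indecomposable projective modules over \<open>A/soc P\<close>
  are therefore quotients of modules \<open>A e\<close> by a submodule that lies in every nonzero submodule,
  and the quadri conditions pass to such quotients.\<close>

section \<open>One-sided ideals and the opposite ring\<close>

text \<open>Most of the work goes into the claim that a colocal \<open>A e\<close> which is not
  uniserial is injective. Two incomparable left ideals \<open>N\<close>, \<open>K\<close> in it use
  up the length four, so that \<open>S < N, K < W < A e\<close> with socle \<open>S\<close> and
  radical \<open>W\<close>. The bound four for \<open>f A\<close> then leaves two cases: either
  \<open>s A\<close> is the smallest right ideal in \<open>f A\<close>, or a quotient of
  \<open>f J\<close> that pairs nondegenerately with \<open>W/S\<close> is simple. The second case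
  would make \<open>W/S\<close> cyclic, by a comparison of lengths over the base ring. This
  comparison is made with additive relations on a corner \<open>g W\<close>, which is stable under
  central scalars but in general not a left ideal; therefore the chain condition is imposed on all
  scalar submodules. Lengths enter as upper bounds that a given chain exhausts, so they are modelled
  by strictly monotone functions into the naturals. The ring-level hypotheses are symmetric, and
  right ideals are left ideals of the opposite ring. But \<open>soc P\<close> comes from a left
  module, so its behaviour in right ideals needs an argument of its own, through the converse half
  of Fuller's theorem.\<close>

definition lideal :: "('a, 'x) ring_scheme \<Rightarrow> 'a set \<Rightarrow> bool" where
  "lideal A N \<longleftrightarrow> N \<subseteq> carrier A \<and> \<zero>\<^bsub>A\<^esub> \<in> N \<and> (\<forall>x\<in>N. \<forall>y\<in>N. x \<oplus>\<^bsub>A\<^esub> y \<in> N) \<and>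
    (\<forall>a\<in>carrier A. \<forall>x\<in>N. a \<otimes>\<^bsub>A\<^esub> x \<in> N)"

abbreviation rideal :: "('a, 'x) ring_scheme \<Rightarrow> 'a set \<Rightarrow> bool" where
  "rideal A \<equiv> lideal (opposite_ring A)"

definition lprinc :: "('a, 'x) ring_scheme \<Rightarrow> 'a \<Rightarrow> 'a set" where
  "lprinc A x = (\<lambda>a. a \<otimes>\<^bsub>A\<^esub> x) ` carrier A"

abbreviation rprinc :: "('a, 'x) ring_scheme \<Rightarrow> 'a \<Rightarrow> 'a set" where
  "rprinc A \<equiv> lprinc (opposite_ring A)"

definition primitive :: "('a, 'x) ring_scheme \<Rightarrow> 'a \<Rightarrow> bool" where
  "primitive A e \<longleftrightarrow> e \<in> carrier A \<and> e \<noteq> \<zero>\<^bsub>A\<^esub> \<and> e \<otimes>\<^bsub>A\<^esub> e = e \<and>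
    (\<forall>u\<in>carrier A. \<forall>v\<in>carrier A. u \<otimes>\<^bsub>A\<^esub> u = u \<and> v \<otimes>\<^bsub>A\<^esub> v = v \<and> u \<otimes>\<^bsub>A\<^esub> v = \<zero>\<^bsub>A\<^esub> \<and>
      v \<otimes>\<^bsub>A\<^esub> u = \<zero>\<^bsub>A\<^esub> \<and> u \<oplus>\<^bsub>A\<^esub> v = e \<longrightarrow> u = \<zero>\<^bsub>A\<^esub> \<or> v = \<zero>\<^bsub>A\<^esub>)"

text \<open>For the rings considered below this is the Jacobson radical; the definition is chosen because
  it is visibly invariant under passing to the opposite ring.\<close>

definition jac :: "('a, 'x) ring_scheme \<Rightarrow> 'a set" where
  "jac A = {x \<in> carrier A. \<forall>e. primitive A e \<longrightarrow>
    (\<forall>b\<in>carrier A. \<forall>a\<in>carrier A. b \<otimes>\<^bsub>A\<^esub> x \<otimes>\<^bsub>A\<^esub> a \<noteq> e)}"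

text \<open>Says that \<open>X/Y\<close> is a simple module, in terms of left ideals only, so that
  composition series can be used before any quotient module is formed.\<close>

definition covers :: "('a, 'x) ring_scheme \<Rightarrow> 'a set \<Rightarrow> 'a set \<Rightarrow> bool" where
  "covers A X Y \<longleftrightarrow> lideal A X \<and> lideal A Y \<and> Y \<subset> X \<and>
    (\<forall>Z. lideal A Z \<and> Y \<subseteq> Z \<and> Z \<subseteq> X \<longrightarrow> Z = Y \<or> Z = X)"

definition smallest_lideal :: "('a, 'x) ring_scheme \<Rightarrow> 'a set \<Rightarrow> 'a set \<Rightarrow> bool" where
  "smallest_lideal A S X \<longleftrightarrow> lideal A S \<and> S \<noteq> {\<zero>\<^bsub>A\<^esub>} \<and> S \<subseteq> X \<and>
    (\<forall>Z. lideal A Z \<and> Z \<subseteq> X \<and> Z \<noteq> {\<zero>\<^bsub>A\<^esub>} \<longrightarrow> S \<subseteq> Z)"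

text \<open>A stand-in for the length of the left ideals inside \<open>X\<close>. Along a strict
  chain \<open>d\<close> grows by at least one at each step, so a bound on \<open>d X\<close> limits
  all chains, and a chain that exhausts the bound has all its values forced.\<close>

definition lmono :: "('a, 'x) ring_scheme \<Rightarrow> 'a set \<Rightarrow> ('a set \<Rightarrow> nat) \<Rightarrow> bool" where
  "lmono A X d \<longleftrightarrow> (\<forall>Y Z. lideal A Y \<and> lideal A Z \<and> Y \<subset> Z \<and> Z \<subseteq> X \<longrightarrow> d Y < d Z)"

text \<open>Corners such as \<open>{y \<in> W. g \<otimes> y = y}\<close> are stable under central
  scalars without being left ideals, and chain conditions are needed for them too. Closure under
  negatives is a separate clause because \<open>C\<close> need not contain
  \<open>\<ominus> \<one>\<close>.\<close>

definition scalar_submodule :: "('a, 'x) ring_scheme \<Rightarrow> 'a set \<Rightarrow> 'a set \<Rightarrow> bool" where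
  "scalar_submodule A C N \<longleftrightarrow> N \<subseteq> carrier A \<and> \<zero>\<^bsub>A\<^esub> \<in> N \<and> (\<forall>x\<in>N. \<forall>y\<in>N. x \<oplus>\<^bsub>A\<^esub> y \<in> N) \<and>
    (\<forall>x\<in>N. \<ominus>\<^bsub>A\<^esub> x \<in> N) \<and> (\<forall>a\<in>C. \<forall>x\<in>N. a \<otimes>\<^bsub>A\<^esub> x \<in> N)"

lemma opposite_ring_simps [simp]:
  "carrier (opposite_ring A) = carrier A" "\<zero>\<^bsub>opposite_ring A\<^esub> = \<zero>\<^bsub>A\<^esub>" "\<one>\<^bsub>opposite_ring A\<^esub> = \<one>\<^bsub>A\<^esub>"
  "x \<oplus>\<^bsub>opposite_ring A\<^esub> y = x \<oplus>\<^bsub>A\<^esub> y" "x \<otimes>\<^bsub>opposite_ring A\<^esub> y = y \<otimes>\<^bsub>A\<^esub> x"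
  by (simp_all add: opposite_ring_def)

lemma opposite_ring_opposite [simp]: "opposite_ring (opposite_ring A) = A"
  by (simp add: opposite_ring_def)

lemma opposite_ring_a_inv [simp]: "\<ominus>\<^bsub>opposite_ring A\<^esub> x = \<ominus>\<^bsub>A\<^esub> x"
  by (simp add: a_inv_def opposite_ring_def m_inv_def)

lemma opposite_ring_minus [simp]: "x \<ominus>\<^bsub>opposite_ring A\<^esub> y = x \<ominus>\<^bsub>A\<^esub> y"
  by (simp add: a_minus_def)

lemma ring_opposite: "ring A \<Longrightarrow> ring (opposite_ring A)"
proof -
  assume "ring A"
  then interpret ring A .
  show ?thesis
    by unfold_locales
      (auto simp: Units_def l_distr r_distr m_assoc a_ac opposite_ring_def intro: r_neg l_neg add.r_inv_ex)
qed

lemma primitive_opposite [simp]: "primitive (opposite_ring A) e = primitive A e"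
  unfolding primitive_def by auto

lemma jac_opposite: "ring A \<Longrightarrow> jac (opposite_ring A) = jac A"
proof -
  assume "ring A"
  then interpret ring A .
  show ?thesis unfolding jac_def by (auto simp: m_assoc[symmetric]) (auto simp: m_assoc)
qed

lemma lideal_rideal_iff:
  "rideal A N \<longleftrightarrow> N \<subseteq> carrier A \<and> \<zero>\<^bsub>A\<^esub> \<in> N \<and> (\<forall>x\<in>N. \<forall>y\<in>N. x \<oplus>\<^bsub>A\<^esub> y \<in> N) \<and>
    (\<forall>a\<in>carrier A. \<forall>x\<in>N. x \<otimes>\<^bsub>A\<^esub> a \<in> N)"
  by (simp add: lideal_def)

lemma rprinc_iff: "rprinc A x = (\<lambda>a. x \<otimes>\<^bsub>A\<^esub> a) ` carrier A"
  by (simp add: lprinc_def)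

lemma mem_set_add: "x \<in> X <+>\<^bsub>A\<^esub> Y \<longleftrightarrow> (\<exists>a\<in>X. \<exists>b\<in>Y. x = a \<oplus>\<^bsub>A\<^esub> b)"
  by (auto simp: set_add_def set_mult_def)

lemma lidealD:
  assumes "lideal A N"
  shows "N \<subseteq> carrier A" "\<zero>\<^bsub>A\<^esub> \<in> N" "\<And>x. x \<in> N \<Longrightarrow> x \<in> carrier A"
    "\<And>x y. x \<in> N \<Longrightarrow> y \<in> N \<Longrightarrow> x \<oplus>\<^bsub>A\<^esub> y \<in> N"
    "\<And>a x. a \<in> carrier A \<Longrightarrow> x \<in> N \<Longrightarrow> a \<otimes>\<^bsub>A\<^esub> x \<in> N"
  using assms by (auto simp: lideal_def)

context ring
begin

lemma lideal_minus: "lideal R N \<Longrightarrow> x \<in> N \<Longrightarrow> \<ominus> x \<in> N"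
  using lidealD[of R N] l_minus[of \<one> x] by (metis add.inv_closed l_one one_closed)

lemma lideal_diff: "lideal R N \<Longrightarrow> x \<in> N \<Longrightarrow> y \<in> N \<Longrightarrow> x \<ominus> y \<in> N"
  unfolding minus_eq by (simp add: lideal_minus lidealD)

lemma lideal_Int: "lideal R N \<Longrightarrow> lideal R K \<Longrightarrow> lideal R (N \<inter> K)"
  by (auto simp: lideal_def)

lemma lideal_zero [simp]: "lideal R {\<zero>}"
  by (auto simp: lideal_def)

lemma lideal_carrier [simp]: "lideal R (carrier R)"
  by (auto simp: lideal_def)

lemma lideal_lprinc [simp]: "x \<in> carrier R \<Longrightarrow> lideal R (lprinc R x)"
  unfolding lideal_def lprinc_def
proof (intro conjI ballI)
  assume x: "x \<in> carrier R"
  show "\<zero> \<in> (\<lambda>a. a \<otimes> x) ` carrier R" using x by (auto intro!: image_eqI[of _ _ \<zero>])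
  fix y z assume "y \<in> (\<lambda>a. a \<otimes> x) ` carrier R" "z \<in> (\<lambda>a. a \<otimes> x) ` carrier R"
  then obtain a b where "a \<in> carrier R" "b \<in> carrier R" "y = a \<otimes> x" "z = b \<otimes> x" by auto
  then show "y \<oplus> z \<in> (\<lambda>a. a \<otimes> x) ` carrier R" using x
    by (auto intro!: image_eqI[of _ _ "a \<oplus> b"] simp: l_distr)
next
  fix b y assume "x \<in> carrier R" "b \<in> carrier R" "y \<in> (\<lambda>a. a \<otimes> x) ` carrier R"
  then obtain a where "a \<in> carrier R" "y = a \<otimes> x" by auto
  then show "b \<otimes> y \<in> (\<lambda>a. a \<otimes> x) ` carrier R" using \<open>b \<in> carrier R\<close> \<open>x \<in> carrier R\<close>
    by (auto intro!: image_eqI[of _ _ "b \<otimes> a"] simp: m_assoc)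
qed auto

lemma lprinc_self [simp]: "x \<in> carrier R \<Longrightarrow> x \<in> lprinc R x"
  by (auto simp: lprinc_def intro!: image_eqI[of _ _ \<one>])

lemma lprinc_subset: "lideal R N \<Longrightarrow> x \<in> N \<Longrightarrow> lprinc R x \<subseteq> N"
  by (auto simp: lideal_def lprinc_def)

lemma lprincI: "a \<in> carrier R \<Longrightarrow> a \<otimes> x \<in> lprinc R x"
  by (auto simp: lprinc_def)

lemma lprincE: "y \<in> lprinc R x \<Longrightarrow> (\<And>a. a \<in> carrier R \<Longrightarrow> y = a \<otimes> x \<Longrightarrow> thesis) \<Longrightarrow> thesis"
  by (auto simp: lprinc_def)

lemma lprinc_idem:
  assumes "e \<in> carrier R" "e \<otimes> e = e"
  shows "x \<in> lprinc R e \<longleftrightarrow> x \<in> carrier R \<and> x \<otimes> e = x"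
  using assms by (auto simp: lprinc_def m_assoc) (metis image_eqI)

lemma lideal_add: 
  assumes "lideal R X" "lideal R Y"
  shows "lideal R (X <+>\<^bsub>R\<^esub> Y)"
  unfolding lideal_def
proof (intro conjI ballI)
  note X = lidealD[OF assms(1)] and Y = lidealD[OF assms(2)]
  show "X <+>\<^bsub>R\<^esub> Y \<subseteq> carrier R" using X(3) Y(3) by (auto simp: mem_set_add)
  show "\<zero> \<in> X <+>\<^bsub>R\<^esub> Y" using X(2) Y(2) by (force simp: mem_set_add)
  show "x \<oplus> y \<in> X <+>\<^bsub>R\<^esub> Y" if "x \<in> X <+>\<^bsub>R\<^esub> Y" "y \<in> X <+>\<^bsub>R\<^esub> Y" for x y
  proof -
    from that obtain a b c d where "a \<in> X" "b \<in> Y" "c \<in> X" "d \<in> Y" "x = a \<oplus> b" "y = c \<oplus> d"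
      by (auto simp: mem_set_add)
    moreover from this have "a \<in> carrier R" "b \<in> carrier R" "c \<in> carrier R" "d \<in> carrier R"
      using X(3) Y(3) by auto
    ultimately have "x \<oplus> y = (a \<oplus> c) \<oplus> (b \<oplus> d)" by (simp add: a_ac)
    moreover have "a \<oplus> c \<in> X" "b \<oplus> d \<in> Y"
      using X(4) Y(4) \<open>a \<in> X\<close> \<open>c \<in> X\<close> \<open>b \<in> Y\<close> \<open>d \<in> Y\<close> by blast+
    ultimately show ?thesis unfolding mem_set_add by blast
  qed
  show "a \<otimes> x \<in> X <+>\<^bsub>R\<^esub> Y" if "a \<in> carrier R" "x \<in> X <+>\<^bsub>R\<^esub> Y" for a x
  proof -
    from that obtain b c where bc: "b \<in> X" "c \<in> Y" "x = b \<oplus> c" by (auto simp: mem_set_add)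
    then have "a \<otimes> x = a \<otimes> b \<oplus> a \<otimes> c" using X(3) Y(3) that(1) by (simp add: r_distr)
    moreover have "a \<otimes> b \<in> X" "a \<otimes> c \<in> Y" using X(5) Y(5) that(1) bc by blast+
    ultimately show ?thesis unfolding mem_set_add by blast
  qed
qed

lemma lideal_add_upper:
  assumes "lideal R X" "lideal R Y"
  shows "X \<subseteq> X <+>\<^bsub>R\<^esub> Y" "Y \<subseteq> X <+>\<^bsub>R\<^esub> Y"
  using lidealD[OF assms(1)] lidealD[OF assms(2)] by (force simp: mem_set_add)+

lemma lideal_add_least: "lideal R Z \<Longrightarrow> X \<subseteq> Z \<Longrightarrow> Y \<subseteq> Z \<Longrightarrow> X <+>\<^bsub>R\<^esub> Y \<subseteq> Z"
  by (auto simp: mem_set_add lidealD subset_iff)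

lemma lideal_image: 
  assumes "lideal R X" "m \<in> carrier R" shows "lideal R ((\<lambda>x. x \<otimes> m) ` X)"
  unfolding lideal_def
proof (intro conjI ballI)
  note X = lidealD[OF assms(1)]
  show "(\<lambda>x. x \<otimes> m) ` X \<subseteq> carrier R" "\<zero> \<in> (\<lambda>x. x \<otimes> m) ` X"
    using assms(2) X by (auto intro!: image_eqI[of _ _ \<zero>])
  show "x \<oplus> y \<in> (\<lambda>x. x \<otimes> m) ` X" if xy: "x \<in> (\<lambda>x. x \<otimes> m) ` X" "y \<in> (\<lambda>x. x \<otimes> m) ` X" for x y
  proof -
    from xy obtain a b where "a \<in> X" "b \<in> X" "x = a \<otimes> m" "y = b \<otimes> m" by auto
    then show ?thesis using X assms(2) by (auto intro!: image_eqI[of _ _ "a \<oplus> b"] simp: l_distr)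
  qed
  show "a \<otimes> x \<in> (\<lambda>x. x \<otimes> m) ` X" if xy: "x \<in> (\<lambda>x. x \<otimes> m) ` X" "a \<in> carrier R" for a x
  proof -
    from xy obtain b where "b \<in> X" "x = b \<otimes> m" by auto
    then show ?thesis using X assms(2) xy by (auto intro!: image_eqI[of _ _ "a \<otimes> b"] simp: m_assoc)
  qed
qed

lemma lideal_vimage:
  assumes "lideal R X" "m \<in> carrier R" "lideal R Y" 
  shows "lideal R {x \<in> X. x \<otimes> m \<in> Y}"
  unfolding lideal_def
proof (intro conjI ballI)
  note X = lidealD[OF assms(1)] and Y = lidealD[OF assms(3)]
  show "{x \<in> X. x \<otimes> m \<in> Y} \<subseteq> carrier R" "\<zero> \<in> {x \<in> X. x \<otimes> m \<in> Y}"
    using X Y assms(2) by auto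
  show "x \<oplus> y \<in> {x \<in> X. x \<otimes> m \<in> Y}" if "x \<in> {x \<in> X. x \<otimes> m \<in> Y}" "y \<in> {x \<in> X. x \<otimes> m \<in> Y}" for x y
    using that X Y assms(2) by (auto simp: l_distr)
  show "a \<otimes> x \<in> {x \<in> X. x \<otimes> m \<in> Y}" if "a \<in> carrier R" "x \<in> {x \<in> X. x \<otimes> m \<in> Y}" for a x
    using that X Y assms(2) by (auto simp: m_assoc)
qed

lemma primitiveD:
  assumes "primitive R e" shows "e \<in> carrier R" "e \<noteq> \<zero>" "e \<otimes> e = e" 
  using assms by (auto simp: primitive_def)

lemma diff_zero_iff: "x \<in> carrier R \<Longrightarrow> y \<in> carrier R \<Longrightarrow> x \<ominus> y = \<zero> \<longleftrightarrow> x = y"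
  using minus_equality[of x "\<ominus> y"] r_neg by (auto simp: minus_eq)

lemma diff_self [simp]: "x \<in> carrier R \<Longrightarrow> x \<ominus> x = \<zero>"
  by (simp add: diff_zero_iff)

lemma minus_distrib:
  assumes "x \<in> carrier R" "y \<in> carrier R" "z \<in> carrier R"
  shows "(x \<ominus> y) \<otimes> z = x \<otimes> z \<ominus> y \<otimes> z" "z \<otimes> (x \<ominus> y) = z \<otimes> x \<ominus> z \<otimes> y"
  using assms by (simp_all add: minus_eq l_distr r_distr l_minus r_minus)

lemma diff_add_cancel: "x \<in> carrier R \<Longrightarrow> y \<in> carrier R \<Longrightarrow> (x \<ominus> y) \<oplus> y = x"
  by (simp add: minus_eq a_assoc l_neg)

lemma lideal_diffD: "lideal R N \<Longrightarrow> x \<ominus> y \<in> N \<Longrightarrow> y \<in> N \<Longrightarrow> x \<in> carrier R \<Longrightarrow> x \<in> N"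
  using lidealD(4)[of R N "x \<ominus> y" y] lidealD(3)[of R N] diff_add_cancel by metis

text \<open>Multiplying \<open>x \<oplus> y = e\<close> by \<open>x\<close> from the left shows that
  \<open>x \<ominus> x \<otimes> x = x \<otimes> y\<close> lies in \<open>X \<inter> Y\<close>, so
  both sides vanish. Hence \<open>x\<close> and \<open>y\<close> are orthogonal idempotents with sum
  \<open>e\<close>.\<close>

lemma primitive_indecomposable:
  assumes e: "primitive R e" and XY: "lideal R X" "lideal R Y" "X \<subseteq> lprinc R e" "Y \<subseteq> lprinc R e"
    "X \<inter> Y = {\<zero>}" and xy: "x \<in> X" "y \<in> Y" "x \<oplus> y = e"
  shows "x = \<zero> \<or> y = \<zero>"
proof -
  have c: "x \<in> carrier R" "y \<in> carrier R" and xe: "x \<otimes> e = x" "y \<otimes> e = y"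
    using lprinc_idem[OF primitiveD(1,3)[OF e]] XY(3,4) xy by auto
  have 1: "x \<otimes> x = x \<and> x \<otimes> y = \<zero>" 
    if "x \<in> carrier R" "y \<in> carrier R" "x \<oplus> y = e" "x \<otimes> e = x" "lideal R X" "lideal R Y" "X \<inter> Y = {\<zero>}"
      "x \<in> X" "y \<in> Y" for x y X Y
  proof -
    have "x = x \<otimes> x \<oplus> x \<otimes> y" using that by (simp flip: r_distr)
    then have "x \<otimes> y = x \<ominus> x \<otimes> x" using that
      by (metis a_comm m_closed minus_eq r_neg1 a_inv_closed)
    moreover have "x \<ominus> x \<otimes> x \<in> X" "x \<otimes> y \<in> Y"
      using that by (auto intro!: lideal_diff lidealD(5))
    ultimately have "x \<otimes> y = \<zero>" using that by auto
    with \<open>x = x \<otimes> x \<oplus> x \<otimes> y\<close> show ?thesis using that by simp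
  qed
  have "x \<otimes> x = x \<and> x \<otimes> y = \<zero>" "y \<otimes> y = y \<and> y \<otimes> x = \<zero>"
    using 1[of x y X Y] 1[of y x Y X] c XY xy xe by (auto simp: a_comm Int_commute)
  then show ?thesis using e c xy(3) unfolding primitive_def by blast
qed

end

section \<open>Primitive idempotents and the radical\<close>

text \<open>What the ring-level part keeps of a quadri-biserial artin algebra: \<open>C\<close> is
  the image of the base ring, and the two length bounds come from condition (1) for left and right
  modules. All assumptions are symmetric, so statements about right ideals are obtained by
  interpreting the locale in the opposite ring.\<close>

locale qring = ring A for A (structure) +
  fixes C :: "'a set"
  assumes scalars: "C \<subseteq> carrier A"
    and central: "\<And>c x. c \<in> C \<Longrightarrow> x \<in> carrier A \<Longrightarrow> c \<otimes> x = x \<otimes> c"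
    and dcc: "\<And>X :: nat \<Rightarrow> 'a set. (\<And>n. scalar_submodule A C (X n)) \<Longrightarrow>
      (\<And>n. X (Suc n) \<subseteq> X n) \<Longrightarrow> \<exists>n. X (Suc n) = X n"
    and left_length: "\<And>e. primitive A e \<Longrightarrow> \<exists>d. lmono A (lprinc A e) d \<and> d (lprinc A e) \<le> 4"
    and right_length: "\<And>e. primitive A e \<Longrightarrow>
      \<exists>d. lmono (opposite_ring A) (rprinc A e) d \<and> d (rprinc A e) \<le> 4"
begin

lemma qring_opposite: "qring (opposite_ring A) C"
proof -
  interpret op: ring "opposite_ring A" by (rule ring_opposite) unfold_locales
  have "scalar_submodule (opposite_ring A) C N = scalar_submodule A C N" for N
  proof -
    have "N \<subseteq> carrier A \<Longrightarrow> (\<forall>a\<in>C. \<forall>x\<in>N. x \<otimes> a \<in> N) = (\<forall>a\<in>C. \<forall>x\<in>N. a \<otimes> x \<in> N)"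
      by (metis central subsetD)
    then show ?thesis by (auto simp: scalar_submodule_def)
  qed
  then show ?thesis
    using scalars dcc left_length right_length
    by (intro qring.intro qring_axioms.intro op.ring_axioms) (simp_all add: central[symmetric])
qed

lemma lideal_scalar: "lideal A N \<Longrightarrow> scalar_submodule A C N"
  using scalars lideal_minus[of N] by (auto simp: lideal_def scalar_submodule_def)

lemma wf_scalar: "wf {(X, Y). scalar_submodule A C X \<and> scalar_submodule A C Y \<and> X \<subset> Y}"
  unfolding wf_iff_no_infinite_down_chain
proof
  assume "\<exists>f. \<forall>i. (f (Suc i), f i) \<in> {(X, Y). scalar_submodule A C X \<and> scalar_submodule A C Y \<and> X \<subset> Y}"
  then obtain f where f: "\<And>i. scalar_submodule A C (f i)" "\<And>i. f (Suc i) \<subset> f i" by blast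
  then show False using dcc[of f] by (metis psubset_imp_subset psubset_eq)
qed

lemma wf_lideal: "wf {(X, Y). lideal A X \<and> lideal A Y \<and> X \<subset> Y}"
  by (rule wf_subset[OF wf_scalar]) (auto intro: lideal_scalar)

text \<open>Descends on the left ideal \<open>A e\<close>: a proper orthogonal summand
  \<open>u\<close> of \<open>e\<close> generates a strictly smaller one, because its complement
  \<open>v\<close> lies in \<open>A e\<close> while \<open>v \<otimes> u = \<zero>\<close>.\<close>

lemma idem_induct [consumes 2, case_names zero primitive add]:
  assumes "e \<in> carrier A" "e \<otimes> e = e"
    and zero: "P \<zero>" and prim: "\<And>e. primitive A e \<Longrightarrow> P e"
    and add: "\<And>u v. u \<in> carrier A \<Longrightarrow> v \<in> carrier A \<Longrightarrow> u \<otimes> u = u \<Longrightarrow> v \<otimes> v = v \<Longrightarrow> u \<otimes> v = \<zero> \<Longrightarrow>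
      v \<otimes> u = \<zero> \<Longrightarrow> P u \<Longrightarrow> P v \<Longrightarrow> P (u \<oplus> v)"
  shows "P e"
proof -
  have "\<forall>e. e \<in> carrier A \<longrightarrow> e \<otimes> e = e \<longrightarrow> X = lprinc A e \<longrightarrow> P e" for X
  proof (induction X rule: wf_induct_rule[OF wf_lideal])
    case (1 X)
    show ?case
    proof (intro allI impI)
      fix e assume e: "e \<in> carrier A" "e \<otimes> e = e" "X = lprinc A e"
      have less: "P u" if uv: "u \<in> carrier A" "v \<in> carrier A" "u \<otimes> u = u" "v \<otimes> v = v" "u \<otimes> v = \<zero>"
        "v \<otimes> u = \<zero>" "v \<noteq> \<zero>" "u \<oplus> v = e" for u v
      proof -
        have "u \<otimes> e = u" "v \<otimes> e = v" using uv by (auto simp: r_distr simp flip: uv(8))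
        then have "lprinc A u \<subseteq> lprinc A e"
          using uv(1) e(1,2) by (intro lprinc_subset) (auto simp: lprinc_idem)
        moreover have "v \<in> lprinc A e" "v \<notin> lprinc A u"
          using uv e \<open>v \<otimes> e = v\<close> by (auto simp: lprinc_idem)
        ultimately have "lprinc A u \<subset> X" using e(3) by blast
        then show ?thesis using 1[of "lprinc A u"] uv e by auto
      qed
      show "P e"
      proof (cases "e = \<zero> \<or> primitive A e")
        case True
        then show ?thesis using zero prim by auto
      next
        case False
        then obtain u v where uv: "u \<in> carrier A" "v \<in> carrier A" "u \<otimes> u = u" "v \<otimes> v = v" "u \<otimes> v = \<zero>"
          "v \<otimes> u = \<zero>" "u \<noteq> \<zero>" "v \<noteq> \<zero>" "u \<oplus> v = e"
          using e by (auto simp: primitive_def)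
        then have "P u" "P v" using less[of u v] less[of v u] by (auto simp: a_comm)
        then show ?thesis using add uv by blast
      qed
    qed
  qed
  then show ?thesis using assms by blast
qed

text \<open>Plays the role of a fixed decomposition of \<open>\<one>\<close> into orthogonal
  primitive idempotents: \<open>idem_induct\<close> for \<open>\<one>\<close> reduces membership in
  an additively closed set to the pieces \<open>g \<otimes> x\<close>.\<close>

lemma decomp_left:
  assumes "x \<in> carrier A" "\<zero> \<in> X" "\<And>y z. y \<in> X \<Longrightarrow> z \<in> X \<Longrightarrow> y \<oplus> z \<in> X"
    and "\<And>g. primitive A g \<Longrightarrow> g \<otimes> x \<in> X"
  shows "x \<in> X"
proof -
  have "\<one> \<otimes> x \<in> X"
    by (rule idem_induct[of \<one>]) (use assms in \<open>auto simp: l_distr\<close>)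
  then show ?thesis using assms(1) by simp
qed

lemma decomp_right:
  assumes "x \<in> carrier A" "\<zero> \<in> X" "\<And>y z. y \<in> X \<Longrightarrow> z \<in> X \<Longrightarrow> y \<oplus> z \<in> X"
    and "\<And>g. primitive A g \<Longrightarrow> x \<otimes> g \<in> X"
  shows "x \<in> X"
  using qring.decomp_left[OF qring_opposite, of x X] assms by simp

lemma lmono_le:
  assumes "lmono A X d" "lideal A Y" "lideal A Z" "Y \<subseteq> Z" "Z \<subseteq> X"
  shows "d Y \<le> d Z" "d Y = d Z \<Longrightarrow> Y = Z"
  using assms unfolding lmono_def by (metis order_le_less psubsetI less_irrefl_nat)+

lemma incseq_stable:
  assumes d: "lmono A X d" and X: "lideal A X"
    and Y: "\<And>n::nat. lideal A (Y n)" "\<And>n. Y n \<subseteq> Y (Suc n)" "\<And>n. Y n \<subseteq> X"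
  shows "\<exists>n. Y (Suc n) = Y n"
proof (rule ccontr)
  assume "\<nexists>n. Y (Suc n) = Y n"
  then have "d (Y n) < d (Y (Suc n))" for n
    using d Y unfolding lmono_def by (metis psubsetI)
  then have "n \<le> d (Y n)" for n by (induction n) (auto intro: Suc_leI order_le_less_trans)
  from this[of "Suc (d X)"] show False
    using lmono_le(1)[OF d Y(1) X Y(3)] by (metis not_less_eq_eq order_trans subset_refl)
qed

text \<open>Fitting's lemma for the right multiplication by \<open>a\<close> on \<open>A e\<close>.\<close>

lemma corner_nilpotent:
  assumes e: "primitive A e" and a: "a \<in> carrier A" "e \<otimes> a = a" "a \<otimes> e = a" and ne: "e \<notin> lprinc A a"
  shows "\<exists>n::nat. e \<otimes> a [^] n = \<zero>"
proof -
  note e' = primitiveD[OF e]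
  define p where "p n = e \<otimes> a [^] n" for n :: nat
  have pc[simp]: "p n \<in> carrier A" for n using a e' by (simp add: p_def)
  have p0: "p 0 = e" using e' by (simp add: p_def)
  have pS: "p (Suc n) = p n \<otimes> a" for n using a e' by (simp add: p_def m_assoc)
  have pe: "p n \<otimes> e = p n" for n by (cases n) (use e' a p0 pS in \<open>auto simp: m_assoc\<close>)
  have padd: "p (n + m) = p n \<otimes> p m" for n m
    by (induction m) (use a p0 pe in \<open>auto simp: pS m_assoc\<close>)
  have ep: "e \<otimes> p n = p n" for n using padd[of 0 n] p0 by simp
  obtain d where d: "lmono A (lprinc A e) d" using left_length[OF e] by blast
  have in_e: "lprinc A (p n) \<subseteq> lprinc A e" for n
    using pe[of n] e' by (intro lprinc_subset) (auto simp: lprinc_idem)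
  \<comment> \<open>The images of the powers of right multiplication by \<open>a\<close> descend and
    become stationary at \<open>k\<close>; their kernels \<open>K n\<close> ascend and become
    stationary at \<open>l\<close>.\<close>
  have "\<exists>n. lprinc A (p (Suc n)) = lprinc A (p n)"
  proof (rule dcc)
    show "lprinc A (p (Suc n)) \<subseteq> lprinc A (p n)" for n
      using padd[of 1 n] by (intro lprinc_subset) (auto simp: lprincI)
  qed (auto intro: lideal_scalar)
  then obtain k where k: "lprinc A (p (Suc k)) = lprinc A (p k)" by blast
  have im: "p k \<in> lprinc A (p (k + m))" for m
  proof (induction m)
    case (Suc m)
    then obtain z where z: "z \<in> carrier A" "p k = z \<otimes> p (k + m)" by (auto elim: lprincE)
    have "p k \<in> lprinc A (p (Suc k))" using k by simp
    then obtain w where w: "w \<in> carrier A" "p k = w \<otimes> p (Suc k)" by (auto elim: lprincE)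
    have "p (Suc k) = z \<otimes> p (k + Suc m)" using z a(1) by (simp add: pS m_assoc)
    then have "p k = (w \<otimes> z) \<otimes> p (k + Suc m)" using w z by (simp add: m_assoc)
    then show ?case using w z lprincI[of "w \<otimes> z"] by auto
  qed simp
  define K where "K n = {y \<in> lprinc A e. y \<otimes> p n \<in> {\<zero>}}" for n
  have K: "lideal A (K n)" for n using e' unfolding K_def by (intro lideal_vimage) auto
  have "\<exists>n. K (Suc n) = K n"
  proof (rule incseq_stable[OF d])
    show "K n \<subseteq> K (Suc n)" for n unfolding K_def using e' a
      by (auto simp: pS lprinc_idem simp flip: m_assoc)
  qed (use K e' in \<open>auto simp: K_def\<close>)
  then obtain l where l: "K (Suc l) = K l" by blast
  have ker: "K (l + m) = K l" for m
  proof (induction m)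
    case (Suc m)
    have "y \<in> K (l + m)" if y: "y \<in> K (l + Suc m)" for y
    proof -
      have "y \<otimes> p m \<in> K (Suc l)" using y e' pe[of m] padd[of m "Suc l"]
        by (auto simp: K_def lprinc_idem m_assoc add.commute)
      then have "y \<otimes> p m \<in> K l" using l by simp
      then show ?thesis using y padd[of m l] e' by (auto simp: K_def lprinc_idem m_assoc add.commute)
    qed
    moreover have "K (l + m) \<subseteq> K (l + Suc m)" unfolding K_def using e' a
      by (auto simp: pS lprinc_idem simp flip: m_assoc)
    ultimately show ?case using Suc by blast
  qed simp
  \<comment> \<open>Beyond both stationary indices. The additional step leaves a last factor
    \<open>a\<close> in \<open>p N\<close>, which is split off at the end to put \<open>e\<close>
    into \<open>A a\<close>.\<close>
  define N where "N = Suc (k + l)"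
  have "p k \<in> lprinc A (p (k + (Suc l + N)))" by (rule im)
  then obtain z0 where z0: "z0 \<in> carrier A" "p k = z0 \<otimes> p (k + (Suc l + N))" by (auto elim: lprincE)
  define z where "z = p (Suc l) \<otimes> z0"
  have z: "z \<in> carrier A" using z0 by (simp add: z_def)
  have pN: "p N = z \<otimes> p (N + N)"
  proof -
    have "p N = p (Suc l) \<otimes> p k" by (simp add: N_def add.commute flip: padd)
    also have "\<dots> = p (Suc l) \<otimes> (z0 \<otimes> p (N + N))" using z0 by (simp add: N_def ac_simps)
    finally show ?thesis using z0 by (simp add: z_def m_assoc)
  qed
  \<comment> \<open>The Fitting decomposition of \<open>e\<close>: since
    \<open>p N = z \<otimes> p (N + N)\<close>, one has \<open>w \<otimes> p N = p N\<close>, so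
    \<open>e \<ominus> w\<close> lies in the kernel \<open>K N\<close> and \<open>w\<close> in the
    image \<open>A (p N)\<close>. These meet in zero, and primitivity of \<open>e\<close> removes
    one of them.\<close>
  define w where "w = z \<otimes> p N"
  have w: "w \<in> carrier A" "w \<in> lprinc A (p N)" "w \<otimes> e = w" using z pe[of N] e'
    by (auto simp: w_def lprincI m_assoc)
  have KN: "K N = K l" "K (N + N) = K l" using ker[of "Suc k"] ker[of "Suc k + N"] by (auto simp: N_def ac_simps)
  have "w \<otimes> p N = p N" using pN padd[of N N] z by (simp add: w_def m_assoc)
  then have "(e \<ominus> w) \<otimes> p N = \<zero>" using w(1) e'(1) ep[of N] by (simp add: minus_distrib)
  moreover have "(e \<ominus> w) \<otimes> e = e \<ominus> w" using w e' by (simp add: minus_distrib)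
  ultimately have y: "e \<ominus> w \<in> K N" using w(1) e' by (simp add: K_def lprinc_idem)
  have "e \<ominus> w = \<zero> \<or> w = \<zero>"
  proof (rule primitive_indecomposable[OF e, of "K N" "lprinc A (p N)"])
    show "lprinc A (p N) \<subseteq> lprinc A e" by (rule in_e)
    show "K N \<subseteq> lprinc A e" by (auto simp: K_def)
    show "K N \<inter> lprinc A (p N) = {\<zero>}"
    proof -
      have "x = \<zero>" if x: "x \<in> K N" "x \<in> lprinc A (p N)" for x
      proof -
        obtain u where u: "u \<in> carrier A" "x = u \<otimes> p N" using x(2) by (auto elim: lprincE)
        have "u \<otimes> e \<in> K (N + N)" using u x(1) e' ep[of N] ep[of "N + N"] padd[of N N]
          by (auto simp: K_def m_assoc lprinc_idem)
        then have "u \<otimes> e \<in> K N" using KN by simp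
        then show ?thesis using u e' ep[of N] by (auto simp: K_def m_assoc)
      qed
      then show ?thesis using lidealD(2)[OF K] lidealD(2)[OF lideal_lprinc[OF pc]] by blast
    qed
    show "(e \<ominus> w) \<oplus> w = e" using e' w by (simp add: diff_add_cancel)
  qed (use K w y in auto)
  then show ?thesis
  proof
    assume "e \<ominus> w = \<zero>"
    then have "e = w" using e' w by (simp add: diff_zero_iff)
    then have "e = z \<otimes> p N" using w_def by simp
    then have "e = (z \<otimes> p (k + l)) \<otimes> a" using z a by (simp add: N_def pS m_assoc)
    then have "e \<in> lprinc A a" using z a lprincI[of "z \<otimes> p (k + l)" a] by simp
    with ne show ?thesis by blast
  next
    assume "w = \<zero>"
    then have "z \<otimes> p N = \<zero>" using w_def by simp
    then have "p N = \<zero>" using pN padd[of N N] z by (metis m_assoc pc l_null)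
    then show ?thesis by (auto simp: p_def)
  qed
qed

text \<open>The corner \<open>e A e\<close> is local. After rescaling,
  \<open>b \<oplus> a = e\<close> inside the corner; if \<open>A a\<close> does not contain
  \<open>e\<close>, then \<open>a\<close> is nilpotent, and the telescoping identity \<open>e
  \<ominus> q \<otimes> a = (e \<ominus> q) \<oplus> q \<otimes> b\<close> for
  \<open>q = e \<otimes> a [^] m\<close> puts all \<open>e \<ominus> e \<otimes> a [^] m\<close>,
  hence \<open>e\<close>, into \<open>A b\<close>.\<close>

lemma local_add:
  assumes e: "primitive A e" and xy: "x \<in> carrier A" "y \<in> carrier A" "x \<otimes> e = x" "y \<otimes> e = y"
    and "e \<in> lprinc A (x \<oplus> y)"
  shows "e \<in> lprinc A x \<or> e \<in> lprinc A y"
proof (rule disjCI)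
  assume ny: "e \<notin> lprinc A y"
  note e' = primitiveD[OF e]
  obtain c where c: "c \<in> carrier A" "e = c \<otimes> (x \<oplus> y)" using assms(6) by (auto elim: lprincE)
  define a b where "a = e \<otimes> c \<otimes> y" and "b = e \<otimes> c \<otimes> x"
  have ab: "a \<in> carrier A" "b \<in> carrier A" "e \<otimes> a = a" "a \<otimes> e = a" "e \<otimes> b = b" "b \<otimes> e = b"
    using e' c xy unfolding a_def b_def by (auto simp: m_assoc) (auto simp flip: m_assoc)
  have "e \<otimes> e = e \<otimes> (c \<otimes> (x \<oplus> y))" using c(2) by simp
  then have sum: "b \<oplus> a = e" using e' c xy unfolding a_def b_def by (simp add: m_assoc r_distr)
  have "a \<in> lprinc A y" "b \<in> lprinc A x" unfolding a_def b_def using e' c xy by (auto intro!: lprincI)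
  then have "lprinc A a \<subseteq> lprinc A y" "lprinc A b \<subseteq> lprinc A x" 
    using xy lprinc_subset[OF lideal_lprinc] by blast+
  then have "e \<notin> lprinc A a" using ny by blast
  then obtain n :: nat where n: "e \<otimes> a [^] n = \<zero>" using corner_nilpotent[OF e] ab by blast
  have "e \<ominus> e \<otimes> a [^] m \<in> lprinc A b" for m :: nat
  proof (induction m)
    case 0 then show ?case using e' ab lidealD(2)[OF lideal_lprinc[of b]] by (simp add: minus_eq r_neg)
  next
    case (Suc m)
    define q where "q = e \<otimes> a [^] m"
    have q: "q \<in> carrier A" "q \<otimes> e = q" 
      using e' ab unfolding q_def by (cases m; auto simp: m_assoc)+
    have "q = q \<otimes> b \<oplus> q \<otimes> a" using q ab sum by (metis r_distr)
    moreover have "e \<otimes> a [^] (Suc m) = q \<otimes> a" using e' ab by (simp add: q_def m_assoc)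
    ultimately have "e \<ominus> e \<otimes> a [^] (Suc m) = (e \<ominus> q) \<oplus> q \<otimes> b"
      using e' ab q
      by (smt (verit) a_inv_closed a_minus_def add.m_assoc add.m_closed add.m_lcomm m_closed r_neg1 r_zero r_neg l_neg add.m_comm)
    then show ?case using Suc ab q unfolding q_def[symmetric]
      by (auto intro!: lidealD(4)[OF lideal_lprinc] lprincI)
  qed
  from this[of n] have "e \<in> lprinc A b" using n e' by (simp add: minus_eq)
  then show "e \<in> lprinc A x" using \<open>lprinc A b \<subseteq> lprinc A x\<close> by blast
qed

end

section \<open>The Jacobson radical and composition series of left ideals\<close>

context qring
begin

lemma add_diff_cancel: "x \<in> carrier A \<Longrightarrow> y \<in> carrier A \<Longrightarrow> x \<oplus> y \<ominus> y = x"
  by (simp add: minus_eq a_assoc r_neg)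

lemma diff_zero: "x \<in> carrier A \<Longrightarrow> x \<ominus> \<zero> = x"
  by (simp add: minus_eq)

lemma jacI: "x \<in> carrier A \<Longrightarrow> (\<And>g a b. primitive A g \<Longrightarrow> a \<in> carrier A \<Longrightarrow> b \<in> carrier A \<Longrightarrow>
    b \<otimes> x \<otimes> a = g \<Longrightarrow> False) \<Longrightarrow> x \<in> jac A"
  unfolding jac_def by blast

lemma jac_carrier: "x \<in> jac A \<Longrightarrow> x \<in> carrier A"
  unfolding jac_def by blast

text \<open>In \<open>A e\<close> being radical means failing to generate \<open>A e\<close>. If
  \<open>b \<otimes> x \<otimes> a\<close> is a primitive \<open>g\<close>, then
  \<open>y = e \<otimes> a \<otimes> g \<otimes> b \<otimes> x\<close> is a nonzero idempotent of
  \<open>e A e\<close>, so it equals \<open>e\<close>, and \<open>y\<close> is a left multiple of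
  \<open>x\<close>. This is the form in which the radical is used almost everywhere below: a
  nonradical element of \<open>A e\<close> can be cancelled to \<open>e\<close>.\<close>

lemma jac_mem:
  assumes e: "primitive A e" and x: "x \<in> carrier A" "x \<otimes> e = x"
  shows "x \<in> jac A \<longleftrightarrow> e \<notin> lprinc A x"
proof
  assume "x \<in> jac A"
  then show "e \<notin> lprinc A x"
    using e x unfolding jac_def by (auto elim!: lprincE) (metis one_closed r_one m_closed)
next
  assume ne: "e \<notin> lprinc A x"
  note e' = primitiveD[OF e]
  show "x \<in> jac A"
  proof (rule jacI[OF x(1)])
    fix g a b assume g: "primitive A g" and ab: "a \<in> carrier A" "b \<in> carrier A" "b \<otimes> x \<otimes> a = g"
    note g' = primitiveD[OF g]
    define y where "y = e \<otimes> a \<otimes> g \<otimes> b \<otimes> x"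
    have y: "y \<in> carrier A" "e \<otimes> y = y" "y \<otimes> e = y" using e' g' ab x
      unfolding y_def by (auto simp: m_assoc) (metis m_assoc e'(1,3) m_closed)
    have xea: "b \<otimes> (x \<otimes> (e \<otimes> (a \<otimes> z))) = g \<otimes> z" if "z \<in> carrier A" for z
      using that ab x e' by (metis m_assoc m_closed)
    have yy: "y \<otimes> y = y" unfolding y_def using e' g' ab x xea
      by (simp add: m_assoc) (metis g'(3) m_assoc g'(1) m_closed)
    have "b \<otimes> x \<otimes> y \<otimes> a = g"
      unfolding y_def using e' g' ab x xea by (simp add: m_assoc)
    then have y0: "y \<noteq> \<zero>" using g' ab x by auto
    have "e \<ominus> y \<in> carrier A" "(e \<ominus> y) \<otimes> (e \<ominus> y) = e \<ominus> y" "y \<otimes> (e \<ominus> y) = \<zero>" "(e \<ominus> y) \<otimes> y = \<zero>"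
      "y \<oplus> (e \<ominus> y) = e"
      using y yy e' by (simp_all add: minus_distrib diff_zero a_comm[of y] diff_add_cancel)
    then have "e \<ominus> y = \<zero>" using e y yy y0 unfolding primitive_def by blast
    then have "e = y" using y e' by (simp add: diff_zero_iff)
    then have "e \<in> lprinc A x" unfolding y_def using e' g' ab x lprincI[of "e \<otimes> a \<otimes> g \<otimes> b" x] by simp
    with ne show False ..
  qed
qed

lemma jac_mult:
  assumes "x \<in> jac A" "a \<in> carrier A" shows "a \<otimes> x \<in> jac A" "x \<otimes> a \<in> jac A"
proof -
  have x: "x \<in> carrier A" using assms jac_carrier by blast
  show "a \<otimes> x \<in> jac A"
  proof (rule jacI)
    fix g c b assume "primitive A g" "c \<in> carrier A" "b \<in> carrier A" "b \<otimes> (a \<otimes> x) \<otimes> c = g"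
    then show False using assms x unfolding jac_def by (auto simp flip: m_assoc)
  qed (use assms x in auto)
  show "x \<otimes> a \<in> jac A"
  proof (rule jacI)
    fix g c b assume "primitive A g" "c \<in> carrier A" "b \<in> carrier A" "b \<otimes> (x \<otimes> a) \<otimes> c = g"
    moreover from this have "b \<otimes> x \<otimes> (a \<otimes> c) = g" using assms x by (simp add: m_assoc)
    ultimately show False using assms x unfolding jac_def by blast
  qed (use assms x in auto)
qed

text \<open>A primitive \<open>g = b \<otimes> (x \<oplus> y) \<otimes> a\<close> splits into two
  elements of \<open>A g\<close>, one of which generates \<open>A g\<close> by
  \<open>local_add\<close>.\<close>

lemma jac_add:
  assumes xy: "x \<in> jac A" "y \<in> jac A" shows "x \<oplus> y \<in> jac A"
proof (rule jacI)
  have c: "x \<in> carrier A" "y \<in> carrier A" using xy jac_carrier by auto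
  then show "x \<oplus> y \<in> carrier A" by simp
  fix g a b assume g: "primitive A g" and ab: "a \<in> carrier A" "b \<in> carrier A" "b \<otimes> (x \<oplus> y) \<otimes> a = g"
  note g' = primitiveD[OF g]
  define p q where "p = b \<otimes> x \<otimes> a \<otimes> g" and "q = b \<otimes> y \<otimes> a \<otimes> g"
  have pq: "p \<in> carrier A" "q \<in> carrier A" "p \<otimes> g = p" "q \<otimes> g = q" "p \<in> jac A" "q \<in> jac A"
    using c ab g' xy unfolding p_def q_def by (auto simp: m_assoc jac_mult)
  have "p \<oplus> q = b \<otimes> (x \<oplus> y) \<otimes> a \<otimes> g" using c ab(1,2) g' unfolding p_def q_def
    by (simp add: l_distr r_distr)
  then have "p \<oplus> q = g" using ab g' by simp
  then have "g \<in> lprinc A p \<or> g \<in> lprinc A q" using local_add[OF g pq(1-4)] g' by simp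
  then show False using jac_mem[OF g] pq by blast
qed

lemma jac_lideal: "lideal A (jac A)"
proof -
  have "\<zero> \<in> jac A" by (rule jacI) (use primitiveD(2) in auto)
  then show ?thesis unfolding lideal_def
    by (intro conjI ballI subsetI) (auto intro: jac_add jac_mult jac_carrier)
qed

lemma jac_op: "jac (opposite_ring A) = jac A"
  by (rule jac_opposite) unfold_locales

lemma primitive_not_jac: "primitive A e \<Longrightarrow> e \<notin> jac A"
  using jac_mem[of e e] primitiveD[of e] by simp

lemma jac_mem_op:
  assumes e: "primitive A e" and x: "x \<in> carrier A" "e \<otimes> x = x"
  shows "x \<in> jac A \<longleftrightarrow> e \<notin> rprinc A x"
  using qring.jac_mem[OF qring_opposite, of e x] assms by (simp add: jac_op)

lemma coversD:
  assumes "covers A X Y" shows "lideal A X" "lideal A Y" "Y \<subseteq> X" "Y \<noteq> X"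
    "\<And>Z. lideal A Z \<Longrightarrow> Y \<subseteq> Z \<Longrightarrow> Z \<subseteq> X \<Longrightarrow> Z = Y \<or> Z = X"
  using assms unfolding covers_def by auto

lemma covers_span:
  assumes "covers A X Y" "x \<in> X" "x \<notin> Y"
  shows "X = Y <+>\<^bsub>A\<^esub> lprinc A x"
proof -
  note c = coversD[OF assms(1)]
  have x: "x \<in> carrier A" using lidealD(3)[OF c(1)] assms(2) by simp
  have "Y <+>\<^bsub>A\<^esub> lprinc A x \<subseteq> X" 
    using lprinc_subset[OF c(1) assms(2)] c by (intro lideal_add_least) auto
  moreover have "Y \<subseteq> Y <+>\<^bsub>A\<^esub> lprinc A x" "x \<in> Y <+>\<^bsub>A\<^esub> lprinc A x"
    using lideal_add_upper[OF c(2) lideal_lprinc[OF x]] lprinc_self[OF x] by (simp_all add: subsetD)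
  ultimately show ?thesis using c(5)[of "Y <+>\<^bsub>A\<^esub> lprinc A x"] c(2) x assms(3) lideal_add by auto
qed

text \<open>The radical annihilates simple subquotients, by Nakayama's argument: if
  \<open>j \<otimes> g \<otimes> x\<close> were outside \<open>Y\<close> it would generate
  \<open>X\<close> modulo \<open>Y\<close>, in particular \<open>g \<otimes> x\<close>, and the
  resulting relation can be solved for \<open>g \<otimes> x\<close>.\<close>

lemma covers_jac:
  assumes XY: "covers A X Y" and j: "j \<in> jac A" and x: "x \<in> X"
  shows "j \<otimes> x \<in> Y"
proof -
  note c = coversD[OF XY] and Y = lidealD[OF coversD(2)[OF XY]] and X = lidealD[OF coversD(1)[OF XY]]
  have jx: "j \<in> carrier A" "x \<in> carrier A" using jac_carrier[OF j] X(3)[OF x] by auto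
  have "j \<in> {i \<in> carrier A. i \<otimes> x \<in> Y}"
  proof (rule decomp_right[OF jx(1)])
    show "\<zero> \<in> {i \<in> carrier A. i \<otimes> x \<in> Y}" using jx Y(2) by simp
    show "y \<oplus> z \<in> {i \<in> carrier A. i \<otimes> x \<in> Y}" 
      if "y \<in> {i \<in> carrier A. i \<otimes> x \<in> Y}" "z \<in> {i \<in> carrier A. i \<otimes> x \<in> Y}" for y z
      using that Y(4) jx by (simp add: l_distr)
    fix g assume g: "primitive A g"
    note g' = primitiveD[OF g]
    have "j \<otimes> g \<otimes> x \<in> Y"
    proof (rule ccontr)
      assume n: "j \<otimes> g \<otimes> x \<notin> Y"
      have "j \<otimes> g \<otimes> x \<in> X" "g \<otimes> x \<in> X" using X(5) x jx g' by auto
      then have "g \<otimes> x \<in> Y <+>\<^bsub>A\<^esub> lprinc A (j \<otimes> g \<otimes> x)" using covers_span[OF XY _ n] by simp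
      then obtain y a where ya: "y \<in> Y" "a \<in> carrier A" "g \<otimes> x = y \<oplus> a \<otimes> (j \<otimes> g \<otimes> x)"
        by (auto simp: mem_set_add elim!: lprincE)
      have yc: "y \<in> carrier A" using Y(3) ya by blast
      \<comment> \<open>The equation becomes
        \<open>(g \<ominus> q) \<otimes> x = g \<otimes> y\<close>. As \<open>q\<close> is radical
        and \<open>g\<close> is not, \<open>g \<ominus> q\<close> generates \<open>A g\<close> and
        can be cancelled.\<close>
      define q where "q = g \<otimes> a \<otimes> j \<otimes> g"
      have q: "q \<in> carrier A" "q \<otimes> g = q" "q \<in> jac A" using g' ya jx j
        unfolding q_def by (auto simp: m_assoc jac_mult)
      have u: "g \<ominus> q \<in> carrier A" "(g \<ominus> q) \<otimes> g = g \<ominus> q" using q g' by (auto simp: minus_distrib)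
      have "g \<otimes> x = g \<otimes> (g \<otimes> x)" using g' jx by (simp flip: m_assoc)
      also have "\<dots> = g \<otimes> y \<oplus> q \<otimes> x" unfolding ya(3) q_def using g' jx yc ya(2)
        by (simp add: r_distr m_assoc)
      finally have "(g \<ominus> q) \<otimes> x = g \<otimes> y" using g' jx yc q
        by (simp add: minus_distrib add_diff_cancel)
      then have in_Y: "(g \<ominus> q) \<otimes> x \<in> Y" using Y(5) g' ya by simp
      have "g \<ominus> q \<notin> jac A"
        using lideal_diffD[OF jac_lideal, of g q] q(3) g' primitive_not_jac[OF g] by blast
      then obtain b where "b \<in> carrier A" "g = b \<otimes> (g \<ominus> q)" 
        using jac_mem[OF g u] by (auto elim: lprincE)
      then have "g \<otimes> x \<in> Y" using in_Y Y(5)[of b] u jx by (metis m_assoc)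
      then have "j \<otimes> g \<otimes> x \<in> Y" using Y(5) jx g' by (simp add: m_assoc)
      with n show False ..
    qed
    then show "j \<otimes> g \<in> {i \<in> carrier A. i \<otimes> x \<in> Y}" using jx g' by simp
  qed
  then show ?thesis by simp
qed

text \<open>The length bounds are given for primitive idempotents only; \<open>idem_induct\<close>
  for \<open>\<one>\<close> adds them up.\<close>

lemma finite_length: "\<exists>d. lmono A (carrier A) d"
proof -
  have "\<exists>d. lmono A (lprinc A \<one>) d"
  proof (rule idem_induct[of \<one>])
    have "lprinc A \<zero> = {\<zero>}" by (auto simp: lprinc_def intro: exI[of _ \<zero>])
    moreover have False if "lideal A Y" "Y \<subset> Z" "Z \<subseteq> {\<zero>}" for Y Z
      using lidealD(2)[OF that(1)] that by blast
    ultimately show "\<exists>d. lmono A (lprinc A \<zero>) d" unfolding lmono_def by metis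
    show "\<exists>d. lmono A (lprinc A e) d" if "primitive A e" for e using left_length[OF that] by blast
    fix u v assume uv: "u \<in> carrier A" "v \<in> carrier A" "u \<otimes> u = u" "v \<otimes> v = v" "u \<otimes> v = \<zero>" "v \<otimes> u = \<zero>"
      "\<exists>d. lmono A (lprinc A u) d" "\<exists>d. lmono A (lprinc A v) d"
    then obtain d1 d2 where d: "lmono A (lprinc A u) d1" "lmono A (lprinc A v) d2" by blast
    \<comment> \<open>For \<open>X\<close> inside \<open>A (u \<oplus> v)\<close> the projection of
      \<open>X\<close> onto the second summand is right multiplication by \<open>v\<close>, with
      kernel \<open>X \<inter> A u\<close>; \<open>F\<close> adds the sizes of kernel and
      image.\<close>
    define F where "F X = d1 (X \<inter> lprinc A u) + d2 ((\<lambda>x. x \<otimes> v) ` X)" for X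
    have "F X < F Y" if XY: "lideal A X" "lideal A Y" "X \<subset> Y" "Y \<subseteq> lprinc A (u \<oplus> v)" for X Y
    proof -
      have sub: "(\<lambda>x. x \<otimes> v) ` Y \<subseteq> lprinc A v" using lidealD(3)[OF XY(2)] by (auto intro: lprincI)
      have le: "d1 (X \<inter> lprinc A u) \<le> d1 (Y \<inter> lprinc A u)"
        "d1 (X \<inter> lprinc A u) = d1 (Y \<inter> lprinc A u) \<Longrightarrow> X \<inter> lprinc A u = Y \<inter> lprinc A u"
        using lmono_le[OF d(1) lideal_Int[OF XY(1)] lideal_Int[OF XY(2)]] XY(3) uv(1)
        by (meson Int_lower2 Int_mono lideal_lprinc order_refl psubset_imp_subset)+
      have le2: "d2 ((\<lambda>x. x \<otimes> v) ` X) \<le> d2 ((\<lambda>x. x \<otimes> v) ` Y)"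
        "d2 ((\<lambda>x. x \<otimes> v) ` X) = d2 ((\<lambda>x. x \<otimes> v) ` Y) \<Longrightarrow> (\<lambda>x. x \<otimes> v) ` X = (\<lambda>x. x \<otimes> v) ` Y"
        using lmono_le[OF d(2) lideal_image[OF XY(1) uv(2)] lideal_image[OF XY(2) uv(2)] _ sub] XY(3) by blast+
      show ?thesis
      proof (rule ccontr)
        assume "\<not> F X < F Y"
        then have eq: "X \<inter> lprinc A u = Y \<inter> lprinc A u" "(\<lambda>x. x \<otimes> v) ` X = (\<lambda>x. x \<otimes> v) ` Y"
          using le le2 unfolding F_def by linarith+
        have "y \<in> X" if y: "y \<in> Y" for y
        proof -
          obtain x where x: "x \<in> X" "y \<otimes> v = x \<otimes> v" using eq(2) y by blast
          have c: "x \<in> carrier A" "y \<in> carrier A" using lidealD(3)[OF XY(2)] x(1) y XY(3) by auto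
          have z: "y \<ominus> x \<in> Y" using lideal_diff[OF XY(2) y] x(1) XY(3) by auto
          then have "(y \<ominus> x) \<otimes> (u \<oplus> v) = y \<ominus> x"
            using XY(4) lprinc_idem[of "u \<oplus> v"] uv by (auto simp: l_distr r_distr)
          then have "(y \<ominus> x) \<otimes> u = y \<ominus> x"
            using c uv x by (simp add: r_distr minus_distrib diff_zero_iff)
          then have "y \<ominus> x \<in> Y \<inter> lprinc A u" using z c uv by (simp add: lprinc_idem)
          then have "y \<ominus> x \<in> X" using eq(1) by blast
          then show ?thesis using lideal_diffD[OF XY(1) _ x(1) c(2)] by blast
        qed
        then show False using XY(3) by blast
      qed
    qed
    then show "\<exists>d. lmono A (lprinc A (u \<oplus> v)) d" unfolding lmono_def by blast
  qed auto
  moreover have "lprinc A \<one> = carrier A" by (auto simp: lprinc_def)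
  ultimately show ?thesis by simp
qed

lemma exists_covered:
  assumes "lideal A X" "lideal A Z" "Z \<subset> X"
  obtains Y where "covers A X Y" "Z \<subseteq> Y"
proof -
  obtain d where d: "lmono A (carrier A) d" using finite_length by blast
  let ?P = "\<lambda>Y. lideal A Y \<and> Z \<subseteq> Y \<and> Y \<subset> X"
  have X: "X \<subseteq> carrier A" using assms lidealD(1) by blast
  have bound: "\<forall>Y. ?P Y \<longrightarrow> d Y < Suc (d X)"
    using lmono_le(1)[OF d _ assms(1) _ X] by (simp add: less_Suc_eq_le psubset_imp_subset)
  have "?P Z" using assms by blast
  from ex_has_greatest_nat[OF this bound] obtain Y where Y: "?P Y" "\<And>Y'. ?P Y' \<Longrightarrow> d Y' \<le> d Y" by blast
  have "covers A X Y" unfolding covers_def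
  proof (intro conjI allI impI)
    fix W assume W: "lideal A W \<and> Y \<subseteq> W \<and> W \<subseteq> X"
    show "W = Y \<or> W = X"
    proof (rule ccontr)
      assume n: "\<not> (W = Y \<or> W = X)"
      then have "?P W" using W Y(1) by blast
      then have "d W \<le> d Y" using Y(2) by blast
      moreover have "d Y < d W" using d W Y(1) n X unfolding lmono_def by (metis psubsetI subset_trans)
      ultimately show False by simp
    qed
  qed (use assms Y in auto)
  with Y(1) that show ?thesis by blast
qed

text \<open>Induction along a composition series of \<open>X\<close>.\<close>

lemma cover_induct [consumes 1, case_names zero cover]:
  assumes "lideal A X" "P {\<zero>}" "\<And>X Y. covers A X Y \<Longrightarrow> P Y \<Longrightarrow> P X"
  shows "P X"
  using assms(1)
proof (induction X rule: wf_induct_rule[OF wf_lideal])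
  case (1 X)
  show ?case
  proof (cases "X = {\<zero>}")
    case False
    then have "{\<zero>} \<subset> X" using 1(2) lidealD(2) by blast
    then obtain Y where Y: "covers A X Y" using exists_covered[OF 1(2) lideal_zero] by metis
    then have "P Y" using 1 coversD[OF Y] by blast
    then show ?thesis using assms(3) Y by blast
  qed (use assms in auto)
qed

lemma smallestD:
  assumes "smallest_lideal A (lprinc A s) X" "s \<in> carrier A"
  shows "s \<noteq> \<zero>" "lprinc A s \<subseteq> X" "s \<in> X"
    "\<And>Z. lideal A Z \<Longrightarrow> Z \<subseteq> X \<Longrightarrow> Z \<noteq> {\<zero>} \<Longrightarrow> s \<in> Z"
proof -
  have "lprinc A \<zero> = {\<zero>}" by (auto simp: lprinc_def intro: exI[of _ \<zero>])
  then show "s \<noteq> \<zero>" using assms unfolding smallest_lideal_def by auto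
  show "lprinc A s \<subseteq> X" using assms unfolding smallest_lideal_def by blast
  then show "s \<in> X" using assms(2) by (meson lprinc_self subsetD)
  fix Z assume "lideal A Z" "Z \<subseteq> X" "Z \<noteq> {\<zero>}"
  then have "lprinc A s \<subseteq> Z" using assms unfolding smallest_lideal_def by blast
  then show "s \<in> Z" using assms(2) by (meson lprinc_self subsetD)
qed

lemma smallestD':
  assumes "smallest_lideal A (lprinc A s) (lprinc A e)" "s \<in> carrier A" "e \<in> carrier A"
    "x \<in> lprinc A e" "x \<noteq> \<zero>"
  shows "\<exists>a\<in>carrier A. s = a \<otimes> x"
proof -
  have "x \<in> carrier A" using assms lidealD(3)[OF lideal_lprinc] by blast
  then have "s \<in> lprinc A x"
    using lprinc_subset[OF lideal_lprinc[OF assms(3)] assms(4)] assms(5) lprinc_self[of x]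
    by (intro smallestD(4)[OF assms(1,2)]) (auto simp del: lprinc_self)
  then show ?thesis by (auto elim: lprincE)
qed

lemma smallest_covers:
  assumes "smallest_lideal A (lprinc A s) X" "s \<in> carrier A"
  shows "covers A (lprinc A s) {\<zero>}"
proof -
  note s = smallestD[OF assms]
  have L: "lideal A (lprinc A s)" "s \<in> lprinc A s" using assms(2) by auto
  show ?thesis unfolding covers_def
  proof (intro conjI allI impI)
    show "{\<zero>} \<subset> lprinc A s" using s(1) L lidealD(2)[OF L(1)] by blast
    fix Z assume Z: "lideal A Z \<and> {\<zero>} \<subseteq> Z \<and> Z \<subseteq> lprinc A s"
    show "Z = {\<zero>} \<or> Z = lprinc A s"
    proof (rule disjCI)
      assume "Z \<noteq> lprinc A s"
      then show "Z = {\<zero>}" using s(2) s(4)[of Z] Z lprinc_subset[of Z s] by blast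
    qed
  qed (use L in auto)
qed

lemma jac_smallest:
  assumes "smallest_lideal A (lprinc A s) X" "s \<in> carrier A" "j \<in> jac A" "x \<in> lprinc A s"
  shows "j \<otimes> x = \<zero>"
  using covers_jac[OF smallest_covers[OF assms(1,2)] assms(3,4)] by simp

text \<open>For a primitive \<open>g\<close> with \<open>g \<otimes> c \<noteq> \<zero>\<close> the
  smallest left ideal is reached as \<open>s = a \<otimes> g \<otimes> c\<close>. Since the radical
  kills \<open>c\<close>, the coefficient \<open>a \<otimes> g\<close> is not radical, so
  \<open>g\<close> is a left multiple of it and \<open>g \<otimes> c\<close> a left multiple of
  \<open>s\<close>.\<close>

lemma soc_smallest:
  assumes e: "e \<in> carrier A" and s: "smallest_lideal A (lprinc A s) (lprinc A e)" "s \<in> carrier A"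
    and c: "c \<in> lprinc A e" "\<And>j. j \<in> jac A \<Longrightarrow> j \<otimes> c = \<zero>"
  shows "c \<in> lprinc A s"
proof -
  have cc: "c \<in> carrier A" using c(1) e lidealD(3)[OF lideal_lprinc] by blast
  note L = lidealD[OF lideal_lprinc[OF s(2)]]
  show ?thesis
  proof (rule decomp_left[OF cc L(2)])
    fix g assume g: "primitive A g"
    note g' = primitiveD[OF g]
    show "g \<otimes> c \<in> lprinc A s"
    proof (cases "g \<otimes> c = \<zero>")
      case False
      have "g \<otimes> c \<in> lprinc A e" using lidealD(5)[OF lideal_lprinc] e g' c by blast
      then obtain a where a: "a \<in> carrier A" "s = a \<otimes> (g \<otimes> c)" using smallestD'[OF s e _ False] by blast
      have ag: "a \<otimes> g \<in> carrier A" "a \<otimes> g \<otimes> g = a \<otimes> g" using a g' by (auto simp: m_assoc)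
      have sc: "s = a \<otimes> g \<otimes> c" using a g' cc by (simp add: m_assoc)
      then have "a \<otimes> g \<notin> jac A" using c(2) smallestD(1)[OF s] by blast
      then obtain b where b: "b \<in> carrier A" "g = b \<otimes> (a \<otimes> g)" using jac_mem[OF g ag] by (auto elim: lprincE)
      then have "g \<otimes> c = b \<otimes> s" using sc cc ag by (metis m_assoc)
      then show ?thesis using b lprincI by simp
    qed (use L in simp)
  qed (use L in blast)
qed

section \<open>Injective pairs\<close>

text \<open>The witness \<open>s\<close> is an argument because it generates both socles at once;
  the computations below move coefficients from one side of \<open>s\<close> to the other.\<close>

definition ipair :: "'a \<Rightarrow> 'a \<Rightarrow> 'a \<Rightarrow> bool" where
  "ipair e f s \<longleftrightarrow> primitive A e \<and> primitive A f \<and> s \<in> carrier A \<and> f \<otimes> s = s \<and> s \<otimes> e = s \<and>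
    smallest_lideal A (lprinc A s) (lprinc A e) \<and>
    smallest_lideal (opposite_ring A) (rprinc A s) (rprinc A f)"

end

context qring
begin

lemma ipairD:
  assumes "ipair e f s"
  shows "primitive A e" "primitive A f" "s \<in> carrier A" "f \<otimes> s = s" "s \<otimes> e = s" "s \<noteq> \<zero>"
    "smallest_lideal A (lprinc A s) (lprinc A e)"
    "smallest_lideal (opposite_ring A) (rprinc A s) (rprinc A f)"
    "e \<in> carrier A" "f \<in> carrier A" "e \<otimes> e = e" "f \<otimes> f = f"
  using assms smallestD(1)[of s] primitiveD[of e] primitiveD[of f] unfolding ipair_def by auto

lemma ipair_jac:
  assumes p: "ipair e f s" and j: "j \<in> jac A"
  shows "j \<otimes> s = \<zero>" "s \<otimes> j = \<zero>"
proof -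
  note p' = ipairD[OF p]
  show "j \<otimes> s = \<zero>" using jac_smallest[OF p'(7,3) j] p'(3) by simp
  interpret op: qring "opposite_ring A" C by (rule qring_opposite)
  show "s \<otimes> j = \<zero>" using op.jac_smallest[OF p'(8), of j s] p'(3) j op.lprinc_self[of s] by (simp add: jac_op)
qed

lemma ipair_op:
  assumes p: "ipair e f s" shows "qring.ipair (opposite_ring A) f e s"
  using ipairD[OF p] qring.ipair_def[OF qring_opposite] by simp

text \<open>As a left multiple of \<open>s\<close>, the element \<open>x\<close> is killed by the
  radical from the right. Hence it lies in the right socle of \<open>f A\<close>, which is
  \<open>s A\<close> by \<open>soc_smallest\<close> in the opposite ring.\<close>

lemma ipair_swap:
  assumes p: "ipair e f s" and x: "x \<in> lprinc A s" "f \<otimes> x = x"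
  shows "\<exists>v\<in>carrier A. e \<otimes> v = v \<and> v \<otimes> e = v \<and> x = s \<otimes> v"
proof -
  note p' = ipairD[OF p]
  interpret op: qring "opposite_ring A" C by (rule qring_opposite)
  obtain a where a: "a \<in> carrier A" "x = a \<otimes> s" using x by (auto elim: lprincE)
  have "x \<in> rprinc A s"
  proof (rule op.soc_smallest[OF _ p'(8)])
    show "x \<in> rprinc A f" using op.lprinc_idem[of f x] p' a x by simp
    fix j assume "j \<in> jac (opposite_ring A)"
    then have j: "j \<in> jac A" by (simp add: jac_op)
    then show "j \<otimes>\<^bsub>opposite_ring A\<^esub> x = \<zero>\<^bsub>opposite_ring A\<^esub>"
      using ipair_jac(2)[OF p j] a p'(3) jac_carrier[OF j] by (simp add: m_assoc)
  qed (use p' in auto)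
  then obtain b where b: "b \<in> carrier A" "x = s \<otimes> b" by (auto simp: rprinc_iff)
  have xe: "x \<otimes> e = x" using a p' by (simp add: m_assoc)
  have "x = s \<otimes> (e \<otimes> b \<otimes> e)" using b p' xe by (metis m_assoc m_closed)
  moreover have "e \<otimes> (e \<otimes> b \<otimes> e) = e \<otimes> b \<otimes> e" using b p' by (simp flip: m_assoc)
  moreover have "e \<otimes> b \<otimes> e \<otimes> e = e \<otimes> b \<otimes> e" using b p' by (simp add: m_assoc)
  ultimately show ?thesis using b p' by (intro bexI[of _ "e \<otimes> b \<otimes> e"]) auto
qed

lemma ipair_mem_right:
  assumes p: "ipair e f s" and u: "u \<in> carrier A" "f \<otimes> u = u" "u \<noteq> \<zero>"
  shows "\<exists>v\<in>carrier A. v \<otimes> e = v \<and> s = u \<otimes> v"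
proof -
  note p' = ipairD[OF p]
  interpret op: qring "opposite_ring A" C by (rule qring_opposite)
  obtain v where v: "v \<in> carrier A" "s = u \<otimes> v"
    using op.smallestD'[OF p'(8), of u] op.lprinc_idem[of f u] p' u by auto
  have "s = u \<otimes> (v \<otimes> e)" using v u p' by (metis m_assoc)
  then show ?thesis using v p' by (intro bexI[of _ "v \<otimes> e"]) (auto simp: m_assoc)
qed

text \<open>For the product \<open>f A \<times> A e \<rightarrow> f A e\<close>, the part of
  \<open>K\<close> in \<open>f A\<close> is recovered from the annihilator of \<open>K\<close> in
  \<open>A e\<close>. This nondegeneracy is what a pair provides in place of a duality. The proof
  climbs a composition series of \<open>K\<close>: in a step from \<open>K0\<close> to
  \<open>K\<close> at most one new generator \<open>w\<close> in \<open>f A\<close> has to be taken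
  into account.\<close>

lemma double_annihilator:
  assumes p: "ipair e f s" and K: "lideal A K"
    and z: "z \<in> carrier A" "f \<otimes> z = z" 
      "\<And>c. c \<in> carrier A \<Longrightarrow> c \<otimes> e = c \<Longrightarrow> (\<And>k. k \<in> K \<Longrightarrow> k \<otimes> c = \<zero>) \<Longrightarrow> z \<otimes> c = \<zero>"
  shows "z \<in> K"
proof -
  note p' = ipairD[OF p]
  have "\<forall>z\<in>carrier A. f \<otimes> z = z \<longrightarrow>
      (\<forall>c\<in>carrier A. c \<otimes> e = c \<longrightarrow> (\<forall>k\<in>K. k \<otimes> c = \<zero>) \<longrightarrow> z \<otimes> c = \<zero>) \<longrightarrow> z \<in> K"
    using K
  proof (induction K rule: cover_induct)
    case zero
    show ?case
    proof (intro ballI impI)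
      fix z assume z: "z \<in> carrier A" "f \<otimes> z = z"
        "\<forall>c\<in>carrier A. c \<otimes> e = c \<longrightarrow> (\<forall>k\<in>{\<zero>}. k \<otimes> c = \<zero>) \<longrightarrow> z \<otimes> c = \<zero>"
      show "z \<in> {\<zero>}"
      proof (rule ccontr)
        assume "z \<notin> {\<zero>}"
        then obtain v where "v \<in> carrier A" "v \<otimes> e = v" "s = z \<otimes> v" using ipair_mem_right[OF p z(1,2)] by auto
        then show False using z(3) p'(6) by auto
      qed
    qed
  next
    case (cover K K0)
    note c = coversD[OF cover(1)]
    have IH: "z \<in> K0" if "z \<in> carrier A" "f \<otimes> z = z"
      "\<And>c. c \<in> carrier A \<Longrightarrow> c \<otimes> e = c \<Longrightarrow> (\<And>k. k \<in> K0 \<Longrightarrow> k \<otimes> c = \<zero>) \<Longrightarrow> z \<otimes> c = \<zero>" for z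
      using cover(2) that by blast
    show ?case
    proof (intro ballI impI)
      fix z assume z: "z \<in> carrier A" "f \<otimes> z = z"
        "\<forall>c\<in>carrier A. c \<otimes> e = c \<longrightarrow> (\<forall>k\<in>K. k \<otimes> c = \<zero>) \<longrightarrow> z \<otimes> c = \<zero>"
      show "z \<in> K"
      \<comment> \<open>If \<open>f\<close> kills \<open>K/K0\<close>, then \<open>K\<close> and
        \<open>K0\<close> have the same annihilator in \<open>A e\<close>: a nonzero
        \<open>k \<otimes> c'\<close> would have \<open>s\<close> as a multiple, and the
        coefficient, moved into \<open>f A\<close>, would lie in \<open>K0\<close>.\<close>
      proof (cases "\<exists>w\<in>K. f \<otimes> w = w \<and> w \<notin> K0")
        case False
        have "z \<in> K0"
        proof (rule IH[OF z(1,2)])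
          fix c' assume c': "c' \<in> carrier A" "c' \<otimes> e = c'" "\<And>k. k \<in> K0 \<Longrightarrow> k \<otimes> c' = \<zero>"
          have "k \<otimes> c' = \<zero>" if k: "k \<in> K" for k
          proof (rule ccontr)
            assume n: "k \<otimes> c' \<noteq> \<zero>"
            have kc: "k \<in> carrier A" using lidealD(3)[OF c(1) k] .
            have "k \<otimes> c' \<in> lprinc A e" using kc c' p' by (simp add: lprinc_idem m_assoc)
            then obtain a where a: "a \<in> carrier A" "s = a \<otimes> (k \<otimes> c')"
              using smallestD'[OF p'(7,3,9) _ n] by blast
            have "f \<otimes> a \<otimes> k \<in> K" using lidealD(5)[OF c(1) _ k] a p' by simp
            moreover have "f \<otimes> (f \<otimes> a \<otimes> k) = f \<otimes> a \<otimes> k" using a kc p' by (simp flip: m_assoc)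
            ultimately have "f \<otimes> a \<otimes> k \<in> K0" using False by blast
            then have "f \<otimes> a \<otimes> k \<otimes> c' = \<zero>" using c'(3) by blast
            then have "f \<otimes> s = \<zero>" using a kc c'(1) p' by (simp add: m_assoc)
            then show False using p' by simp
          qed
          then show "z \<otimes> c' = \<zero>" using z(3) c' by blast
        qed
        then show ?thesis using c by blast
      next
        case True
        then obtain w where w: "w \<in> K" "f \<otimes> w = w" "w \<notin> K0" by blast
        have wc: "w \<in> carrier A" using lidealD(3)[OF c(1) w(1)] .
        define rK0 where "rK0 = {c \<in> carrier A. c \<otimes> e = c \<and> (\<forall>k\<in>K0. k \<otimes> c = \<zero>)}"
        have K: "K = K0 <+>\<^bsub>A\<^esub> lprinc A w" by (rule covers_span[OF cover(1) w(1,3)])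
        have rK: "z \<otimes> c' = \<zero>" if "c' \<in> rK0" "w \<otimes> c' = \<zero>" for c'
        proof -
          have "k \<otimes> c' = \<zero>" if k: "k \<in> K" for k
          proof -
            obtain k0 a where "k0 \<in> K0" "a \<in> carrier A" "k = k0 \<oplus> a \<otimes> w"
              using k unfolding K by (auto simp: mem_set_add elim!: lprincE)
            moreover from this have "k0 \<in> carrier A" using lidealD(3)[OF c(2)] by blast
            ultimately show ?thesis using \<open>c' \<in> rK0\<close> \<open>w \<otimes> c' = \<zero>\<close> wc
              by (simp add: rK0_def l_distr m_assoc)
          qed
          then show ?thesis using z(3) that unfolding rK0_def by blast
        qed
        have rK0_mult: "c' \<otimes> v \<in> rK0" if "c' \<in> rK0" "v \<in> carrier A" "v \<otimes> e = v" for c' v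
        proof -
          have "k \<otimes> (c' \<otimes> v) = \<zero>" if "k \<in> K0" for k
            using \<open>c' \<in> rK0\<close> that lidealD(3)[OF c(2) that] \<open>v \<in> carrier A\<close>
            by (simp add: rK0_def flip: m_assoc)
          then show ?thesis using that p' by (auto simp: rK0_def m_assoc)
        qed
        have "\<exists>c'\<in>rK0. w \<otimes> c' \<noteq> \<zero>"
        proof (rule ccontr)
          assume "\<not> ?thesis"
          then have "w \<in> K0" by (intro IH[OF wc w(2)]) (auto simp: rK0_def)
          with w(3) show False ..
        qed
        \<comment> \<open>By the induction hypothesis for \<open>w\<close> itself. A right multiple
          of \<open>c1\<close> is then normalised to \<open>c0\<close> with
          \<open>w \<otimes> c0 = s\<close>.\<close>
        then obtain c1 where c1: "c1 \<in> rK0" "w \<otimes> c1 \<noteq> \<zero>" by blast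
        then have c1c: "c1 \<in> carrier A" by (simp add: rK0_def)
        have "f \<otimes> (w \<otimes> c1) = w \<otimes> c1" using wc w(2) c1c p' by (simp flip: m_assoc)
        then obtain v where v: "v \<in> carrier A" "v \<otimes> e = v" "s = w \<otimes> c1 \<otimes> v"
          using ipair_mem_right[OF p _ _ c1(2)] wc c1c by auto
        define c0 where "c0 = c1 \<otimes> v"
        have c0: "c0 \<in> rK0" "c0 \<in> carrier A" "c0 \<otimes> e = c0" "w \<otimes> c0 = s"
          using rK0_mult[OF c1(1) v(1,2)] v wc c1c p' unfolding c0_def rK0_def by (auto simp: m_assoc)
        have swap: "\<exists>v\<in>carrier A. e \<otimes> v = v \<and> v \<otimes> e = v \<and> w \<otimes> c' = s \<otimes> v" if c': "c' \<in> rK0" for c'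
        proof (rule ipair_swap[OF p])
          have cc: "c' \<in> carrier A" "c' \<otimes> e = c'" using c' by (auto simp: rK0_def)
          show "f \<otimes> (w \<otimes> c') = w \<otimes> c'" using wc w(2) cc p' by (simp flip: m_assoc)
          show "w \<otimes> c' \<in> lprinc A s"
          proof (rule soc_smallest[OF p'(9,7,3)])
            show "w \<otimes> c' \<in> lprinc A e" using wc cc p' by (simp add: lprinc_idem m_assoc)
            fix j assume j: "j \<in> jac A"
            have "j \<otimes> w \<otimes> c' = \<zero>" using covers_jac[OF cover(1) j w(1)] c' by (simp add: rK0_def)
            then show "j \<otimes> (w \<otimes> c') = \<zero>" using wc cc jac_carrier[OF j] by (simp add: m_assoc)
          qed
        qed
        \<comment> \<open>Otherwise some \<open>c0 \<otimes> (j \<otimes> v)\<close> is not killed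
          by \<open>z\<close>; yet it is killed by \<open>K0\<close> and by \<open>w\<close>, since
          \<open>w \<otimes> c0 \<otimes> j = s \<otimes> j = \<zero>\<close>.\<close>
        have zc0J: "z \<otimes> c0 \<otimes> j = \<zero>" if j: "j \<in> jac A" for j
        proof (rule ccontr)
          assume n: "z \<otimes> c0 \<otimes> j \<noteq> \<zero>"
          have jc: "j \<in> carrier A" using jac_carrier[OF j] .
          have "f \<otimes> (z \<otimes> c0 \<otimes> j) = z \<otimes> c0 \<otimes> j" using z(1,2) c0(2) jc p' by (simp flip: m_assoc)
          then obtain v where v: "v \<in> carrier A" "v \<otimes> e = v" "s = z \<otimes> c0 \<otimes> j \<otimes> v"
            using ipair_mem_right[OF p _ _ n] z(1) c0(2) jc by auto
          have "c0 \<otimes> (j \<otimes> v) \<in> rK0" using rK0_mult[OF c0(1), of "j \<otimes> v"] jc v p' by (simp add: m_assoc)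
          moreover have "w \<otimes> (c0 \<otimes> (j \<otimes> v)) = \<zero>"
          proof -
            have "w \<otimes> (c0 \<otimes> (j \<otimes> v)) = s \<otimes> j \<otimes> v" using wc c0 jc v by (simp flip: m_assoc)
            then show ?thesis using ipair_jac(2)[OF p j] v by simp
          qed
          ultimately have "z \<otimes> (c0 \<otimes> (j \<otimes> v)) = \<zero>" by (rule rK)
          then have "s = \<zero>" using v z(1) c0(2) jc by (simp add: m_assoc)
          with p'(6) show False ..
        qed
        interpret op: qring "opposite_ring A" C by (rule qring_opposite)
        have "z \<otimes> c0 \<in> rprinc A s"
        proof (rule op.soc_smallest[OF _ p'(8)])
          show "z \<otimes> c0 \<in> rprinc A f" using op.lprinc_idem[of f "z \<otimes> c0"] p' z(1,2) c0(2)
            by (simp flip: m_assoc)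
          show "j \<otimes>\<^bsub>opposite_ring A\<^esub> (z \<otimes> c0) = \<zero>\<^bsub>opposite_ring A\<^esub>" if "j \<in> jac (opposite_ring A)" for j
            using zc0J that by (simp add: jac_op)
        qed (use p' in auto)
        then obtain t where t: "t \<in> carrier A" "f \<otimes> t = t" "z \<otimes> c0 = t \<otimes> s"
          using qring.ipair_swap[OF qring_opposite ipair_op[OF p], of "z \<otimes> c0"] z(1) c0(2,3) p'(9)
          by (auto simp: m_assoc)
        \<comment> \<open>Since
          \<open>z \<otimes> c0 = t \<otimes> s = t \<otimes> w \<otimes> c0\<close>, the difference
          kills \<open>c0\<close>. Any \<open>c'\<close> annihilated by \<open>K0\<close> satisfies
          \<open>w \<otimes> c' = s \<otimes> v\<close>, so it agrees with
          \<open>c0 \<otimes> v\<close> up to an element annihilated by all of \<open>K\<close>.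
          Thus \<open>z'\<close> kills \<open>c'\<close> as well, and the induction hypothesis gives
          \<open>z' \<in> K0\<close>.\<close>
        define z' where "z' = z \<ominus> t \<otimes> w"
        have z'c: "z' \<in> carrier A" using z(1) t wc by (simp add: z'_def)
        have "z' \<in> K0"
        proof (rule IH[OF z'c])
          show "f \<otimes> z' = z'" unfolding z'_def using z(1,2) t wc p' by (simp add: minus_distrib flip: m_assoc)
          fix c' assume c': "c' \<in> carrier A" "c' \<otimes> e = c'" "\<And>k. k \<in> K0 \<Longrightarrow> k \<otimes> c' = \<zero>"
          then have c'r: "c' \<in> rK0" by (simp add: rK0_def)
          obtain v where v: "v \<in> carrier A" "v \<otimes> e = v" "w \<otimes> c' = s \<otimes> v" using swap[OF c'r] by blast
          have d: "c' \<ominus> c0 \<otimes> v \<in> rK0"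
          proof -
            have "k \<otimes> (c' \<ominus> c0 \<otimes> v) = \<zero>" if k: "k \<in> K0" for k
              using c' rK0_mult[OF c0(1) v(1,2)] k c0(2) v(1) lidealD(3)[OF c(2) k]
              by (simp add: minus_distrib rK0_def)
            then show ?thesis using c' c0(2) v p' by (simp add: rK0_def minus_distrib m_assoc)
          qed
          have "w \<otimes> (c' \<ominus> c0 \<otimes> v) = w \<otimes> c' \<ominus> w \<otimes> c0 \<otimes> v" using c'(1) c0(2) v(1) wc by (simp add: minus_distrib m_assoc)
          also have "\<dots> = \<zero>" using v c0(4) p'(3) by simp
          finally have w0: "w \<otimes> (c' \<ominus> c0 \<otimes> v) = \<zero>" .
          have "z \<otimes> (c' \<ominus> c0 \<otimes> v) = \<zero>" using rK[OF d w0] .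
          then have "z \<otimes> c' \<ominus> z \<otimes> c0 \<otimes> v = \<zero>" using z(1) c' c0 v by (simp add: minus_distrib m_assoc)
          then have "z \<otimes> c' = t \<otimes> s \<otimes> v" using z(1) c' c0(2) v t(1,3) p'(3) by (simp add: diff_zero_iff)
          moreover have "t \<otimes> w \<otimes> c' = t \<otimes> s \<otimes> v" using t wc c' v p'(3) by (simp add: m_assoc)
          ultimately show "z' \<otimes> c' = \<zero>" unfolding z'_def using z(1) t wc c' v p'(3)
            by (simp add: minus_distrib)
        qed
        then have "z' \<in> K" using c by blast
        moreover have "t \<otimes> w \<in> K" using lidealD(5)[OF c(1)] t w by blast
        ultimately show ?thesis unfolding z'_def using lideal_diffD[OF c(1) _ _ z(1)] by blast
      qed
    qed
  qed
  then show ?thesis using z by blast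
qed

text \<open>Fuller's criterion, in the form of Baer's test: \<open>A e\<close> is injective if \<open>(A e, f A)\<close> is a pair.\<close>

lemma ipair_baer:
  assumes p: "ipair e f s" and K: "lideal A K"
    and h: "\<And>k. k \<in> K \<Longrightarrow> h k \<in> lprinc A e" "\<And>k l. k \<in> K \<Longrightarrow> l \<in> K \<Longrightarrow> h (k \<oplus> l) = h k \<oplus> h l"
      "\<And>a k. a \<in> carrier A \<Longrightarrow> k \<in> K \<Longrightarrow> h (a \<otimes> k) = a \<otimes> h k"
  shows "\<exists>c\<in>lprinc A e. \<forall>k\<in>K. h k = k \<otimes> c"
proof -
  note p' = ipairD[OF p]
  have Le: "lideal A (lprinc A e)" using p' by simp
  show ?thesis using K h
  proof (induction K rule: cover_induct)
    case zero
    have "h \<zero> = \<zero> \<otimes> h \<zero>" using zero(3)[of \<zero> \<zero>] by simp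
    then have "h \<zero> = \<zero>" using zero(1)[of \<zero>] lidealD(3)[OF Le] by simp
    then show ?case using lidealD(2)[OF Le] by (auto intro!: bexI[of _ \<zero>])
  next
    case (cover K K0)
    note c = coversD[OF cover(1)]
    obtain c0 where c0: "c0 \<in> lprinc A e" "\<And>k. k \<in> K0 \<Longrightarrow> h k = k \<otimes> c0"
      using cover(2) cover.prems c(3) by (auto simp: subset_iff)
    have c0c: "c0 \<in> carrier A" using lidealD(3)[OF Le c0(1)] .
    have Kc: "\<And>k. k \<in> K \<Longrightarrow> k \<in> carrier A" using lidealD(3)[OF c(1)] .
    have hc: "\<And>k. k \<in> K \<Longrightarrow> h k \<in> carrier A" using lidealD(3)[OF Le cover.prems(1)] .
    \<comment> \<open>Subtracting the multiplication that represents \<open>h\<close> on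
      \<open>K0\<close> leaves a homomorphism on the simple module \<open>K/K0\<close>.\<close>
    define h' where "h' k = h k \<ominus> k \<otimes> c0" for k
    have h'e: "h' k \<in> lprinc A e" if "k \<in> K" for k
      unfolding h'_def using lideal_diff[OF Le cover.prems(1)[OF that] lidealD(5)[OF Le Kc[OF that] c0(1)]] .
    have h'0: "h' k = \<zero>" if "k \<in> K0" for k
      using that c0(2) c0c Kc c(3) unfolding h'_def by (auto simp: subset_iff)
    have h'a: "h' (a \<otimes> k) = a \<otimes> h' k" if "a \<in> carrier A" "k \<in> K" for a k
      using that cover.prems(3) hc Kc c0c unfolding h'_def by (simp add: minus_distrib m_assoc)
    have h'p: "h' (k \<oplus> l) = h' k \<oplus> h' l" if "k \<in> K" "l \<in> K" for k l
      using that cover.prems(2) hc Kc c0c unfolding h'_def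
      by (simp add: minus_eq l_distr minus_add a_ac)
    have fin: "h k = k \<otimes> (c0 \<oplus> c1)" if "h' k = k \<otimes> c1" "c1 \<in> carrier A" "k \<in> K" for k c1
    proof -
      have "h k = h' k \<oplus> k \<otimes> c0" unfolding h'_def using hc Kc c0c that by (simp add: diff_add_cancel)
      then show ?thesis using that Kc c0c by (simp add: r_distr a_comm)
    qed
    show ?case
    proof (cases "\<forall>k\<in>K. h' k = \<zero>")
      case True
      then have "h k = k \<otimes> c0" if "k \<in> K" for k using fin[of k \<zero>] that Kc c0c by simp
      then show ?thesis using c0(1) by blast
    next
      case False
      then obtain k where k: "k \<in> K" "h' k \<noteq> \<zero>" by blast
      then obtain a where a: "a \<in> carrier A" "s = a \<otimes> h' k"
        using smallestD'[OF p'(7,3,9) h'e] by blast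
      \<comment> \<open>A generator of \<open>K\<close> modulo \<open>K0\<close> that lies in
        \<open>f A\<close> and on which \<open>h'\<close> takes the value \<open>s\<close>.\<close>
      define w where "w = f \<otimes> a \<otimes> k"
      have w: "w \<in> K" "w \<in> carrier A" "f \<otimes> w = w" "h' w = s"
      proof -
        show wK: "w \<in> K" unfolding w_def using lidealD(5)[OF c(1) _ k(1)] a p' by simp
        then show "w \<in> carrier A" by (rule Kc)
        show "f \<otimes> w = w" unfolding w_def using a Kc[OF k(1)] p' by (simp flip: m_assoc)
        have "h' w = f \<otimes> a \<otimes> h' k" unfolding w_def using h'a[OF _ k(1)] a p' by simp
        also have "\<dots> = f \<otimes> s" using a p' lidealD(3)[OF Le h'e[OF k(1)]] by (simp add: m_assoc)
        finally show "h' w = s" using p' by simp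
      qed
      have wK0: "w \<notin> K0" using h'0 w p'(6) by auto
      have K: "K = K0 <+>\<^bsub>A\<^esub> lprinc A w" by (rule covers_span[OF cover(1) w(1) wK0])
      \<comment> \<open>Contraposition of \<open>double_annihilator\<close>: as \<open>w\<close> is
        not in \<open>K0\<close>, something in \<open>A e\<close> is killed by \<open>K0\<close> but
        not by \<open>w\<close>. Scaled so that \<open>w \<otimes> c2 = s\<close>, it represents
        \<open>h'\<close> on \<open>K0\<close> and on \<open>w\<close>, hence on
        \<open>K\<close>.\<close>
      obtain c1 where c1: "c1 \<in> carrier A" "c1 \<otimes> e = c1" "\<And>k. k \<in> K0 \<Longrightarrow> k \<otimes> c1 = \<zero>" "w \<otimes> c1 \<noteq> \<zero>"
        using double_annihilator[OF p c(2) w(2,3)] wK0 by blast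
      have "f \<otimes> (w \<otimes> c1) = w \<otimes> c1" using w c1 p' by (simp flip: m_assoc)
      then obtain v where v: "v \<in> carrier A" "v \<otimes> e = v" "s = w \<otimes> c1 \<otimes> v"
        using ipair_mem_right[OF p _ _ c1(4)] w c1 by auto
      define c2 where "c2 = c1 \<otimes> v"
      have c2: "c2 \<in> carrier A" "c2 \<in> lprinc A e" "w \<otimes> c2 = s" unfolding c2_def
        using c1(1) v w p' by (auto simp: lprinc_idem m_assoc)
      have c2K0: "l \<otimes> c2 = \<zero>" if "l \<in> K0" for l
        using c1(1) c1(3)[OF that] v lidealD(3)[OF c(2) that] unfolding c2_def by (simp flip: m_assoc)
      have "h' l = l \<otimes> c2" if l: "l \<in> K" for l
      proof -
        obtain k0 b where kb: "k0 \<in> K0" "b \<in> carrier A" "l = k0 \<oplus> b \<otimes> w"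
          using l unfolding K by (auto simp: mem_set_add elim!: lprincE)
        have k0: "k0 \<in> K" "k0 \<in> carrier A" using kb c(3) Kc by auto
        have bw: "b \<otimes> w \<in> K" using lidealD(5)[OF c(1) kb(2) w(1)] .
        have "h' l = b \<otimes> s" using h'p[OF k0(1) bw] h'0[OF kb(1)] h'a[OF kb(2) w(1)] w(4) p'(3) kb by simp
        moreover have "l \<otimes> c2 = b \<otimes> s" using c2K0[OF kb(1)] kb k0 w c2 p'(3) by (simp add: l_distr m_assoc)
        ultimately show ?thesis by simp
      qed
      then have "\<forall>l\<in>K. h l = l \<otimes> (c0 \<oplus> c2)" using fin c2(1) by blast
      moreover have "c0 \<oplus> c2 \<in> lprinc A e" using lidealD(4)[OF Le c0(1) c2(2)] .
      ultimately show ?thesis by blast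
    qed
  qed
qed

end

section \<open>Loewy chains of length four, and additive relations on scalar submodules\<close>

context qring
begin

text \<open>The left ideal \<open>J X\<close>, as an intersection; its iterates on
  \<open>A e\<close> form the Loewy series.\<close>

definition jprod :: "'a set \<Rightarrow> 'a set" where
  "jprod X = {x \<in> carrier A. \<forall>Y. lideal A Y \<and> (\<forall>j\<in>jac A. \<forall>x\<in>X. j \<otimes> x \<in> Y) \<longrightarrow> x \<in> Y}"

lemma lideal_jprod: "lideal A (jprod X)"
  unfolding lideal_def jprod_def by auto

lemma jprodI: "j \<in> jac A \<Longrightarrow> x \<in> X \<Longrightarrow> x \<in> carrier A \<Longrightarrow> j \<otimes> x \<in> jprod X"
  unfolding jprod_def using jac_carrier by auto

lemma jprod_covers: "covers A X Y \<Longrightarrow> jprod X \<subseteq> Y"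
  using covers_jac coversD(2) unfolding jprod_def by blast

text \<open>If \<open>J\<^sup>3 e\<close> is nonzero, the four layers of
  \<open>A e > J e > J\<^sup>2 e > J\<^sup>3 e > 0\<close> exhaust the length four, so each is
  simple and every left ideal inside \<open>A e\<close> is a term of the chain. The last nonzero
  term is the smallest. The chain is strict because a maximal submodule of each nonzero term
  contains the next term.\<close>

lemma loewy_smallest:
  assumes e: "primitive A e" and j: "j1 \<in> jac A" "j2 \<in> jac A" "j3 \<in> jac A"
    and s: "s = j1 \<otimes> j2 \<otimes> j3 \<otimes> e" "s \<noteq> \<zero>"
  shows "smallest_lideal A (lprinc A s) (lprinc A e)"
proof -
  note e' = primitiveD[OF e]
  have jc: "j1 \<in> carrier A" "j2 \<in> carrier A" "j3 \<in> carrier A" using j jac_carrier by auto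
  have sc: "s \<in> carrier A" using jc e' s by simp
  define X where "X = rec_nat (lprinc A e) (\<lambda>_. jprod)"
  have X0: "X 0 = lprinc A e" and XS: "X (Suc n) = jprod (X n)" for n by (simp_all add: X_def)
  have L: "lideal A (X n)" for n by (cases n) (use X0 XS lideal_jprod e' in auto)
  have in1: "j3 \<otimes> e \<in> X 1" using jprodI[OF j(3), of e "X 0"] X0 XS[of 0] e' by simp
  have in2: "j2 \<otimes> (j3 \<otimes> e) \<in> X 2" using jprodI[OF j(2) in1] XS[of 1] jc e' by (simp add: numeral_2_eq_2)
  have in3: "s \<in> X 3" using jprodI[OF j(1) in2] XS[of 2] jc e' s by (simp add: numeral_3_eq_3 m_assoc)
  have nz: "X n \<noteq> {\<zero>}" if n: "n \<le> 3" for n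
  proof -
    have "\<exists>x\<in>X n. x \<noteq> \<zero>"
    proof -
      consider "n = 0" | "n = 1" | "n = 2" | "n = 3" using n by linarith
      then show ?thesis
      proof cases
        case 1
        then have "e \<in> X n" using X0 e' by simp
        then show ?thesis using e'(2) by blast
      next
        case 2 then show ?thesis using in1 s jc e' by (intro bexI[of _ "j3 \<otimes> e"]) (auto simp: m_assoc)
      next
        case 3 then show ?thesis using in2 s jc e' by (intro bexI[of _ "j2 \<otimes> (j3 \<otimes> e)"]) (auto simp: m_assoc)
      next
        case 4 then show ?thesis using in3 s by blast
      qed
    qed
    then show ?thesis by blast
  qed
  have zero_sub: "{\<zero>} \<subset> Z" if "lideal A Z" "Z \<noteq> {\<zero>}" for Z using that lidealD(2) by blast
  have strict: "X (Suc n) \<subset> X n" if n: "n \<le> 3" for n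
  proof -
    obtain Y where Y: "covers A (X n) Y"
      using exists_covered[OF L lideal_zero zero_sub[OF L nz[OF n]]] by metis
    show ?thesis using jprod_covers[OF Y] coversD[OF Y] XS[of n] by auto
  qed
  obtain d where d: "lmono A (lprinc A e) d" "d (lprinc A e) \<le> 4" using left_length[OF e] by blast
  have lt: "d Y < d Z" if "lideal A Y" "lideal A Z" "Y \<subset> Z" "Z \<subseteq> X 0" for Y Z
    using d(1) that X0 unfolding lmono_def by simp
  have sub: "X 1 \<subseteq> X 0" "X 2 \<subseteq> X 1" "X 3 \<subseteq> X 2" using strict[of 0] strict[of 1] strict[of 2]
    by (auto simp: numeral_2_eq_2 numeral_3_eq_3)
  have "d (X 1) < d (X 0)" "d (X 2) < d (X 1)" "d (X 3) < d (X 2)" "d {\<zero>} < d (X 3)"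
    using lt[OF L L strict[of 0]] lt[OF L L strict[of 1]] lt[OF L L strict[of 2]]
      lt[OF lideal_zero L zero_sub[OF L nz[of 3]]] sub by (simp_all add: numeral_2_eq_2 numeral_3_eq_3)
  \<comment> \<open>Four strict increases below the bound four determine every value.\<close>
  then have dX: "d (X 0) = 4" "d (X 1) = 3" "d (X 2) = 2" "d (X 3) = 1" "d {\<zero>} = 0"
    using d(2) X0 by auto
  \<comment> \<open>A proper \<open>Z\<close> lies in some maximal \<open>Y\<close> below
    \<open>X n\<close>, which also contains \<open>X (Suc n)\<close>. If \<open>Z\<close> is not
    inside \<open>X (Suc n)\<close>, then \<open>Y\<close> lies strictly between two terms whose
    values differ by one.\<close>
  have step: "Z = X n \<or> Z \<subseteq> X (Suc n)" if n: "n \<le> 2" and Z: "lideal A Z" "Z \<subseteq> X n" for n Z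
  proof (rule disjCI)
    assume nZ: "\<not> Z \<subseteq> X (Suc n)"
    show "Z = X n"
    proof (rule ccontr)
      assume "Z \<noteq> X n"
      then obtain Y where Y: "covers A (X n) Y" "Z \<subseteq> Y" using exists_covered[OF L Z(1)] Z(2) by blast
      note Y' = coversD[OF Y(1)]
      have "X (Suc n) \<subset> Y" using jprod_covers[OF Y(1)] XS[of n] Y(2) nZ by auto
      moreover have "Y \<subset> X n" using Y' by blast
      moreover have "X n \<subseteq> X 0" using n sub by (cases n; cases "n - 1") (auto simp: numeral_2_eq_2)
      ultimately have "d (X (Suc n)) < d Y" "d Y < d (X n)" using lt[OF L Y'(2)] lt[OF Y'(2) L] by auto
      then show False using dX n by (cases n; cases "n - 1") (auto simp: numeral_2_eq_2 numeral_3_eq_3)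
    qed
  qed
  have X3: "X 3 \<subseteq> Z" if Z: "lideal A Z" "Z \<subseteq> lprinc A e" "Z \<noteq> {\<zero>}" for Z
  proof (rule ccontr)
    assume n: "\<not> X 3 \<subseteq> Z"
    have "Z \<subseteq> X 1" using step[of 0 Z] Z X0 n sub by auto
    then have "Z \<subseteq> X 2" using step[of 1 Z] Z n sub by (auto simp: numeral_2_eq_2)
    then have "Z \<subset> X 3" using step[of 2 Z] Z n sub by (auto simp: numeral_3_eq_3)
    then have "d {\<zero>} < d Z" "d Z < d (X 3)" using lt[OF lideal_zero Z(1) zero_sub[OF Z(1,3)]] lt[OF Z(1) L] Z X0 sub
      by auto
    then show False using dX by simp
  qed
  have se: "s \<in> lprinc A e" using s jc e' by (simp add: lprincI)
  have sX: "lprinc A s \<subseteq> X 3" using lprinc_subset[OF L in3] .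
  have "lprinc A s \<noteq> {\<zero>}" using lprinc_self[OF sc] s(2) by auto
  then show ?thesis unfolding smallest_lideal_def
    using X3 sX lprinc_subset[OF lideal_lprinc se] e' sc by auto
qed

text \<open>The factors \<open>f \<otimes> j1\<close> and \<open>j3 \<otimes> e\<close> are radical
  again, so \<open>loewy_smallest\<close> applies to the same \<open>s\<close> from both
  sides.\<close>

lemma loewy_ipair:
  assumes e: "primitive A e" and f: "primitive A f" and j: "j1 \<in> jac A" "j2 \<in> jac A" "j3 \<in> jac A"
    and s: "s = f \<otimes> j1 \<otimes> j2 \<otimes> j3 \<otimes> e" "s \<noteq> \<zero>"
  shows "ipair e f s"
proof -
  note e' = primitiveD[OF e] and f' = primitiveD[OF f]
  interpret op: qring "opposite_ring A" C by (rule qring_opposite)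
  have jc: "j1 \<in> carrier A" "j2 \<in> carrier A" "j3 \<in> carrier A" using j jac_carrier by auto
  have "smallest_lideal A (lprinc A s) (lprinc A e)"
    using loewy_smallest[OF e jac_mult(1)[OF j(1), of f] j(2,3)] s f' by simp
  moreover have "smallest_lideal (opposite_ring A) (rprinc A s) (rprinc A f)"
    using op.loewy_smallest[of f "j3 \<otimes> e" j2 j1 s] f s jac_mult(2)[OF j(3), of e] j e' f' jc
    by (simp add: jac_op m_assoc)
  ultimately show ?thesis unfolding ipair_def using e f s e' f' jc by (simp add: m_assoc) (simp flip: m_assoc)
qed

text \<open>An injective endomorphism of an artinian module is onto, here for an additive relation
  that is a map only modulo \<open>Z\<close>: it is total, its values over \<open>\<zero>\<close>
  include \<open>Z\<close>, and what it relates to \<open>\<zero>\<close> lies in \<open>Z\<close>.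
  The iterated images \<open>X n\<close> of \<open>M\<close> descend and become stationary
  somewhere.\<close>

lemma scalar_peel:
  assumes M: "scalar_submodule A C M" and Z: "Z \<subseteq> M"
    and H: "H \<subseteq> M \<times> M" "\<And>y z y' z'. (y, z) \<in> H \<Longrightarrow> (y', z') \<in> H \<Longrightarrow> (y \<oplus> y', z \<oplus> z') \<in> H"
      "\<And>y z. (y, z) \<in> H \<Longrightarrow> (\<ominus> y, \<ominus> z) \<in> H"
      "\<And>y z r. (y, z) \<in> H \<Longrightarrow> r \<in> C \<Longrightarrow> (r \<otimes> y, r \<otimes> z) \<in> H"
    and total: "\<And>y. y \<in> M \<Longrightarrow> \<exists>z. (y, z) \<in> H"
    and zero: "\<And>z. z \<in> Z \<Longrightarrow> (\<zero>, z) \<in> H" "\<zero> \<in> Z"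
    and inj: "\<And>y. (y, \<zero>) \<in> H \<Longrightarrow> y \<in> Z"
  shows "H `` M = M"
proof -
  have Mc: "M \<subseteq> carrier A" and M0: "\<zero> \<in> M" using M by (auto simp: scalar_submodule_def)
  define X where "X = rec_nat M (\<lambda>_ Y. H `` Y)"
  have X0: "X 0 = M" and XS: "X (Suc n) = H `` X n" for n by (simp_all add: X_def)
  have S: "scalar_submodule A C (X n)" for n
  proof (induction n)
    case (Suc n)
    note IH = Suc[unfolded scalar_submodule_def]
    show ?case unfolding scalar_submodule_def XS
    proof (intro conjI ballI)
      show "H `` X n \<subseteq> carrier A" using H(1) Mc by blast
      show "\<zero> \<in> H `` X n" using zero IH by blast
      show "x \<oplus> y \<in> H `` X n" if "x \<in> H `` X n" "y \<in> H `` X n" for x y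
        using that H(2) IH by (auto simp: Image_iff) metis
      show "\<ominus> x \<in> H `` X n" if "x \<in> H `` X n" for x using that H(3) IH unfolding Image_iff by blast
      show "r \<otimes> x \<in> H `` X n" if "r \<in> C" "x \<in> H `` X n" for r x using that H(4) IH unfolding Image_iff by blast
    qed
  qed (use X0 M in simp)
  have dec: "X (Suc n) \<subseteq> X n" for n
  proof (induction n)
    case 0 then show ?case using XS X0 H(1) by auto
  next
    case (Suc n) then show ?case using XS[of "Suc n"] XS[of n] by blast
  qed
  have ZX: "Z \<subseteq> X n" for n
  proof (cases n)
    case (Suc m)
    have "\<zero> \<in> X m" using S[of m] by (simp add: scalar_submodule_def)
    then show ?thesis using zero(1) Suc XS[of m] by blast
  qed (use X0 Z in simp)
  \<comment> \<open>Stationarity moves down by one index: a value \<open>z\<close> of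
    \<open>y \<in> X n\<close> is also a value of some \<open>y' \<in> X (Suc n)\<close>, so
    \<open>y \<ominus> y'\<close> is related to \<open>\<zero>\<close>, lies in \<open>Z\<close>,
    and therefore in \<open>X (Suc n)\<close>.\<close>
  have peel: "X (Suc n) = X n \<Longrightarrow> X 1 = X 0" for n
  proof (induction n)
    case (Suc n)
    have "X n \<subseteq> X (Suc n)"
    proof
      fix y assume y: "y \<in> X n"
      have XM: "X k \<subseteq> M" for k by (induction k) (use X0 dec in auto)
      obtain z where z: "(y, z) \<in> H" using total XM y by blast
      then have "z \<in> X (Suc (Suc n))" using XS[of n] y Suc(2) by blast
      then obtain y' where y': "y' \<in> X (Suc n)" "(y', z) \<in> H" using XS[of "Suc n"] by blast
      have c: "y \<in> carrier A" "y' \<in> carrier A" "z \<in> carrier A" using XM y y'(1) Mc z H(1) by blast+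
      have "(y \<oplus> \<ominus> y', z \<oplus> \<ominus> z) \<in> H" using H(2)[OF z H(3)[OF y'(2)]] .
      then have "y \<ominus> y' \<in> X (Suc n)" using inj ZX c by (auto simp: r_neg minus_eq)
      then have "(y \<ominus> y') \<oplus> y' \<in> X (Suc n)" using y'(1) S[of "Suc n"] by (simp add: scalar_submodule_def)
      then show "y \<in> X (Suc n)" using c by (simp add: diff_add_cancel)
    qed
    then show ?case using Suc dec by blast
  qed simp
  obtain n where "X (Suc n) = X n" using dcc[of X] S dec by blast
  then have "X 1 = X 0" by (rule peel)
  then show ?thesis using X0 XS[of 0] by simp
qed

end

section \<open>Colocal projective modules that are not uniserial\<close>

context qring
begin

lemma smallest_lidealI:
  assumes s: "s \<in> carrier A" "s \<noteq> \<zero>" "lprinc A s \<subseteq> X"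
    and "\<And>y. y \<in> X \<Longrightarrow> y \<noteq> \<zero> \<Longrightarrow> s \<in> lprinc A y" and X: "lideal A X"
  shows "smallest_lideal A (lprinc A s) X"
  unfolding smallest_lideal_def
proof (intro conjI allI impI)
  show "lprinc A s \<noteq> {\<zero>}" using lprinc_self[OF s(1)] s(2) by auto
  fix Z assume Z: "lideal A Z \<and> Z \<subseteq> X \<and> Z \<noteq> {\<zero>}"
  then obtain y where y: "y \<in> Z" "y \<noteq> \<zero>" using lidealD(2)[of A Z] by blast
  then have "s \<in> lprinc A y" using assms(4) Z by blast
  then have "s \<in> Z" using lprinc_subset[of Z y] Z y by blast
  then show "lprinc A s \<subseteq> Z" using lprinc_subset Z by blast
qed (use assms in auto)

text \<open>Only the right-hand half has to be shown: \<open>s A\<close> is smallest in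
  \<open>f A\<close>. The pairing of \<open>f J\<close> with \<open>W\<close>, where
  \<open>W = N + K\<close> turns out to be the radical of \<open>A e\<close>, has values in the
  simple socle \<open>S\<close>. If the quotient of \<open>f J\<close> by the annihilator of
  \<open>W\<close> is not simple, the length bound for \<open>f A\<close> settles the matter. If it
  is simple, \<open>W/S\<close> would be generated by one element, although it is the sum of the two
  different simple modules \<open>N/S\<close> and \<open>K/S\<close> over a semisimple situation
  that \<open>noncyclic\<close> rules out for a generator in a corner \<open>g W\<close>.\<close>

lemma colocal_ipair:
  assumes e: "primitive A e" and f: "primitive A f"
    and s: "s \<in> carrier A" "f \<otimes> s = s" "s \<otimes> e = s" "smallest_lideal A (lprinc A s) (lprinc A e)"
    and N: "lideal A N" "N \<subseteq> lprinc A e" and K: "lideal A K" "K \<subseteq> lprinc A e"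
    and inc: "\<not> N \<subseteq> K" "\<not> K \<subseteq> N"
  shows "ipair e f s"
proof -
  interpret op: qring "opposite_ring A" C by (rule qring_opposite)
  note e' = primitiveD[OF e] and f' = primitiveD[OF f]
  note Nc = lidealD[OF N(1)] and Kc = lidealD[OF K(1)]
  note sm = smallestD[OF s(4,1)]
  define S where "S = lprinc A s"
  define W where "W = N <+>\<^bsub>A\<^esub> K"
  have LS: "lideal A S" and Le: "lideal A (lprinc A e)" and LW: "lideal A W"
    using s e' N K unfolding S_def W_def by (auto intro: lideal_add)
  have LNK: "lideal A (N \<inter> K)" using lideal_Int[OF N(1) K(1)] .
  have sS: "s \<in> S" using s unfolding S_def by simp
  have ideal_S: "S \<subseteq> Z" if "lideal A Z" "Z \<subseteq> lprinc A e" "Z \<noteq> {\<zero>}" for Z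
    using lprinc_subset[OF that(1) sm(4)[OF that]] unfolding S_def .
  have SN: "S \<subseteq> N" "S \<subseteq> K" using ideal_S[OF N] ideal_S[OF K] inc Nc(2) Kc(2) by auto
  have NW: "N \<subset> W" "K \<subset> W" using lideal_add_upper[OF N(1) K(1)] inc unfolding W_def by auto
  have We: "W \<subseteq> lprinc A e" unfolding W_def by (rule lideal_add_least[OF Le N(2) K(2)])
  have not_e: "Z = lprinc A e" if "lideal A Z" "Z \<subseteq> lprinc A e" "e \<in> Z" for Z
    using lprinc_subset[OF that(1,3)] that(2) by blast
  have eN: "e \<notin> N" "e \<notin> K" using not_e[OF N] not_e[OF K] N(2) K(2) inc by auto
  have mem_e: "x \<in> carrier A \<and> x \<otimes> e = x" if "x \<in> lprinc A e" for x using that e' by (simp add: lprinc_idem)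
  \<comment> \<open>\<open>A e\<close> is local: by \<open>local_add\<close> one of the two summands
    of \<open>e\<close> would generate \<open>A e\<close>.\<close>
  have eW: "e \<notin> W"
  proof
    assume "e \<in> W"
    then obtain n k where nk: "n \<in> N" "k \<in> K" "e = n \<oplus> k" unfolding W_def by (auto simp: mem_set_add)
    then have "e \<in> lprinc A n \<or> e \<in> lprinc A k"
      using local_add[OF e, of n k] mem_e N(2) K(2) e' lprinc_self by (metis subsetD)
    then show False using lprinc_subset[OF N(1) nk(1)] lprinc_subset[OF K(1) nk(2)] eN by blast
  qed
  have We': "W \<subset> lprinc A e" using We eW e' lprinc_self[of e] by blast
  obtain d where d: "lmono A (lprinc A e) d" "d (lprinc A e) \<le> 4" using left_length[OF e] by blast
  have lt: "d Y < d Z" if "lideal A Y" "lideal A Z" "Y \<subset> Z" "Z \<subseteq> lprinc A e" for Y Z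
    using d(1) that unfolding lmono_def by simp
  have S0: "{\<zero>} \<subset> S" using sm(1) sS lidealD(2)[OF LS] by auto
  have NK: "N \<inter> K \<subset> N" "N \<inter> K \<subset> K" using inc by auto
  have SNK: "S \<subseteq> N \<inter> K" using SN by blast
  have NKe: "N \<inter> K \<subseteq> lprinc A e" using N by blast
  have "d {\<zero>} < d S" "d S \<le> d (N \<inter> K)" "d (N \<inter> K) < d N" "d (N \<inter> K) < d K" "d N < d W" "d K < d W"
    "d W < d (lprinc A e)"
    using lt[OF lideal_zero LS S0] lmono_le(1)[OF d(1) LS LNK SNK NKe] lt[OF LNK N(1) NK(1) N(2)]
      lt[OF LNK K(1) NK(2) K(2)] lt[OF N(1) LW NW(1) We] lt[OF K(1) LW NW(2) We] lt[OF LW Le We'] SN N(2) by auto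
  then have dv: "d S = 1" "d (N \<inter> K) = 1" "d N = 2" "d K = 2" "d W = 3" "d (lprinc A e) = 4" using d(2) by auto
  have NKS: "N \<inter> K = S" using lmono_le(2)[OF d(1) LS LNK SNK NKe] dv by simp
  have cov: "covers A Y Z" if "lideal A Y" "lideal A Z" "Z \<subset> Y" "Y \<subseteq> lprinc A e" "d Y = Suc (d Z)" for Y Z
    unfolding covers_def
  proof (intro conjI allI impI)
    fix V assume V: "lideal A V \<and> Z \<subseteq> V \<and> V \<subseteq> Y"
    show "V = Z \<or> V = Y"
    proof (rule ccontr)
      assume n: "\<not> ?thesis"
      then have "d Z < d V" "d V < d Y" using lt[OF that(2), of V] lt[OF _ that(1), of V] V that by auto
      with that(5) show False by simp
    qed
  qed (use that in auto)
  have covN: "covers A N S" "covers A K S" "covers A (lprinc A e) W"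
    using cov[OF N(1) LS _ N(2)] cov[OF K(1) LS _ K(2)] cov[OF Le LW We'] dv NK[unfolded NKS] by auto
  have jS: "j \<otimes> x = \<zero>" if "j \<in> jac A" "x \<in> S" for j x
    using jac_smallest[OF s(4,1) that(1)] that(2) unfolding S_def by blast
  have jW: "j \<otimes> x \<in> S" if j: "j \<in> jac A" and x: "x \<in> W" for j x
  proof -
    obtain n k where nk: "n \<in> N" "k \<in> K" "x = n \<oplus> k" using x unfolding W_def by (auto simp: mem_set_add)
    have "j \<otimes> n \<in> S" "j \<otimes> k \<in> S" using covers_jac[OF covN(1) j nk(1)] covers_jac[OF covN(2) j nk(2)] .
    then show ?thesis using lidealD(4)[OF LS] nk Nc(3) Kc(3) jac_carrier[OF j] by (simp add: r_distr)
  qed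
  have Wc: "x \<in> carrier A" "x \<otimes> e = x" if "x \<in> W" for x using mem_e We that by auto
  have Sc: "x \<in> carrier A" if "x \<in> S" for x using lidealD(3)[OF LS that] .
  have SW: "S \<subseteq> W" using SN NW by auto
  \<comment> \<open>\<open>W\<close> is the radical of \<open>A e\<close>: it omits
    \<open>e\<close>, and the radical kills the simple quotient \<open>A e/W\<close>.\<close>
  have W_iff: "x \<in> W \<longleftrightarrow> x \<in> jac A" if "x \<in> carrier A" "x \<otimes> e = x" for x
  proof
    assume x: "x \<in> W"
    have "e \<notin> lprinc A x" using lprinc_subset[OF LW x] eW by blast
    then show "x \<in> jac A" using jac_mem[OF e that] by blast
  next
    assume x: "x \<in> jac A"
    show "x \<in> W" using covers_jac[OF covN(3) x, of e] that e' by simp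
  qed
  have soc: "c \<in> S" if "c \<in> W" "\<And>j. j \<in> jac A \<Longrightarrow> j \<otimes> c = \<zero>" for c
    using soc_smallest[OF e'(1) s(4,1) _ that(2)] that(1) We unfolding S_def by blast
  have "\<not> W \<subseteq> S" using NW SN NK NKS by auto
  then obtain x0 where "x0 \<in> W" "x0 \<notin> S" by blast
  \<comment> \<open>Elements of \<open>W\<close> killed by the radical lie in \<open>S\<close>.
    Consequently \<open>s\<close> is a left multiple of a product of the two radical elements
    \<open>j0\<close> and \<open>x0\<close>.\<close>
  then obtain j0 where jx0: "j0 \<in> jac A" "x0 \<in> W" "j0 \<otimes> x0 \<noteq> \<zero>" using soc by blast
  have gen_s: "\<exists>a\<in>carrier A. s = a \<otimes> x" if "x \<in> W" "x \<noteq> \<zero>" for x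
    using smallestD'[OF s(4,1) e'(1) _ that(2)] that(1) We by blast
  \<comment> \<open>A generator \<open>y\<close> of \<open>W\<close> modulo \<open>S\<close>
    generates \<open>W\<close>, since \<open>S\<close> lies in every nonzero left ideal. With
    \<open>y = g \<otimes> y\<close> this makes \<open>W\<close> a quotient of the local module
    \<open>A g\<close>, which cannot be the sum of the proper submodules \<open>N\<close> and
    \<open>K\<close>.\<close>
  have noncyclic: False if g: "primitive A g" and y: "y \<in> W" "g \<otimes> y = y" and
    gen: "W \<subseteq> lprinc A y <+>\<^bsub>A\<^esub> S" for g y
  proof -
    note g' = primitiveD[OF g]
    have yc: "y \<in> carrier A" using Wc y by blast
    have y0: "y \<noteq> \<zero>"
    proof
      assume y0: "y = \<zero>"
      have "lprinc A y \<subseteq> S" using lprinc_subset[OF LS] y0 lidealD(2)[OF LS] by simp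
      then have "W \<subseteq> S" using gen lideal_add_least[OF LS _ order_refl] by blast
      with \<open>\<not> W \<subseteq> S\<close> show False ..
    qed
    have Ly: "lideal A (lprinc A y)" "lprinc A y \<subseteq> W" using yc lprinc_subset[OF LW y(1)] by auto
    have "S \<subseteq> lprinc A y" using ideal_S[OF Ly(1)] Ly(2) We lprinc_self[OF yc] y0 by blast
    then have Wy: "W = lprinc A y" using gen lideal_add_least[OF Ly(1) order_refl] Ly(2) by blast
    obtain n k where nk: "n \<in> N" "k \<in> K" "y = n \<oplus> k" using y(1) unfolding W_def by (auto simp: mem_set_add)
    have "n \<in> lprinc A y" "k \<in> lprinc A y" using nk NW Wy by blast+
    then obtain a b where a: "a \<in> carrier A" "n = a \<otimes> y" and b: "b \<in> carrier A" "k = b \<otimes> y"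
      by (auto elim!: lprincE)
    \<comment> \<open>Otherwise \<open>g\<close> would be a left multiple of
      \<open>g \<otimes> c \<otimes> g\<close>, and \<open>y\<close> would be a left multiple of
      \<open>c \<otimes> y\<close>, hence in the proper submodule \<open>Z\<close>.\<close>
    have key: "g \<otimes> c \<otimes> g \<in> jac A" if c: "c \<in> carrier A" and Z: "lideal A Z" "c \<otimes> y \<in> Z" "Z \<subset> W" for c Z
    proof (rule ccontr)
      assume "g \<otimes> c \<otimes> g \<notin> jac A"
      then obtain u where u: "u \<in> carrier A" "g = u \<otimes> (g \<otimes> c \<otimes> g)"
        using jac_mem[OF g, of "g \<otimes> c \<otimes> g"] g' c by (auto elim: lprincE simp: m_assoc)
      have "y = u \<otimes> (g \<otimes> c \<otimes> g) \<otimes> y" using y(2) u(2) by simp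
      also have "\<dots> = u \<otimes> g \<otimes> (c \<otimes> y)" using u(1) g' c yc y(2) by (simp add: m_assoc)
      finally have "y \<in> Z" using lidealD(5)[OF Z(1) _ Z(2), of "u \<otimes> g"] u g' by simp
      then have "W \<subseteq> Z" using lprinc_subset[OF Z(1)] Wy by blast
      with Z(3) show False by blast
    qed
    have ka: "g \<otimes> a \<otimes> g \<in> jac A" using key[OF a(1) N(1)] nk(1)[unfolded a(2)] NW(1) by blast
    have kb: "g \<otimes> b \<otimes> g \<in> jac A" using key[OF b(1) K(1)] nk(2)[unfolded b(2)] NW(2) by blast
    define q where "q = g \<otimes> a \<otimes> g \<oplus> g \<otimes> b \<otimes> g"
    have q: "q \<in> jac A" "q \<in> carrier A" "q \<otimes> g = q"
      using jac_add[OF ka kb] g' a b unfolding q_def by (auto simp: l_distr m_assoc)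
    have "q \<otimes> y = g \<otimes> (a \<otimes> y \<oplus> b \<otimes> y)" using g' a(1) b(1) yc y(2) unfolding q_def
      by (simp add: l_distr r_distr m_assoc)
    then have "q \<otimes> y = y" by (metis a(2) b(2) nk(3) y(2))
    then have "(g \<ominus> q) \<otimes> y = \<zero>" using g' q yc y(2) by (simp add: minus_distrib)
    moreover have "g \<ominus> q \<notin> jac A"
      using lideal_diffD[OF jac_lideal _ q(1) g'(1)] primitive_not_jac[OF g] by blast
    then obtain u where "u \<in> carrier A" "g = u \<otimes> (g \<ominus> q)"
      using jac_mem[OF g, of "g \<ominus> q"] g' q by (auto elim: lprincE simp: minus_distrib)
    ultimately have "y = \<zero>" using y(2) yc q g'(1) by (metis m_assoc minus_closed r_null)
    with y0 show False ..
  qed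
  \<comment> \<open>Multiplication pairs \<open>f J\<close> with \<open>W\<close>, with values in
    \<open>S\<close>. \<open>K0\<close> is its left kernel, and the right kernel is
    \<open>S\<close>.\<close>
  define FJ where "FJ = {x \<in> carrier A. f \<otimes> x = x \<and> x \<in> jac A}"
  define K0 where "K0 = {x \<in> FJ. \<forall>w\<in>W. x \<otimes> w = \<zero>}"
  have FJc: "x \<in> carrier A" "f \<otimes> x = x" "x \<in> jac A" if "x \<in> FJ" for x using that by (auto simp: FJ_def)
  have jac0: "\<zero> \<in> jac A" using lidealD(2)[OF jac_lideal] .
  have RFJ: "rideal A FJ" unfolding lideal_rideal_iff FJ_def using f' jac_add jac_mult jac0
    by (auto simp: r_distr simp flip: m_assoc)
  have RK0: "rideal A K0" unfolding lideal_rideal_iff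
  proof (intro conjI ballI)
    show "K0 \<subseteq> carrier A" using FJc by (auto simp: K0_def)
    show "\<zero> \<in> K0" using lidealD(2)[OF RFJ] Wc by (auto simp: K0_def)
    show "x \<oplus> y \<in> K0" if "x \<in> K0" "y \<in> K0" for x y
      using that lidealD(4)[OF RFJ, of x y] FJc Wc by (auto simp: K0_def l_distr)
    show "x \<otimes> a \<in> K0" if a: "a \<in> carrier A" and x: "x \<in> K0" for a x
    proof -
      have "x \<otimes> a \<otimes> w = \<zero>" if w: "w \<in> W" for w
        using lidealD(5)[OF LW a w] x a FJc Wc[OF w] by (auto simp: K0_def m_assoc)
      then show ?thesis using lidealD(5)[OF RFJ, of a x] x a by (simp add: K0_def)
    qed
  qed
  have K0W: "x \<otimes> w = \<zero>" if "x \<in> K0" "w \<in> W" for x w using that by (simp add: K0_def)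
  have K0FJ: "K0 \<subseteq> FJ" by (auto simp: K0_def)
  have sjx: "\<exists>a\<in>carrier A. s = a \<otimes> (j0 \<otimes> x0)"
    using gen_s[of "j0 \<otimes> x0"] jW[OF jx0(1,2)] jx0(3) SW by blast
  then obtain a0 where a0: "a0 \<in> carrier A" "s = a0 \<otimes> (j0 \<otimes> x0)" by blast
  \<comment> \<open>With \<open>s = a0 \<otimes> (j0 \<otimes> x0)\<close>, the product contains
    \<open>x0 \<otimes> w \<in> J W \<subseteq> S\<close>, which \<open>j0\<close> kills.\<close>
  have sw: "s \<otimes> w = \<zero>" if w: "w \<in> W" for w
  proof -
    have "x0 \<in> jac A" using W_iff[of x0] Wc[OF jx0(2)] jx0(2) by blast
    then have "j0 \<otimes> (x0 \<otimes> w) = \<zero>" using jS[OF jx0(1) jW[OF _ w]] by blast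
    then show ?thesis using a0 jac_carrier[OF jx0(1)] Wc[OF jx0(2)] Wc[OF w] by (simp add: m_assoc)
  qed
  have SK0: "x \<in> K0" if x: "x \<in> S" "f \<otimes> x = x" for x
  proof -
    obtain a where a: "a \<in> carrier A" "x = a \<otimes> s" using x unfolding S_def by (auto elim: lprincE)
    have "x \<in> W" using SW x by blast
    then have "x \<in> FJ" using W_iff[of x] Wc[of x] x by (simp add: FJ_def)
    moreover have "x \<otimes> w = \<zero>" if "w \<in> W" for w using a s(1) sw[OF that] Wc[OF that] by (simp add: m_assoc)
    ultimately show ?thesis by (simp add: K0_def)
  qed
  have sK0: "s \<in> K0" using SK0[OF sS s(2)] .
  have FJK0: "K0 \<noteq> FJ"
  proof -
    define u where "u = f \<otimes> a0 \<otimes> j0"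
    have jc: "j0 \<in> carrier A" "x0 \<in> carrier A" using jac_carrier[OF jx0(1)] Wc[OF jx0(2)] by auto
    have "u \<in> FJ" unfolding u_def FJ_def using f' a0 jc jac_mult(1)[OF jx0(1), of "f \<otimes> a0"]
      by (simp flip: m_assoc)
    moreover have "u \<otimes> x0 = f \<otimes> s" unfolding u_def using a0 f' jc by (simp add: m_assoc)
    then have "u \<notin> K0" using K0W[of u x0] jx0(2) s(2) sm(1) by auto
    ultimately show ?thesis by blast
  qed
  have sR: "rprinc A s \<subseteq> K0" using op.lprinc_subset[OF RK0 sK0] .
  have LRs: "rideal A (rprinc A s)" using op.lideal_lprinc[of s] s by simp
  have Lf: "rideal A (rprinc A f)" using op.lideal_lprinc[of f] f' by simp
  have mem_f: "x \<in> rprinc A f \<longleftrightarrow> x \<in> carrier A \<and> f \<otimes> x = x" for x using op.lprinc_idem[of f x] f' by simp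
  have FJf: "FJ \<subset> rprinc A f"
  proof
    show "FJ \<subseteq> rprinc A f" using FJc(1,2) mem_f by blast
    have "f \<notin> FJ" "f \<in> rprinc A f" using primitive_not_jac[OF f] FJc(3) mem_f f' by blast+
    then show "FJ \<noteq> rprinc A f" by blast
  qed
  \<comment> \<open>Either there is a right ideal strictly between \<open>K0\<close> and
    \<open>f J\<close>; then \<open>0 < s A \<le> K0 < X < f J < f A\<close> exhausts the bound four
    and \<open>K0 = s A\<close> is simple. Or \<open>f J/K0\<close> is simple, which is
    refuted.\<close>
  show ?thesis
  proof (cases "\<exists>X. rideal A X \<and> K0 \<subset> X \<and> X \<subset> FJ")
    case True
    then obtain X where X: "rideal A X" "K0 \<subset> X" "X \<subset> FJ" by blast
    obtain d where d: "lmono (opposite_ring A) (rprinc A f) d" "d (rprinc A f) \<le> 4"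
      using right_length[OF f] by blast
    have lt: "d Y < d Z" if "rideal A Y" "rideal A Z" "Y \<subset> Z" "Z \<subseteq> rprinc A f" for Y Z
      using d(1) that unfolding lmono_def by simp
    have z: "rideal A {\<zero>}" using op.lideal_zero by simp
    have "s \<in> rprinc A s" using op.lprinc_self[of s] s(1) by simp
    then have s0: "{\<zero>} \<subset> rprinc A s" using sm(1) lidealD(2)[OF LRs] by auto
    have K0f: "K0 \<subseteq> rprinc A f" "X \<subseteq> rprinc A f" using K0FJ FJf X by auto
    have "d {\<zero>} < d (rprinc A s)" "d (rprinc A s) \<le> d K0" "d K0 < d X" "d X < d FJ" "d FJ < d (rprinc A f)"
      using lt[OF z LRs s0] op.lmono_le(1)[OF d(1) LRs RK0 sR] lt[OF RK0 X(1,2)] lt[OF X(1) RFJ X(3)]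
        lt[OF RFJ Lf FJf] K0f sR FJf by auto
    then have dv: "d (rprinc A s) = 1" "d K0 = 1" "d {\<zero>} = 0" using d(2) by auto
    have K0s: "rprinc A s = K0" using op.lmono_le(2)[OF d(1) LRs RK0 sR K0f(1)] dv by simp
    \<comment> \<open>Every nonzero \<open>y\<close> has a nonzero multiple in the simple
      \<open>K0\<close>: outside the radical it generates \<open>f A\<close>, and inside the radical
      but outside \<open>K0\<close> some \<open>y \<otimes> w\<close> is a nonzero element of
      \<open>S\<close> in \<open>f A\<close>, hence of \<open>K0\<close>.\<close>
    have "s \<in> rprinc A y" if y: "y \<in> rprinc A f" "y \<noteq> \<zero>" for y
    proof -
      have yc: "y \<in> carrier A" "f \<otimes> y = y" using y mem_f by auto
      have Ly: "rideal A (rprinc A y)" using op.lideal_lprinc[of y] yc by simp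
      have Lyf: "rprinc A y \<subseteq> rprinc A f" using op.lprinc_subset[OF Lf y(1)] .
      have yy: "y \<in> rprinc A y" using op.lprinc_self[of y] yc by simp
      have fin: "s \<in> rprinc A y" if x: "x \<in> K0" "x \<in> rprinc A y" "x \<noteq> \<zero>" for x
      proof -
        have L: "rideal A (K0 \<inter> rprinc A y)" using op.lideal_Int[OF RK0 Ly] .
        have sub: "{\<zero>} \<subset> K0 \<inter> rprinc A y" using x lidealD(2)[OF L] by auto
        have "d {\<zero>} < d (K0 \<inter> rprinc A y)" using lt[OF z L sub] K0f by auto
        moreover have "d (K0 \<inter> rprinc A y) \<le> d K0"
          using op.lmono_le(1)[OF d(1) L RK0 _ K0f(1)] by blast
        ultimately have "d (K0 \<inter> rprinc A y) = d K0" using dv by simp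
        then have "K0 \<inter> rprinc A y = K0" using op.lmono_le(2)[OF d(1) L RK0 _ K0f(1)] by blast
        then show ?thesis using sK0 by blast
      qed
      show ?thesis
      proof (cases "y \<in> K0")
        case True then show ?thesis using fin[OF True yy y(2)] by simp
      next
        case nK0: False
        show ?thesis
        proof (cases "y \<in> jac A")
          case True
          then have "y \<in> FJ" using yc by (simp add: FJ_def)
          then obtain w where w: "w \<in> W" "y \<otimes> w \<noteq> \<zero>" using nK0 by (auto simp: K0_def)
          have "y \<otimes> w \<in> K0" using SK0[OF jW[OF True w(1)]] yc Wc[OF w(1)] f' by (simp flip: m_assoc)
          moreover have "y \<otimes> w \<in> rprinc A y" using Wc[OF w(1)] by (auto simp: rprinc_iff)
          ultimately show ?thesis using fin w(2) by blast
        next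
          case False
          then have "f \<in> rprinc A y" using jac_mem_op[OF f yc] by blast
          then have "rprinc A f \<subseteq> rprinc A y" using op.lprinc_subset[OF Ly] by blast
          then show ?thesis using sK0 K0f by blast
        qed
      qed
    qed
    then have "smallest_lideal (opposite_ring A) (rprinc A s) (rprinc A f)"
      using op.smallest_lidealI[of s "rprinc A f"] s(1) sm(1) sR K0f Lf by auto
    then show ?thesis unfolding ipair_def using e f s by blast
  next
    case False
    \<comment> \<open>Now \<open>f J/K0\<close> is generated by a single
      \<open>b = b \<otimes> g\<close>. Up to duality \<open>W/S\<close> is no larger, so it is
      generated by one element \<open>y1\<close> of \<open>g W\<close>, contrary to
      \<open>noncyclic\<close>.\<close>
    then have covFJ: "covers (opposite_ring A) FJ K0"
      unfolding covers_def using RFJ RK0 K0FJ FJK0 by blast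
    have "\<exists>x\<in>FJ. x \<notin> K0" using K0FJ FJK0 by blast
    then obtain x where x: "x \<in> FJ" "x \<notin> K0" by blast
    have "\<exists>g. primitive A g \<and> x \<otimes> g \<notin> K0"
    proof (rule ccontr)
      assume "\<not> ?thesis"
      then have "x \<in> K0" using decomp_right[of x K0] x FJc lidealD(2,4)[OF RK0] by auto
      with x(2) show False ..
    qed
    then obtain g where g: "primitive A g" and xg: "x \<otimes> g \<notin> K0" by blast
    note g' = primitiveD[OF g]
    define b where "b = x \<otimes> g"
    have b: "b \<in> FJ" "b \<notin> K0" "b \<otimes> g = b" "b \<in> carrier A" "b \<in> jac A" "f \<otimes> b = b"
    proof -
      show bF: "b \<in> FJ" using lidealD(5)[OF RFJ _ x(1), of g] g' unfolding b_def by simp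
      show "b \<notin> K0" using xg unfolding b_def .
      show "b \<otimes> g = b" unfolding b_def using FJc(1)[OF x(1)] g' by (simp add: m_assoc)
    qed (rule FJc[OF lidealD(5)[OF RFJ _ x(1), of g, simplified, OF g'(1), folded b_def]])+
    have bJ: "b \<otimes> j \<in> K0" if "j \<in> jac A" for j
      using op.covers_jac[OF covFJ _ b(1), of j] that by (simp add: jac_op)
    have FJb: "\<exists>c\<in>carrier A. \<exists>k\<in>K0. x = b \<otimes> c \<oplus> k" if "x \<in> FJ" for x
    proof -
      have "x \<in> K0 <+>\<^bsub>opposite_ring A\<^esub> rprinc A b" using op.covers_span[OF covFJ b(1,2)] that by simp
      then obtain k c where kc: "k \<in> K0" "c \<in> carrier A" "x = k \<oplus> b \<otimes> c" by (auto simp: mem_set_add rprinc_iff)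
      moreover have "k \<in> carrier A" using kc(1) K0FJ FJc by blast
      ultimately show ?thesis using a_comm b(4) by (metis m_closed)
    qed
    \<comment> \<open>\<open>s\<close> is a left multiple of some \<open>j \<otimes> y\<close> with
      \<open>j\<close> radical. The coefficient lies in \<open>f J\<close>, and its component in
      \<open>K0\<close> kills \<open>y\<close>, so its component \<open>b \<otimes> c\<close> does
      not.\<close>
    have nonzero: "\<exists>c\<in>carrier A. b \<otimes> c \<otimes> y \<noteq> \<zero>" if y: "y \<in> W" "y \<notin> S" for y
    proof -
      obtain j where j: "j \<in> jac A" "j \<otimes> y \<noteq> \<zero>" using soc[OF y(1)] y(2) by blast
      have jc: "j \<in> carrier A" "y \<in> carrier A" using jac_carrier[OF j(1)] Wc[OF y(1)] by auto
      have "j \<otimes> y \<in> W" using jW[OF j(1) y(1)] SW by blast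
      then obtain a where a: "a \<in> carrier A" "s = a \<otimes> (j \<otimes> y)" using gen_s[OF _ j(2)] by blast
      have "f \<otimes> a \<otimes> j \<in> FJ" unfolding FJ_def using f' a jc jac_mult(1)[OF j(1), of "f \<otimes> a"]
        by (simp flip: m_assoc)
      then obtain c k where ck: "c \<in> carrier A" "k \<in> K0" "f \<otimes> a \<otimes> j = b \<otimes> c \<oplus> k" using FJb by blast
      have "f \<otimes> a \<otimes> j \<otimes> y = f \<otimes> s" using a f' jc by (simp add: m_assoc)
      then have "b \<otimes> c \<otimes> y \<oplus> k \<otimes> y = s" using ck jc b s(2) K0FJ FJc by (auto simp: l_distr)
      then have "b \<otimes> c \<otimes> y = s" using K0W[OF ck(2) y(1)] b ck jc by simp
      then show ?thesis using sm(1) ck(1) by auto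
    qed
    define M where "M = {y \<in> W. g \<otimes> y = y}"
    have MW: "y \<in> W" "g \<otimes> y = y" "y \<in> carrier A" if "y \<in> M" for y using that Wc by (auto simp: M_def)
    have gM: "g \<otimes> c \<otimes> y \<in> M" if "c \<in> carrier A" "y \<in> W" for c y
      using lidealD(5)[OF LW _ that(2), of "g \<otimes> c"] that g' Wc[OF that(2)]
      by (simp add: M_def flip: m_assoc)
    have bS: "b \<otimes> y = \<zero>" if "y \<in> S" for y using jS[OF b(5) that] .
    obtain c1 where c1: "c1 \<in> carrier A" "b \<otimes> c1 \<otimes> x0 \<noteq> \<zero>"
    proof -
      have "x0 \<notin> S" using jS[OF jx0(1)] jx0(3) by blast
      then show ?thesis using nonzero[OF jx0(2)] that by blast
    qed
    define y1 where "y1 = g \<otimes> c1 \<otimes> x0"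
    have y1M: "y1 \<in> M" unfolding y1_def using gM c1(1) jx0(2) by blast
    have "b \<otimes> y1 = b \<otimes> c1 \<otimes> x0" unfolding y1_def using b(3,4) c1(1) g' Wc[OF jx0(2)] by (metis m_assoc m_closed)
    then have y1S: "y1 \<notin> S" using bS[of y1] c1(2) by auto
    have y1c: "y1 \<in> carrier A" using MW(3)[OF y1M] .
    define Z where "Z = M \<inter> S"
    have CM: "scalar_submodule A C M"
    proof -
      have "r \<otimes> x \<in> M" if "r \<in> C" "x \<in> M" for r x
      proof -
        have r: "r \<in> carrier A" using that scalars by blast
        have "g \<otimes> (r \<otimes> x) = r \<otimes> x" using central[OF that(1)] r g' MW[OF that(2)] by (metis m_assoc)
        then show ?thesis using lidealD(5)[OF LW r] MW[OF that(2)] by (simp add: M_def)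
      qed
      moreover have "\<ominus> x \<in> M" if "x \<in> M" for x
        using lideal_minus[OF LW] MW[OF that] g' by (simp add: M_def r_minus)
      ultimately show ?thesis
        using lidealD(2,4)[OF LW] Wc g' unfolding scalar_submodule_def by (auto simp: M_def r_distr)
    qed
    text \<open>Without a duality at hand, the inequality between the lengths of \<open>M\<close> and of \<open>f J g\<close> modulo
      \<open>K0\<close> is expressed by a relation that is total on \<open>M\<close> and injective modulo \<open>S\<close> and \<open>K0\<close>.\<close>
    define good where "good M' G \<longleftrightarrow> scalar_submodule A C M' \<and> M' \<subseteq> M \<and>
      (\<forall>(y, n)\<in>G. y \<in> M \<and> n \<in> FJ \<and> n \<otimes> g = n) \<and> (\<forall>y\<in>M. \<exists>n. (y, n) \<in> G) \<and>
      (\<forall>(y, n)\<in>G. \<forall>(y', n')\<in>G. (y \<oplus> y', n \<oplus> n') \<in> G) \<and> (\<forall>(y, n)\<in>G. (\<ominus> y, \<ominus> n) \<in> G) \<and>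
      (\<forall>r\<in>C. \<forall>(y, n)\<in>G. (r \<otimes> y, r \<otimes> n) \<in> G) \<and>
      (\<forall>(y, n)\<in>G. n \<in> K0 \<longrightarrow> y \<in> M') \<and> (\<forall>(y, n)\<in>G. \<forall>m\<in>M'. n \<otimes> m = \<zero>)" for M' G
    have goodD: "scalar_submodule A C M'" "M' \<subseteq> M" "\<And>y n. (y, n) \<in> G \<Longrightarrow> y \<in> M \<and> n \<in> FJ \<and> n \<otimes> g = n"
      "\<And>y. y \<in> M \<Longrightarrow> \<exists>n. (y, n) \<in> G"
      "\<And>y n y' n'. (y, n) \<in> G \<Longrightarrow> (y', n') \<in> G \<Longrightarrow> (y \<oplus> y', n \<oplus> n') \<in> G"
      "\<And>y n. (y, n) \<in> G \<Longrightarrow> (\<ominus> y, \<ominus> n) \<in> G"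
      "\<And>y n r. (y, n) \<in> G \<Longrightarrow> r \<in> C \<Longrightarrow> (r \<otimes> y, r \<otimes> n) \<in> G"
      "\<And>y n. (y, n) \<in> G \<Longrightarrow> n \<in> K0 \<Longrightarrow> y \<in> M'"
      "\<And>y n m. (y, n) \<in> G \<Longrightarrow> m \<in> M' \<Longrightarrow> n \<otimes> m = \<zero>" if "good M' G" for M' G
      using that unfolding good_def by blast+
    have Mc: "M \<subseteq> carrier A" using MW by blast
    have z0: "\<zero> \<in> FJ" "\<zero> \<in> K0" using lidealD(2)[OF RFJ] lidealD(2)[OF RK0] by auto
    \<comment> \<open>The zero relation is injective modulo all of \<open>M\<close>, which is the
      trivial start of the descent.\<close>
    have "good M ((\<lambda>y. (y, \<zero>)) ` M)"
      unfolding good_def using CM z0 Mc scalars g'(1)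
      by (auto simp: scalar_submodule_def subset_iff)
    then have "M \<in> {M'. scalar_submodule A C M' \<and> (\<exists>G. good M' G)}" using CM by blast
    \<comment> \<open>A minimal \<open>M'\<close> is shown to lie in \<open>S\<close>. Its relation
      then embeds \<open>M\<close> modulo \<open>S\<close> into \<open>f J g\<close> modulo
      \<open>K0\<close>.\<close>
    from wfE_min[OF wf_scalar this] obtain M' where
      "M' \<in> {M'. scalar_submodule A C M' \<and> (\<exists>G. good M' G)}" and
      min: "\<And>M''. (M'', M') \<in> {(X, Y). scalar_submodule A C X \<and> scalar_submodule A C Y \<and> X \<subset> Y} \<Longrightarrow>
        M'' \<notin> {M'. scalar_submodule A C M' \<and> (\<exists>G. good M' G)}" by blast
    then obtain G where G: "good M' G" by blast
    note G' = goodD[OF G]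
    have FJn: "n \<in> carrier A" "f \<otimes> n = n" "n \<in> jac A" "n \<otimes> g = n" if "(y, n) \<in> G" for y n
      using G'(3)[OF that] FJc by auto
    have "M' \<subseteq> S"
    proof (rule ccontr)
      assume "\<not> M' \<subseteq> S"
      then obtain m where m: "m \<in> M'" "m \<notin> S" by blast
      have mM: "m \<in> M" using m(1) G'(2) by blast
      note m' = MW[OF mM]
      obtain c where c: "c \<in> carrier A" "b \<otimes> c \<otimes> m \<noteq> \<zero>" using nonzero[OF m'(1) m(2)] by blast
      define n0 where "n0 = b \<otimes> c \<otimes> g"
      have n0: "n0 \<in> carrier A" "f \<otimes> n0 = n0" "n0 \<in> jac A" "n0 \<otimes> g = n0"
        unfolding n0_def using b c(1) g' f' by (auto simp: jac_mult m_assoc simp flip: m_assoc[of f b])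
      have n0m: "n0 \<otimes> m \<noteq> \<zero>" unfolding n0_def using b(4) c g'(1) m'(2,3) by (simp add: m_assoc)
      have n0S: "n0 \<otimes> y \<in> S" if "y \<in> W" for y using jW[OF n0(3) that] .
      \<comment> \<open>\<open>n0\<close> does not kill \<open>m \<in> M'\<close>, so
        \<open>M2\<close> is smaller. To remain injective modulo \<open>M2\<close> the relation must
        remember \<open>n0 \<otimes> y\<close>, an element of \<open>S\<close>; it is written as
        \<open>t \<otimes> s\<close> and stored as the summand \<open>t \<otimes> n0\<close>. The
        coefficient \<open>t\<close> is unique only up to the radical, which is why relations are
        used instead of maps.\<close>
      define M2 where "M2 = {y \<in> M'. n0 \<otimes> y = \<zero>}"
      define G2 where "G2 = {(y, n \<oplus> t \<otimes> n0) | y n t.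
        (y, n) \<in> G \<and> t \<in> carrier A \<and> f \<otimes> t = t \<and> t \<otimes> f = t \<and> n0 \<otimes> y = t \<otimes> s}"
      have M'c: "y \<in> carrier A" "y \<in> W" if "y \<in> M'" for y using MW[of y] G'(2) that by auto
      have cM2: "scalar_submodule A C M2"
      proof -
        note sm' = G'(1)[unfolded scalar_submodule_def]
        have "n0 \<otimes> (r \<otimes> x) = r \<otimes> (n0 \<otimes> x)" if "r \<in> C" "x \<in> carrier A" for r x
        proof -
          have "r \<in> carrier A" using that scalars by blast
          then show ?thesis using n0(1) that central[OF that(1) n0(1)] by (simp flip: m_assoc)
        qed
        then show ?thesis unfolding scalar_submodule_def M2_def
          using sm' n0(1) scalars by (auto simp: r_distr r_minus subset_iff)
      qed
      have inG2: "(y, n \<oplus> t \<otimes> n0) \<in> G2"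
        if "(y, n) \<in> G" "t \<in> carrier A" "f \<otimes> t = t" "t \<otimes> f = t" "n0 \<otimes> y = t \<otimes> s" for y n t
        using that unfolding G2_def by blast
      have fromG2: "\<exists>n t. p = n \<oplus> t \<otimes> n0 \<and> (y, n) \<in> G \<and> t \<in> carrier A \<and> f \<otimes> t = t \<and> t \<otimes> f = t \<and>
        n0 \<otimes> y = t \<otimes> s" if "(y, p) \<in> G2" for y p
        using that unfolding G2_def by blast
      have tn0: "t \<otimes> n0 \<in> FJ" if "t \<in> carrier A" "f \<otimes> t = t" for t
        using that n0 f' jac_mult(1)[OF n0(3) that(1)] by (simp add: FJ_def flip: m_assoc)
      have "good M2 G2" unfolding good_def
      proof (intro conjI ballI impI; (clarify)?)
        show "scalar_submodule A C M2" by (rule cM2)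
        show "x \<in> M" if "x \<in> M2" for x using that G'(2) by (auto simp: M2_def)
      next
        fix y p assume "(y, p) \<in> G2"
        then obtain n t where nt: "p = n \<oplus> t \<otimes> n0" "(y, n) \<in> G" "t \<in> carrier A" "f \<otimes> t = t" "t \<otimes> f = t"
          "n0 \<otimes> y = t \<otimes> s" using fromG2 by blast
        have "t \<otimes> n0 \<otimes> g = t \<otimes> n0" using nt n0 g' by (simp add: m_assoc)
        then show "y \<in> M \<and> p \<in> FJ \<and> p \<otimes> g = p"
          using G'(3)[OF nt(2)] lidealD(4)[OF RFJ _ tn0[OF nt(3,4)], of n] FJn[OF nt(2)] nt(1,3) n0(1) g'(1)
          by (simp add: l_distr)
        have tc: "t \<otimes> n0 \<in> carrier A" using nt n0 by simp
        show "(\<ominus> y, \<ominus> p) \<in> G2"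
        proof -
          have yc: "y \<in> carrier A" using G'(3)[OF nt(2)] MW by blast
          have "\<ominus> p = \<ominus> n \<oplus> (\<ominus> t) \<otimes> n0" using nt(1,3) n0(1) FJn[OF nt(2)] by (simp add: minus_add l_minus)
          then show ?thesis using inG2[OF G'(6)[OF nt(2)], of "\<ominus> t"] nt n0(1) f'(1) s(1) yc
            by (simp add: l_minus r_minus)
        qed
        \<comment> \<open>Evaluation at \<open>m\<close> separates the two summands of
          \<open>p\<close>: both \<open>p\<close> and \<open>n\<close> kill \<open>m\<close>, so
          \<open>t\<close> kills \<open>n0 \<otimes> m \<noteq> \<zero>\<close> and must be radical.
          Then \<open>t \<otimes> n0 \<in> K0\<close>, hence \<open>n \<in> K0\<close>, and
          \<open>n0 \<otimes> y = t \<otimes> s = \<zero>\<close>.\<close>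
        show "y \<in> M2" if p: "p \<in> K0"
        proof -
          have "p \<otimes> m = \<zero>" using K0W[OF p m'(1)] .
          then have tm: "t \<otimes> (n0 \<otimes> m) = \<zero>"
            using nt(1,3) n0(1) FJn(1)[OF nt(2)] m'(3) G'(9)[OF nt(2) m(1)] by (simp add: l_distr m_assoc)
          have tj: "t \<in> jac A"
          proof (rule ccontr)
            assume "t \<notin> jac A"
            then obtain u where u: "u \<in> carrier A" "f = u \<otimes> t" using jac_mem[OF f nt(3,5)] by (auto elim: lprincE)
            have "n0 \<otimes> m = f \<otimes> (n0 \<otimes> m)" using n0 m'(3) f' by (simp flip: m_assoc)
            also have "\<dots> = u \<otimes> (t \<otimes> (n0 \<otimes> m))" using u nt(3) n0(1) m'(3) by (simp add: m_assoc)
            finally show False using n0m tm u by simp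
          qed
          have "t \<otimes> n0 \<in> K0" using tn0[OF nt(3,4)] jS[OF tj n0S] nt(3) n0(1) Wc by (simp add: K0_def m_assoc)
          then have "p \<ominus> t \<otimes> n0 \<in> K0" using op.lideal_diff[OF RK0 p] by simp
          then have "n \<in> K0" using nt(1) FJn(1)[OF nt(2)] tc by (simp add: add_diff_cancel)
          then have "y \<in> M'" using G'(8)[OF nt(2)] by blast
          then show ?thesis using nt(6) jS[OF tj sS] by (simp add: M2_def)
        qed
        show "p \<otimes> m2 = \<zero>" if "m2 \<in> M2" for m2
          using that nt(1,3) n0(1) FJn(1)[OF nt(2)] G'(9)[OF nt(2), of m2] M'c[of m2]
          by (simp add: M2_def l_distr m_assoc)
        show "(r \<otimes> y, r \<otimes> p) \<in> G2" if r: "r \<in> C" for r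
        proof -
          have rc: "r \<in> carrier A" using r scalars by blast
          have yc: "y \<in> carrier A" using G'(3)[OF nt(2)] MW by blast
          have "r \<otimes> p = r \<otimes> n \<oplus> (r \<otimes> t) \<otimes> n0"
            using nt(1,3) n0(1) FJn[OF nt(2)] rc by (simp add: r_distr m_assoc)
          moreover have "f \<otimes> (r \<otimes> t) = r \<otimes> t"
            using nt(3,4) f'(1) rc central[OF r f'(1)] by (metis m_assoc)
          moreover have "r \<otimes> t \<otimes> f = r \<otimes> t" using nt rc f' by (simp add: m_assoc)
          moreover have "n0 \<otimes> (r \<otimes> y) = r \<otimes> t \<otimes> s"
            using central[OF r n0(1)] nt(3,6) n0(1) rc yc s(1) by (metis m_assoc)
          ultimately show ?thesis using inG2[OF G'(7)[OF nt(2) r], of "r \<otimes> t"] rc nt(3) by simp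
        qed
        fix y' p' assume "(y', p') \<in> G2"
        then obtain n' t' where nt': "p' = n' \<oplus> t' \<otimes> n0" "(y', n') \<in> G" "t' \<in> carrier A" "f \<otimes> t' = t'"
          "t' \<otimes> f = t'" "n0 \<otimes> y' = t' \<otimes> s" using fromG2 by blast
        show "(y \<oplus> y', p \<oplus> p') \<in> G2"
        proof -
          have c: "y \<in> carrier A" "y' \<in> carrier A" using G'(3)[OF nt(2)] G'(3)[OF nt'(2)] MW by blast+
          have "p \<oplus> p' = (n \<oplus> n') \<oplus> (t \<oplus> t') \<otimes> n0"
            using nt(1,3) nt'(1,3) n0(1) FJn(1)[OF nt(2)] FJn(1)[OF nt'(2)] by (simp add: l_distr a_ac)
          then show ?thesis using inG2[OF G'(5)[OF nt(2) nt'(2)], of "t \<oplus> t'"] nt nt' c n0(1) f'(1) s(1)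
            by (simp add: l_distr r_distr)
        qed
      next
        fix y assume y: "y \<in> M"
        obtain n where n: "(y, n) \<in> G" using G'(4)[OF y] by blast
        note y' = MW[OF y]
        obtain a where a: "a \<in> carrier A" "n0 \<otimes> y = a \<otimes> s" using n0S[OF y'(1)] unfolding S_def by (auto elim: lprincE)
        have "n0 \<otimes> y = f \<otimes> (n0 \<otimes> y)" using n0 y' f' by (simp flip: m_assoc)
        also have "\<dots> = (f \<otimes> a \<otimes> f) \<otimes> s" using a f' s by (simp add: m_assoc)
        finally have "(y, n \<oplus> (f \<otimes> a \<otimes> f) \<otimes> n0) \<in> G2"
          using a(1) f' by (intro inG2[OF n]) (auto simp: m_assoc simp flip: m_assoc[of f f])
        then show "\<exists>n. (y, n) \<in> G2" by blast
      qed
      moreover have "M2 \<subset> M'" using m(1) n0m unfolding M2_def by blast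
      ultimately show False using min[of M2] cM2 G'(1) by blast
    qed
    \<comment> \<open>Follows \<open>G\<close> by
      \<open>b \<otimes> c \<oplus> k \<mapsto> c \<otimes> y1\<close> modulo \<open>S\<close>.
      Injectivity survives: if \<open>c \<otimes> y1 \<in> S\<close>, then \<open>c\<close> is
      radical because \<open>y1 \<notin> S\<close>, so \<open>b \<otimes> c \<in> K0\<close>. This
      gives an injective relation from \<open>M\<close> modulo \<open>S\<close> to itself whose
      values are multiples of \<open>y1\<close>; being onto, it shows
      \<open>M \<subseteq> A y1 + S\<close>.\<close>
    define H where "H = {(y, z). y \<in> M \<and> z \<in> M \<and> (\<exists>n c k. (y, n) \<in> G \<and> c \<in> carrier A \<and> c \<otimes> g = c \<and>
      k \<in> K0 \<and> n = b \<otimes> c \<oplus> k \<and> z \<ominus> c \<otimes> y1 \<in> S)}"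
    have HI: "(y, z) \<in> H" if "y \<in> M" "z \<in> M" "(y, n) \<in> G" "c \<in> carrier A" "c \<otimes> g = c"
      "k \<in> K0" "n = b \<otimes> c \<oplus> k" "z \<ominus> c \<otimes> y1 \<in> S" for y z n c k
      using that unfolding H_def by blast
    have HE: "\<exists>n c k. y \<in> M \<and> z \<in> M \<and> (y, n) \<in> G \<and> c \<in> carrier A \<and> c \<otimes> g = c \<and>
      k \<in> K0 \<and> n = b \<otimes> c \<oplus> k \<and> z \<ominus> c \<otimes> y1 \<in> S" if "(y, z) \<in> H" for y z
      using that unfolding H_def by blast
    have K0c: "k \<in> carrier A" if "k \<in> K0" for k using that K0FJ FJc by blast
    note CM' = CM[unfolded scalar_submodule_def]
    have "H `` M = M"
    proof (rule scalar_peel[OF CM, of Z])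
      show "Z \<subseteq> M" by (auto simp: Z_def)
      show "H \<subseteq> M \<times> M" unfolding H_def by blast
      show "\<zero> \<in> Z" using CM' lidealD(2)[OF LS] by (simp add: Z_def)
      show "\<exists>z. (y, z) \<in> H" if y: "y \<in> M" for y
      proof -
        obtain n where n: "(y, n) \<in> G" using G'(4)[OF y] by blast
        obtain c k where ck: "c \<in> carrier A" "k \<in> K0" "n = b \<otimes> c \<oplus> k" using FJb G'(3)[OF n] by blast
        have "n = (b \<otimes> c \<oplus> k) \<otimes> g" using FJn(4)[OF n] ck by simp
        also have "\<dots> = b \<otimes> (g \<otimes> c \<otimes> g) \<oplus> k \<otimes> g"
          using b(3,4) ck K0c[OF ck(2)] g' by (simp add: l_distr flip: m_assoc)
        finally have "n = b \<otimes> (g \<otimes> c \<otimes> g) \<oplus> k \<otimes> g" .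
        moreover have "k \<otimes> g \<in> K0" using lidealD(5)[OF RK0 _ ck(2), of g] g' by simp
        moreover have "g \<otimes> c \<otimes> g \<otimes> y1 = g \<otimes> c \<otimes> y1" using g'(1) ck(1) MW[OF y1M] by (simp add: m_assoc)
        then have "g \<otimes> c \<otimes> g \<otimes> y1 \<in> M" using gM[OF ck(1) MW(1)[OF y1M]] by simp
        moreover have "g \<otimes> c \<otimes> g \<otimes> y1 \<ominus> g \<otimes> c \<otimes> g \<otimes> y1 \<in> S" using lidealD(2)[OF LS] g' ck y1c by simp
        ultimately show ?thesis using HI[OF y _ n, of "g \<otimes> c \<otimes> g \<otimes> y1" "g \<otimes> c \<otimes> g" "k \<otimes> g"] g' ck(1)
          by (auto simp: m_assoc)
      qed
      show "(y \<oplus> y', z \<oplus> z') \<in> H" if yz: "(y, z) \<in> H" "(y', z') \<in> H" for y z y' z'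
      proof -
        obtain n c k where 1: "y \<in> M" "z \<in> M" "(y, n) \<in> G" "c \<in> carrier A" "c \<otimes> g = c"
          "k \<in> K0" "n = b \<otimes> c \<oplus> k" "z \<ominus> c \<otimes> y1 \<in> S" using HE[OF yz(1)] by blast
        obtain n' c' k' where 2: "y' \<in> M" "z' \<in> M" "(y', n') \<in> G" "c' \<in> carrier A" "c' \<otimes> g = c'"
          "k' \<in> K0" "n' = b \<otimes> c' \<oplus> k'" "z' \<ominus> c' \<otimes> y1 \<in> S" using HE[OF yz(2)] by blast
        have "n \<oplus> n' = b \<otimes> (c \<oplus> c') \<oplus> (k \<oplus> k')"
          using 1(4,7) 2(4,7) b(4) K0c[OF 1(6)] K0c[OF 2(6)] by (simp add: r_distr a_ac)
        moreover have "z \<oplus> z' \<ominus> (c \<oplus> c') \<otimes> y1 = (z \<ominus> c \<otimes> y1) \<oplus> (z' \<ominus> c' \<otimes> y1)"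
          using 1(4) 2(4) MW(3)[OF 1(2)] MW(3)[OF 2(2)] y1c by (simp add: minus_eq l_distr minus_add a_ac)
        then have "z \<oplus> z' \<ominus> (c \<oplus> c') \<otimes> y1 \<in> S" using lidealD(4)[OF LS 1(8) 2(8)] by simp
        moreover have "k \<oplus> k' \<in> K0" using lidealD(4)[OF RK0 1(6) 2(6)] by simp
        moreover have "y \<oplus> y' \<in> M" "z \<oplus> z' \<in> M" using 1 2 CM' by blast+
        ultimately show ?thesis using HI[OF _ _ G'(5)[OF 1(3) 2(3)], of _ "c \<oplus> c'" "k \<oplus> k'"] 1(4,5) 2(4,5) g'(1)
          by (simp add: l_distr)
      qed
      show "(\<ominus> y, \<ominus> z) \<in> H" if yz: "(y, z) \<in> H" for y z
      proof -
        obtain n c k where 1: "y \<in> M" "z \<in> M" "(y, n) \<in> G" "c \<in> carrier A" "c \<otimes> g = c"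
          "k \<in> K0" "n = b \<otimes> c \<oplus> k" "z \<ominus> c \<otimes> y1 \<in> S" using HE[OF yz(1)] by blast
        have "\<ominus> n = b \<otimes> (\<ominus> c) \<oplus> (\<ominus> k)"
          using 1(4,7) b(4) K0c[OF 1(6)] by (simp add: r_minus minus_add)
        moreover have "\<ominus> z \<ominus> (\<ominus> c) \<otimes> y1 = \<ominus> (z \<ominus> c \<otimes> y1)"
          using 1(4) MW(3)[OF 1(2)] y1c by (simp add: minus_eq l_minus minus_add)
        then have "\<ominus> z \<ominus> (\<ominus> c) \<otimes> y1 \<in> S" using lideal_minus[OF LS 1(8)] by simp
        moreover have "\<ominus> k \<in> K0" using op.lideal_minus[OF RK0 1(6)] by simp
        moreover have "\<ominus> y \<in> M" "\<ominus> z \<in> M" using 1 CM' by blast+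
        ultimately show ?thesis using HI[OF _ _ G'(6)[OF 1(3)], of _ "\<ominus> c" "\<ominus> k"] 1(4,5) g'(1)
          by (simp add: l_minus)
      qed
      show "(r \<otimes> y, r \<otimes> z) \<in> H" if yz: "(y, z) \<in> H" and r: "r \<in> C" for y z r
      proof -
        obtain n c k where 1: "y \<in> M" "z \<in> M" "(y, n) \<in> G" "c \<in> carrier A" "c \<otimes> g = c"
          "k \<in> K0" "n = b \<otimes> c \<oplus> k" "z \<ominus> c \<otimes> y1 \<in> S" using HE[OF yz] by blast
        have rc: "r \<in> carrier A" using r scalars by blast
        have "r \<otimes> (b \<otimes> c) = b \<otimes> (r \<otimes> c)" using central[OF r b(4)] b(4) rc 1(4) by (metis m_assoc)
        then have "r \<otimes> n = b \<otimes> (r \<otimes> c) \<oplus> r \<otimes> k"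
          using 1(4,7) b(4) K0c[OF 1(6)] rc by (simp add: r_distr)
        moreover have "r \<otimes> z \<ominus> (r \<otimes> c) \<otimes> y1 = r \<otimes> (z \<ominus> c \<otimes> y1)"
          using 1(4) MW(3)[OF 1(2)] y1c rc by (simp add: minus_distrib m_assoc)
        then have "r \<otimes> z \<ominus> (r \<otimes> c) \<otimes> y1 \<in> S" using lidealD(5)[OF LS rc 1(8)] by simp
        moreover have "k \<otimes> r \<in> K0" using lidealD(5)[OF RK0 _ 1(6), of r] rc by simp
        then have "r \<otimes> k \<in> K0" using central[OF r K0c[OF 1(6)]] by simp
        moreover have "r \<otimes> y \<in> M" "r \<otimes> z \<in> M" using 1 r CM' by blast+
        ultimately show ?thesis using HI[OF _ _ G'(7)[OF 1(3) r], of _ "r \<otimes> c" "r \<otimes> k"] 1(4,5) g'(1) rc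
          by (simp add: m_assoc)
      qed
      show "(\<zero>, z) \<in> H" if z: "z \<in> Z" for z
      proof -
        have M0: "\<zero> \<in> M" using CM' by blast
        then obtain n where n: "(\<zero>, n) \<in> G" using G'(4) by blast
        have "(\<zero> \<oplus> \<ominus> \<zero>, n \<oplus> \<ominus> n) \<in> G" using G'(5)[OF n G'(6)[OF n]] .
        then have "(\<zero>, \<zero>) \<in> G" using FJn(1)[OF n] by (simp add: r_neg)
        then show ?thesis using HI[OF M0 _ _ zero_closed _ z0(2)] z y1c b(4) g'(1) MW(3)[of z] by (simp add: Z_def diff_zero)
      qed
      show "y \<in> Z" if y: "(y, \<zero>) \<in> H" for y
      proof -
        obtain n c k where 1: "y \<in> M" "\<zero> \<in> M" "(y, n) \<in> G" "c \<in> carrier A" "c \<otimes> g = c"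
          "k \<in> K0" "n = b \<otimes> c \<oplus> k" "\<zero> \<ominus> c \<otimes> y1 \<in> S" using HE[OF y] by blast
        have cy: "c \<otimes> y1 \<in> S" using lideal_minus[OF LS 1(8)] 1(4) y1c by (simp add: minus_eq)
        have "c \<in> jac A"
        proof (rule ccontr)
          assume "c \<notin> jac A"
          then obtain u where u: "u \<in> carrier A" "g = u \<otimes> c" using jac_mem[OF g 1(4,5)] by (auto elim: lprincE)
          have "y1 = u \<otimes> (c \<otimes> y1)" using MW(2)[OF y1M] u 1(4) y1c by (simp flip: m_assoc)
          then show False using lidealD(5)[OF LS u(1) cy] y1S by simp
        qed
        then have "n \<in> K0" using lidealD(4)[OF RK0 bJ 1(6)] 1(7) by simp
        then have "y \<in> M'" using G'(8)[OF 1(3)] by blast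
        then show ?thesis using \<open>M' \<subseteq> S\<close> 1(1) by (auto simp: Z_def)
      qed
    qed
    have L1: "lideal A (lprinc A y1 <+>\<^bsub>A\<^esub> S)" using y1c LS by (intro lideal_add) auto
    have Msub: "z \<in> lprinc A y1 <+>\<^bsub>A\<^esub> S" if "z \<in> M" for z
    proof -
      have "z \<in> H `` M" using that \<open>H `` M = M\<close> by simp
      then obtain y where "(y, z) \<in> H" by (rule ImageE)
      then obtain c where c: "c \<in> carrier A" "z \<ominus> c \<otimes> y1 \<in> S" using HE by blast
      have "z = c \<otimes> y1 \<oplus> (z \<ominus> c \<otimes> y1)" using c(1) y1c MW(3)[OF that] by (simp add: a_comm[of "c \<otimes> y1"] diff_add_cancel)
      then show ?thesis using c lprincI unfolding mem_set_add by blast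
    qed
    \<comment> \<open>From \<open>g W\<close> to all of \<open>W\<close>: if
      \<open>h \<otimes> y\<close> is outside \<open>S\<close>, then
      \<open>b \<otimes> v \<otimes> y \<noteq> \<zero>\<close> for some
      \<open>v = g \<otimes> c \<otimes> h\<close>. Such a \<open>v\<close> is not radical, since
      \<open>b J \<subseteq> K0\<close> kills \<open>W\<close>; so \<open>h = u \<otimes> v\<close>,
      and \<open>v \<otimes> y\<close> is in \<open>g W\<close>.\<close>
    have "y \<in> lprinc A y1 <+>\<^bsub>A\<^esub> S" if y: "y \<in> W" for y
    proof (rule decomp_left)
      show "y \<in> carrier A" using Wc[OF y] by simp
      fix h assume h: "primitive A h"
      note h' = primitiveD[OF h]
      have hy: "h \<otimes> y \<in> W" using lidealD(5)[OF LW _ y] h' by simp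
      have yc: "y \<in> carrier A" using Wc[OF y] by simp
      show "h \<otimes> y \<in> lprinc A y1 <+>\<^bsub>A\<^esub> S"
      proof (cases "h \<otimes> y \<in> S")
        case True then show ?thesis using lideal_add_upper(2)[OF _ LS, of "lprinc A y1"] y1c by auto
      next
        case False
        then obtain c where c: "c \<in> carrier A" "b \<otimes> c \<otimes> (h \<otimes> y) \<noteq> \<zero>" using nonzero[OF hy] by blast
        define v where "v = g \<otimes> c \<otimes> h"
        have v: "v \<in> carrier A" "v \<otimes> h = v" using g' h' c(1) by (auto simp: v_def m_assoc)
        have bv: "b \<otimes> v \<otimes> y = b \<otimes> c \<otimes> (h \<otimes> y)"
        proof -
          have "b \<otimes> v \<otimes> y = (b \<otimes> g) \<otimes> c \<otimes> h \<otimes> y" unfolding v_def using b(4) g' h' c(1) yc by (simp add: m_assoc)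
          then show ?thesis using b(3,4) h' c(1) yc by (simp add: m_assoc)
        qed
        have "v \<notin> jac A" using K0W[OF bJ y] bv c(2) by metis
        then obtain u where u: "u \<in> carrier A" "h = u \<otimes> v" using jac_mem[OF h v] by (auto elim: lprincE)
        have "v \<otimes> y = g \<otimes> c \<otimes> (h \<otimes> y)" unfolding v_def using g' h' c(1) yc by (simp add: m_assoc)
        then have "v \<otimes> y \<in> lprinc A y1 <+>\<^bsub>A\<^esub> S" using Msub[OF gM[OF c(1) hy]] by simp
        then have "u \<otimes> (v \<otimes> y) \<in> lprinc A y1 <+>\<^bsub>A\<^esub> S" using lidealD(5)[OF L1 u(1)] by simp
        then show ?thesis using u v yc by (simp add: m_assoc)
      qed
    qed (use lidealD(2,4)[OF L1] in auto)
    then have "W \<subseteq> lprinc A y1 <+>\<^bsub>A\<^esub> S" by (rule subsetI)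
    then have False by (rule noncyclic[OF g MW(1,2)[OF y1M]])
    then show ?thesis ..
  qed
qed

end

section \<open>Modules and semilinear maps\<close>

lemma left_module_ring: "left_module A M \<Longrightarrow> ring A"
  by (simp add: left_module_def)

context left_module
begin

lemma smult_zero_left [simp]: "x \<in> carrier M \<Longrightarrow> \<zero> \<odot>\<^bsub>M\<^esub> x = \<zero>\<^bsub>M\<^esub>"
proof -
  assume x: "x \<in> carrier M"
  have "\<zero> \<odot>\<^bsub>M\<^esub> x \<oplus>\<^bsub>M\<^esub> \<zero> \<odot>\<^bsub>M\<^esub> x = \<zero> \<odot>\<^bsub>M\<^esub> x"
    using smult_l_distr[of \<zero> \<zero> x] x by simp
  then show ?thesis using x M.add.r_cancel_one by simp
qed

lemma smult_zero_right [simp]: "a \<in> carrier A \<Longrightarrow> a \<odot>\<^bsub>M\<^esub> \<zero>\<^bsub>M\<^esub> = \<zero>\<^bsub>M\<^esub>"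
proof -
  assume a: "a \<in> carrier A"
  have "a \<odot>\<^bsub>M\<^esub> \<zero>\<^bsub>M\<^esub> \<oplus>\<^bsub>M\<^esub> a \<odot>\<^bsub>M\<^esub> \<zero>\<^bsub>M\<^esub> = a \<odot>\<^bsub>M\<^esub> \<zero>\<^bsub>M\<^esub>"
    using smult_r_distr[of a "\<zero>\<^bsub>M\<^esub>" "\<zero>\<^bsub>M\<^esub>"] a by simp
  then show ?thesis using a M.add.r_cancel_one by simp
qed

lemma smult_minus_one: "x \<in> carrier M \<Longrightarrow> (\<ominus> \<one>) \<odot>\<^bsub>M\<^esub> x = \<ominus>\<^bsub>M\<^esub> x"
proof -
  assume x: "x \<in> carrier M"
  have "(\<ominus> \<one>) \<odot>\<^bsub>M\<^esub> x \<oplus>\<^bsub>M\<^esub> \<one> \<odot>\<^bsub>M\<^esub> x = \<zero>\<^bsub>M\<^esub>"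
    using smult_l_distr[of "\<ominus> \<one>" \<one> x] x by (simp add: A.l_neg)
  then show ?thesis using x by (metis M.minus_equality smult_one A.add.inv_closed A.one_closed smult_closed)
qed

lemma minus_zero: "\<ominus>\<^bsub>M\<^esub> \<zero>\<^bsub>M\<^esub> = \<zero>\<^bsub>M\<^esub>"
  using M.l_neg[of "\<zero>\<^bsub>M\<^esub>"] M.r_zero[of "\<ominus>\<^bsub>M\<^esub> \<zero>\<^bsub>M\<^esub>"] by simp

lemma submodule_iff:
  "submodule N A M \<longleftrightarrow> N \<subseteq> carrier M \<and> \<zero>\<^bsub>M\<^esub> \<in> N \<and> (\<forall>x\<in>N. \<forall>y\<in>N. x \<oplus>\<^bsub>M\<^esub> y \<in> N) \<and>
    (\<forall>a\<in>carrier A. \<forall>x\<in>N. a \<odot>\<^bsub>M\<^esub> x \<in> N)"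
proof
  assume "submodule N A M"
  then interpret N: submodule N A M .
  show "N \<subseteq> carrier M \<and> \<zero>\<^bsub>M\<^esub> \<in> N \<and> (\<forall>x\<in>N. \<forall>y\<in>N. x \<oplus>\<^bsub>M\<^esub> y \<in> N) \<and>
    (\<forall>a\<in>carrier A. \<forall>x\<in>N. a \<odot>\<^bsub>M\<^esub> x \<in> N)"
    using N.subset N.one_closed N.m_closed N.smult_closed by auto
next
  assume N: "N \<subseteq> carrier M \<and> \<zero>\<^bsub>M\<^esub> \<in> N \<and> (\<forall>x\<in>N. \<forall>y\<in>N. x \<oplus>\<^bsub>M\<^esub> y \<in> N) \<and>
    (\<forall>a\<in>carrier A. \<forall>x\<in>N. a \<odot>\<^bsub>M\<^esub> x \<in> N)"
  have "\<ominus>\<^bsub>M\<^esub> x \<in> N" if "x \<in> N" for x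
    using N that smult_minus_one[of x] by (metis A.add.inv_closed A.one_closed subsetD)
  then show "submodule N A M"
    using N by (intro submodule.intro subgroup.intro submodule_axioms.intro) (auto simp: a_inv_def)
qed

lemma submoduleD:
  assumes "submodule N A M"
  shows "N \<subseteq> carrier M" "\<zero>\<^bsub>M\<^esub> \<in> N" "\<And>x. x \<in> N \<Longrightarrow> x \<in> carrier M"
    "\<And>x y. x \<in> N \<Longrightarrow> y \<in> N \<Longrightarrow> x \<oplus>\<^bsub>M\<^esub> y \<in> N"
    "\<And>a x. a \<in> carrier A \<Longrightarrow> x \<in> N \<Longrightarrow> a \<odot>\<^bsub>M\<^esub> x \<in> N"
    "\<And>x. x \<in> N \<Longrightarrow> \<ominus>\<^bsub>M\<^esub> x \<in> N"
    "\<And>x y. x \<in> N \<Longrightarrow> y \<in> N \<Longrightarrow> x \<ominus>\<^bsub>M\<^esub> y \<in> N"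
proof -
  note N = assms[unfolded submodule_iff]
  show "N \<subseteq> carrier M" "\<zero>\<^bsub>M\<^esub> \<in> N" "\<And>x. x \<in> N \<Longrightarrow> x \<in> carrier M"
    "\<And>x y. x \<in> N \<Longrightarrow> y \<in> N \<Longrightarrow> x \<oplus>\<^bsub>M\<^esub> y \<in> N"
    "\<And>a x. a \<in> carrier A \<Longrightarrow> x \<in> N \<Longrightarrow> a \<odot>\<^bsub>M\<^esub> x \<in> N" using N by auto
  show m: "\<ominus>\<^bsub>M\<^esub> x \<in> N" if "x \<in> N" for x
    using N that smult_minus_one[of x] by (metis A.add.inv_closed A.one_closed subsetD)
  show "x \<ominus>\<^bsub>M\<^esub> y \<in> N" if "x \<in> N" "y \<in> N" for x y
    using N m[OF that(2)] that(1) by (simp add: a_minus_def)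
qed

lemma submodule_carrier [simp]: "submodule (carrier M) A M"
  by (simp add: submodule_iff)

lemma submodule_zero [simp]: "submodule {\<zero>\<^bsub>M\<^esub>} A M"
  by (simp add: submodule_iff)

lemma submodule_Int: "submodule N A M \<Longrightarrow> submodule K A M \<Longrightarrow> submodule (N \<inter> K) A M"
  by (auto simp: submodule_iff)

lemma submodule_add: 
  assumes "submodule N A M" "submodule K A M"
  shows "submodule (N <+>\<^bsub>M\<^esub> K) A M"
  unfolding submodule_iff
proof (intro conjI ballI)
  note X = submoduleD[OF assms(1)] and Y = submoduleD[OF assms(2)]
  show "N <+>\<^bsub>M\<^esub> K \<subseteq> carrier M" using X(3) Y(3) by (auto simp: mem_set_add)
  show "\<zero>\<^bsub>M\<^esub> \<in> N <+>\<^bsub>M\<^esub> K" using X(2) Y(2) M.l_zero[of "\<zero>\<^bsub>M\<^esub>"] unfolding mem_set_add by force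
  show "x \<oplus>\<^bsub>M\<^esub> y \<in> N <+>\<^bsub>M\<^esub> K" if "x \<in> N <+>\<^bsub>M\<^esub> K" "y \<in> N <+>\<^bsub>M\<^esub> K" for x y
  proof -
    from that obtain a b c d where abcd: "a \<in> N" "b \<in> K" "c \<in> N" "d \<in> K" "x = a \<oplus>\<^bsub>M\<^esub> b" "y = c \<oplus>\<^bsub>M\<^esub> d"
      by (auto simp: mem_set_add)
    then have "x \<oplus>\<^bsub>M\<^esub> y = (a \<oplus>\<^bsub>M\<^esub> c) \<oplus>\<^bsub>M\<^esub> (b \<oplus>\<^bsub>M\<^esub> d)"
      using X(3) Y(3) by (simp add: M.a_ac)
    then show ?thesis using X(4) Y(4) abcd unfolding mem_set_add by blast
  qed
  show "a \<odot>\<^bsub>M\<^esub> x \<in> N <+>\<^bsub>M\<^esub> K" if a: "a \<in> carrier A" and x: "x \<in> N <+>\<^bsub>M\<^esub> K" for a x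
  proof -
    obtain b c where bc: "b \<in> N" "c \<in> K" "x = b \<oplus>\<^bsub>M\<^esub> c" using x by (auto simp: mem_set_add)
    then have "a \<odot>\<^bsub>M\<^esub> x = a \<odot>\<^bsub>M\<^esub> b \<oplus>\<^bsub>M\<^esub> a \<odot>\<^bsub>M\<^esub> c" using X(3) Y(3) a by (simp add: smult_r_distr)
    then show ?thesis using X(5) Y(5) a bc unfolding mem_set_add by blast
  qed
qed

lemma submodule_add_upper:
  assumes "submodule N A M" "submodule K A M"
  shows "N \<subseteq> N <+>\<^bsub>M\<^esub> K" "K \<subseteq> N <+>\<^bsub>M\<^esub> K"
proof -
  note X = submoduleD[OF assms(1)] and Y = submoduleD[OF assms(2)]
  show "N \<subseteq> N <+>\<^bsub>M\<^esub> K"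
  proof
    fix x assume "x \<in> N" then show "x \<in> N <+>\<^bsub>M\<^esub> K"
      unfolding mem_set_add using Y(2) X(3) by (intro bexI[of _ x] bexI[of _ "\<zero>\<^bsub>M\<^esub>"]) auto
  qed
  show "K \<subseteq> N <+>\<^bsub>M\<^esub> K"
  proof
    fix x assume "x \<in> K" then show "x \<in> N <+>\<^bsub>M\<^esub> K"
      unfolding mem_set_add using X(2) Y(3) by (intro bexI[of _ "\<zero>\<^bsub>M\<^esub>"] bexI[of _ x]) auto
  qed
qed

lemma submodule_add_least:
  "submodule Z A M \<Longrightarrow> N \<subseteq> Z \<Longrightarrow> K \<subseteq> Z \<Longrightarrow> N <+>\<^bsub>M\<^esub> K \<subseteq> Z"
  using submoduleD(4) by (fastforce simp: mem_set_add)

lemma sub_left_module: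
  assumes "submodule N A M" shows "left_module A (sub M N)"
proof -
  note N = submoduleD[OF assms]
  interpret N: submodule N A M by fact
  have "abelian_group (sub M N)"
  proof (rule abelian_groupI)
    show "\<exists>y\<in>carrier (sub M N). y \<oplus>\<^bsub>sub M N\<^esub> x = \<zero>\<^bsub>sub M N\<^esub>" if "x \<in> carrier (sub M N)" for x
      using that N(3,6) M.l_neg by (intro bexI[of _ "\<ominus>\<^bsub>M\<^esub> x"]) auto
  qed (simp_all add: N(2) N(3) N(4) M.a_ac)
  then show ?thesis
    by (intro left_module.intro left_module_axioms.intro A.ring_axioms)
      (simp_all add: N(3) N(5) smult_l_distr smult_r_distr smult_assoc)
qed

lemma submodule_sub_iff:
  assumes "submodule N A M" shows "submodule K A (sub M N) \<longleftrightarrow> submodule K A M \<and> K \<subseteq> N"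
proof -
  interpret N: left_module A "sub M N" by (rule sub_left_module[OF assms])
  show ?thesis using submoduleD(1)[OF assms] by (auto simp: N.submodule_iff submodule_iff)
qed

lemma generated_submodule:
  assumes "S \<subseteq> carrier M"
  shows "submodule (generated_submodule A M S) A M" "S \<subseteq> generated_submodule A M S"
    "\<And>N. submodule N A M \<Longrightarrow> S \<subseteq> N \<Longrightarrow> generated_submodule A M S \<subseteq> N"
proof -
  show s: "S \<subseteq> generated_submodule A M S" by (auto simp: generated_submodule_def)
  show l: "\<And>N. submodule N A M \<Longrightarrow> S \<subseteq> N \<Longrightarrow> generated_submodule A M S \<subseteq> N"
    by (auto simp: generated_submodule_def)
  show "submodule (generated_submodule A M S) A M"
    unfolding submodule_iff
    using l[OF submodule_carrier assms] by (auto simp: generated_submodule_def submoduleD)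
qed

lemma abelian_subgroup_submodule: "submodule N A M \<Longrightarrow> abelian_subgroup N M"
  using submodule.axioms(1) by (intro abelian_subgroupI3 additive_subgroup.intro M.abelian_group_axioms) auto

lemma quotient_carrier: "carrier (quotient_module M N) = {N +>\<^bsub>M\<^esub> x | x. x \<in> carrier M}"
  by (auto simp: quotient_module_def A_RCOSETS_def RCOSETS_def a_r_coset_def)

lemma coset_eq_iff:
  assumes "submodule N A M" "x \<in> carrier M" "y \<in> carrier M"
  shows "N +>\<^bsub>M\<^esub> x = N +>\<^bsub>M\<^esub> y \<longleftrightarrow> x \<ominus>\<^bsub>M\<^esub> y \<in> N"
proof -
  interpret S: abelian_subgroup N M by (rule abelian_subgroup_submodule[OF assms(1)])
  show ?thesis
  proof
    assume "N +>\<^bsub>M\<^esub> x = N +>\<^bsub>M\<^esub> y"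
    then have "x \<in> N +>\<^bsub>M\<^esub> y" using S.a_rcos_self[OF assms(2)] by simp
    then show "x \<ominus>\<^bsub>M\<^esub> y \<in> N" using S.a_rcos_module_imp[OF assms(3)] assms
      by (simp add: a_minus_def)
  next
    assume "x \<ominus>\<^bsub>M\<^esub> y \<in> N"
    then have "x \<in> N +>\<^bsub>M\<^esub> y" using S.a_rcos_module_rev[OF assms(3,2)]
      by (simp add: a_minus_def)
    then show "N +>\<^bsub>M\<^esub> x = N +>\<^bsub>M\<^esub> y" using S.a_repr_independence'[of x y] assms by simp
  qed
qed

lemma coset_mem_iff:
  assumes "submodule N A M" "x \<in> carrier M"
  shows "y \<in> N +>\<^bsub>M\<^esub> x \<longleftrightarrow> y \<in> carrier M \<and> y \<ominus>\<^bsub>M\<^esub> x \<in> N"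
proof -
  interpret S: abelian_subgroup N M by (rule abelian_subgroup_submodule[OF assms(1)])
  show ?thesis
    using S.a_rcos_module_imp[OF assms(2)]
      S.a_rcos_module_rev[OF assms(2)] S.a_elemrcos_carrier[OF assms(2)]
    by (auto simp: a_minus_def)
qed

lemma quotient_ops:
  assumes N: "submodule N A M"
  shows "\<zero>\<^bsub>quotient_module M N\<^esub> = N"
    "\<And>x. x \<in> carrier M \<Longrightarrow> N +>\<^bsub>M\<^esub> x \<in> carrier (quotient_module M N)"
    "\<And>x y. x \<in> carrier M \<Longrightarrow> y \<in> carrier M \<Longrightarrow>
      (N +>\<^bsub>M\<^esub> x) \<oplus>\<^bsub>quotient_module M N\<^esub> (N +>\<^bsub>M\<^esub> y) = N +>\<^bsub>M\<^esub> (x \<oplus>\<^bsub>M\<^esub> y)"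
    "\<And>a x. a \<in> carrier A \<Longrightarrow> x \<in> carrier M \<Longrightarrow>
      a \<odot>\<^bsub>quotient_module M N\<^esub> (N +>\<^bsub>M\<^esub> x) = N +>\<^bsub>M\<^esub> (a \<odot>\<^bsub>M\<^esub> x)"
    "\<And>x. x \<in> carrier M \<Longrightarrow> N +>\<^bsub>M\<^esub> x = N \<longleftrightarrow> x \<in> N"
proof -
  interpret S: abelian_subgroup N M by (rule abelian_subgroup_submodule[OF N])
  show "\<zero>\<^bsub>quotient_module M N\<^esub> = N" by (simp add: quotient_module_def)
  show "\<And>x. x \<in> carrier M \<Longrightarrow> N +>\<^bsub>M\<^esub> x \<in> carrier (quotient_module M N)" by (auto simp: quotient_carrier)
  show "\<And>x y. x \<in> carrier M \<Longrightarrow> y \<in> carrier M \<Longrightarrow>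
      (N +>\<^bsub>M\<^esub> x) \<oplus>\<^bsub>quotient_module M N\<^esub> (N +>\<^bsub>M\<^esub> y) = N +>\<^bsub>M\<^esub> (x \<oplus>\<^bsub>M\<^esub> y)"
    by (simp add: quotient_module_def S.a_rcos_sum)
  show "N +>\<^bsub>M\<^esub> x = N \<longleftrightarrow> x \<in> N" if "x \<in> carrier M" for x
    using coset_eq_iff[OF N that M.zero_closed] that submoduleD(1)[OF N] minus_zero by (simp add: a_minus_def)
  show "a \<odot>\<^bsub>quotient_module M N\<^esub> (N +>\<^bsub>M\<^esub> x) = N +>\<^bsub>M\<^esub> (a \<odot>\<^bsub>M\<^esub> x)"
    if a: "a \<in> carrier A" and x: "x \<in> carrier M" for a x
  proof -
    have "N +>\<^bsub>M\<^esub> (a \<odot>\<^bsub>M\<^esub> y) = N +>\<^bsub>M\<^esub> (a \<odot>\<^bsub>M\<^esub> x)" if y: "y \<in> N +>\<^bsub>M\<^esub> x" for y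
    proof -
      have yc: "y \<in> carrier M" "y \<ominus>\<^bsub>M\<^esub> x \<in> N" using y coset_mem_iff[OF N x] by auto
      have "a \<odot>\<^bsub>M\<^esub> (y \<ominus>\<^bsub>M\<^esub> x) \<oplus>\<^bsub>M\<^esub> a \<odot>\<^bsub>M\<^esub> x = a \<odot>\<^bsub>M\<^esub> y"
        using a x yc by (simp flip: smult_r_distr) (simp add: a_minus_def M.a_assoc M.l_neg)
      then have "a \<odot>\<^bsub>M\<^esub> y \<ominus>\<^bsub>M\<^esub> a \<odot>\<^bsub>M\<^esub> x = a \<odot>\<^bsub>M\<^esub> (y \<ominus>\<^bsub>M\<^esub> x)"
        using a x yc by (metis M.add.inv_solve_right M.minus_closed a_minus_def smult_closed)
      then show ?thesis using a x yc submoduleD(5)[OF N a yc(2)] coset_eq_iff[OF N] by simp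
    qed
    moreover have "x \<in> N +>\<^bsub>M\<^esub> x" by (rule S.a_rcos_self[OF x])
    ultimately have "(\<Union>y\<in>N +>\<^bsub>M\<^esub> x. N +>\<^bsub>M\<^esub> (a \<odot>\<^bsub>M\<^esub> y)) = N +>\<^bsub>M\<^esub> (a \<odot>\<^bsub>M\<^esub> x)" by blast
    then show ?thesis by (simp add: quotient_module_def)
  qed
qed

lemma quotient_left_module:
  assumes N: "submodule N A M" shows "left_module A (quotient_module M N)"
proof -
  note q = quotient_ops[OF N]
  let ?Q = "quotient_module M N"
  have ex: "\<exists>x\<in>carrier M. X = N +>\<^bsub>M\<^esub> x" if "X \<in> carrier ?Q" for X using that by (auto simp: quotient_carrier)
  have z: "N = N +>\<^bsub>M\<^esub> \<zero>\<^bsub>M\<^esub>" using q(5)[of "\<zero>\<^bsub>M\<^esub>"] submoduleD(2)[OF N] by simp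
  have "abelian_group ?Q"
  proof (rule abelian_groupI)
    show "X \<oplus>\<^bsub>?Q\<^esub> Y \<in> carrier ?Q" if "X \<in> carrier ?Q" "Y \<in> carrier ?Q" for X Y
      using ex[OF that(1)] ex[OF that(2)] q by auto
    show "\<zero>\<^bsub>?Q\<^esub> \<in> carrier ?Q" using q(2)[of "\<zero>\<^bsub>M\<^esub>"] q(1) z by simp
    show "(X \<oplus>\<^bsub>?Q\<^esub> Y) \<oplus>\<^bsub>?Q\<^esub> Z = X \<oplus>\<^bsub>?Q\<^esub> (Y \<oplus>\<^bsub>?Q\<^esub> Z)"
      if "X \<in> carrier ?Q" "Y \<in> carrier ?Q" "Z \<in> carrier ?Q" for X Y Z
      using ex[OF that(1)] ex[OF that(2)] ex[OF that(3)] q by (auto simp: M.a_assoc)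
    show "X \<oplus>\<^bsub>?Q\<^esub> Y = Y \<oplus>\<^bsub>?Q\<^esub> X" if "X \<in> carrier ?Q" "Y \<in> carrier ?Q" for X Y
      using ex[OF that(1)] ex[OF that(2)] q by (auto simp: M.a_comm)
    show "\<zero>\<^bsub>?Q\<^esub> \<oplus>\<^bsub>?Q\<^esub> X = X" if X: "X \<in> carrier ?Q" for X
    proof -
      obtain x where x: "x \<in> carrier M" "X = N +>\<^bsub>M\<^esub> x" using ex[OF X] by blast
      then show ?thesis using q(3)[of "\<zero>\<^bsub>M\<^esub>" x] z q(1) by simp
    qed
    show "\<exists>Y\<in>carrier ?Q. Y \<oplus>\<^bsub>?Q\<^esub> X = \<zero>\<^bsub>?Q\<^esub>" if X: "X \<in> carrier ?Q" for X
    proof -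
      obtain x where x: "x \<in> carrier M" "X = N +>\<^bsub>M\<^esub> x" using ex[OF X] by blast
      then show ?thesis using q(3)[of "\<ominus>\<^bsub>M\<^esub> x" x] z q(1,2)
        by (intro bexI[of _ "N +>\<^bsub>M\<^esub> (\<ominus>\<^bsub>M\<^esub> x)"]) (simp_all add: M.l_neg)
    qed
  qed
  then show ?thesis
  proof (intro left_module.intro left_module_axioms.intro A.ring_axioms)
    show "a \<odot>\<^bsub>?Q\<^esub> X \<in> carrier ?Q" if "a \<in> carrier A" "X \<in> carrier ?Q" for a X
      using ex[OF that(2)] that(1) q by auto
    show "(a \<oplus> b) \<odot>\<^bsub>?Q\<^esub> X = a \<odot>\<^bsub>?Q\<^esub> X \<oplus>\<^bsub>?Q\<^esub> b \<odot>\<^bsub>?Q\<^esub> X" if "a \<in> carrier A" "b \<in> carrier A" "X \<in> carrier ?Q" for a b X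
      using ex[OF that(3)] that(1,2) q by (auto simp: smult_l_distr)
    show "a \<odot>\<^bsub>?Q\<^esub> (X \<oplus>\<^bsub>?Q\<^esub> Y) = a \<odot>\<^bsub>?Q\<^esub> X \<oplus>\<^bsub>?Q\<^esub> a \<odot>\<^bsub>?Q\<^esub> Y"
      if "a \<in> carrier A" "X \<in> carrier ?Q" "Y \<in> carrier ?Q" for a X Y
      using ex[OF that(2)] ex[OF that(3)] that(1) q by (auto simp: smult_r_distr)
    show "(a \<otimes> b) \<odot>\<^bsub>?Q\<^esub> X = a \<odot>\<^bsub>?Q\<^esub> (b \<odot>\<^bsub>?Q\<^esub> X)" if "a \<in> carrier A" "b \<in> carrier A" "X \<in> carrier ?Q" for a b X
      using ex[OF that(3)] that(1,2) q by (auto simp: smult_assoc)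
    show "\<one> \<odot>\<^bsub>?Q\<^esub> X = X" if "X \<in> carrier ?Q" for X
      using ex[OF that] q by auto
  qed
qed

end

lemma regular_left_module: "ring A \<Longrightarrow> left_module A (regular_module A)"
proof -
  assume "ring A"
  then interpret ring A .
  have "abelian_group (regular_module A)"
    by (rule abelian_groupI) (auto simp: scalar_module_def a_ac intro: add.l_inv_ex)
  then show ?thesis
    by (intro left_module.intro left_module_axioms.intro ring_axioms)
      (auto simp: scalar_module_def l_distr r_distr m_assoc)
qed

lemma regular_module_simps [simp]:
  "carrier (scalar_module p A) = carrier A" "\<zero>\<^bsub>scalar_module p A\<^esub> = \<zero>\<^bsub>A\<^esub>"
  "x \<oplus>\<^bsub>scalar_module p A\<^esub> y = x \<oplus>\<^bsub>A\<^esub> y" "a \<odot>\<^bsub>scalar_module p A\<^esub> x = p a \<otimes>\<^bsub>A\<^esub> x"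
  "set_add (scalar_module p A) = set_add A"
  by (simp_all add: scalar_module_def set_add_def set_mult_def fun_eq_iff)

lemma submodule_regular: "ring A \<Longrightarrow> submodule N A (regular_module A) \<longleftrightarrow> lideal A N"
  using left_module.submodule_iff[OF regular_left_module] by (simp add: lideal_def)

lemma set_add_sub [simp]: "set_add (sub M N) = set_add M"
  by (simp add: set_add_def set_mult_def fun_eq_iff)

lemma a_r_coset_sub [simp]: "a_r_coset (sub M N) = a_r_coset M"
  by (simp add: a_r_coset_def r_coset_def fun_eq_iff)

text \<open>Covers two situations at once: surjective \<open>A\<close>-linear maps, with
  \<open>p\<close> the identity, and surjections from an \<open>A\<close>-module to a module over a
  quotient ring, with \<open>p\<close> the quotient map. As \<open>p\<close> is onto, the submodules
  of \<open>X\<close> over \<open>B\<close> are exactly the images of the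
  \<open>A\<close>-submodules containing the kernel.\<close>

locale semi_epi =
  fixes A :: "('a, 'x) ring_scheme" and B :: "('b, 'y) ring_scheme"
    and M :: "('a, 'm) module" and X :: "('b, 'n) module" and p h
  assumes M: "left_module A M" and X: "left_module B X"
    and p: "p ` carrier A = carrier B" and onto: "h ` carrier M = carrier X"
    and add: "\<And>x y. x \<in> carrier M \<Longrightarrow> y \<in> carrier M \<Longrightarrow> h (x \<oplus>\<^bsub>M\<^esub> y) = h x \<oplus>\<^bsub>X\<^esub> h y"
    and smult: "\<And>a x. a \<in> carrier A \<Longrightarrow> x \<in> carrier M \<Longrightarrow> h (a \<odot>\<^bsub>M\<^esub> x) = p a \<odot>\<^bsub>X\<^esub> h x"
begin

sublocale M: left_module A M by (rule M)
sublocale X: left_module B X by (rule X)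

lemma closed: "x \<in> carrier M \<Longrightarrow> h x \<in> carrier X"
  using onto by blast

lemma scalar_closed: "a \<in> carrier A \<Longrightarrow> p a \<in> carrier B"
  using p by blast

lemma zero [simp]: "h \<zero>\<^bsub>M\<^esub> = \<zero>\<^bsub>X\<^esub>"
proof -
  have "h \<zero>\<^bsub>M\<^esub> \<oplus>\<^bsub>X\<^esub> h \<zero>\<^bsub>M\<^esub> = h \<zero>\<^bsub>M\<^esub>" using add[of "\<zero>\<^bsub>M\<^esub>" "\<zero>\<^bsub>M\<^esub>"] by simp
  then show ?thesis using closed X.M.add.r_cancel_one by simp
qed

lemma minus: "x \<in> carrier M \<Longrightarrow> y \<in> carrier M \<Longrightarrow> h (x \<ominus>\<^bsub>M\<^esub> y) = h x \<ominus>\<^bsub>X\<^esub> h y"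
proof -
  assume xy: "x \<in> carrier M" "y \<in> carrier M"
  have "h (x \<ominus>\<^bsub>M\<^esub> y) \<oplus>\<^bsub>X\<^esub> h y = h x"
    using xy by (simp flip: add) (simp add: a_minus_def M.M.a_assoc M.M.l_neg)
  then show ?thesis using xy closed by (metis X.M.add.inv_solve_right M.M.minus_closed a_minus_def)
qed

definition ker :: "'m set" where "ker = {x \<in> carrier M. h x = \<zero>\<^bsub>X\<^esub>}"

lemma image_submodule:
  assumes "submodule N A M" shows "submodule (h ` N) B X"
  unfolding X.submodule_iff
proof (intro conjI ballI)
  note N = M.submoduleD[OF assms]
  show "h ` N \<subseteq> carrier X" using N(3) closed by blast
  show "\<zero>\<^bsub>X\<^esub> \<in> h ` N" using N(2) zero by (metis imageI)
  show "x \<oplus>\<^bsub>X\<^esub> y \<in> h ` N" if xy: "x \<in> h ` N" "y \<in> h ` N" for x y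
  proof -
    obtain u v where "u \<in> N" "v \<in> N" "x = h u" "y = h v" using xy by blast
    then show ?thesis using N(3,4) add by (metis imageI)
  qed
  show "b \<odot>\<^bsub>X\<^esub> x \<in> h ` N" if b: "b \<in> carrier B" and x: "x \<in> h ` N" for b x
  proof -
    obtain a u where "a \<in> carrier A" "b = p a" "u \<in> N" "x = h u" using b x p by blast
    then show ?thesis using N(3,5) smult by (metis imageI)
  qed
qed

lemma vimage_submodule:
  assumes "submodule K B X" shows "submodule {x \<in> carrier M. h x \<in> K} A M"
  unfolding M.submodule_iff
  using X.submoduleD(2,4)[OF assms] X.submoduleD(5)[OF assms scalar_closed] add smult by auto

lemma image_vimage: "K \<subseteq> carrier X \<Longrightarrow> h ` {x \<in> carrier M. h x \<in> K} = K"
  using onto by (auto simp: image_iff subset_iff)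

lemma submodule_image_iff: "submodule K B X \<longleftrightarrow> (\<exists>N. submodule N A M \<and> ker \<subseteq> N \<and> K = h ` N)"
proof
  assume K: "submodule K B X"
  have "ker \<subseteq> {x \<in> carrier M. h x \<in> K}" using X.submoduleD(2)[OF K] by (auto simp: ker_def)
  then show "\<exists>N. submodule N A M \<and> ker \<subseteq> N \<and> K = h ` N"
    using vimage_submodule[OF K] image_vimage[OF X.submoduleD(1)[OF K]] by metis
qed (auto intro: image_submodule)

lemma image_mem_iff:
  assumes "submodule N A M" "ker \<subseteq> N" "x \<in> carrier M"
  shows "h x \<in> h ` N \<longleftrightarrow> x \<in> N"
proof
  assume "h x \<in> h ` N"
  then obtain y where y: "y \<in> N" "h x = h y" by blast
  have yc: "y \<in> carrier M" using M.submoduleD(3)[OF assms(1) y(1)] .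
  have "h (x \<ominus>\<^bsub>M\<^esub> y) = \<zero>\<^bsub>X\<^esub>" using minus[OF assms(3) yc] y(2) closed[OF yc] X.M.r_neg by (simp add: a_minus_def)
  then have "x \<ominus>\<^bsub>M\<^esub> y \<in> N" using assms(2,3) yc by (auto simp: ker_def)
  then have "(x \<ominus>\<^bsub>M\<^esub> y) \<oplus>\<^bsub>M\<^esub> y \<in> N" using M.submoduleD(4)[OF assms(1)] y(1) by blast
  then show "x \<in> N" using assms(3) yc by (simp add: a_minus_def M.M.a_assoc M.M.l_neg)
qed blast

lemma image_subset_iff:
  assumes "submodule N A M" "K \<subseteq> carrier M" "ker \<subseteq> N"
  shows "h ` K \<subseteq> h ` N \<longleftrightarrow> K \<subseteq> N"
  using image_mem_iff[OF assms(1,3)] assms(2) by blast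

lemma submodule_ker: "submodule ker A M"
  using vimage_submodule[OF X.submodule_zero] by (simp add: ker_def)

lemma restrict:
  assumes "submodule N A M" shows "semi_epi A B (sub M N) (sub X (h ` N)) p h"
proof -
  interpret N: left_module A "sub M N" by (rule M.sub_left_module[OF assms])
  interpret K: left_module B "sub X (h ` N)" by (rule X.sub_left_module[OF image_submodule[OF assms]])
  show ?thesis
    using M.submoduleD(3)[OF assms] add smult p by unfold_locales auto
qed

lemma inj_iff_ker: "inj_on h (carrier M) \<longleftrightarrow> ker = {\<zero>\<^bsub>M\<^esub>}"
proof
  assume "inj_on h (carrier M)"
  then have "x = \<zero>\<^bsub>M\<^esub>" if "x \<in> carrier M" "h x = \<zero>\<^bsub>X\<^esub>" for x
    using that zero by (metis M.M.zero_closed inj_onD)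
  then show "ker = {\<zero>\<^bsub>M\<^esub>}" by (auto simp: ker_def)
next
  assume k: "ker = {\<zero>\<^bsub>M\<^esub>}"
  show "inj_on h (carrier M)"
  proof (rule inj_onI)
    fix x y assume xy: "x \<in> carrier M" "y \<in> carrier M" "h x = h y"
    then have "h (x \<ominus>\<^bsub>M\<^esub> y) = \<zero>\<^bsub>X\<^esub>" using minus closed X.M.r_neg by (simp add: a_minus_def)
    then have "x \<ominus>\<^bsub>M\<^esub> y = \<zero>\<^bsub>M\<^esub>" using k xy by (auto simp: ker_def)
    then show "x = y" using xy by (metis M.M.add.inv_solve_right M.M.l_zero M.M.zero_closed a_minus_def)
  qed
qed

lemma image_coset:
  assumes N: "submodule N A M" and x: "x \<in> carrier M"
  shows "h ` (N +>\<^bsub>M\<^esub> x) = h ` N +>\<^bsub>X\<^esub> h x"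
proof -
  note K = image_submodule[OF N]
  have "y \<in> h ` (N +>\<^bsub>M\<^esub> x)" if y: "y \<in> h ` N +>\<^bsub>X\<^esub> h x" for y
  proof -
    have yc: "y \<in> carrier X" "y \<ominus>\<^bsub>X\<^esub> h x \<in> h ` N" using y X.coset_mem_iff[OF K closed[OF x]] by auto
    then obtain n where n: "n \<in> N" "y \<ominus>\<^bsub>X\<^esub> h x = h n" by blast
    have nc: "n \<in> carrier M" using M.submoduleD(3)[OF N n(1)] .
    have "y = h n \<oplus>\<^bsub>X\<^esub> h x" unfolding n(2)[symmetric] using yc(1) closed[OF x] by (simp add: a_minus_def X.M.a_assoc X.M.l_neg)
    then have "y = h (n \<oplus>\<^bsub>M\<^esub> x)" using add nc x by simp
    moreover have "n \<oplus>\<^bsub>M\<^esub> x \<in> N +>\<^bsub>M\<^esub> x"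
      using nc x n(1) by (simp add: M.coset_mem_iff[OF N x] a_minus_def M.M.a_assoc M.M.r_neg)
    ultimately show ?thesis by blast
  qed
  moreover have "h y \<in> h ` N +>\<^bsub>X\<^esub> h x" if "y \<in> N +>\<^bsub>M\<^esub> x" for y
    using that x closed by (auto simp: M.coset_mem_iff[OF N x] X.coset_mem_iff[OF K closed[OF x]] simp flip: minus)
  ultimately show ?thesis by blast
qed

lemma quotient:
  assumes N: "submodule N A M"
  shows "semi_epi A B (quotient_module M N) (quotient_module X (h ` N)) p (image h)"
    "ker \<subseteq> N \<Longrightarrow> inj_on (image h) (carrier (quotient_module M N))"
proof -
  note K = image_submodule[OF N]
  interpret qM: left_module A "quotient_module M N" by (rule M.quotient_left_module[OF N])
  interpret qX: left_module B "quotient_module X (h ` N)" by (rule X.quotient_left_module[OF K])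
  note q = M.quotient_ops[OF N] and r = X.quotient_ops[OF K]
  note c = image_coset[OF N]
  show "semi_epi A B (quotient_module M N) (quotient_module X (h ` N)) p (image h)"
  proof unfold_locales
    show "p ` carrier A = carrier B" by (rule p)
    show "(`) h ` carrier (quotient_module M N) = carrier (quotient_module X (h ` N))"
    proof -
      have "(`) h ` carrier (quotient_module M N) = (\<lambda>x. h ` N +>\<^bsub>X\<^esub> h x) ` carrier M"
        unfolding M.quotient_carrier using c by (auto simp: image_iff)
      also have "\<dots> = (\<lambda>y. h ` N +>\<^bsub>X\<^esub> y) ` carrier X" unfolding onto[symmetric] by (simp add: image_image)
      also have "\<dots> = carrier (quotient_module X (h ` N))" unfolding X.quotient_carrier by auto
      finally show ?thesis .
    qed
    show "h ` (C \<oplus>\<^bsub>quotient_module M N\<^esub> D) = h ` C \<oplus>\<^bsub>quotient_module X (h ` N)\<^esub> h ` D"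
      if CD: "C \<in> carrier (quotient_module M N)" "D \<in> carrier (quotient_module M N)" for C D
    proof -
      obtain x y where xy: "x \<in> carrier M" "y \<in> carrier M" "C = N +>\<^bsub>M\<^esub> x" "D = N +>\<^bsub>M\<^esub> y"
        using CD by (auto simp: M.quotient_carrier)
      then show ?thesis using q(3)[OF xy(1,2)] r(3)[OF closed[OF xy(1)] closed[OF xy(2)]] c add by simp
    qed
    show "h ` (a \<odot>\<^bsub>quotient_module M N\<^esub> C) = p a \<odot>\<^bsub>quotient_module X (h ` N)\<^esub> h ` C"
      if a: "a \<in> carrier A" and C: "C \<in> carrier (quotient_module M N)" for a C
    proof -
      obtain x where x: "x \<in> carrier M" "C = N +>\<^bsub>M\<^esub> x" using C by (auto simp: M.quotient_carrier)
      have "p a \<in> carrier B" using a p by blast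
      then show ?thesis using q(4)[OF a x(1)] r(4)[OF _ closed[OF x(1)]] c x a smult by simp
    qed
  qed
  show "inj_on (image h) (carrier (quotient_module M N))" if k: "ker \<subseteq> N"
  proof (rule inj_onI)
    fix C D assume CD: "C \<in> carrier (quotient_module M N)" "D \<in> carrier (quotient_module M N)" and eq: "h ` C = h ` D"
    obtain x y where xy: "x \<in> carrier M" "y \<in> carrier M" "C = N +>\<^bsub>M\<^esub> x" "D = N +>\<^bsub>M\<^esub> y"
      using CD by (auto simp: M.quotient_carrier)
    have "h (x \<ominus>\<^bsub>M\<^esub> y) \<in> h ` N"
      using xy eq c X.coset_eq_iff[OF K closed[OF xy(1)] closed[OF xy(2)]] minus by simp
    then have "x \<ominus>\<^bsub>M\<^esub> y \<in> N" using image_mem_iff[OF N k] xy by simp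
    then show "C = D" using M.coset_eq_iff[OF N] xy by simp
  qed
qed

end

section \<open>Monotone functions on submodules as a substitute for length\<close>

definition smono :: "('a, 'x) ring_scheme \<Rightarrow> ('a, 'b) module \<Rightarrow> ('b set \<Rightarrow> nat) \<Rightarrow> bool" where
  "smono A M d \<longleftrightarrow> (\<forall>N K. submodule N A M \<and> submodule K A M \<and> N \<subset> K \<longrightarrow> d N < d K)"

lemma smonoD: "smono A M d \<Longrightarrow> submodule N A M \<Longrightarrow> submodule K A M \<Longrightarrow> N \<subset> K \<Longrightarrow> d N < d K"
  by (auto simp: smono_def)

lemma smono_le: "smono A M d \<Longrightarrow> submodule N A M \<Longrightarrow> submodule K A M \<Longrightarrow> N \<subseteq> K \<Longrightarrow> d N \<le> d K"
  using smonoD[of A M d N K] by (metis order_le_less psubsetI)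

lemma smono_eq: "smono A M d \<Longrightarrow> submodule N A M \<Longrightarrow> submodule K A M \<Longrightarrow> N \<subseteq> K \<Longrightarrow> d K \<le> d N \<Longrightarrow> N = K"
  using smonoD[of A M d N K] by fastforce

lemma simple_moduleD:
  assumes "simple_module A M"
  shows "left_module A M" "carrier M \<noteq> {\<zero>\<^bsub>M\<^esub>}" "\<And>N. submodule N A M \<Longrightarrow> N = {\<zero>\<^bsub>M\<^esub>} \<or> N = carrier M"
  using assms by (auto simp: simple_module_def)

context semi_epi
begin

lemma image_eq_iff:
  assumes "submodule N A M" "submodule K A M" "ker \<subseteq> N" "ker \<subseteq> K"
  shows "h ` N = h ` K \<longleftrightarrow> N = K"
  using image_subset_iff[OF assms(1) M.submoduleD(1)[OF assms(2)] assms(3)]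
    image_subset_iff[OF assms(2) M.submoduleD(1)[OF assms(1)] assms(4)] by blast

lemma ker_least: "submodule K B X \<Longrightarrow> submodule {x \<in> carrier M. h x \<in> K} A M \<and>
    ker \<subseteq> {x \<in> carrier M. h x \<in> K} \<and> h ` {x \<in> carrier M. h x \<in> K} = K"
  using vimage_submodule X.submoduleD(2)[of K] image_vimage[OF X.submoduleD(1)] by (auto simp: ker_def)

lemma image_ker: "h ` ker = {\<zero>\<^bsub>X\<^esub>}"
  using zero M.submoduleD(2)[OF submodule_ker] by (auto simp: ker_def)

lemma ker_carrier: "ker \<subseteq> carrier M"
  by (auto simp: ker_def)

lemma maximal_image_iff:
  assumes N: "submodule N A M" "ker \<subseteq> N"
  shows "maximal_submodule (h ` N) B X \<longleftrightarrow> maximal_submodule N A M"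
proof
  assume m: "maximal_submodule (h ` N) B X"
  show "maximal_submodule N A M" unfolding maximal_submodule_def
  proof (intro conjI allI impI N)
    show "N \<noteq> carrier M" using m onto by (auto simp: maximal_submodule_def)
    fix K assume K: "submodule K A M \<and> N \<subseteq> K"
    then have "h ` K = h ` N \<or> h ` K = h ` carrier M"
      using m image_submodule[of K] onto unfolding maximal_submodule_def by blast
    then show "K = N \<or> K = carrier M"
      using image_eq_iff[of K N] image_eq_iff[of K "carrier M"] K N ker_carrier by auto
  qed
next
  assume m: "maximal_submodule N A M"
  show "maximal_submodule (h ` N) B X" unfolding maximal_submodule_def
  proof (intro conjI allI impI)
    show "submodule (h ` N) B X" by (rule image_submodule[OF N(1)])
    show "h ` N \<noteq> carrier X"
      using image_eq_iff[OF N(1) M.submodule_carrier N(2) ker_carrier] onto m by (auto simp: maximal_submodule_def)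
    fix K assume K: "submodule K B X \<and> h ` N \<subseteq> K"
    define L where "L = {x \<in> carrier M. h x \<in> K}"
    have L: "submodule L A M" "ker \<subseteq> L" "h ` L = K" using ker_least K unfolding L_def by auto
    then have "N \<subseteq> L" using K image_subset_iff[OF L(1) M.submoduleD(1)[OF N(1)] L(2)] by blast
    then have "L = N \<or> L = carrier M" using m L(1) unfolding maximal_submodule_def by blast
    then show "K = h ` N \<or> K = carrier X" using L(3) onto by blast
  qed
qed

text \<open>Under this assumption the maximal submodules on both sides correspond to each other. It
  holds whenever the kernel is contained in every nonzero submodule and \<open>X\<close> is nonzero;
  see \<open>ker_in_maximal\<close>.\<close>

lemma radical_image:
  assumes "\<And>N. maximal_submodule N A M \<Longrightarrow> ker \<subseteq> N"
  shows "radical B X = h ` radical A M" "ker \<subseteq> radical A M"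
proof -
  show k: "ker \<subseteq> radical A M" using assms ker_carrier by (auto simp: radical_def)
  show "radical B X = h ` radical A M"
  proof (intro equalityI subsetI)
    fix y assume y: "y \<in> radical B X"
    then obtain x where x: "x \<in> carrier M" "y = h x" using onto by (auto simp: radical_def)
    have "x \<in> N" if N: "maximal_submodule N A M" for N
    proof -
      have s: "submodule N A M" using N by (simp add: maximal_submodule_def)
      have "h x \<in> h ` N" using y x maximal_image_iff[OF s assms[OF N]] N by (auto simp: radical_def)
      then show ?thesis using image_mem_iff[OF s assms[OF N] x(1)] by simp
    qed
    then show "y \<in> h ` radical A M" using x by (auto simp: radical_def)
  next
    fix y assume "y \<in> h ` radical A M"
    then obtain x where x: "x \<in> carrier M" "y = h x" "\<And>N. maximal_submodule N A M \<Longrightarrow> x \<in> N"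
      by (auto simp: radical_def)
    have "y \<in> K" if K: "maximal_submodule K B X" for K
    proof -
      define L where "L = {x \<in> carrier M. h x \<in> K}"
      have L: "submodule L A M" "ker \<subseteq> L" "h ` L = K"
        using ker_least K unfolding L_def maximal_submodule_def by auto
      then have "maximal_submodule L A M" using maximal_image_iff[OF L(1,2)] K by simp
      then show ?thesis using x L(3) by blast
    qed
    then show "y \<in> radical B X" using x closed by (auto simp: radical_def)
  qed
qed

end

context left_module
begin

lemma quotient_semi_epi:
  assumes N: "submodule N A M"
  shows "semi_epi A A M (quotient_module M N) (\<lambda>a. a) (\<lambda>x. N +>\<^bsub>M\<^esub> x)"
    "semi_epi.ker M (quotient_module M N) (\<lambda>x. N +>\<^bsub>M\<^esub> x) = N"
proof -
  interpret q: left_module A "quotient_module M N" by (rule quotient_left_module[OF N])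
  note q = quotient_ops[OF N]
  show e: "semi_epi A A M (quotient_module M N) (\<lambda>a. a) (\<lambda>x. N +>\<^bsub>M\<^esub> x)"
    using q by unfold_locales (auto simp: quotient_carrier)
  interpret e: semi_epi A A M "quotient_module M N" "\<lambda>a. a" "\<lambda>x. N +>\<^bsub>M\<^esub> x" by (rule e)
  show "e.ker = N" using q(1,5) submoduleD(1)[OF N] unfolding e.ker_def by blast
qed

lemma submodule_radical: "submodule (radical A M) A M"
  unfolding submodule_iff radical_def using submoduleD by (auto simp: maximal_submodule_def)

lemma simple_iff_maximal: "simple_module A M \<longleftrightarrow> maximal_submodule {\<zero>\<^bsub>M\<^esub>} A M"
  unfolding simple_module_def maximal_submodule_def using left_module_axioms submoduleD(2) by auto

lemma simple_quotient_iff: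
  assumes N: "submodule N A M"
  shows "simple_module A (quotient_module M N) \<longleftrightarrow> maximal_submodule N A M"
proof -
  interpret q: left_module A "quotient_module M N" by (rule quotient_left_module[OF N])
  interpret e: semi_epi A A M "quotient_module M N" "\<lambda>a. a" "\<lambda>x. N +>\<^bsub>M\<^esub> x"
    by (rule quotient_semi_epi[OF N])
  have "(\<lambda>x. N +>\<^bsub>M\<^esub> x) ` N = {\<zero>\<^bsub>quotient_module M N\<^esub>}"
    using e.image_ker quotient_semi_epi(2)[OF N] by simp
  then show ?thesis
    using q.simple_iff_maximal e.maximal_image_iff[OF N] quotient_semi_epi(2)[OF N] by simp
qed

lemma maximal_sub_iff:
  assumes "submodule N A M"
  shows "maximal_submodule K A (sub M N) \<longleftrightarrow>
    submodule K A M \<and> K \<subset> N \<and> (\<forall>L. submodule L A M \<and> K \<subseteq> L \<and> L \<subseteq> N \<longrightarrow> L = K \<or> L = N)"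
  unfolding maximal_submodule_def submodule_sub_iff[OF assms] by auto

text \<open>\<open>d N\<close> counts the steps of the given composition series at which
  \<open>N\<close> contains an element of \<open>C (Suc i)\<close> outside \<open>C i\<close>.
  Submodules \<open>N \<subseteq> K\<close> that meet the same steps are equal, by induction along
  the series. This turns the existence of one series into a bound for all chains.\<close>

lemma has_length_smono:
  assumes "has_length A M n"
  shows "\<exists>d. smono A M d \<and> d (carrier M) \<le> n"
proof -
  obtain C where C: "C 0 = {\<zero>\<^bsub>M\<^esub>}" "C n = carrier M" "\<And>i. i \<le> n \<Longrightarrow> submodule (C i) A M"
    "\<And>i. i < n \<Longrightarrow> C i \<subseteq> C (Suc i) \<and> simple_module A (quotient_module (sub M (C (Suc i))) (C i))"
    using assms unfolding has_length_def by blast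
  define J where "J N = {i. i < n \<and> (\<exists>x\<in>N. x \<in> C (Suc i) \<and> x \<notin> C i)}" for N
  define d where "d N = card (J N)" for N
  have fin: "finite (J N)" for N by (simp add: J_def)
  have "d N < d K" if N: "submodule N A M" and K: "submodule K A M" and NK: "N \<subset> K" for N K
  proof -
    have sub: "J N \<subseteq> J K" using NK by (auto simp: J_def)
    have "J N \<noteq> J K"
    proof
      assume eq: "J N = J K"
      have "i \<le> n \<Longrightarrow> K \<inter> C i \<subseteq> N" for i
      proof (induction i)
        case 0 then show ?case using C(1) submoduleD(2)[OF N] by auto
      next
        case (Suc i)
        note Ci = C(3)[of i] C(3)[of "Suc i"]
        show ?case
        proof
          fix x assume x: "x \<in> K \<inter> C (Suc i)"
          show "x \<in> N"
          proof (cases "i \<in> J K")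
            case False
            then have "x \<in> C i" using x Suc(2) by (auto simp: J_def)
            then show ?thesis using Suc x by auto
          next
            case True
            then obtain y where y: "y \<in> N" "y \<in> C (Suc i)" "y \<notin> C i" using eq by (auto simp: J_def)
            have si: "submodule (C i) A M" "submodule (C (Suc i)) A M" using Ci Suc by auto
            interpret s: left_module A "sub M (C (Suc i))" by (rule sub_left_module[OF si(2)])
            have max: "maximal_submodule (C i) A (sub M (C (Suc i)))"
              using s.simple_quotient_iff[of "C i"] C(4)[of i] Suc(2) submodule_sub_iff[OF si(2)] si by auto
            \<comment> \<open>\<open>N\<close> meets the simple factor at \<open>i\<close>, so
              \<open>N \<inter> C (Suc i)\<close> fills \<open>C (Suc i)\<close> modulo
              \<open>C i\<close>. Thus \<open>x\<close> differs from an element of \<open>N\<close>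
              by an element of \<open>K \<inter> C i\<close>, to which the induction hypothesis
              applies.\<close>
            define L where "L = (N \<inter> C (Suc i)) <+>\<^bsub>M\<^esub> C i"
            have NC: "submodule (N \<inter> C (Suc i)) A M" using submodule_Int N si by blast
            have L: "submodule L A M" unfolding L_def by (rule submodule_add[OF NC si(1)])
            have up: "N \<inter> C (Suc i) \<subseteq> L" "C i \<subseteq> L" unfolding L_def using submodule_add_upper[OF NC si(1)] .
            have "L \<subseteq> C (Suc i)" unfolding L_def using submodule_add_least[OF si(2)] C(4)[of i] Suc(2) by auto
            then have "L = C (Suc i)" using max[unfolded maximal_sub_iff[OF si(2)]] L up y by blast
            then have "x \<in> L" using x by simp
            then obtain a b where ab: "a \<in> N" "b \<in> C i" "x = a \<oplus>\<^bsub>M\<^esub> b"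
              unfolding L_def by (auto simp: mem_set_add)
            have c: "a \<in> carrier M" "b \<in> carrier M" using ab submoduleD(3) N si by blast+
            have "b = x \<ominus>\<^bsub>M\<^esub> a" using ab(3) c by (simp add: a_minus_def M.a_comm[of a b] M.a_assoc M.r_neg)
            then have "b \<in> K" using submoduleD(7)[OF K] x ab(1) NK by auto
            then have "b \<in> N" using Suc ab(2) by auto
            then show ?thesis using submoduleD(4)[OF N] ab by blast
          qed
        qed
      qed
      from this[of n] have "K \<subseteq> N" using C(2) submoduleD(1)[OF K] by auto
      with NK show False by blast
    qed
    then show ?thesis unfolding d_def using psubset_card_mono[OF fin] sub by blast
  qed
  moreover have "d (carrier M) \<le> n"
    unfolding d_def using card_mono[of "{..<n}" "J (carrier M)"] by (auto simp: J_def)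
  ultimately show ?thesis unfolding smono_def by blast
qed

lemma smono_maximal:
  assumes d: "smono A M d" and N: "submodule N A M" "N \<noteq> carrier M"
  shows "\<exists>K. maximal_submodule K A M \<and> N \<subseteq> K"
proof -
  let ?P = "\<lambda>K. submodule K A M \<and> N \<subseteq> K \<and> K \<noteq> carrier M"
  have bound: "\<forall>K. ?P K \<longrightarrow> d K < Suc (d (carrier M))"
    using smono_le[OF d _ submodule_carrier submoduleD(1)] by (simp add: less_Suc_eq_le)
  have "?P N" using N by blast
  from ex_has_greatest_nat[OF this bound] obtain K where K: "?P K" "\<And>L. ?P L \<Longrightarrow> d L \<le> d K" by blast
  have "maximal_submodule K A M" unfolding maximal_submodule_def
  proof (intro conjI allI impI)
    fix L assume L: "submodule L A M \<and> K \<subseteq> L"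
    show "L = K \<or> L = carrier M"
    proof (rule ccontr)
      assume n: "\<not> ?thesis"
      then have "d L \<le> d K" using K(2)[of L] K(1) L by blast
      then show False using smono_eq[OF d, of K L] K(1) L n by blast
    qed
  qed (use K in auto)
  then show ?thesis using K(1) by blast
qed

lemma smono_sub: "smono A M d \<Longrightarrow> submodule N A M \<Longrightarrow> smono A (sub M N) d"
  unfolding smono_def by (simp add: submodule_sub_iff)

lemma smono_simple:
  assumes d: "smono A M d" and N: "submodule N A M" "N \<noteq> {\<zero>\<^bsub>M\<^esub>}"
  shows "\<exists>S. submodule S A M \<and> S \<subseteq> N \<and> simple_module A (sub M S)"
proof -
  let ?P = "\<lambda>K. submodule K A M \<and> K \<subseteq> N \<and> K \<noteq> {\<zero>\<^bsub>M\<^esub>}"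
  have "?P N" using N by blast
  then obtain S where S: "?P S" "\<And>L. ?P L \<Longrightarrow> d S \<le> d L" using ex_has_least_nat[of ?P N d] by blast
  interpret s: left_module A "sub M S" using sub_left_module S by blast
  have "simple_module A (sub M S)" unfolding simple_module_def
  proof (intro conjI allI impI s.left_module_axioms)
    show "carrier (sub M S) \<noteq> {\<zero>\<^bsub>sub M S\<^esub>}" using S by simp
    fix L assume "submodule L A (sub M S)"
    then have L: "submodule L A M" "L \<subseteq> S" using submodule_sub_iff S by auto
    show "L = {\<zero>\<^bsub>sub M S\<^esub>} \<or> L = carrier (sub M S)"
      using S(2)[of L] smono_eq[OF d L(1) _ L(2)] S(1) L by auto
  qed
  then show ?thesis using S(1) by blast
qed

text \<open>Removes maximal submodules from the top; each lowers \<open>d\<close>. Since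
  \<open>d\<close> may jump by more than one, the length is only bounded by
  \<open>d (carrier M)\<close>.\<close>

lemma smono_has_length:
  assumes d: "smono A M d"
  shows "\<exists>k\<le>d (carrier M). has_length A M k"
proof -
  have "submodule N A M \<Longrightarrow> \<exists>k C. k \<le> d N \<and> C 0 = {\<zero>\<^bsub>M\<^esub>} \<and> C k = N \<and> (\<forall>i\<le>k. submodule (C i) A M) \<and>
      (\<forall>i<k. C i \<subseteq> C (Suc i) \<and> simple_module A (quotient_module (sub M (C (Suc i))) (C i)))" for N
  proof (induction "d N" arbitrary: N rule: less_induct)
    case less
    show ?case
    proof (cases "N = {\<zero>\<^bsub>M\<^esub>}")
      case True
      then show ?thesis by (intro exI[of _ 0] exI[of _ "\<lambda>_. {\<zero>\<^bsub>M\<^esub>}"]) auto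
    next
      case False
      interpret s: left_module A "sub M N" by (rule sub_left_module[OF less(2)])
      have "submodule {\<zero>\<^bsub>M\<^esub>} A (sub M N)" using submodule_sub_iff[OF less(2)] submoduleD(2)[OF less(2)] by simp
      then obtain K where K: "maximal_submodule K A (sub M N)"
        using s.smono_maximal[OF smono_sub[OF d less(2)], of "{\<zero>\<^bsub>M\<^esub>}"] False by auto
      note K' = K[unfolded maximal_sub_iff[OF less(2)]]
      have dK: "d K < d N" using smonoD[OF d _ less(2)] K' by blast
      obtain k C where C: "k \<le> d K" "C 0 = {\<zero>\<^bsub>M\<^esub>}" "C k = K" "\<forall>i\<le>k. submodule (C i) A M"
        "\<forall>i<k. C i \<subseteq> C (Suc i) \<and> simple_module A (quotient_module (sub M (C (Suc i))) (C i))"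
        using less(1)[OF dK] K' by blast
      define D where "D i = (if i \<le> k then C i else N)" for i
      have "simple_module A (quotient_module (sub M N) K)"
        using s.simple_quotient_iff[of K] K by (auto simp: maximal_submodule_def)
      then have "Suc k \<le> d N \<and> D 0 = {\<zero>\<^bsub>M\<^esub>} \<and> D (Suc k) = N \<and> (\<forall>i\<le>Suc k. submodule (D i) A M) \<and>
        (\<forall>i<Suc k. D i \<subseteq> D (Suc i) \<and> simple_module A (quotient_module (sub M (D (Suc i))) (D i)))"
        using C dK K' less(2) by (auto simp: D_def less_Suc_eq)
      then show ?thesis by blast
    qed
  qed
  from this[OF submodule_carrier] show ?thesis unfolding has_length_def by blast
qed

lemma submodule_cyclic:
  assumes "b \<in> carrier M" shows "submodule {a \<odot>\<^bsub>M\<^esub> b | a. a \<in> carrier A} A M"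
  unfolding submodule_iff
proof (intro conjI ballI)
  let ?S = "{a \<odot>\<^bsub>M\<^esub> b | a. a \<in> carrier A}"
  show "?S \<subseteq> carrier M" using assms by auto
  show "\<zero>\<^bsub>M\<^esub> \<in> ?S" using assms by (auto intro!: exI[of _ \<zero>])
  show "x \<oplus>\<^bsub>M\<^esub> y \<in> ?S" if "x \<in> ?S" "y \<in> ?S" for x y
    using that assms by (auto simp flip: smult_l_distr)
  show "a \<odot>\<^bsub>M\<^esub> x \<in> ?S" if "a \<in> carrier A" "x \<in> ?S" for a x
    using that assms by (auto simp flip: smult_assoc)
qed

text \<open>Modularity: a submodule of \<open>Z + A b\<close> is determined, among comparable ones,
  by its intersection with \<open>Z\<close> and its image modulo \<open>Z\<close>, and the latter by
  the ideal of coefficients of \<open>b\<close>. It serves both the length functions and the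
  descending chains over the base ring.\<close>

lemma adjoin_eq:
  assumes Z: "submodule Z A M" and b: "b \<in> carrier M" and NK: "submodule N A M" "submodule K A M" "N \<subseteq> K"
    and KW: "K \<subseteq> Z <+>\<^bsub>M\<^esub> {a \<odot>\<^bsub>M\<^esub> b | a. a \<in> carrier A}" and KZ: "K \<inter> Z \<subseteq> N"
    and I: "\<And>a. a \<in> carrier A \<Longrightarrow> a \<odot>\<^bsub>M\<^esub> b \<in> K <+>\<^bsub>M\<^esub> Z \<Longrightarrow> a \<odot>\<^bsub>M\<^esub> b \<in> N <+>\<^bsub>M\<^esub> Z"
  shows "N = K"
proof -
  have "x \<in> N" if x: "x \<in> K" for x
  proof -
    have "x \<in> Z <+>\<^bsub>M\<^esub> {a \<odot>\<^bsub>M\<^esub> b | a. a \<in> carrier A}" using KW x by blast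
    then obtain z a where za: "z \<in> Z" "a \<in> carrier A" "x = z \<oplus>\<^bsub>M\<^esub> a \<odot>\<^bsub>M\<^esub> b" by (auto simp: mem_set_add)
    have c: "z \<in> carrier M" "x \<in> carrier M" using submoduleD(3)[OF Z za(1)] submoduleD(3)[OF NK(2) x] .
    have "a \<odot>\<^bsub>M\<^esub> b = x \<oplus>\<^bsub>M\<^esub> \<ominus>\<^bsub>M\<^esub> z" using za(2,3) c b
      by (simp add: M.a_comm[of z] M.a_assoc M.r_neg)
    then have "a \<odot>\<^bsub>M\<^esub> b \<in> K <+>\<^bsub>M\<^esub> Z" unfolding mem_set_add using x submoduleD(6)[OF Z za(1)] by blast
    then have "a \<odot>\<^bsub>M\<^esub> b \<in> N <+>\<^bsub>M\<^esub> Z" by (rule I[OF za(2)])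
    then obtain n z' where nz: "n \<in> N" "z' \<in> Z" "a \<odot>\<^bsub>M\<^esub> b = n \<oplus>\<^bsub>M\<^esub> z'" by (auto simp: mem_set_add)
    have c': "n \<in> carrier M" "z' \<in> carrier M" using submoduleD(3)[OF NK(1) nz(1)] submoduleD(3)[OF Z nz(2)] .
    have xn: "x = n \<oplus>\<^bsub>M\<^esub> (z \<oplus>\<^bsub>M\<^esub> z')" using za(3) nz(3) c c' by (simp add: M.a_ac)
    then have "z \<oplus>\<^bsub>M\<^esub> z' = x \<ominus>\<^bsub>M\<^esub> n" using c c'
      by (simp add: a_minus_def M.a_comm[of n] M.a_assoc M.r_neg)
    then have "z \<oplus>\<^bsub>M\<^esub> z' \<in> N"
      using submoduleD(7)[OF NK(2) x] submoduleD(4)[OF Z za(1) nz(2)] nz(1) NK(3) KZ by auto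
    then show ?thesis using submoduleD(4)[OF NK(1) nz(1)] xn by simp
  qed
  then show ?thesis using NK(3) by blast
qed

text \<open>The size of \<open>N\<close> is the size of \<open>N \<inter> Z\<close> plus that of the
  left ideal \<open>I N\<close> of coefficients of \<open>b\<close> modulo \<open>Z\<close>.\<close>

lemma smono_adjoin:
  assumes d: "lmono A (carrier A) dA" and Z: "submodule Z A M" and b: "b \<in> carrier M"
    and dZ: "smono A (sub M Z) dZ" 
  shows "\<exists>d. smono A (sub M (Z <+>\<^bsub>M\<^esub> {a \<odot>\<^bsub>M\<^esub> b | a. a \<in> carrier A})) d"
proof -
  define W where "W = Z <+>\<^bsub>M\<^esub> {a \<odot>\<^bsub>M\<^esub> b | a. a \<in> carrier A}"
  have W: "submodule W A M" unfolding W_def by (rule submodule_add[OF Z submodule_cyclic[OF b]])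
  define I where "I N = {a \<in> carrier A. a \<odot>\<^bsub>M\<^esub> b \<in> N <+>\<^bsub>M\<^esub> Z}" for N
  have I: "lideal A (I N)" if "submodule N A M" for N
    using submoduleD(2,4,5)[OF submodule_add[OF that Z]] b
    unfolding I_def lideal_def by (auto simp: smult_l_distr smult_assoc)
  have Imono: "I N \<subseteq> I K" if "N \<subseteq> K" for N K using that unfolding I_def by (auto simp: mem_set_add)
  have IA: "I N \<subseteq> carrier A" for N by (auto simp: I_def)
  define F where "F N = dZ (N \<inter> Z) + dA (I N)" for N
  have "F N < F K" if NK: "submodule N A M" "submodule K A M" "N \<subset> K" "K \<subseteq> W" for N K
  proof -
    have s: "submodule (N \<inter> Z) A (sub M Z)" "submodule (K \<inter> Z) A (sub M Z)"
      using submodule_Int Z NK by (auto simp: submodule_sub_iff[OF Z])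
    have 1: "dZ (N \<inter> Z) \<le> dZ (K \<inter> Z)" using smono_le[OF dZ s] NK by blast
    have 2: "dA (I N) \<le> dA (I K)" "dA (I N) = dA (I K) \<Longrightarrow> I N = I K"
      using d I[OF NK(1)] I[OF NK(2)] Imono[of N K] NK(3) IA[of K] unfolding lmono_def
      by (metis order_le_less psubsetI psubset_imp_subset, metis less_irrefl_nat psubsetI psubset_imp_subset)
    show ?thesis
    proof (rule ccontr)
      assume "\<not> ?thesis"
      then have eq: "dZ (N \<inter> Z) = dZ (K \<inter> Z)" "I N = I K" using 1 2 unfolding F_def by linarith+
      have "N \<inter> Z = K \<inter> Z" using smono_eq[OF dZ s] eq(1) NK(3) by auto
      then have "N = K" using eq(2) NK by (intro adjoin_eq[OF Z b NK(1,2) _ NK(4)[unfolded W_def]]) (auto simp: I_def)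
      then show False using NK(3) by blast
    qed
  qed
  then have "smono A (sub M W) F" unfolding smono_def by (simp add: submodule_sub_iff[OF W])
  then show ?thesis unfolding W_def by blast
qed

lemma finitely_generated_smono:
  assumes d: "lmono A (carrier A) dA" and fg: "finitely_generated A M"
  shows "\<exists>d. smono A M d"
proof -
  obtain B where B: "finite B" "B \<subseteq> carrier M" "generated_submodule A M B = carrier M"
    using fg unfolding finitely_generated_def by blast
  have "\<exists>Z. submodule Z A M \<and> B \<subseteq> Z \<and> (\<exists>d. smono A (sub M Z) d)"
    using B(1,2)
  proof (induction B rule: finite_induct)
    case empty
    have "smono A (sub M {\<zero>\<^bsub>M\<^esub>}) (\<lambda>_. 0)"
      unfolding smono_def submodule_sub_iff[OF submodule_zero] using submoduleD(2) by blast
    then show ?case using submodule_zero by blast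
  next
    case (insert b B)
    then obtain Z dZ where Z: "submodule Z A M" "B \<subseteq> Z" "smono A (sub M Z) dZ" by auto
    have b: "b \<in> carrier M" using insert by simp
    let ?W = "Z <+>\<^bsub>M\<^esub> {a \<odot>\<^bsub>M\<^esub> b | a. a \<in> carrier A}"
    have "b \<in> {a \<odot>\<^bsub>M\<^esub> b | a. a \<in> carrier A}" using b by (auto intro!: exI[of _ \<one>])
    then have "insert b B \<subseteq> ?W" using submodule_add_upper[OF Z(1) submodule_cyclic[OF b]] Z(2) by blast
    then show ?case using submodule_add[OF Z(1) submodule_cyclic[OF b]] smono_adjoin[OF d Z(1) b Z(3)] by blast
  qed
  then obtain Z d where Z: "submodule Z A M" "B \<subseteq> Z" "smono A (sub M Z) d" by blast
  have "Z = carrier M" using generated_submodule(3)[OF B(2) Z(1,2)] B(3) submoduleD(1)[OF Z(1)] by blast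
  then show ?thesis using Z(3) by auto
qed

text \<open>Among the finite subsets of \<open>N\<close> take one that generates a submodule of
  largest \<open>d\<close>; adding any further element cannot enlarge it.\<close>

lemma smono_finitely_generated:
  assumes d: "smono A M d" and N: "submodule N A M"
  shows "finitely_generated A (sub M N)"
proof -
  interpret s: left_module A "sub M N" by (rule sub_left_module[OF N])
  let ?P = "\<lambda>B. finite B \<and> B \<subseteq> N"
  let ?g = "generated_submodule A (sub M N)"
  have g: "submodule (?g B) A M \<and> ?g B \<subseteq> N \<and> B \<subseteq> ?g B" if "B \<subseteq> N" for B
    using s.generated_submodule[of B] that by (simp add: submodule_sub_iff[OF N])
  have "\<forall>B. ?P B \<longrightarrow> d (?g B) < Suc (d N)"
    using smono_le[OF d _ N] g by (simp add: less_Suc_eq_le)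
  from ex_has_greatest_nat[of ?P "{}", OF _ this] obtain B where
    B: "?P B" "\<And>B'. ?P B' \<Longrightarrow> d (?g B') \<le> d (?g B)" by auto
  have "N \<subseteq> ?g B"
  proof
    fix x assume x: "x \<in> N"
    have P: "?P (insert x B)" using B x by simp
    have le: "?g B \<subseteq> ?g (insert x B)"
      using s.generated_submodule(3)[of B "?g (insert x B)"] s.generated_submodule(1)[of "insert x B"] g[of "insert x B"] P B
      by auto
    have "?g B = ?g (insert x B)" using smono_eq[OF d _ _ le B(2)[OF P]] g B(1) P by blast
    then show "x \<in> ?g B" using g[of "insert x B"] P by blast
  qed
  then have "?g B = N" using g B(1) by blast
  then show ?thesis unfolding finitely_generated_def using B(1) by auto
qed

end

section \<open>Invariance of module properties under semilinear isomorphisms\<close>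

locale semi_iso = semi_epi +
  assumes inj: "inj_on h (carrier M)"
begin

lemma ker_zero: "ker = {\<zero>\<^bsub>M\<^esub>}"
  using inj inj_iff_ker by simp

lemma ker_sub: "submodule N A M \<Longrightarrow> ker \<subseteq> N"
  using M.submoduleD(2) by (simp add: ker_zero)

lemma img_eq: "submodule N A M \<Longrightarrow> submodule K A M \<Longrightarrow> h ` N = h ` K \<longleftrightarrow> N = K"
  using image_eq_iff ker_sub by blast

lemma img_subset: "submodule N A M \<Longrightarrow> submodule K A M \<Longrightarrow> h ` N \<subseteq> h ` K \<longleftrightarrow> N \<subseteq> K"
  using image_subset_iff ker_sub M.submoduleD(1) by blast

lemma img_zero: "submodule N A M \<Longrightarrow> h ` N = {\<zero>\<^bsub>X\<^esub>} \<longleftrightarrow> N = {\<zero>\<^bsub>M\<^esub>}"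
  using img_eq[of N "{\<zero>\<^bsub>M\<^esub>}"] by simp

lemma img_carrier: "submodule N A M \<Longrightarrow> h ` N = carrier X \<longleftrightarrow> N = carrier M"
  using img_eq[of N "carrier M"] onto by simp

lemma all_submodules: "(\<forall>K. submodule K B X \<longrightarrow> P K) \<longleftrightarrow> (\<forall>N. submodule N A M \<longrightarrow> P (h ` N))"
proof
  assume R: "\<forall>N. submodule N A M \<longrightarrow> P (h ` N)"
  show "\<forall>K. submodule K B X \<longrightarrow> P K"
  proof (intro allI impI)
    fix K assume "submodule K B X"
    then obtain N where "submodule N A M" "K = h ` N" unfolding submodule_image_iff by blast
    then show "P K" using R by blast
  qed
qed (use image_submodule in simp)

lemma submodule_img:
  assumes "N \<subseteq> carrier M" shows "submodule (h ` N) B X \<longleftrightarrow> submodule N A M"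
proof
  assume "submodule (h ` N) B X"
  then obtain K where K: "submodule K A M" "h ` N = h ` K" using submodule_image_iff by blast
  then have "N = K" using inj_on_image_eq_iff[OF inj assms M.submoduleD(1)[OF K(1)]] by simp
  then show "submodule N A M" using K(1) by simp
qed (rule image_submodule)

lemma img_Int: "submodule N A M \<Longrightarrow> submodule K A M \<Longrightarrow> h ` (N \<inter> K) = h ` N \<inter> h ` K"
  using inj_on_image_Int[OF inj] M.submoduleD(1) by blast

lemma img_add: 
  assumes "submodule N A M" "submodule K A M"
  shows "h ` (N <+>\<^bsub>M\<^esub> K) = h ` N <+>\<^bsub>X\<^esub> h ` K"
proof -
  have "h (x \<oplus>\<^bsub>M\<^esub> y) = h x \<oplus>\<^bsub>X\<^esub> h y" if "x \<in> N" "y \<in> K" for x y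
    using add M.submoduleD(3)[OF assms(1) that(1)] M.submoduleD(3)[OF assms(2) that(2)] by blast
  note eq = this
  show ?thesis
  proof (intro equalityI subsetI)
    fix z assume "z \<in> h ` (N <+>\<^bsub>M\<^esub> K)"
    then obtain x y where "x \<in> N" "y \<in> K" "z = h (x \<oplus>\<^bsub>M\<^esub> y)" by (auto simp: mem_set_add)
    then show "z \<in> h ` N <+>\<^bsub>X\<^esub> h ` K" using eq unfolding mem_set_add by blast
  next
    fix z assume "z \<in> h ` N <+>\<^bsub>X\<^esub> h ` K"
    then obtain x y where "x \<in> N" "y \<in> K" "z = h x \<oplus>\<^bsub>X\<^esub> h y" by (auto simp: mem_set_add)
    then have "z = h (x \<oplus>\<^bsub>M\<^esub> y)" "x \<oplus>\<^bsub>M\<^esub> y \<in> N <+>\<^bsub>M\<^esub> K" using eq by (auto simp: mem_set_add)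
    then show "z \<in> h ` (N <+>\<^bsub>M\<^esub> K)" by blast
  qed
qed

lemma restrict_iso: "submodule N A M \<Longrightarrow> semi_iso A B (sub M N) (sub X (h ` N)) p h"
  using restrict inj_on_subset[OF inj M.submoduleD(1)] by (auto intro!: semi_iso.intro semi_iso_axioms.intro)

lemma quotient_iso:
  "submodule N A M \<Longrightarrow> semi_iso A B (quotient_module M N) (quotient_module X (h ` N)) p (image h)"
  using quotient ker_sub by (auto intro!: semi_iso.intro semi_iso_axioms.intro)

lemma simple_iso: "simple_module B X \<longleftrightarrow> simple_module A M"
  unfolding M.simple_iff_maximal X.simple_iff_maximal
  using maximal_image_iff[OF M.submodule_zero ker_sub[OF M.submodule_zero]] by simp

lemma uniserial_iso: "uniserial B X \<longleftrightarrow> uniserial A M"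
proof -
  have "uniserial B X \<longleftrightarrow> (\<forall>N. submodule N B X \<longrightarrow> (\<forall>K. submodule K B X \<longrightarrow> N \<subseteq> K \<or> K \<subseteq> N))"
    unfolding uniserial_def by blast
  also have "\<dots> \<longleftrightarrow> (\<forall>N. submodule N A M \<longrightarrow> (\<forall>K. submodule K A M \<longrightarrow> h ` N \<subseteq> h ` K \<or> h ` K \<subseteq> h ` N))"
    unfolding all_submodules ..
  also have "\<dots> \<longleftrightarrow> uniserial A M" unfolding uniserial_def by (simp add: img_subset) blast
  finally show ?thesis .
qed

lemma direct_sum_iso:
  assumes "N \<subseteq> carrier M" "K \<subseteq> carrier M"
  shows "internal_direct_sum B X (h ` N) (h ` K) \<longleftrightarrow> internal_direct_sum A M N K"
proof -
  have "h ` N <+>\<^bsub>X\<^esub> h ` K = carrier X \<longleftrightarrow> N <+>\<^bsub>M\<^esub> K = carrier M" if "submodule N A M" "submodule K A M"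
    using img_carrier[OF M.submodule_add[OF that]] img_add[OF that] by simp
  moreover have "h ` N \<inter> h ` K = {\<zero>\<^bsub>X\<^esub>} \<longleftrightarrow> N \<inter> K = {\<zero>\<^bsub>M\<^esub>}" if "submodule N A M" "submodule K A M"
    using img_zero[OF M.submodule_Int[OF that]] img_Int[OF that] by simp
  ultimately show ?thesis unfolding internal_direct_sum_def using submodule_img assms by blast
qed

lemma direct_sum_ex:
  assumes "internal_direct_sum B X N' K'"
  shows "\<exists>N K. N' = h ` N \<and> K' = h ` K \<and> submodule N A M \<and> submodule K A M \<and> internal_direct_sum A M N K"
proof -
  obtain N K where NK: "submodule N A M" "submodule K A M" "N' = h ` N" "K' = h ` K"
    using assms submodule_image_iff unfolding internal_direct_sum_def by meson
  then show ?thesis using assms direct_sum_iso[of N K] M.submoduleD(1) by blast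
qed

lemma indecomposable_iso: "indecomposable B X \<longleftrightarrow> indecomposable A M"
proof -
  have 1: "carrier X = {\<zero>\<^bsub>X\<^esub>} \<longleftrightarrow> carrier M = {\<zero>\<^bsub>M\<^esub>}" using img_zero[OF M.submodule_carrier] onto by simp
  have 2: "(\<forall>N' K'. internal_direct_sum B X N' K' \<longrightarrow> N' = {\<zero>\<^bsub>X\<^esub>} \<or> K' = {\<zero>\<^bsub>X\<^esub>}) \<longleftrightarrow>
    (\<forall>N K. internal_direct_sum A M N K \<longrightarrow> N = {\<zero>\<^bsub>M\<^esub>} \<or> K = {\<zero>\<^bsub>M\<^esub>})" (is "?L \<longleftrightarrow> ?R")
  proof
    assume L: ?L
    show ?R
    proof (intro allI impI)
      fix N K assume i: "internal_direct_sum A M N K"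
      then have s: "submodule N A M" "submodule K A M" by (auto simp: internal_direct_sum_def)
      have "internal_direct_sum B X (h ` N) (h ` K)" using i direct_sum_iso s M.submoduleD(1) by blast
      then have "h ` N = {\<zero>\<^bsub>X\<^esub>} \<or> h ` K = {\<zero>\<^bsub>X\<^esub>}" using L by blast
      then show "N = {\<zero>\<^bsub>M\<^esub>} \<or> K = {\<zero>\<^bsub>M\<^esub>}" using img_zero[OF s(1)] img_zero[OF s(2)] by simp
    qed
  next
    assume R: ?R
    show ?L
    proof (intro allI impI)
      fix N' K' assume "internal_direct_sum B X N' K'"
      then obtain N K where "N' = h ` N" "K' = h ` K" "internal_direct_sum A M N K" using direct_sum_ex by blast
      then show "N' = {\<zero>\<^bsub>X\<^esub>} \<or> K' = {\<zero>\<^bsub>X\<^esub>}" using R by fastforce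
    qed
  qed
  show ?thesis unfolding indecomposable_def 1 2 ..
qed

lemma has_length_iso: "has_length B X n \<longleftrightarrow> has_length A M n"
proof
  assume "has_length A M n"
  then obtain C where C: "C 0 = {\<zero>\<^bsub>M\<^esub>}" "C n = carrier M" "\<And>i. i \<le> n \<Longrightarrow> submodule (C i) A M"
    "\<And>i. i < n \<Longrightarrow> C i \<subseteq> C (Suc i) \<and> simple_module A (quotient_module (sub M (C (Suc i))) (C i))"
    unfolding has_length_def by blast
  have "simple_module B (quotient_module (sub X (h ` C (Suc i))) (h ` C i))" if i: "i < n" for i
  proof -
    have s: "submodule (C i) A M" "submodule (C (Suc i)) A M" using C(3) i by auto
    interpret r: semi_iso A B "sub M (C (Suc i))" "sub X (h ` C (Suc i))" p h by (rule restrict_iso[OF s(2)])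
    interpret q: semi_iso A B "quotient_module (sub M (C (Suc i))) (C i)"
      "quotient_module (sub X (h ` C (Suc i))) (h ` C i)" p "image h"
      by (rule r.quotient_iso) (use s C(4)[OF i] M.submodule_sub_iff[OF s(2)] in auto)
    show ?thesis using q.simple_iso C(4)[OF i] by simp
  qed
  moreover have "h ` C i \<subseteq> h ` C (Suc i)" if "i < n" for i using C(4)[OF that] by blast
  ultimately show "has_length B X n" unfolding has_length_def
    using C(1,2) onto image_submodule[OF C(3)] by (intro exI[of _ "\<lambda>i. h ` C i"]) auto
next
  assume "has_length B X n"
  then obtain D where D: "D 0 = {\<zero>\<^bsub>X\<^esub>}" "D n = carrier X" "\<And>i. i \<le> n \<Longrightarrow> submodule (D i) B X"
    "\<And>i. i < n \<Longrightarrow> D i \<subseteq> D (Suc i) \<and> simple_module B (quotient_module (sub X (D (Suc i))) (D i))"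
    unfolding has_length_def by blast
  define C where "C i = {x \<in> carrier M. h x \<in> D i}" for i
  have C: "submodule (C i) A M" "h ` C i = D i" if "i \<le> n" for i
    using ker_least[OF D(3)[OF that]] unfolding C_def by auto
  have "simple_module A (quotient_module (sub M (C (Suc i))) (C i))" if i: "i < n" for i
  proof -
    have s: "submodule (C i) A M" "submodule (C (Suc i)) A M" "C i \<subseteq> C (Suc i)"
      using C i D(4)[OF i] by (auto simp: C_def)
    interpret r: semi_iso A B "sub M (C (Suc i))" "sub X (h ` C (Suc i))" p h by (rule restrict_iso[OF s(2)])
    interpret q: semi_iso A B "quotient_module (sub M (C (Suc i))) (C i)"
      "quotient_module (sub X (h ` C (Suc i))) (h ` C i)" p "image h"
      by (rule r.quotient_iso) (use s M.submodule_sub_iff[OF s(2)] in auto)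
    show ?thesis using q.simple_iso D(4)[OF i] C(2) i by simp
  qed
  moreover have "C i \<subseteq> C (Suc i)" if "i < n" for i using D(4)[OF that] by (auto simp: C_def)
  moreover have "C 0 = {\<zero>\<^bsub>M\<^esub>}" using D(1) ker_zero by (simp add: C_def ker_def)
  moreover have "C n = carrier M" using D(2) closed by (auto simp: C_def)
  ultimately show "has_length A M n" unfolding has_length_def using C(1) by blast
qed

lemma generated_iso:
  assumes S: "S \<subseteq> carrier M"
  shows "generated_submodule B X (h ` S) = h ` generated_submodule A M S"
proof
  note g = M.generated_submodule[OF S]
  have hS: "h ` S \<subseteq> carrier X" using S closed by blast
  show "generated_submodule B X (h ` S) \<subseteq> h ` generated_submodule A M S"
    by (rule X.generated_submodule(3)[OF hS image_submodule[OF g(1)]]) (use g in blast)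
  let ?V = "{x \<in> carrier M. h x \<in> generated_submodule B X (h ` S)}"
  have "S \<subseteq> ?V" using S X.generated_submodule(2)[OF hS] by blast
  then have "generated_submodule A M S \<subseteq> ?V"
    using g(3)[OF vimage_submodule[OF X.generated_submodule(1)[OF hS]]] by blast
  then show "h ` generated_submodule A M S \<subseteq> generated_submodule B X (h ` S)" by blast
qed

lemma simple_submodules:
  "{S. submodule S B X \<and> simple_module B (sub X S)} = image h ` {S. submodule S A M \<and> simple_module A (sub M S)}"
proof -
  have "simple_module B (sub X (h ` S)) \<longleftrightarrow> simple_module A (sub M S)" if "submodule S A M" for S
    using semi_iso.simple_iso[OF restrict_iso[OF that]] .
  then show ?thesis using submodule_image_iff ker_sub by (auto simp: image_iff) (metis image_submodule)+
qed

lemma socle_iso: "socle B X = h ` socle A M"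
proof -
  have "\<Union>{S. submodule S A M \<and> simple_module A (sub M S)} \<subseteq> carrier M" using M.submoduleD(1) by blast
  from generated_iso[OF this] show ?thesis unfolding socle_def simple_submodules image_Union .
qed

lemma largest_iso: "submodule N A M \<Longrightarrow> largest_proper_submodule (h ` N) B X \<longleftrightarrow> largest_proper_submodule N A M"
proof -
  assume N: "submodule N A M"
  have "(\<forall>K. submodule K B X \<longrightarrow> K \<noteq> carrier X \<longrightarrow> K \<subseteq> h ` N) \<longleftrightarrow>
    (\<forall>K. submodule K A M \<longrightarrow> K \<noteq> carrier M \<longrightarrow> K \<subseteq> N)"
    unfolding all_submodules by (simp add: img_carrier img_subset N cong: imp_cong)
  then show ?thesis
    using N image_submodule[OF N] img_carrier[OF N] by (simp add: largest_proper_submodule_def imp_conjL)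
qed

lemma smallest_iso: "submodule N A M \<Longrightarrow> smallest_nonzero_submodule (h ` N) B X \<longleftrightarrow> smallest_nonzero_submodule N A M"
proof -
  assume N: "submodule N A M"
  have "(\<forall>K. submodule K B X \<longrightarrow> K \<noteq> {\<zero>\<^bsub>X\<^esub>} \<longrightarrow> h ` N \<subseteq> K) \<longleftrightarrow>
    (\<forall>K. submodule K A M \<longrightarrow> K \<noteq> {\<zero>\<^bsub>M\<^esub>} \<longrightarrow> N \<subseteq> K)"
    unfolding all_submodules by (simp add: img_zero img_subset N cong: imp_cong)
  then show ?thesis
    using N image_submodule[OF N] img_zero[OF N] by (simp add: smallest_nonzero_submodule_def imp_conjL)
qed

lemma biserial_iso:
  assumes "biserial_module A M" shows "biserial_module B X"
proof -
  obtain N K where NK: "submodule N A M" "submodule K A M" "uniserial A (sub M N)" "uniserial A (sub M K)"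
    "\<not> N \<subseteq> K" "\<not> K \<subseteq> N" "N <+>\<^bsub>M\<^esub> K = carrier M \<or> largest_proper_submodule (N <+>\<^bsub>M\<^esub> K) A M"
    "N \<inter> K = {\<zero>\<^bsub>M\<^esub>} \<or> smallest_nonzero_submodule (N \<inter> K) A M"
    using assms unfolding biserial_module_def by blast
  note s = M.submodule_add[OF NK(1,2)] M.submodule_Int[OF NK(1,2)]
  have "indecomposable B X" using assms indecomposable_iso by (simp add: biserial_module_def)
  moreover have "uniserial B (sub X (h ` N))" "uniserial B (sub X (h ` K))"
    using semi_iso.uniserial_iso[OF restrict_iso[OF NK(1)]] semi_iso.uniserial_iso[OF restrict_iso[OF NK(2)]] NK by auto
  moreover have "h ` N <+>\<^bsub>X\<^esub> h ` K = carrier X \<or> largest_proper_submodule (h ` N <+>\<^bsub>X\<^esub> h ` K) B X"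
    using NK(7) img_carrier[OF s(1)] largest_iso[OF s(1)] img_add[OF NK(1,2)] by auto
  moreover have "h ` N \<inter> h ` K = {\<zero>\<^bsub>X\<^esub>} \<or> smallest_nonzero_submodule (h ` N \<inter> h ` K) B X"
    using NK(8) img_zero[OF s(2)] smallest_iso[OF s(2)] img_Int[OF NK(1,2)] by auto
  ultimately show ?thesis unfolding biserial_module_def
    using image_submodule[OF NK(1)] image_submodule[OF NK(2)] NK(5,6) img_subset[OF NK(1,2)] img_subset[OF NK(2,1)]
    by blast
qed

end

section \<open>Homomorphisms, projectivity and injectivity\<close>

lemma module_homD:
  assumes "f \<in> module_hom A M N"
  shows "\<And>x. x \<in> carrier M \<Longrightarrow> f x \<in> carrier N"
    "\<And>x y. x \<in> carrier M \<Longrightarrow> y \<in> carrier M \<Longrightarrow> f (x \<oplus>\<^bsub>M\<^esub> y) = f x \<oplus>\<^bsub>N\<^esub> f y"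
    "\<And>a x. a \<in> carrier A \<Longrightarrow> x \<in> carrier M \<Longrightarrow> f (a \<odot>\<^bsub>M\<^esub> x) = a \<odot>\<^bsub>N\<^esub> f x"
  using assms by (auto simp: module_hom_def)

lemma module_homI:
  assumes "\<And>x. x \<in> carrier M \<Longrightarrow> f x \<in> carrier N"
    "\<And>x y. x \<in> carrier M \<Longrightarrow> y \<in> carrier M \<Longrightarrow> f (x \<oplus>\<^bsub>M\<^esub> y) = f x \<oplus>\<^bsub>N\<^esub> f y"
    "\<And>a x. a \<in> carrier A \<Longrightarrow> x \<in> carrier M \<Longrightarrow> f (a \<odot>\<^bsub>M\<^esub> x) = a \<odot>\<^bsub>N\<^esub> f x"
  shows "f \<in> module_hom A M N"
  using assms by (auto simp: module_hom_def)

lemma module_hom_comp: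
  assumes "f \<in> module_hom A M N" "g \<in> module_hom A N K"
  shows "(\<lambda>x. g (f x)) \<in> module_hom A M K"
  using module_homD[OF assms(1)] module_homD[OF assms(2)] by (auto intro!: module_homI)

lemma module_hom_semi_epi:
  assumes "left_module A M" "left_module A N" "f \<in> module_hom A M N" "f ` carrier M = carrier N"
  shows "semi_epi A A M N (\<lambda>a. a) f"
  using assms module_homD[OF assms(3)] by (auto intro!: semi_epi.intro)

lemma module_hom_image:
  assumes M: "left_module A M" and N: "left_module A N" and f: "f \<in> module_hom A M N" and K: "submodule K A M"
  shows "submodule (f ` K) A N" "semi_epi A A (sub M K) (sub N (f ` K)) (\<lambda>a. a) f"
proof -
  interpret M: left_module A M by fact
  interpret N: left_module A N by fact
  note f' = module_homD[OF f] and K' = M.submoduleD[OF K]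
  have f0: "f \<zero>\<^bsub>M\<^esub> = \<zero>\<^bsub>N\<^esub>"
    using f'(2)[of "\<zero>\<^bsub>M\<^esub>" "\<zero>\<^bsub>M\<^esub>"] f'(1)[of "\<zero>\<^bsub>M\<^esub>"] N.M.add.r_cancel_one by simp
  show s: "submodule (f ` K) A N" unfolding N.submodule_iff
  proof (intro conjI ballI)
    show "f ` K \<subseteq> carrier N" using K'(3) f'(1) by blast
    show "\<zero>\<^bsub>N\<^esub> \<in> f ` K" using f0 K'(2) by (metis imageI)
    show "x \<oplus>\<^bsub>N\<^esub> y \<in> f ` K" if xy: "x \<in> f ` K" "y \<in> f ` K" for x y
    proof -
      obtain u v where "u \<in> K" "v \<in> K" "x = f u" "y = f v" using xy by blast
      then show ?thesis using f'(2) K'(3,4) by (metis imageI)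
    qed
    show "a \<odot>\<^bsub>N\<^esub> x \<in> f ` K" if a: "a \<in> carrier A" and x: "x \<in> f ` K" for a x
    proof -
      obtain u where "u \<in> K" "x = f u" using x by blast
      then show ?thesis using f'(3) K'(3,5) a by (metis imageI)
    qed
  qed
  show "semi_epi A A (sub M K) (sub N (f ` K)) (\<lambda>a. a) f"
    using M.sub_left_module[OF K] N.sub_left_module[OF s] f' K'(3) by (auto intro!: semi_epi.intro)
qed

lemma semi_iso_hom:
  assumes "semi_iso A A M N (\<lambda>a. a) f"
  shows "f \<in> module_hom A M N" "inv_into (carrier M) f \<in> module_hom A N M"
    "\<And>x. x \<in> carrier M \<Longrightarrow> inv_into (carrier M) f (f x) = x"
    "\<And>y. y \<in> carrier N \<Longrightarrow> f (inv_into (carrier M) f y) = y"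
    "semi_iso A A N M (\<lambda>a. a) (inv_into (carrier M) f)"
proof -
  interpret semi_iso A A M N "\<lambda>a. a" f by fact
  let ?g = "inv_into (carrier M) f"
  show f: "f \<in> module_hom A M N" using closed add smult by (auto intro!: module_homI)
  show gf: "?g (f x) = x" if "x \<in> carrier M" for x using inj that by simp
  show fg: "f (?g y) = y" if "y \<in> carrier N" for y using onto that by (simp add: f_inv_into_f)
  have gc: "?g y \<in> carrier M" if "y \<in> carrier N" for y using onto that by (simp add: inv_into_into)
  show g: "?g \<in> module_hom A N M"
  proof (rule module_homI[OF gc])
    show "?g (x \<oplus>\<^bsub>N\<^esub> y) = ?g x \<oplus>\<^bsub>M\<^esub> ?g y" if "x \<in> carrier N" "y \<in> carrier N" for x y
    proof -
      have "f (?g x \<oplus>\<^bsub>M\<^esub> ?g y) = x \<oplus>\<^bsub>N\<^esub> y" using add gc fg that by simp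
      then show ?thesis using gf[of "?g x \<oplus>\<^bsub>M\<^esub> ?g y"] gc that by simp
    qed
    show "?g (a \<odot>\<^bsub>N\<^esub> x) = a \<odot>\<^bsub>M\<^esub> ?g x" if "a \<in> carrier A" "x \<in> carrier N" for a x
    proof -
      have "f (a \<odot>\<^bsub>M\<^esub> ?g x) = a \<odot>\<^bsub>N\<^esub> x" using smult gc fg that by simp
      then show ?thesis using gf[of "a \<odot>\<^bsub>M\<^esub> ?g x"] gc that by simp
    qed
  qed
  have "?g ` carrier N = carrier M" using gf gc closed by (force simp: image_iff)
  moreover have "inj_on ?g (carrier N)" using fg by (metis inj_onI)
  ultimately show "semi_iso A A N M (\<lambda>a. a) ?g"
    using module_hom_semi_epi[OF X M g] by (auto intro!: semi_iso.intro semi_iso_axioms.intro)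
qed

text \<open>The module axioms of \<open>X\<close> are inherited along the surjection, so for a
  module given by a new record only the compatibility of its operations with \<open>h\<close> has to
  be checked.\<close>

lemma left_module_image:
  assumes M: "left_module A M" and B: "ring B" and p: "p ` carrier A = carrier B" "p \<one>\<^bsub>A\<^esub> = \<one>\<^bsub>B\<^esub>"
    "\<And>a b. a \<in> carrier A \<Longrightarrow> b \<in> carrier A \<Longrightarrow> p (a \<oplus>\<^bsub>A\<^esub> b) = p a \<oplus>\<^bsub>B\<^esub> p b"
    "\<And>a b. a \<in> carrier A \<Longrightarrow> b \<in> carrier A \<Longrightarrow> p (a \<otimes>\<^bsub>A\<^esub> b) = p a \<otimes>\<^bsub>B\<^esub> p b"
    and h: "h ` carrier M = carrier X" "h \<zero>\<^bsub>M\<^esub> = \<zero>\<^bsub>X\<^esub>"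
    "\<And>x y. x \<in> carrier M \<Longrightarrow> y \<in> carrier M \<Longrightarrow> h (x \<oplus>\<^bsub>M\<^esub> y) = h x \<oplus>\<^bsub>X\<^esub> h y"
    "\<And>a x. a \<in> carrier A \<Longrightarrow> x \<in> carrier M \<Longrightarrow> h (a \<odot>\<^bsub>M\<^esub> x) = p a \<odot>\<^bsub>X\<^esub> h x"
  shows "semi_epi A B M X p h"
proof -
  interpret M: left_module A M by fact
  have ex: "\<exists>x\<in>carrier M. y = h x" if "y \<in> carrier X" for y using h(1) that by blast
  have exb: "\<exists>a\<in>carrier A. b = p a" if "b \<in> carrier B" for b using p(1) that by blast
  have hc: "h x \<in> carrier X" if "x \<in> carrier M" for x using h(1) that by blast
  have "abelian_group X"
  proof (rule abelian_groupI)
    show "x \<oplus>\<^bsub>X\<^esub> y \<in> carrier X" if "x \<in> carrier X" "y \<in> carrier X" for x y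
      using ex[OF that(1)] ex[OF that(2)] hc by (auto simp flip: h(3))
    show "\<zero>\<^bsub>X\<^esub> \<in> carrier X" using hc[of "\<zero>\<^bsub>M\<^esub>"] h(2) by simp
    show "(x \<oplus>\<^bsub>X\<^esub> y) \<oplus>\<^bsub>X\<^esub> z = x \<oplus>\<^bsub>X\<^esub> (y \<oplus>\<^bsub>X\<^esub> z)" if "x \<in> carrier X" "y \<in> carrier X" "z \<in> carrier X" for x y z
      using ex[OF that(1)] ex[OF that(2)] ex[OF that(3)] by (auto simp: M.M.a_assoc simp flip: h(3))
    show "x \<oplus>\<^bsub>X\<^esub> y = y \<oplus>\<^bsub>X\<^esub> x" if "x \<in> carrier X" "y \<in> carrier X" for x y
      using ex[OF that(1)] ex[OF that(2)] by (auto simp: M.M.a_comm simp flip: h(3))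
    show "\<zero>\<^bsub>X\<^esub> \<oplus>\<^bsub>X\<^esub> x = x" if "x \<in> carrier X" for x
      using ex[OF that] by (auto simp flip: h(2,3))
    show "\<exists>y\<in>carrier X. y \<oplus>\<^bsub>X\<^esub> x = \<zero>\<^bsub>X\<^esub>" if x: "x \<in> carrier X" for x
    proof -
      obtain u where u: "u \<in> carrier M" "x = h u" using ex[OF x] by blast
      then have "h (\<ominus>\<^bsub>M\<^esub> u) \<oplus>\<^bsub>X\<^esub> x = \<zero>\<^bsub>X\<^esub>" by (simp add: M.M.l_neg flip: h(2,3))
      then show ?thesis using hc[of "\<ominus>\<^bsub>M\<^esub> u"] u by auto
    qed
  qed
  then have "left_module B X"
  proof (intro left_module.intro left_module_axioms.intro B)
    show "b \<odot>\<^bsub>X\<^esub> x \<in> carrier X" if "b \<in> carrier B" "x \<in> carrier X" for b x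
      using ex[OF that(2)] exb[OF that(1)] hc by (auto simp flip: h(4))
    show "(a \<oplus>\<^bsub>B\<^esub> b) \<odot>\<^bsub>X\<^esub> x = a \<odot>\<^bsub>X\<^esub> x \<oplus>\<^bsub>X\<^esub> b \<odot>\<^bsub>X\<^esub> x"
      if "a \<in> carrier B" "b \<in> carrier B" "x \<in> carrier X" for a b x
      using ex[OF that(3)] exb[OF that(1)] exb[OF that(2)] by (auto simp: M.smult_l_distr simp flip: h(3,4) p(3))
    show "a \<odot>\<^bsub>X\<^esub> (x \<oplus>\<^bsub>X\<^esub> y) = a \<odot>\<^bsub>X\<^esub> x \<oplus>\<^bsub>X\<^esub> a \<odot>\<^bsub>X\<^esub> y"
      if "a \<in> carrier B" "x \<in> carrier X" "y \<in> carrier X" for a x y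
      using ex[OF that(2)] ex[OF that(3)] exb[OF that(1)] by (auto simp: M.smult_r_distr simp flip: h(3,4))
    show "(a \<otimes>\<^bsub>B\<^esub> b) \<odot>\<^bsub>X\<^esub> x = a \<odot>\<^bsub>X\<^esub> (b \<odot>\<^bsub>X\<^esub> x)" if "a \<in> carrier B" "b \<in> carrier B" "x \<in> carrier X" for a b x
      using ex[OF that(3)] exb[OF that(1)] exb[OF that(2)] by (auto simp: M.smult_assoc simp flip: h(4) p(4))
    show "\<one>\<^bsub>B\<^esub> \<odot>\<^bsub>X\<^esub> x = x" if "x \<in> carrier X" for x
      using ex[OF that] by (auto simp flip: h(4) p(2))
  qed
  then show ?thesis using assms by (auto intro!: semi_epi.intro)
qed

definition transport :: "('b \<Rightarrow> 'c) \<Rightarrow> ('a, 'b) module \<Rightarrow> ('a, 'c) module" where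
  "transport f M = \<lparr>carrier = f ` carrier M, mult = (\<lambda>x y. x), one = f \<zero>\<^bsub>M\<^esub>, zero = f \<zero>\<^bsub>M\<^esub>,
    add = (\<lambda>x y. f (inv_into (carrier M) f x \<oplus>\<^bsub>M\<^esub> inv_into (carrier M) f y)),
    smult = (\<lambda>a x. f (a \<odot>\<^bsub>M\<^esub> inv_into (carrier M) f x))\<rparr>"

lemma transport_iso:
  assumes M: "left_module A M" and f: "inj_on f (carrier M)"
  shows "semi_iso A A M (transport f M) (\<lambda>a. a) f"
proof -
  have "semi_epi A A M (transport f M) (\<lambda>a. a) f"
    by (rule left_module_image[OF M left_module_ring[OF M]]) (use f in \<open>auto simp: transport_def\<close>)
  then show ?thesis using f by (auto intro!: semi_iso.intro semi_iso_axioms.intro)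
qed

text \<open>Restriction of scalars. The identity becomes a semilinear isomorphism, so modules over a
  quotient ring can be treated by results about \<open>A\<close>-modules.\<close>

definition pullback :: "('a \<Rightarrow> 'b) \<Rightarrow> ('b, 'n) module \<Rightarrow> ('a, 'n) module" where
  "pullback p X = \<lparr>carrier = carrier X, mult = mult X, one = one X, zero = zero X, add = add X,
    smult = (\<lambda>a x. p a \<odot>\<^bsub>X\<^esub> x)\<rparr>"

lemma pullback_simps [simp]: "carrier (pullback p X) = carrier X" "\<zero>\<^bsub>pullback p X\<^esub> = \<zero>\<^bsub>X\<^esub>"
  "x \<oplus>\<^bsub>pullback p X\<^esub> y = x \<oplus>\<^bsub>X\<^esub> y" "a \<odot>\<^bsub>pullback p X\<^esub> x = p a \<odot>\<^bsub>X\<^esub> x"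
  by (simp_all add: pullback_def)

lemma pullback_iso:
  assumes X: "left_module B X" and A: "ring A" and p: "p ` carrier A = carrier B" "p \<in> ring_hom A B"
  shows "semi_iso A B (pullback p X) X p (\<lambda>x. x)"
proof -
  interpret X: left_module B X by fact
  note p' = ring_hom_memE[OF p(2)]
  have pc: "a \<in> carrier A \<Longrightarrow> p a \<in> carrier B" for a using p by blast
  have "abelian_group (pullback p X)"
    by (rule abelian_groupI) (auto simp: X.M.a_ac intro: X.M.add.l_inv_ex)
  then have "left_module A (pullback p X)"
    using p' pc by (intro left_module.intro left_module_axioms.intro A)
      (auto simp: X.smult_l_distr X.smult_r_distr X.smult_assoc)
  then show ?thesis using X p by (auto intro!: semi_iso.intro semi_iso_axioms.intro semi_epi.intro)
qed

lemma (in semi_epi) finitely_generated_image: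
  assumes "finitely_generated A M" shows "finitely_generated B X"
proof -
  obtain S where S: "finite S" "S \<subseteq> carrier M" "generated_submodule A M S = carrier M"
    using assms unfolding finitely_generated_def by blast
  have hS: "h ` S \<subseteq> carrier X" using S closed by blast
  have "S \<subseteq> {x \<in> carrier M. h x \<in> generated_submodule B X (h ` S)}"
    using S X.generated_submodule(2)[OF hS] by blast
  then have "carrier M \<subseteq> {x \<in> carrier M. h x \<in> generated_submodule B X (h ` S)}"
    using M.generated_submodule(3)[OF S(2) vimage_submodule[OF X.generated_submodule(1)[OF hS]]] S(3) by blast
  then have "carrier X \<subseteq> generated_submodule B X (h ` S)" unfolding onto[symmetric] by blast
  then have "generated_submodule B X (h ` S) = carrier X"
    using X.submoduleD(1)[OF X.generated_submodule(1)[OF hS]] by blast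
  then show ?thesis unfolding finitely_generated_def using S(1) hS by blast
qed

lemma (in semi_epi) fg_image: "fg_module A M \<Longrightarrow> fg_module B X"
  using finitely_generated_image X by (simp add: fg_module_def)

text \<open>Coefficients are counted from the end of the list, so that \<open>lincomb M c bs\<close>
  is unaffected by a change of \<open>c\<close> at \<open>length bs\<close>, and a new head can be
  given its coefficient by a function update.\<close>

fun lincomb :: "('a, 'b) module \<Rightarrow> (nat \<Rightarrow> 'a) \<Rightarrow> 'b list \<Rightarrow> 'b" where
  "lincomb M c [] = \<zero>\<^bsub>M\<^esub>"
| "lincomb M c (b # bs) = c (length bs) \<odot>\<^bsub>M\<^esub> b \<oplus>\<^bsub>M\<^esub> lincomb M c bs"

lemma lincomb_cong: "(\<And>i. i < length bs \<Longrightarrow> c i = c' i) \<Longrightarrow> lincomb M c bs = lincomb M c' bs"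
  by (induction bs) auto

lemma (in left_module) lincomb_span:
  assumes "set bs \<subseteq> carrier M"
  shows "submodule {lincomb M c bs | c. \<forall>i. c i \<in> carrier A} A M \<and>
    set bs \<subseteq> {lincomb M c bs | c. \<forall>i. c i \<in> carrier A}"
  using assms
proof (induction bs)
  case Nil
  have "{lincomb M c [] | c. \<forall>i. c i \<in> carrier A} = {\<zero>\<^bsub>M\<^esub>}" by (auto intro!: exI[of _ "\<lambda>_. \<zero>"])
  then show ?case by simp
next
  case (Cons b bs)
  let ?V = "\<lambda>bs. {lincomb M c bs | c. \<forall>i. c i \<in> carrier A}"
  let ?S = "{a \<odot>\<^bsub>M\<^esub> b | a. a \<in> carrier A}"
  have b: "b \<in> carrier M" and IH: "submodule (?V bs) A M" "set bs \<subseteq> ?V bs" using Cons by auto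
  have eq: "?V (b # bs) = ?S <+>\<^bsub>M\<^esub> ?V bs"
  proof (intro equalityI subsetI)
    fix x assume "x \<in> ?V (b # bs)"
    then show "x \<in> ?S <+>\<^bsub>M\<^esub> ?V bs" unfolding mem_set_add by auto
  next
    fix x assume "x \<in> ?S <+>\<^bsub>M\<^esub> ?V bs"
    then obtain a c where ac: "a \<in> carrier A" "\<forall>i. c i \<in> carrier A" "x = a \<odot>\<^bsub>M\<^esub> b \<oplus>\<^bsub>M\<^esub> lincomb M c bs"
      unfolding mem_set_add by blast
    have "lincomb M (c(length bs := a)) bs = lincomb M c bs" by (rule lincomb_cong) auto
    then have "x = lincomb M (c(length bs := a)) (b # bs)" using ac by simp
    then show "x \<in> ?V (b # bs)" using ac by fastforce
  qed
  have "b \<in> ?S" using b by (auto intro!: exI[of _ \<one>])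
  then show ?case using submodule_add[OF submodule_cyclic[OF b] IH(1)]
      submodule_add_upper[OF submodule_cyclic[OF b] IH(1)] IH(2) unfolding eq by auto
qed

text \<open>An element is replaced by the set of all coefficient sequences that represent it in a
  fixed list of generators. These sets are nonempty and pairwise disjoint, so the replacement is
  injective, and its values have the type required by \<open>cmod\<close>.\<close>

lemma cmod_copy:
  fixes M :: "('a, 'b) module"
  assumes M: "fg_module A M"
  obtains N :: "'a cmod" and f where "semi_iso A A M N (\<lambda>a. a) f" "fg_module A N"
proof -
  interpret left_module A M using M by (simp add: fg_module_def)
  obtain B where B: "finite B" "B \<subseteq> carrier M" "generated_submodule A M B = carrier M"
    using M unfolding fg_module_def finitely_generated_def by blast
  obtain bs where bs: "set bs = B" using finite_list[OF B(1)] by blast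
  let ?V = "{lincomb M c bs | c. \<forall>i. c i \<in> carrier A}"
  have "carrier M \<subseteq> ?V"
    using lincomb_span[of bs] generated_submodule(3)[OF B(2), of ?V] B(2,3) bs by auto
  then have ex: "\<exists>c. (\<forall>i. c i \<in> carrier A) \<and> lincomb M c bs = x" if "x \<in> carrier M" for x
    using that by blast
  define f where "f x = {c. (\<forall>i. c i \<in> carrier A) \<and> lincomb M c bs = x}" for x
  have "inj_on f (carrier M)"
  proof (rule inj_onI)
    fix x y assume xy: "x \<in> carrier M" "y \<in> carrier M" "f x = f y"
    obtain c where "c \<in> f x" using ex[OF xy(1)] by (auto simp: f_def)
    moreover from this have "c \<in> f y" using xy by simp
    ultimately show "x = y" by (auto simp: f_def)
  qed
  then interpret s: semi_iso A A M "transport f M" "\<lambda>a. a" f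
    using transport_iso left_module_axioms by blast
  show ?thesis using that[OF s.semi_iso_axioms s.fg_image[OF M]] .
qed

text \<open>The definition tests lifting only against modules of type \<open>cmod\<close>;
  conjugating with copies of \<open>X\<close> and \<open>Y\<close> extends it to test modules of
  arbitrary type.\<close>

lemma projectiveD:
  assumes Q: "projective A Q" and XY: "fg_module A X" "fg_module A Y"
    and g: "g \<in> module_hom A X Y" "g ` carrier X = carrier Y" and h: "h \<in> module_hom A Q Y"
  shows "\<exists>k\<in>module_hom A Q X. \<forall>x\<in>carrier Q. g (k x) = h x"
proof -
  obtain X' :: "'a cmod" and a where X': "semi_iso A A X X' (\<lambda>a. a) a" "fg_module A X'"
    by (rule cmod_copy[OF XY(1)])
  obtain Y' :: "'a cmod" and b where Y': "semi_iso A A Y Y' (\<lambda>a. a) b" "fg_module A Y'"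
    by (rule cmod_copy[OF XY(2)])
  note a = semi_iso_hom[OF X'(1)] and b = semi_iso_hom[OF Y'(1)]
  let ?a = "inv_into (carrier X) a" and ?b = "inv_into (carrier Y) b"
  define g' where "g' x = b (g (?a x))" for x
  have g': "g' \<in> module_hom A X' Y'"
    unfolding g'_def using module_hom_comp[OF module_hom_comp[OF a(2) g(1)] b(1)] by simp
  have "g' ` carrier X' = carrier Y'"
  proof -
    have "?a ` carrier X' = carrier X" using semi_epi.onto[OF semi_iso.axioms(1)[OF a(5)]] .
    moreover have "b ` carrier Y = carrier Y'" using semi_epi.onto[OF semi_iso.axioms(1)[OF Y'(1)]] .
    ultimately show ?thesis using g(2)
      image_image[of b "\<lambda>x. g (?a x)" "carrier X'"] image_image[of g ?a "carrier X'"] by (simp add: g'_def)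
  qed
  then obtain k where k: "k \<in> module_hom A Q X'" "\<forall>x\<in>carrier Q. g' (k x) = b (h x)"
    using Q[unfolded projective_def, THEN conjunct2, rule_format, of X' Y' g' "\<lambda>x. b (h x)"] X'(2) Y'(2) g' module_hom_comp[OF h b(1)] by blast
  have "g (?a (k x)) = h x" if x: "x \<in> carrier Q" for x
  proof -
    have "b (g (?a (k x))) = b (h x)" using k(2) x by (simp add: g'_def)
    then show ?thesis
      using b(3) module_homD(1)[OF g(1) module_homD(1)[OF a(2) module_homD(1)[OF k(1) x]]] module_homD(1)[OF h x]
      by metis
  qed
  then show ?thesis by (intro bexI[OF _ module_hom_comp[OF k(1) a(2)]]) simp
qed

lemma injectiveD:
  assumes E: "injective A E" and XY: "fg_module A X" "fg_module A Y"
    and g: "g \<in> module_hom A X Y" "inj_on g (carrier X)" and h: "h \<in> module_hom A X E"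
  shows "\<exists>k\<in>module_hom A Y E. \<forall>x\<in>carrier X. k (g x) = h x"
proof -
  obtain X' :: "'a cmod" and a where X': "semi_iso A A X X' (\<lambda>a. a) a" "fg_module A X'"
    by (rule cmod_copy[OF XY(1)])
  obtain Y' :: "'a cmod" and b where Y': "semi_iso A A Y Y' (\<lambda>a. a) b" "fg_module A Y'"
    by (rule cmod_copy[OF XY(2)])
  note a = semi_iso_hom[OF X'(1)] and b = semi_iso_hom[OF Y'(1)]
  let ?a = "inv_into (carrier X) a"
  define g' where "g' x = b (g (?a x))" for x
  have g': "g' \<in> module_hom A X' Y'"
    unfolding g'_def using module_hom_comp[OF module_hom_comp[OF a(2) g(1)] b(1)] by simp
  have "inj_on g' (carrier X')"
  proof (rule inj_onI)
    fix x y assume xy: "x \<in> carrier X'" "y \<in> carrier X'" "g' x = g' y"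
    then have c: "?a x \<in> carrier X" "?a y \<in> carrier X" using module_homD(1)[OF a(2)] by auto
    then have "g (?a x) = g (?a y)" using b(3) module_homD(1)[OF g(1)] xy(3) unfolding g'_def by metis
    then have "?a x = ?a y" using g(2) c by (auto dest: inj_onD)
    then show "x = y" using a(4) xy by metis
  qed
  then obtain k where k: "k \<in> module_hom A Y' E" "\<forall>x\<in>carrier X'. k (g' x) = h (?a x)"
    using E[unfolded injective_def, THEN conjunct2, rule_format, of X' Y' g' "\<lambda>x. h (?a x)"] X'(2) Y'(2) g'
      module_hom_comp[OF a(2) h] by blast
  have "k (b (g x)) = h x" if x: "x \<in> carrier X" for x
    using k(2) module_homD(1)[OF a(1) x] a(3)[OF x] by (auto simp: g'_def)
  then show ?thesis by (intro bexI[OF _ module_hom_comp[OF b(1) k(1)]]) simp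
qed

lemma semi_iso_fg: "semi_iso A B M N p f \<Longrightarrow> fg_module A M \<Longrightarrow> fg_module B N"
  using semi_epi.fg_image semi_iso.axioms(1) by blast

lemma projective_iso:
  assumes f: "semi_iso A A M N (\<lambda>a. a) f" and M: "projective A M"
  shows "projective A N"
  unfolding projective_def
proof (intro conjI allI impI ballI)
  note f' = semi_iso_hom[OF f]
  show "fg_module A N" using semi_iso_fg[OF f] M by (simp add: projective_def)
  fix X Y :: "'a cmod" and g h
  assume XY: "fg_module A X \<and> fg_module A Y" and g: "g \<in> module_hom A X Y" "g ` carrier X = carrier Y"
    and h: "h \<in> module_hom A N Y"
  obtain k where k: "k \<in> module_hom A M X" "\<forall>x\<in>carrier M. g (k x) = h (f x)"
    using projectiveD[OF M conjunct1[OF XY] conjunct2[OF XY] g module_hom_comp[OF f'(1) h]] by blast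
  have "g (k (inv_into (carrier M) f y)) = h y" if "y \<in> carrier N" for y
    using k(2) module_homD(1)[OF f'(2) that] f'(4)[OF that] by auto
  then show "\<exists>k\<in>module_hom A N X. \<forall>x\<in>carrier N. g (k x) = h x"
    by (intro bexI[OF _ module_hom_comp[OF f'(2) k(1)]]) simp
qed

lemma injective_retract:
  assumes M: "injective A M" and N: "fg_module A N"
    and f: "f \<in> module_hom A M N" and r: "r \<in> module_hom A N M" "\<And>y. y \<in> carrier N \<Longrightarrow> f (r y) = y"
  shows "injective A N"
  unfolding injective_def
proof (intro conjI allI impI ballI N)
  fix X Y :: "'a cmod" and g h
  assume XY: "fg_module A X \<and> fg_module A Y" and g: "g \<in> module_hom A X Y" "inj_on g (carrier X)"
    and h: "h \<in> module_hom A X N"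
  obtain k where k: "k \<in> module_hom A Y M" "\<forall>x\<in>carrier X. k (g x) = r (h x)"
    using injectiveD[OF M conjunct1[OF XY] conjunct2[OF XY] g module_hom_comp[OF h r(1)]] by blast
  have "f (k (g x)) = h x" if "x \<in> carrier X" for x
    using k(2) r(2)[OF module_homD(1)[OF h that]] that by simp
  then show "\<exists>k\<in>module_hom A Y N. \<forall>x\<in>carrier X. k (g x) = h x"
    by (intro bexI[OF _ module_hom_comp[OF k(1) f]]) simp
qed

lemma injective_iso:
  assumes f: "semi_iso A A M N (\<lambda>a. a) f" and M: "injective A M"
  shows "injective A N"
  using injective_retract[OF M _ semi_iso_hom(1,2)[OF f] semi_iso_hom(4)[OF f]] semi_iso_fg[OF f] M
  by (simp add: injective_def)

context left_module
begin

lemma cancel_right: "x \<in> carrier M \<Longrightarrow> y \<in> carrier M \<Longrightarrow> x \<ominus>\<^bsub>M\<^esub> y = \<zero>\<^bsub>M\<^esub> \<longleftrightarrow> x = y"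
  by (metis M.add.inv_solve_right M.l_zero M.r_neg M.zero_closed a_minus_def)

lemma direct_sum_projection:
  assumes ds: "internal_direct_sum A M E K"
  obtains f where "f \<in> module_hom A M (sub M E)" "\<And>x. x \<in> E \<Longrightarrow> f x = x" "\<And>x. x \<in> K \<Longrightarrow> f x = \<zero>\<^bsub>M\<^esub>"
    "\<And>x. x \<in> carrier M \<Longrightarrow> x \<ominus>\<^bsub>M\<^esub> f x \<in> K" "\<And>x y. x \<in> E \<Longrightarrow> y \<in> K \<Longrightarrow> f (x \<oplus>\<^bsub>M\<^esub> y) = x"
proof -
  have EK: "submodule E A M" "submodule K A M" "E <+>\<^bsub>M\<^esub> K = carrier M" "E \<inter> K = {\<zero>\<^bsub>M\<^esub>}"
    using ds by (auto simp: internal_direct_sum_def)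
  note E = submoduleD[OF EK(1)] and K = submoduleD[OF EK(2)]
  define f where "f x = (THE e. e \<in> E \<and> x \<ominus>\<^bsub>M\<^esub> e \<in> K)" for x
  have uniq: "e = e'" if "x \<in> carrier M" "e \<in> E" "x \<ominus>\<^bsub>M\<^esub> e \<in> K" "e' \<in> E" "x \<ominus>\<^bsub>M\<^esub> e' \<in> K" for x e e'
  proof -
    have c: "e \<in> carrier M" "e' \<in> carrier M" using E(3) that by auto
    have "(x \<ominus>\<^bsub>M\<^esub> e') \<ominus>\<^bsub>M\<^esub> (x \<ominus>\<^bsub>M\<^esub> e) = (x \<oplus>\<^bsub>M\<^esub> \<ominus>\<^bsub>M\<^esub> x) \<oplus>\<^bsub>M\<^esub> (e \<ominus>\<^bsub>M\<^esub> e')"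
      using that(1) c by (simp add: a_minus_def M.minus_add M.a_ac)
    then have "(x \<ominus>\<^bsub>M\<^esub> e') \<ominus>\<^bsub>M\<^esub> (x \<ominus>\<^bsub>M\<^esub> e) = e \<ominus>\<^bsub>M\<^esub> e'"
      using that(1) c by (simp add: M.r_neg)
    then have "e \<ominus>\<^bsub>M\<^esub> e' \<in> E \<inter> K" using E(7)[OF that(2,4)] K(7)[OF that(5,3)] by simp
    then show ?thesis using EK(4) cancel_right c by auto
  qed
  have ex: "\<exists>e. e \<in> E \<and> x \<ominus>\<^bsub>M\<^esub> e \<in> K" if x: "x \<in> carrier M" for x
  proof -
    obtain e k where ek: "e \<in> E" "k \<in> K" "x = e \<oplus>\<^bsub>M\<^esub> k" using x unfolding EK(3)[symmetric] by (auto simp: mem_set_add)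
    then have "x \<ominus>\<^bsub>M\<^esub> e = k" using E(3) K(3) by (simp add: a_minus_def M.a_comm[of e] M.a_assoc M.r_neg)
    then show ?thesis using ek by blast
  qed
  have f: "f x \<in> E" "x \<ominus>\<^bsub>M\<^esub> f x \<in> K" if "x \<in> carrier M" for x
    using theI'[of "\<lambda>e. e \<in> E \<and> x \<ominus>\<^bsub>M\<^esub> e \<in> K"] ex[OF that] uniq[OF that] unfolding f_def by blast+
  have feq: "f x = e" if "x \<in> carrier M" "e \<in> E" "x \<ominus>\<^bsub>M\<^esub> e \<in> K" for x e
    using uniq[OF that(1) f(1)[OF that(1)] f(2)[OF that(1)] that(2,3)] .
  show ?thesis
  proof (rule that)
    show "f \<in> module_hom A M (sub M E)"
    proof (rule module_homI)
      show "f x \<in> carrier (sub M E)" if "x \<in> carrier M" for x using f that by simp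
      show "f (x \<oplus>\<^bsub>M\<^esub> y) = f x \<oplus>\<^bsub>sub M E\<^esub> f y" if "x \<in> carrier M" "y \<in> carrier M" for x y
      proof -
        have "x \<oplus>\<^bsub>M\<^esub> y \<ominus>\<^bsub>M\<^esub> (f x \<oplus>\<^bsub>M\<^esub> f y) = (x \<ominus>\<^bsub>M\<^esub> f x) \<oplus>\<^bsub>M\<^esub> (y \<ominus>\<^bsub>M\<^esub> f y)"
          using that E(3)[OF f(1)] by (simp add: a_minus_def M.minus_add M.a_ac)
        then show ?thesis using f that E(4) K(4) by (intro feq) auto
      qed
      show "f (a \<odot>\<^bsub>M\<^esub> x) = a \<odot>\<^bsub>sub M E\<^esub> f x" if "a \<in> carrier A" "x \<in> carrier M" for a x
      proof -
        have fc: "f x \<in> carrier M" using E(3)[OF f(1)] that by blast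
        have "a \<odot>\<^bsub>M\<^esub> (x \<ominus>\<^bsub>M\<^esub> f x) \<oplus>\<^bsub>M\<^esub> a \<odot>\<^bsub>M\<^esub> f x = a \<odot>\<^bsub>M\<^esub> x"
          using that fc by (simp flip: smult_r_distr) (simp add: a_minus_def M.a_assoc M.l_neg)
        then have "a \<odot>\<^bsub>M\<^esub> x \<ominus>\<^bsub>M\<^esub> a \<odot>\<^bsub>M\<^esub> f x = a \<odot>\<^bsub>M\<^esub> (x \<ominus>\<^bsub>M\<^esub> f x)"
          using that fc by (metis M.add.inv_solve_right M.minus_closed a_minus_def smult_closed)
        then show ?thesis using f that E(5) K(5) by (intro feq) auto
      qed
    qed
    show "f x = x" if "x \<in> E" for x
      using that E(3) K(2) by (intro feq) (auto simp: a_minus_def M.r_neg)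
    show "f x = \<zero>\<^bsub>M\<^esub>" if "x \<in> K" for x
      using that E(2) K(3) by (intro feq) (auto simp: a_minus_def minus_zero)
    show "x \<ominus>\<^bsub>M\<^esub> f x \<in> K" if "x \<in> carrier M" for x using f that by blast
    show "f (x \<oplus>\<^bsub>M\<^esub> y) = x" if "x \<in> E" "y \<in> K" for x y
      using that E(3) K(3) by (intro feq) (auto simp: a_minus_def M.a_comm[of x] M.a_assoc M.r_neg)
  qed
qed

lemma summand_fg:
  assumes ds: "internal_direct_sum A M E K" and fg: "fg_module A M"
  shows "fg_module A (sub M E)"
proof -
  obtain f where f: "f \<in> module_hom A M (sub M E)" "\<And>x. x \<in> E \<Longrightarrow> f x = x"
    using direct_sum_projection[OF ds] by metis
  have E: "submodule E A M" using ds by (simp add: internal_direct_sum_def)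
  have "f ` carrier M = carrier (sub M E)"
    using module_homD(1)[OF f(1)] f(2) submoduleD(3)[OF E] by (force simp: image_iff)
  then show ?thesis
    using semi_epi.fg_image[OF module_hom_semi_epi[OF left_module_axioms sub_left_module[OF E] f(1)] fg] by blast
qed

lemma inclusion_hom: "submodule N A M \<Longrightarrow> (\<lambda>x. x) \<in> module_hom A (sub M N) M"
  using submoduleD(3) by (intro module_homI) auto

lemma summand_injective:
  assumes ds: "internal_direct_sum A M E K" and inj: "injective A M"
  shows "injective A (sub M E)"
proof -
  obtain f where f: "f \<in> module_hom A M (sub M E)" "\<And>x. x \<in> E \<Longrightarrow> f x = x"
    using direct_sum_projection[OF ds] by metis
  have E: "submodule E A M" using ds by (simp add: internal_direct_sum_def)
  have "fg_module A M" using inj by (simp add: injective_def)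
  then show ?thesis using injective_retract[OF inj summand_fg[OF ds] f(1) inclusion_hom[OF E]] f(2) by simp
qed

lemma retract_split:
  assumes E: "left_module A E" and f: "f \<in> module_hom A E M" and r: "r \<in> module_hom A M E"
    and rf: "\<And>x. x \<in> carrier E \<Longrightarrow> r (f x) = x"
  shows "internal_direct_sum A M (f ` carrier E) {x \<in> carrier M. r x = \<zero>\<^bsub>E\<^esub>}"
proof -
  interpret E: left_module A E by fact
  have fE: "submodule (f ` carrier E) A M"
    using module_hom_image(1)[OF E.left_module_axioms left_module_axioms f E.submodule_carrier] .
  have "r ` carrier M = carrier E" using rf module_homD(1)[OF r] module_homD(1)[OF f] by (force simp: image_iff)
  then interpret r: semi_epi A A M E "\<lambda>a. a" r
    using module_hom_semi_epi[OF left_module_axioms E.left_module_axioms r] by blast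
  have fc: "f x \<in> carrier M" if "x \<in> carrier E" for x using module_homD(1)[OF f that] .
  have f0: "f \<zero>\<^bsub>E\<^esub> = \<zero>\<^bsub>M\<^esub>"
    using module_homD(2)[OF f, of "\<zero>\<^bsub>E\<^esub>" "\<zero>\<^bsub>E\<^esub>"] fc[of "\<zero>\<^bsub>E\<^esub>"] M.add.r_cancel_one by simp
  have "f ` carrier E \<inter> r.ker = {\<zero>\<^bsub>M\<^esub>}"
  proof -
    have "f x = \<zero>\<^bsub>M\<^esub>" if "x \<in> carrier E" "r (f x) = \<zero>\<^bsub>E\<^esub>" for x using that rf f0 by auto
    then have "f ` carrier E \<inter> r.ker \<subseteq> {\<zero>\<^bsub>M\<^esub>}" by (auto simp: r.ker_def)
    then show ?thesis using submoduleD(2)[OF fE] submoduleD(2)[OF r.submodule_ker] by blast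
  qed
  moreover have "f ` carrier E <+>\<^bsub>M\<^esub> r.ker = carrier M"
  proof -
    have "x \<in> f ` carrier E <+>\<^bsub>M\<^esub> r.ker" if x: "x \<in> carrier M" for x
    proof -
      have c: "f (r x) \<in> carrier M" using fc r.closed x by blast
      have "r (x \<ominus>\<^bsub>M\<^esub> f (r x)) = \<zero>\<^bsub>E\<^esub>" using r.minus[OF x c] rf r.closed[OF x] by (simp add: a_minus_def E.M.r_neg)
      then have "x \<ominus>\<^bsub>M\<^esub> f (r x) \<in> r.ker" using x c by (simp add: r.ker_def)
      moreover have "x = f (r x) \<oplus>\<^bsub>M\<^esub> (x \<ominus>\<^bsub>M\<^esub> f (r x))"
        using x c by (simp add: a_minus_def M.a_comm[of x] M.r_neg2)
      ultimately show ?thesis unfolding mem_set_add using r.closed[OF x] by blast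
    qed
    moreover have "f ` carrier E <+>\<^bsub>M\<^esub> r.ker \<subseteq> carrier M"
      using submoduleD(1)[OF submodule_add[OF fE r.submodule_ker]] .
    ultimately show ?thesis by blast
  qed
  ultimately have "internal_direct_sum A M (f ` carrier E) r.ker"
    unfolding internal_direct_sum_def using fE r.submodule_ker by blast
  then show ?thesis unfolding r.ker_def .
qed

lemma injective_split:
  assumes fg: "fg_module A M" and E: "injective A E" and f: "f \<in> module_hom A E M" "inj_on f (carrier E)"
  shows "\<exists>Z. internal_direct_sum A M (f ` carrier E) Z"
proof -
  have Efg: "fg_module A E" using E by (simp add: injective_def)
  then have Em: "left_module A E" by (simp add: fg_module_def)
  have "(\<lambda>x. x) \<in> module_hom A E E" by (rule module_homI) auto
  then obtain r where "r \<in> module_hom A M E" "\<forall>x\<in>carrier E. r (f x) = x"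
    using injectiveD[OF E Efg fg f] by blast
  then show ?thesis using retract_split[OF Em f(1)] by blast
qed

lemma injective_add:
  assumes EK: "submodule E A M" "submodule K A M" "E \<inter> K = {\<zero>\<^bsub>M\<^esub>}"
    and fg: "fg_module A (sub M (E <+>\<^bsub>M\<^esub> K))"
    and inj: "injective A (sub M E)" "injective A (sub M K)"
  shows "injective A (sub M (E <+>\<^bsub>M\<^esub> K))"
proof -
  let ?W = "E <+>\<^bsub>M\<^esub> K"
  have W: "submodule ?W A M" by (rule submodule_add[OF EK(1,2)])
  note up = submodule_add_upper[OF EK(1,2)]
  interpret W: left_module A "sub M ?W" by (rule sub_left_module[OF W])
  have ds: "internal_direct_sum A (sub M ?W) E K" "internal_direct_sum A (sub M ?W) K E"
    using EK up W.submoduleD submodule_sub_iff[OF W] 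
    by (auto simp: internal_direct_sum_def mem_set_add Int_commute) (metis M.a_comm submoduleD(3))+
  obtain f where f: "f \<in> module_hom A (sub M ?W) (sub (sub M ?W) E)" "\<And>x y. x \<in> E \<Longrightarrow> y \<in> K \<Longrightarrow> f (x \<oplus>\<^bsub>sub M ?W\<^esub> y) = x"
    using W.direct_sum_projection[OF ds(1)] by metis
  obtain f' where f': "f' \<in> module_hom A (sub M ?W) (sub (sub M ?W) K)" "\<And>x y. x \<in> K \<Longrightarrow> y \<in> E \<Longrightarrow> f' (x \<oplus>\<^bsub>sub M ?W\<^esub> y) = x"
    using W.direct_sum_projection[OF ds(2)] by metis
  have sum: "f z \<oplus>\<^bsub>M\<^esub> f' z = z" if z: "z \<in> ?W" for z
  proof -
    obtain x y where xy: "x \<in> E" "y \<in> K" "z = x \<oplus>\<^bsub>M\<^esub> y" using z by (auto simp: mem_set_add)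
    then have "z = y \<oplus>\<^bsub>M\<^esub> x" using submoduleD(3) EK M.a_comm by blast
    then show ?thesis using f(2)[OF xy(1,2)] f'(2)[OF xy(2,1)] xy(3) by simp
  qed
  show ?thesis unfolding injective_def
  proof (intro conjI allI impI ballI fg)
    fix X Y :: "'a cmod" and g h
    assume XY: "fg_module A X \<and> fg_module A Y" and g: "g \<in> module_hom A X Y" "inj_on g (carrier X)"
      and h: "h \<in> module_hom A X (sub M ?W)"
    have s: "sub (sub M ?W) E = sub M E" "sub (sub M ?W) K = sub M K" by simp_all
    obtain k where k: "k \<in> module_hom A Y (sub M E)" "\<forall>x\<in>carrier X. k (g x) = f (h x)"
      using injectiveD[OF inj(1) conjunct1[OF XY] conjunct2[OF XY] g module_hom_comp[OF h f(1)[unfolded s]]] by blast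
    obtain k' where k': "k' \<in> module_hom A Y (sub M K)" "\<forall>x\<in>carrier X. k' (g x) = f' (h x)"
      using injectiveD[OF inj(2) conjunct1[OF XY] conjunct2[OF XY] g module_hom_comp[OF h f'(1)[unfolded s]]] by blast
    note kD = module_homD[OF k(1), simplified] and kD' = module_homD[OF k'(1), simplified]
    have c: "k y \<in> carrier M" "k' y \<in> carrier M" if "y \<in> carrier Y" for y
      using kD(1)[OF that] kD'(1)[OF that] submoduleD(3) EK by blast+
    have "(\<lambda>y. k y \<oplus>\<^bsub>M\<^esub> k' y) \<in> module_hom A Y (sub M ?W)"
    proof (rule module_homI)
      show "k y \<oplus>\<^bsub>M\<^esub> k' y \<in> carrier (sub M ?W)" if "y \<in> carrier Y" for y
        using kD(1)[OF that] kD'(1)[OF that] by (auto simp: mem_set_add)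
    qed (simp_all add: kD kD' c M.a_ac smult_r_distr)
    moreover have "\<forall>x\<in>carrier X. k (g x) \<oplus>\<^bsub>M\<^esub> k' (g x) = h x"
      using k(2) k'(2) sum module_homD(1)[OF h] by simp
    ultimately show "\<exists>k\<in>module_hom A Y (sub M ?W). \<forall>x\<in>carrier X. k (g x) = h x"
      by (intro bexI[of _ "\<lambda>y. k y \<oplus>\<^bsub>M\<^esub> k' y"])
  qed
qed

end

section \<open>Left ideals as modules\<close>

context ring
begin

lemma regular_hom: 
  assumes "lideal R N" "lideal R K" "m \<in> carrier R" "\<And>x. x \<in> N \<Longrightarrow> x \<otimes> m \<in> K"
  shows "(\<lambda>x. x \<otimes> m) \<in> module_hom R (sub (regular_module R) N) (sub (regular_module R) K)"
  using assms lidealD(3)[OF assms(1)] by (intro module_homI) (auto simp: l_distr m_assoc)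

lemma regular_left_module': "left_module R (regular_module R)"
  by (rule regular_left_module) unfold_locales

lemma sub_regular_left_module: "lideal R N \<Longrightarrow> left_module R (sub (regular_module R) N)"
  using left_module.sub_left_module[OF regular_left_module'] submodule_regular ring_axioms by blast

lemma submodule_regular_iff: "submodule N R (regular_module R) \<longleftrightarrow> lideal R N"
  by (rule submodule_regular) unfold_locales

lemma submodule_sub_regular_iff:
  "lideal R N \<Longrightarrow> submodule K R (sub (regular_module R) N) \<longleftrightarrow> lideal R K \<and> K \<subseteq> N"
  using left_module.submodule_sub_iff[OF regular_left_module'] submodule_regular_iff by blast

lemma lprinc_fg:
  assumes e: "e \<in> carrier R" shows "fg_module R (sub (regular_module R) (lprinc R e))"
proof -
  interpret left_module R "sub (regular_module R) (lprinc R e)" by (rule sub_regular_left_module) (use e in simp)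
  have "generated_submodule R (sub (regular_module R) (lprinc R e)) {e} = lprinc R e"
  proof
    show "generated_submodule R (sub (regular_module R) (lprinc R e)) {e} \<subseteq> lprinc R e"
      using generated_submodule(3)[of "{e}" "lprinc R e"] submodule_carrier e by simp
    have "lprinc R e \<subseteq> N" if "submodule N R (sub (regular_module R) (lprinc R e))" "{e} \<subseteq> N" for N
      using that submodule_sub_regular_iff[of "lprinc R e"] lprinc_subset e by simp
    then show "lprinc R e \<subseteq> generated_submodule R (sub (regular_module R) (lprinc R e)) {e}"
      unfolding generated_submodule_def by blast
  qed
  then have "finitely_generated R (sub (regular_module R) (lprinc R e))"
    unfolding finitely_generated_def using e by (intro exI[of _ "{e}"] conjI) simp_all
  then show ?thesis using left_module_axioms by (simp add: fg_module_def)
qed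

lemma lprinc_projective:
  assumes e: "e \<in> carrier R" "e \<otimes> e = e"
  shows "projective R (sub (regular_module R) (lprinc R e))"
  unfolding projective_def
proof (intro conjI allI impI ballI lprinc_fg[OF e(1)])
  fix X Y :: "'a cmod" and g h
  let ?Q = "sub (regular_module R) (lprinc R e)"
  assume XY: "fg_module R X \<and> fg_module R Y" and g: "g \<in> module_hom R X Y" "g ` carrier X = carrier Y"
    and h: "h \<in> module_hom R ?Q Y"
  interpret X: left_module R X using XY by (simp add: fg_module_def)
  have "h e \<in> carrier Y" using module_homD(1)[OF h] e by simp
  then obtain x where x: "x \<in> carrier X" "g x = h e" using g(2) by (metis imageE)
  have c: "y \<in> carrier R" "y \<otimes> e = y" if "y \<in> lprinc R e" for y using that e by (auto simp: lprinc_idem)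
  have "(\<lambda>y. y \<odot>\<^bsub>X\<^esub> x) \<in> module_hom R ?Q X"
    using x c by (intro module_homI) (auto simp: X.smult_l_distr X.smult_assoc)
  moreover have "g (y \<odot>\<^bsub>X\<^esub> x) = h y" if y: "y \<in> lprinc R e" for y
  proof -
    have "h (y \<otimes> e) = y \<odot>\<^bsub>Y\<^esub> h e" using module_homD(3)[OF h, of y e] c(1)[OF y] e by simp
    then show ?thesis using module_homD(3)[OF g(1) c(1)[OF y] x(1)] x(2) c(2)[OF y] by simp
  qed
  ultimately show "\<exists>k\<in>module_hom R ?Q X. \<forall>x\<in>carrier ?Q. g (k x) = h x"
    by (intro bexI[of _ "\<lambda>y. y \<odot>\<^bsub>X\<^esub> x"]) auto
qed

lemma lprinc_indecomposable:
  assumes e: "primitive R e" shows "indecomposable R (sub (regular_module R) (lprinc R e))"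
  unfolding indecomposable_def
proof (intro conjI allI impI)
  note e' = primitiveD[OF e]
  have L: "lideal R (lprinc R e)" using e' by simp
  show "carrier (sub (regular_module R) (lprinc R e)) \<noteq> {\<zero>\<^bsub>sub (regular_module R) (lprinc R e)\<^esub>}"
    using lprinc_self[OF e'(1)] e'(2) by auto
  fix N K assume "internal_direct_sum R (sub (regular_module R) (lprinc R e)) N K"
  then have NK: "lideal R N" "N \<subseteq> lprinc R e" "lideal R K" "K \<subseteq> lprinc R e"
    "N <+>\<^bsub>R\<^esub> K = lprinc R e" "N \<inter> K = {\<zero>}"
    unfolding internal_direct_sum_def submodule_sub_regular_iff[OF L] by auto
  have "e \<in> N <+>\<^bsub>R\<^esub> K" using NK(5) e' by simp
  then obtain n k where nk: "n \<in> N" "k \<in> K" "e = n \<oplus> k" by (auto simp: mem_set_add)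
  have c: "n \<in> carrier R" "k \<in> carrier R" using lidealD(3)[OF NK(1) nk(1)] lidealD(3)[OF NK(3) nk(2)] .
  have "n = \<zero> \<or> k = \<zero>" using primitive_indecomposable[OF e NK(1,3,2,4,6) nk(1,2)] nk(3) by simp
  then have "e \<in> K \<or> e \<in> N" using nk c by auto
  then have "lprinc R e \<subseteq> K \<or> lprinc R e \<subseteq> N" using lprinc_subset NK by blast
  then show "N = {\<zero>\<^bsub>sub (regular_module R) (lprinc R e)\<^esub>} \<or> K = {\<zero>\<^bsub>sub (regular_module R) (lprinc R e)\<^esub>}"
    using NK(2,4,6) by auto
qed

end

section \<open>Fuller's theorem for finitely generated modules, and injective hulls inside left
  ideals\<close>

context qring
begin

lemma smono_regular: "\<exists>d. smono A (regular_module A) d"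
proof -
  obtain d where "lmono A (carrier A) d" using finite_length by blast
  then have "smono A (regular_module A) d"
    unfolding smono_def lmono_def submodule_regular_iff using lidealD(1) by blast
  then show ?thesis by blast
qed

lemma lideal_fg: "lideal A N \<Longrightarrow> fg_module A (sub (regular_module A) N)"
  using smono_regular left_module.smono_finitely_generated[OF regular_left_module']
    sub_regular_left_module[of N] submodule_regular_iff unfolding fg_module_def by blast

lemma regular_fg: "fg_module A (regular_module A)"
  using lideal_fg[OF lideal_carrier] by (simp add: scalar_module_def)

lemma fg_smono: "fg_module A M \<Longrightarrow> \<exists>d. smono A M d"
  using finite_length left_module.finitely_generated_smono unfolding fg_module_def by blast

text \<open>On the left ideal of all \<open>a\<close> with \<open>a y \<in> Z\<close>, the map
  \<open>a \<mapsto> h (a y)\<close> is right multiplication by some \<open>c\<close>, according to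
  \<open>ipair_baer\<close>; the extension sends \<open>y\<close> to \<open>c\<close>.\<close>

lemma baer_adjoin:
  assumes p: "ipair e f s" and Y: "left_module A Y" and Z: "submodule Z A Y" and y: "y \<in> carrier Y"
    and h: "h \<in> module_hom A (sub Y Z) (sub (regular_module A) (lprinc A e))"
  shows "\<exists>Z' h'. submodule Z' A Y \<and> Z \<subseteq> Z' \<and> y \<in> Z' \<and>
    h' \<in> module_hom A (sub Y Z') (sub (regular_module A) (lprinc A e)) \<and> (\<forall>z\<in>Z. h' z = h z)"
proof -
  interpret Y: left_module A Y by fact
  note Z' = Y.submoduleD[OF Z] and e' = ipairD(9,11)[OF p]
  have Le: "lideal A (lprinc A e)" using e' by simp
  have hD: "\<And>x. x \<in> Z \<Longrightarrow> h x \<in> lprinc A e" "\<And>x y. x \<in> Z \<Longrightarrow> y \<in> Z \<Longrightarrow> h (x \<oplus>\<^bsub>Y\<^esub> y) = h x \<oplus> h y"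
    "\<And>a x. a \<in> carrier A \<Longrightarrow> x \<in> Z \<Longrightarrow> h (a \<odot>\<^bsub>Y\<^esub> x) = a \<otimes> h x"
    using module_homD[OF h] by auto
  have hc: "h x \<in> carrier A" if "x \<in> Z" for x using lidealD(3)[OF Le hD(1)[OF that]] .
  define K where "K = {a \<in> carrier A. a \<odot>\<^bsub>Y\<^esub> y \<in> Z}"
  have K: "lideal A K" unfolding K_def lideal_def using Z' y
    by (auto simp: Y.smult_l_distr Y.smult_assoc)
  have "\<exists>c\<in>lprinc A e. \<forall>k\<in>K. h (k \<odot>\<^bsub>Y\<^esub> y) = k \<otimes> c"
    by (rule ipair_baer[OF p K]) (use hD y in \<open>auto simp: K_def Y.smult_l_distr Y.smult_assoc\<close>)
  then obtain c where c: "c \<in> lprinc A e" "\<And>a. a \<in> carrier A \<Longrightarrow> a \<odot>\<^bsub>Y\<^esub> y \<in> Z \<Longrightarrow> h (a \<odot>\<^bsub>Y\<^esub> y) = a \<otimes> c"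
    by (auto simp: K_def)
  have cc: "c \<in> carrier A" using lidealD(3)[OF Le c(1)] .
  let ?S = "{a \<odot>\<^bsub>Y\<^esub> y | a. a \<in> carrier A}"
  define W where "W = Z <+>\<^bsub>Y\<^esub> ?S"
  have W: "submodule W A Y" unfolding W_def by (rule Y.submodule_add[OF Z Y.submodule_cyclic[OF y]])
  have up: "Z \<subseteq> W" "?S \<subseteq> W" unfolding W_def using Y.submodule_add_upper[OF Z Y.submodule_cyclic[OF y]] by auto
  \<comment> \<open>The graph of the extension. It is additive and linear, so its being
    single-valued reduces to \<open>Q0\<close>, and this is where the choice of \<open>c\<close>
    enters.\<close>
  define Q where "Q x u \<longleftrightarrow> (\<exists>z\<in>Z. \<exists>a\<in>carrier A. x = z \<oplus>\<^bsub>Y\<^esub> a \<odot>\<^bsub>Y\<^esub> y \<and> u = h z \<oplus> a \<otimes> c)" for x u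
  have h0: "h \<zero>\<^bsub>Y\<^esub> = \<zero>" using hD(3)[of \<zero> "\<zero>\<^bsub>Y\<^esub>"] Z'(2) hc[of "\<zero>\<^bsub>Y\<^esub>"] by simp
  have Qadd: "Q (x \<oplus>\<^bsub>Y\<^esub> x') (u \<oplus> u')" if Qx: "Q x u" "Q x' u'" for x u x' u'
  proof -
    obtain z a z' a' where za: "z \<in> Z" "a \<in> carrier A" "x = z \<oplus>\<^bsub>Y\<^esub> a \<odot>\<^bsub>Y\<^esub> y" "u = h z \<oplus> a \<otimes> c"
      "z' \<in> Z" "a' \<in> carrier A" "x' = z' \<oplus>\<^bsub>Y\<^esub> a' \<odot>\<^bsub>Y\<^esub> y" "u' = h z' \<oplus> a' \<otimes> c"
      using Qx unfolding Q_def by blast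
    have "x \<oplus>\<^bsub>Y\<^esub> x' = (z \<oplus>\<^bsub>Y\<^esub> z') \<oplus>\<^bsub>Y\<^esub> (a \<oplus> a') \<odot>\<^bsub>Y\<^esub> y"
      using za Z'(3) y by (simp add: Y.smult_l_distr Y.M.a_ac)
    moreover have "u \<oplus> u' = h (z \<oplus>\<^bsub>Y\<^esub> z') \<oplus> (a \<oplus> a') \<otimes> c"
      using za hD(2) hc cc by (simp add: l_distr a_ac)
    ultimately show ?thesis unfolding Q_def using za Z'(4) by blast
  qed
  have Qsm: "Q (b \<odot>\<^bsub>Y\<^esub> x) (b \<otimes> u)" if b: "b \<in> carrier A" and Qx: "Q x u" for b x u
  proof -
    obtain z a where za: "z \<in> Z" "a \<in> carrier A" "x = z \<oplus>\<^bsub>Y\<^esub> a \<odot>\<^bsub>Y\<^esub> y" "u = h z \<oplus> a \<otimes> c"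
      using Qx unfolding Q_def by blast
    have "b \<odot>\<^bsub>Y\<^esub> x = b \<odot>\<^bsub>Y\<^esub> z \<oplus>\<^bsub>Y\<^esub> (b \<otimes> a) \<odot>\<^bsub>Y\<^esub> y"
      using za Z'(3) y b by (simp add: Y.smult_r_distr Y.smult_assoc)
    moreover have "b \<otimes> u = h (b \<odot>\<^bsub>Y\<^esub> z) \<oplus> (b \<otimes> a) \<otimes> c"
      using za hD(3) hc cc b by (simp add: r_distr m_assoc)
    ultimately show ?thesis unfolding Q_def using za b Z'(5) by blast
  qed
  have Q0: "u = \<zero>" if Q0: "Q \<zero>\<^bsub>Y\<^esub> u" for u
  proof -
    obtain z a where za: "z \<in> Z" "a \<in> carrier A" "\<zero>\<^bsub>Y\<^esub> = z \<oplus>\<^bsub>Y\<^esub> a \<odot>\<^bsub>Y\<^esub> y" "u = h z \<oplus> a \<otimes> c"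
      using Q0 unfolding Q_def by blast
    have "a \<odot>\<^bsub>Y\<^esub> y = \<ominus>\<^bsub>Y\<^esub> z" using za Z'(3) y
      by (metis Y.M.minus_equality Y.M.minus_minus Y.smult_closed)
    then have ay: "a \<odot>\<^bsub>Y\<^esub> y \<in> Z" using Z'(6) za by simp
    have "u = h z \<oplus> h (a \<odot>\<^bsub>Y\<^esub> y)" using c(2)[OF za(2) ay] za(4) by simp
    also have "\<dots> = h \<zero>\<^bsub>Y\<^esub>" using hD(2)[OF za(1) ay] za(3) by simp
    finally show ?thesis using h0 by simp
  qed
  have Qc: "u \<in> lprinc A e" if "Q x u" for x u
    using that lidealD(4,5)[OF Le] hD(1) c(1) unfolding Q_def by auto
  have Quniq: "u = u'" if "Q x u" "Q x u'" "x \<in> carrier Y" for x u u'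
  proof -
    have uc: "u \<in> carrier A" "u' \<in> carrier A" using Qc that lidealD(3)[OF Le] by auto
    have "Q (x \<oplus>\<^bsub>Y\<^esub> (\<ominus> \<one>) \<odot>\<^bsub>Y\<^esub> x) (u \<oplus> (\<ominus> \<one>) \<otimes> u')" using Qadd[OF that(1) Qsm[OF _ that(2)]] by simp
    then have "Q \<zero>\<^bsub>Y\<^esub> (u \<ominus> u')" using that(3) uc by (simp add: Y.smult_minus_one Y.M.r_neg l_minus a_minus_def)
    then show ?thesis using Q0 uc diff_zero_iff by blast
  qed
  define h' where "h' x = (THE u. Q x u)" for x
  have Wex: "\<exists>u. Q x u" if "x \<in> W" for x using that unfolding W_def Q_def by (auto simp: mem_set_add)
  have Wc: "x \<in> carrier Y" if "x \<in> W" for x using Y.submoduleD(3)[OF W that] .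
  have Qh': "Q x (h' x)" if x: "x \<in> W" for x
  proof -
    obtain u where "Q x u" using Wex[OF x] by blast
    then have "\<exists>!u. Q x u" using Quniq[OF _ _ Wc[OF x]] by blast
    then show ?thesis unfolding h'_def by (rule theI')
  qed
  have h'eq: "h' x = u" if "x \<in> W" "Q x u" for x u using Quniq[OF Qh'[OF that(1)] that(2) Wc[OF that(1)]] .
  have "h' \<in> module_hom A (sub Y W) (sub (regular_module A) (lprinc A e))"
  proof (rule module_homI)
    show "h' x \<in> carrier (sub (regular_module A) (lprinc A e))" if "x \<in> carrier (sub Y W)" for x
      using Qc[OF Qh'] that by simp
    show "h' (x \<oplus>\<^bsub>sub Y W\<^esub> x') = h' x \<oplus>\<^bsub>sub (regular_module A) (lprinc A e)\<^esub> h' x'"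
      if "x \<in> carrier (sub Y W)" "x' \<in> carrier (sub Y W)" for x x'
      using h'eq[OF _ Qadd[OF Qh' Qh']] that Y.submoduleD(4)[OF W] by simp
    show "h' (a \<odot>\<^bsub>sub Y W\<^esub> x) = a \<odot>\<^bsub>sub (regular_module A) (lprinc A e)\<^esub> h' x"
      if "a \<in> carrier A" "x \<in> carrier (sub Y W)" for a x
      using h'eq[OF _ Qsm[OF _ Qh']] that Y.submoduleD(5)[OF W] by simp
  qed
  moreover have "h' z = h z" if z: "z \<in> Z" for z
  proof (rule h'eq)
    show "z \<in> W" using up z by blast
    show "Q z (h z)" unfolding Q_def using z Z'(3) y hc cc
      by (intro bexI[of _ z] bexI[of _ \<zero>]) auto
  qed
  moreover have "y \<in> W" using up(2) y by (auto intro!: exI[of _ \<one>])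
  ultimately show ?thesis using W up(1) by blast
qed

text \<open>Starting from the image of \<open>X\<close>, the finitely many generators of
  \<open>Y\<close> are adjoined one after the other.\<close>

theorem ipair_injective:
  assumes p: "ipair e f s" shows "injective A (sub (regular_module A) (lprinc A e))"
  unfolding injective_def
proof (intro conjI allI impI ballI lprinc_fg)
  show "e \<in> carrier A" using ipairD[OF p] by simp
  fix X Y :: "'a cmod" and g h
  let ?E = "sub (regular_module A) (lprinc A e)"
  assume XY: "fg_module A X \<and> fg_module A Y" and g: "g \<in> module_hom A X Y" "inj_on g (carrier X)"
    and h: "h \<in> module_hom A X ?E"
  interpret X: left_module A X using XY by (simp add: fg_module_def)
  interpret Y: left_module A Y using XY by (simp add: fg_module_def)
  let ?Z = "g ` carrier X"
  have Z: "submodule ?Z A Y" "semi_epi A A X (sub Y ?Z) (\<lambda>a. a) g"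
    using module_hom_image[OF X.left_module_axioms Y.left_module_axioms g(1) X.submodule_carrier] by auto
  then have "semi_iso A A X (sub Y ?Z) (\<lambda>a. a) g" using g(2) by (auto intro!: semi_iso.intro semi_iso_axioms.intro)
  note i = semi_iso_hom[OF this]
  obtain B where B: "finite B" "B \<subseteq> carrier Y" "generated_submodule A Y B = carrier Y"
    using XY unfolding fg_module_def finitely_generated_def by blast
  let ?h = "\<lambda>y. h (inv_into (carrier X) g y)"
  have "\<exists>Z' h'. submodule Z' A Y \<and> ?Z \<subseteq> Z' \<and> B \<subseteq> Z' \<and> h' \<in> module_hom A (sub Y Z') ?E \<and> (\<forall>z\<in>?Z. h' z = ?h z)"
    using B(1,2)
  proof (induction B rule: finite_induct)
    case empty
    then show ?case using Z(1) module_hom_comp[OF i(2) h] by (intro exI[of _ ?Z] exI[of _ ?h]) auto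
  next
    case (insert b B)
    then obtain Z1 h1 where 1: "submodule Z1 A Y" "?Z \<subseteq> Z1" "B \<subseteq> Z1" "h1 \<in> module_hom A (sub Y Z1) ?E"
      "\<forall>z\<in>?Z. h1 z = ?h z" by auto
    obtain Z2 h2 where 2: "submodule Z2 A Y" "Z1 \<subseteq> Z2" "b \<in> Z2" "h2 \<in> module_hom A (sub Y Z2) ?E"
      "\<forall>z\<in>Z1. h2 z = h1 z"
      using baer_adjoin[OF p Y.left_module_axioms 1(1) _ 1(4), of b] insert(4) by auto
    have "\<forall>z\<in>?Z. h2 z = ?h z" using 1(2,5) 2(5) by (metis subsetD)
    moreover have "?Z \<subseteq> Z2" "insert b B \<subseteq> Z2" using 1(2,3) 2(2,3) by auto
    ultimately show ?case using 2(1,4) by blast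
  qed
  then obtain Z' h' where Z': "submodule Z' A Y" "B \<subseteq> Z'" "h' \<in> module_hom A (sub Y Z') ?E" "\<forall>z\<in>?Z. h' z = ?h z"
    by blast
  have "Z' = carrier Y" using Y.generated_submodule(3)[OF B(2) Z'(1,2)] B(3) Y.submoduleD(1)[OF Z'(1)] by blast
  then have "h' \<in> module_hom A Y ?E" using Z'(3) by simp
  moreover have "\<forall>x\<in>carrier X. h' (g x) = h x" using Z'(4) i(3) by simp
  ultimately show "\<exists>k\<in>module_hom A Y ?E. \<forall>x\<in>carrier X. k (g x) = h x" by blast
qed

text \<open>The converse half of Fuller's theorem. The assignment
  \<open>a \<otimes> x \<mapsto> a \<otimes> s\<close> is a well-defined homomorphism from
  \<open>A x\<close> to \<open>E\<close>: if \<open>a \<otimes> x = \<zero>\<close> with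
  \<open>x\<close> nonzero in \<open>f A\<close>, then \<open>a \<otimes> f\<close> is radical and
  kills \<open>s\<close>. An extension to \<open>A\<close> is right multiplication by its value at
  \<open>\<one>\<close>, which is the required \<open>c\<close>.\<close>

lemma injective_right_smallest:
  assumes E: "lideal A E" "injective A (sub (regular_module A) E)"
    and f: "primitive A f" and s: "s \<in> E" "f \<otimes> s = s" "\<And>j. j \<in> jac A \<Longrightarrow> j \<otimes> s = \<zero>"
    and x: "x \<in> carrier A" "f \<otimes> x = x" "x \<noteq> \<zero>"
  shows "\<exists>c\<in>carrier A. s = x \<otimes> c"
proof -
  note f' = primitiveD[OF f]
  have sc: "s \<in> carrier A" using lidealD(3)[OF E(1) s(1)] .
  have Lx: "lideal A (lprinc A x)" using x by simp
  have kill: "a \<otimes> s = \<zero>" if a: "a \<in> carrier A" "a \<otimes> x = \<zero>" for a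
  proof -
    have "a \<otimes> f \<in> jac A"
    proof (rule ccontr)
      assume "a \<otimes> f \<notin> jac A"
      then obtain u where "u \<in> carrier A" "f = u \<otimes> (a \<otimes> f)"
        using jac_mem[OF f, of "a \<otimes> f"] a f' by (auto elim: lprincE simp: m_assoc)
      then have "x = u \<otimes> (a \<otimes> x)" using x a f' by (metis m_assoc m_closed)
      then show False using a x \<open>u \<in> carrier A\<close> by simp
    qed
    then have "a \<otimes> f \<otimes> s = \<zero>" using s(3) by blast
    then show ?thesis using a f' sc s(2) by (simp add: m_assoc)
  qed
  have wd: "a \<otimes> s = b \<otimes> s" if "a \<in> carrier A" "b \<in> carrier A" "a \<otimes> x = b \<otimes> x" for a b
    using kill[of "a \<ominus> b"] that x sc by (simp add: minus_distrib diff_zero_iff)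
  \<comment> \<open>By \<open>wd\<close> the value does not depend on the coefficient
    chosen.\<close>
  define t where "t y = (SOME u. \<exists>a\<in>carrier A. y = a \<otimes> x \<and> u = a \<otimes> s)" for y
  have t: "t (a \<otimes> x) = a \<otimes> s" if a: "a \<in> carrier A" for a
  proof -
    have "\<exists>u. \<exists>b\<in>carrier A. a \<otimes> x = b \<otimes> x \<and> u = b \<otimes> s" using a by blast
    from someI_ex[OF this] obtain b where "b \<in> carrier A" "a \<otimes> x = b \<otimes> x" "t (a \<otimes> x) = b \<otimes> s"
      unfolding t_def by blast
    then show ?thesis using wd[OF a] by simp
  qed
  have "t \<in> module_hom A (sub (regular_module A) (lprinc A x)) (sub (regular_module A) E)"
  proof (rule module_homI; simp)
    show "t y \<in> E" if "y \<in> lprinc A x" for y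
      using that t lidealD(5)[OF E(1) _ s(1)] by (auto elim!: lprincE)
    show "t (y \<oplus> z) = t y \<oplus> t z" if yz: "y \<in> lprinc A x" "z \<in> lprinc A x" for y z
    proof -
      obtain a b where "a \<in> carrier A" "b \<in> carrier A" "y = a \<otimes> x" "z = b \<otimes> x" using yz by (auto elim!: lprincE)
      then show ?thesis using t[of "a \<oplus> b"] t x sc by (simp add: l_distr)
    qed
    show "t (b \<otimes> y) = b \<otimes> t y" if b: "b \<in> carrier A" and y: "y \<in> lprinc A x" for b y
    proof -
      obtain a where "a \<in> carrier A" "y = a \<otimes> x" using y by (auto elim!: lprincE)
      then show ?thesis using t[of "b \<otimes> a"] t x sc b by (simp add: m_assoc)
    qed
  qed
  moreover have "(\<lambda>y. y) \<in> module_hom A (sub (regular_module A) (lprinc A x)) (regular_module A)"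
    using left_module.inclusion_hom[OF regular_left_module'] submodule_regular_iff Lx by blast
  ultimately obtain k where k: "k \<in> module_hom A (regular_module A) (sub (regular_module A) E)"
    "\<forall>y\<in>lprinc A x. k y = t y"
    using injectiveD[OF E(2) lprinc_fg[OF x(1)] regular_fg, of "\<lambda>y. y" t] by auto
  have "k \<one> \<in> carrier A" using module_homD(1)[OF k(1), of \<one>] lidealD(3)[OF E(1)] by simp
  moreover have "x \<otimes> k \<one> = s"
  proof -
    have "k (x \<otimes> \<one>) = x \<otimes> k \<one>" using module_homD(3)[OF k(1), of x \<one>] x by simp
    moreover have "k x = \<one> \<otimes> s" using k(2) t[of \<one>] x by simp
    ultimately show ?thesis using x sc by simp
  qed
  ultimately show ?thesis by blast
qed

text \<open>The injective hull of \<open>S\<close> inside \<open>P\<close>. Take \<open>K\<close>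
  maximal with \<open>K \<inter> S = 0\<close>, and \<open>E\<close> maximal with
  \<open>E \<inter> K = 0\<close> among the left ideals containing \<open>S\<close>. The projection
  of \<open>E + K\<close> onto \<open>E\<close> extends to an endomorphism \<open>t\<close> of the
  injective module \<open>P\<close>, and the two maximality conditions force its image to be
  \<open>E\<close> and its kernel to be \<open>K\<close>, so \<open>P\<close> splits.\<close>

lemma injective_hull_summand:
  assumes P: "lideal A P" "injective A (sub (regular_module A) P)" and S: "covers A S {\<zero>}" "S \<subseteq> P"
  shows "\<exists>E K. lideal A E \<and> lideal A K \<and> E <+>\<^bsub>A\<^esub> K = P \<and> E \<inter> K = {\<zero>} \<and> S \<subseteq> E \<and>
    (\<forall>Z. lideal A Z \<and> Z \<subseteq> E \<and> Z \<noteq> {\<zero>} \<longrightarrow> S \<subseteq> Z)"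
proof -
  note S' = coversD[OF S(1)]
  obtain d where d: "lmono A (carrier A) d" using finite_length by blast
  have lt: "d Y < d Z" if "lideal A Y" "lideal A Z" "Y \<subset> Z" for Y Z
    using d that lidealD(1) unfolding lmono_def by blast
  have greatest: "\<exists>Y. Q Y \<and> (\<forall>Z. Q Z \<and> Y \<subseteq> Z \<longrightarrow> Z = Y)" if "Q Y0" "\<And>Y. Q Y \<Longrightarrow> lideal A Y" for Q Y0
  proof -
    have "\<forall>Y. Q Y \<longrightarrow> d Y < Suc (d (carrier A))"
      using lmono_le(1)[OF d _ lideal_carrier] that(2) lidealD(1)[OF that(2)] by (simp add: less_Suc_eq_le)
    from ex_has_greatest_nat[of Q, OF that(1) this] obtain Y where "Q Y" "\<forall>Z. Q Z \<longrightarrow> d Z \<le> d Y" by blast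
    then show ?thesis using lt that(2) by (metis leD psubsetI)
  qed
  have meet: "S \<subseteq> Z" if "lideal A Z" "Z \<inter> S \<noteq> {\<zero>}" for Z
    using S'(5)[OF lideal_Int[OF that(1) S'(1)]] that lidealD(2) S'(3) by blast
  obtain K where K: "lideal A K" "K \<subseteq> P" "K \<inter> S = {\<zero>}"
    "\<And>Z. lideal A Z \<Longrightarrow> Z \<subseteq> P \<Longrightarrow> Z \<inter> S = {\<zero>} \<Longrightarrow> K \<subseteq> Z \<Longrightarrow> Z = K"
    using greatest[of "\<lambda>K. lideal A K \<and> K \<subseteq> P \<and> K \<inter> S = {\<zero>}" "{\<zero>}"] lidealD(2)[OF P(1)] S'(3) by auto
  have "S \<inter> K = {\<zero>}" using K(3) by blast
  then have "\<exists>Y. (lideal A Y \<and> Y \<subseteq> P \<and> S \<subseteq> Y \<and> Y \<inter> K = {\<zero>}) \<and>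
      (\<forall>Z. (lideal A Z \<and> Z \<subseteq> P \<and> S \<subseteq> Z \<and> Z \<inter> K = {\<zero>}) \<and> Y \<subseteq> Z \<longrightarrow> Z = Y)"
    using S'(1) S(2) by (intro greatest[of _ S]) auto
  then obtain E where E0: "lideal A E \<and> E \<subseteq> P \<and> S \<subseteq> E \<and> E \<inter> K = {\<zero>}" and
    E1: "\<forall>Z. (lideal A Z \<and> Z \<subseteq> P \<and> S \<subseteq> Z \<and> Z \<inter> K = {\<zero>}) \<and> E \<subseteq> Z \<longrightarrow> Z = E"
    by (elim exE conjE) (rule that, simp_all)
  have "Z = E" if "lideal A Z" "Z \<subseteq> P" "Z \<inter> K = {\<zero>}" "E \<subseteq> Z" for Z
    using E1[rule_format, of Z] E0 that by auto
  note E = E0[THEN conjunct1] E0[THEN conjunct2, THEN conjunct1]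
    E0[THEN conjunct2, THEN conjunct2, THEN conjunct1] E0[THEN conjunct2, THEN conjunct2, THEN conjunct2] this
  define W where "W = E <+>\<^bsub>A\<^esub> K"
  have W: "lideal A W" "W \<subseteq> P" unfolding W_def using lideal_add[OF E(1) K(1)] lideal_add_least[OF P(1) E(2) K(2)] by auto
  note up = lideal_add_upper[OF E(1) K(1), folded W_def]
  interpret mW: left_module A "sub (regular_module A) W" by (rule sub_regular_left_module[OF W(1)])
  have "internal_direct_sum A (sub (regular_module A) W) E K"
    unfolding internal_direct_sum_def submodule_sub_regular_iff[OF W(1)]
    using E K up by (simp add: W_def)
  from mW.direct_sum_projection[OF this]
  obtain pr where pr: "pr \<in> module_hom A (sub (regular_module A) W) (sub (sub (regular_module A) W) E)"
    "\<And>x. x \<in> E \<Longrightarrow> pr x = x" "\<And>x. x \<in> K \<Longrightarrow> pr x = \<zero>\<^bsub>sub (regular_module A) W\<^esub>"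
    by metis
  have prh: "pr \<in> module_hom A (sub (regular_module A) W) (sub (regular_module A) P)"
    using module_homD[OF pr(1)] E(2) by (intro module_homI) auto
  have inc: "(\<lambda>x. x) \<in> module_hom A (sub (regular_module A) W) (sub (regular_module A) P)"
    using W by (intro module_homI) auto
  obtain t where t: "t \<in> module_hom A (sub (regular_module A) P) (sub (regular_module A) P)"
    "\<forall>x\<in>W. t x = pr x"
    using injectiveD[OF P(2) lideal_fg[OF W(1)] lideal_fg[OF P(1)] inc _ prh] by (auto simp: inj_on_def)
  have tE: "t x = x" if "x \<in> E" for x using t(2) pr(2) up that by auto
  have tK: "t x = \<zero>" if "x \<in> K" for x using t(2) pr(3) up that by auto
  have tD: "\<And>x. x \<in> P \<Longrightarrow> t x \<in> P" "\<And>x y. x \<in> P \<Longrightarrow> y \<in> P \<Longrightarrow> t (x \<oplus> y) = t x \<oplus> t y"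
    "\<And>a x. a \<in> carrier A \<Longrightarrow> x \<in> P \<Longrightarrow> t (a \<otimes> x) = a \<otimes> t x"
    using module_homD[OF t(1)] by auto
  have Pc: "\<And>x. x \<in> P \<Longrightarrow> x \<in> carrier A" using lidealD(3)[OF P(1)] .
  have t0: "t \<zero> = \<zero>" using tE lidealD(2)[OF E(1)] by blast
  have pre: "lideal A {x \<in> P. t x \<in> V}" if "lideal A V" for V
    unfolding lideal_def using lidealD[OF that] lidealD[OF P(1)] tD t0 by auto
  have img: "lideal A (t ` P)"
    using module_hom_image(1)[OF sub_regular_left_module[OF P(1)] sub_regular_left_module[OF P(1)] t(1)
        left_module.submodule_carrier[OF sub_regular_left_module[OF P(1)]]] submodule_sub_regular_iff[OF P(1)] by simp
  \<comment> \<open>If the intersection is nonzero, its preimage \<open>V\<close> properly contains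
    \<open>K\<close>, so by maximality of \<open>K\<close> it contains \<open>S\<close>. But
    \<open>t\<close> fixes \<open>S\<close>, which would then lie in \<open>K\<close>. Maximality of
    \<open>E\<close> now gives \<open>t P = E\<close>.\<close>
  have "t ` P \<inter> K = {\<zero>}"
  proof (rule ccontr)
    assume n: "t ` P \<inter> K \<noteq> {\<zero>}"
    have LV: "lideal A (t ` P \<inter> K)" using lideal_Int[OF img K(1)] .
    define V where "V = {x \<in> P. t x \<in> t ` P \<inter> K}"
    have V: "lideal A V" "V \<subseteq> P" unfolding V_def using pre[OF LV] by auto
    have KV: "K \<subseteq> V" unfolding V_def using K(2) tK lidealD(2)[OF LV] by auto
    have "V \<inter> S \<noteq> {\<zero>}"
    proof
      assume "V \<inter> S = {\<zero>}"
      then have "V = K" using K(4)[OF V _ KV] by blast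
      obtain y where y: "y \<in> t ` P" "y \<in> K" "y \<noteq> \<zero>" using n lidealD(2)[OF LV] by blast
      then obtain x where x: "x \<in> P" "y = t x" by blast
      then have "x \<in> V" using y unfolding V_def by blast
      then have "t x = \<zero>" using \<open>V = K\<close> tK by blast
      then show False using x y by blast
    qed
    then have "S \<subseteq> V" using meet V(1) by blast
    then have "S \<subseteq> K" using tE E(3) unfolding V_def by fastforce
    then show False using K(3) S'(4) lidealD(2)[OF S'(1)] by blast
  qed
  moreover have "E \<subseteq> t ` P" using tE E(2) by (metis image_iff subsetD subsetI)
  moreover have "t ` P \<subseteq> P" using tD(1) by blast
  ultimately have tP: "t ` P = E" using E(5)[OF img] by blast
  have tx: "t x \<in> E" if "x \<in> P" for x using that tP by blast
  have tt: "t (x \<ominus> t x) = \<zero>" "x \<ominus> t x \<in> P" if "x \<in> P" for x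
  proof -
    have txP: "t x \<in> P" using tD(1) that .
    show m: "x \<ominus> t x \<in> P" by (rule lideal_diff[OF P(1) that txP])
    have "t ((x \<ominus> t x) \<oplus> t x) = t (x \<ominus> t x) \<oplus> t (t x)" using tD(2)[OF m txP] .
    then have "t x = t (x \<ominus> t x) \<oplus> t x" using that tE[OF tx[OF that]] Pc txP by (simp add: diff_add_cancel)
    then show "t (x \<ominus> t x) = \<zero>" using Pc tD(1) m txP by (metis add.r_cancel_one)
  qed
  \<comment> \<open>The kernel contains \<open>K\<close> and meets \<open>S\<close> trivially
    because \<open>t\<close> fixes \<open>S\<close>; maximality of \<open>K\<close> makes them
    equal.\<close>
  have kerK: "x \<in> K" if x: "x \<in> P" "t x = \<zero>" for x
  proof -
    define V where "V = {x \<in> P. t x \<in> {\<zero>}}"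
    have V: "lideal A V" "V \<subseteq> P" "K \<subseteq> V" unfolding V_def using pre[OF lideal_zero] K(2) tK by auto
    have "V \<inter> S = {\<zero>}" using tE E(3) lidealD(2)[OF V(1)] lidealD(2)[OF S'(1)] unfolding V_def by fastforce
    then have "V = K" using K(4)[OF V(1,2) _ V(3)] by blast
    then show ?thesis using x unfolding V_def by blast
  qed
  have "P \<subseteq> W"
  proof
    fix x assume x: "x \<in> P"
    have "x = t x \<oplus> (x \<ominus> t x)" using Pc[OF x] Pc[OF tD(1)[OF x]] by (simp add: a_comm[of "t x"] diff_add_cancel)
    then show "x \<in> W" unfolding W_def mem_set_add using tx[OF x] kerK[OF tt(2,1)[OF x]] by blast
  qed
  then have WP: "W = P" using W(2) by blast
  have "S \<subseteq> Z" if Z: "lideal A Z" "Z \<subseteq> E" "Z \<noteq> {\<zero>}" for Z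
  proof -
    \<comment> \<open>\<open>Z + K\<close> is larger than \<open>K\<close>, so it contains
      \<open>S\<close>. Applying \<open>t\<close>, which fixes \<open>S\<close> and \<open>Z\<close>
      and kills \<open>K\<close>, brings \<open>S\<close> into \<open>Z\<close>.\<close>
    define V where "V = Z <+>\<^bsub>A\<^esub> K"
    have V: "lideal A V" "V \<subseteq> P" "Z \<subseteq> V" "K \<subseteq> V"
      unfolding V_def using lideal_add[OF Z(1) K(1)] lideal_add_upper[OF Z(1) K(1)] lideal_add_least[OF P(1) _ K(2)] Z(2) E(2) by auto
    have "V \<noteq> K" using V(3) Z E(4) lidealD(2)[OF Z(1)] by blast
    then have "V \<inter> S \<noteq> {\<zero>}" using K(4)[OF V(1,2) _ V(4)] by blast
    then have SV: "S \<subseteq> V" using meet V(1) by blast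
    show ?thesis
    proof
      fix x assume x: "x \<in> S"
      then obtain z k where zk: "z \<in> Z" "k \<in> K" "x = z \<oplus> k" using SV unfolding V_def by (auto simp: mem_set_add subset_iff)
      have c: "z \<in> P" "k \<in> P" "x \<in> E" using zk Z(2) E(2,3) K(2) x by auto
      have "t x = z" using tD(2)[OF c(1,2)] zk tE[of z] tK[of k] Z(2) Pc[OF c(1)] by auto
      then show "x \<in> Z" using tE[OF c(3)] zk(1) by simp
    qed
  qed
  then show ?thesis using E K(1) WP unfolding W_def by blast
qed

end

section \<open>The socle of the maximal injective summand\<close>

text \<open>\<open>e\<close> is the component of \<open>\<one>\<close> in \<open>E\<close>. In this
  form a summand is recognised as projective.\<close>

lemma (in ring) summand_idempotent:
  assumes "internal_direct_sum R (regular_module R) E F"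
  shows "\<exists>e. e \<in> carrier R \<and> e \<otimes> e = e \<and> E = lprinc R e"
proof -
  have EF: "lideal R E" "lideal R F" "E <+>\<^bsub>R\<^esub> F = carrier R" "E \<inter> F = {\<zero>}"
    using assms by (auto simp: internal_direct_sum_def submodule_regular_iff)
  have "\<one> \<in> E <+>\<^bsub>R\<^esub> F" using EF(3) by simp
  then obtain e f where ef: "e \<in> E" "f \<in> F" "\<one> = e \<oplus> f" by (auto simp: mem_set_add)
  have c: "e \<in> carrier R" "f \<in> carrier R" using lidealD(3)[OF EF(1) ef(1)] lidealD(3)[OF EF(2) ef(2)] .
  have xe: "x \<otimes> e = x" if x: "x \<in> E" for x
  proof -
    have xc: "x \<in> carrier R" using lidealD(3)[OF EF(1) x] .
    have "x = x \<otimes> e \<oplus> x \<otimes> f" using ef(3) xc c by (metis r_distr r_one)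
    then have "x \<ominus> x \<otimes> e = x \<otimes> f" using xc c
      by (metis a_comm m_closed minus_eq r_neg1 a_inv_closed)
    moreover have "x \<ominus> x \<otimes> e \<in> E" "x \<otimes> f \<in> F"
      using lideal_diff[OF EF(1) x lidealD(5)[OF EF(1) xc ef(1)]] lidealD(5)[OF EF(2) xc ef(2)] by auto
    ultimately have "x \<ominus> x \<otimes> e = \<zero>" using EF(4) by auto
    then show ?thesis using xc c by (simp add: diff_zero_iff)
  qed
  have "E \<subseteq> lprinc R e"
  proof
    fix x assume x: "x \<in> E"
    then show "x \<in> lprinc R e" using lprincI[OF lidealD(3)[OF EF(1) x], of e] xe by simp
  qed
  moreover have "lprinc R e \<subseteq> E" by (rule lprinc_subset[OF EF(1) ef(1)])
  ultimately show ?thesis using c(1) xe[OF ef(1)] by blast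
qed

locale proj_inj = qring A C for A (structure) and C +
  fixes P L
  assumes summands: "internal_direct_sum A (regular_module A) P L"
    and maximal: "maximal_injective_summand A P"
begin

definition soc :: "'a set" where "soc = socle A (sub (regular_module A) P)"

lemma PL: "lideal A P" "lideal A L" "P <+>\<^bsub>A\<^esub> L = carrier A" "P \<inter> L = {\<zero>}"
  "injective A (sub (regular_module A) P)"
  using summands maximal
  by (auto simp: internal_direct_sum_def submodule_regular_iff maximal_injective_summand_def injective_summand_def)

lemma image_lideal_iso:
  assumes E: "lideal A E" and g: "g \<in> module_hom A (sub (regular_module A) E) M" "inj_on g E"
    and M: "left_module A M"
  shows "submodule (g ` E) A M" "semi_iso A A (sub (regular_module A) E) (sub M (g ` E)) (\<lambda>a. a) g"
proof -
  have s: "submodule E A (sub (regular_module A) E)" using submodule_sub_regular_iff[OF E] E by simp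
  note i = module_hom_image[OF sub_regular_left_module[OF E] M g(1) s]
  show "submodule (g ` E) A M" by (rule i(1))
  show "semi_iso A A (sub (regular_module A) E) (sub M (g ` E)) (\<lambda>a. a) g"
    using i(2) g(2) by (auto intro!: semi_iso.intro semi_iso_axioms.intro)
qed

text \<open>The image of \<open>E\<close> is injective, hence a summand of \<open>L\<close>, and
  could be added to \<open>P\<close>, against maximality.\<close>

lemma no_embedding:
  assumes E: "lideal A E" "injective A (sub (regular_module A) E)" "E \<noteq> {\<zero>}"
    and g: "g \<in> module_hom A (sub (regular_module A) E) (sub (regular_module A) L)" "inj_on g E"
  shows False
proof -
  have mL: "left_module A (sub (regular_module A) L)" by (rule sub_regular_left_module[OF PL(2)])
  define F where "F = g ` E"
  note i = image_lideal_iso[OF E(1) g mL, folded F_def]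
  have F: "lideal A F" "F \<subseteq> L" using i(1) submodule_sub_regular_iff[OF PL(2)] by auto
  have injF: "injective A (sub (regular_module A) F)" using injective_iso[OF i(2) E(2)] by simp
  obtain Z where "internal_direct_sum A (sub (regular_module A) L) F Z"
    using left_module.injective_split[OF mL lideal_fg[OF PL(2)] E(2) g(1)] g(2) by (auto simp: F_def)
  then have Z: "lideal A Z" "Z \<subseteq> L" "F <+>\<^bsub>A\<^esub> Z = L" "F \<inter> Z = {\<zero>}"
    by (auto simp: internal_direct_sum_def submodule_sub_regular_iff[OF PL(2)])
  define P' where "P' = P <+>\<^bsub>A\<^esub> F"
  have P': "lideal A P'" "P \<subseteq> P'" "F \<subseteq> P'"
    unfolding P'_def using lideal_add[OF PL(1) F(1)] lideal_add_upper[OF PL(1) F(1)] by auto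
  have PF: "P \<inter> F = {\<zero>}" using PL(4) F(2) lidealD(2)[OF F(1)] lidealD(2)[OF PL(1)] by blast
  have "injective A (sub (regular_module A) P')"
    using left_module.injective_add[OF regular_left_module', of P F] PF PL(1,5) F(1) injF lideal_fg[OF P'(1)]
    by (simp add: P'_def submodule_regular_iff)
  moreover have "internal_direct_sum A (regular_module A) P' Z"
    unfolding internal_direct_sum_def submodule_regular_iff
  proof (intro conjI P'(1) Z(1))
    show "P' <+>\<^bsub>regular_module A\<^esub> Z = carrier (regular_module A)"
    proof -
      have LZ: "lideal A (P' <+>\<^bsub>A\<^esub> Z)" by (rule lideal_add[OF P'(1) Z(1)])
      note up = lideal_add_upper[OF P'(1) Z(1)]
      have "L \<subseteq> P' <+>\<^bsub>A\<^esub> Z" using lideal_add_least[OF LZ, of F Z] Z(3) up P'(3) by auto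
      then have "P <+>\<^bsub>A\<^esub> L \<subseteq> P' <+>\<^bsub>A\<^esub> Z" using lideal_add_least[OF LZ, of P L] P'(2) up by auto
      then show ?thesis using PL(3) lidealD(1)[OF LZ] by auto
    qed
    have "x = \<zero>" if x: "x \<in> P'" "x \<in> Z" for x
    proof -
      obtain p y where py: "p \<in> P" "y \<in> F" "x = p \<oplus> y" using x unfolding P'_def by (auto simp: mem_set_add)
      have c: "p \<in> carrier A" "y \<in> carrier A" using lidealD(3)[OF PL(1) py(1)] lidealD(3)[OF F(1) py(2)] .
      have "p = x \<ominus> y" using py(3) c by (simp add: add_diff_cancel)
      moreover have "x \<ominus> y \<in> L" using lideal_diff[OF PL(2)] x(2) Z(2) py(2) F(2) by auto
      ultimately have "p = \<zero>" using py(1) PL(4) by auto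
      then have "x = y" using py(3) c by simp
      then show ?thesis using py(2) x(2) Z(4) by auto
    qed
    then show "P' \<inter> Z = {\<zero>\<^bsub>regular_module A\<^esub>}" 
      unfolding regular_module_simps using lidealD(2)[OF P'(1)] lidealD(2)[OF Z(1)] by blast
  qed
  ultimately have "P' = P"
    using maximal P'(2) unfolding maximal_injective_summand_def injective_summand_def by blast
  then have F0: "F = {\<zero>}" using P'(3) PF lidealD(2)[OF F(1)] by auto
  have "g x = \<zero>" if "x \<in> E" for x using F0 that unfolding F_def by blast
  then have "x = \<zero>" if "x \<in> E" for x using g(2) lidealD(2)[OF E(1)] that by (metis inj_onD)
  then show False using E(3) lidealD(2)[OF E(1)] by blast
qed

lemma inj_on_smallest:
  assumes E: "lideal A E" and S: "S \<noteq> {\<zero>}" "\<And>Z. lideal A Z \<Longrightarrow> Z \<subseteq> E \<Longrightarrow> Z \<noteq> {\<zero>} \<Longrightarrow> S \<subseteq> Z"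
    and M: "left_module A M" and g: "g \<in> module_hom A (sub (regular_module A) E) M"
    and n: "\<exists>x\<in>S. g x \<noteq> \<zero>\<^bsub>M\<^esub>"
  shows "inj_on g E"
proof -
  interpret M: left_module A M by fact
  interpret E: left_module A "sub (regular_module A) E" by (rule sub_regular_left_module[OF E])
  have s: "submodule E A (sub (regular_module A) E)" using submodule_sub_regular_iff[OF E] E by simp
  interpret g: semi_epi A A "sub (regular_module A) E" "sub M (g ` E)" "\<lambda>a. a" g
    using module_hom_image(2)[OF E.left_module_axioms M g s] by simp
  have k: "lideal A g.ker" "g.ker \<subseteq> E" using g.submodule_ker submodule_sub_regular_iff[OF E] by auto
  have "g.ker = {\<zero>}" using S(2)[OF k] n by (auto simp: g.ker_def)
  then show ?thesis using g.inj_iff_ker by simp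
qed

text \<open>Right multiplication by \<open>m\<close>, followed by the projection to
  \<open>L\<close>, is a homomorphism from \<open>E\<close> to \<open>L\<close>. If it does not
  vanish at some element of \<open>S\<close>, its kernel does not contain \<open>S\<close> and is
  therefore zero, which \<open>no_embedding\<close> forbids.\<close>

lemma mult_into_P:
  assumes E: "lideal A E" "injective A (sub (regular_module A) E)" 
    and S: "S \<noteq> {\<zero>}" "S \<subseteq> E" "\<And>Z. lideal A Z \<Longrightarrow> Z \<subseteq> E \<Longrightarrow> Z \<noteq> {\<zero>} \<Longrightarrow> S \<subseteq> Z"
    and m: "m \<in> carrier A" and x: "x \<in> S"
  shows "x \<otimes> m \<in> P"
proof (rule ccontr)
  assume n: "x \<otimes> m \<notin> P"
  have ds: "internal_direct_sum A (regular_module A) L P"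
  proof -
    have "L <+>\<^bsub>A\<^esub> P = P <+>\<^bsub>A\<^esub> L"
      using lideal_add_least[OF lideal_add[OF PL(1,2)]] lideal_add_least[OF lideal_add[OF PL(2,1)]]
        lideal_add_upper[OF PL(1,2)] lideal_add_upper[OF PL(2,1)] by (simp add: subset_antisym)
    then show ?thesis using summands by (auto simp: internal_direct_sum_def)
  qed
  obtain f where f: "f \<in> module_hom A (regular_module A) (sub (regular_module A) L)"
    "\<And>x. x \<in> carrier A \<Longrightarrow> x \<ominus>\<^bsub>regular_module A\<^esub> f x \<in> P"
    using left_module.direct_sum_projection[OF regular_left_module' ds] by (metis regular_module_simps(1))
  have Ec: "y \<in> carrier A" if "y \<in> E" for y using lidealD(3)[OF E(1) that] .
  have "(\<lambda>y. y \<otimes> m) \<in> module_hom A (sub (regular_module A) E) (regular_module A)"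
    using Ec m by (intro module_homI) (auto simp: l_distr m_assoc)
  then have g: "(\<lambda>y. f (y \<otimes> m)) \<in> module_hom A (sub (regular_module A) E) (sub (regular_module A) L)"
    using module_hom_comp[OF _ f(1)] by blast
  have "f (x \<otimes> m) \<noteq> \<zero>"
  proof
    assume 0: "f (x \<otimes> m) = \<zero>"
    have xm: "x \<otimes> m \<in> carrier A" using Ec x S(2) m by auto
    interpret reg: left_module A "regular_module A" by (rule regular_left_module')
    have "x \<otimes> m \<ominus>\<^bsub>regular_module A\<^esub> \<zero> = x \<otimes> m"
      using xm reg.minus_zero by (simp add: a_minus_def)
    then show False using f(2)[OF xm] n 0 by simp
  qed
  then have "inj_on (\<lambda>y. f (y \<otimes> m)) E"
    using inj_on_smallest[OF E(1) S(1,3) sub_regular_left_module[OF PL(2)] g] x by auto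
  moreover have "E \<noteq> {\<zero>}" using S(1,2) x by (cases "S = {}") auto
  ultimately show False using no_embedding[OF E(1,2) _ g] by blast
qed

text \<open>A summand of \<open>P\<close> is also a summand of \<open>A\<close>, with complement
  \<open>K + L\<close>; so the hull is projective besides being injective.\<close>

lemma hull:
  assumes "covers A S {\<zero>}" "S \<subseteq> P"
  obtains E F where "lideal A E" "E \<subseteq> P" "injective A (sub (regular_module A) E)" "S \<subseteq> E"
    "\<And>Z. lideal A Z \<Longrightarrow> Z \<subseteq> E \<Longrightarrow> Z \<noteq> {\<zero>} \<Longrightarrow> S \<subseteq> Z"
    "internal_direct_sum A (regular_module A) E F"
proof -
  obtain E K where E: "lideal A E" "lideal A K" "E <+>\<^bsub>A\<^esub> K = P" "E \<inter> K = {\<zero>}" "S \<subseteq> E"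
    "\<And>Z. lideal A Z \<Longrightarrow> Z \<subseteq> E \<Longrightarrow> Z \<noteq> {\<zero>} \<Longrightarrow> S \<subseteq> Z"
    using injective_hull_summand[OF PL(1,5) assms] by metis
  have sub: "E \<subseteq> P" "K \<subseteq> P" using lideal_add_upper[OF E(1,2)] E(3) by auto
  have "internal_direct_sum A (sub (regular_module A) P) E K"
    unfolding internal_direct_sum_def submodule_sub_regular_iff[OF PL(1)] using E sub by simp
  then have inj: "injective A (sub (regular_module A) E)"
    using left_module.summand_injective[OF sub_regular_left_module[OF PL(1)] _ PL(5)] by simp
  have KL: "lideal A (K <+>\<^bsub>A\<^esub> L)" by (rule lideal_add[OF E(2) PL(2)])
  note up = lideal_add_upper[OF E(2) PL(2)] lideal_add_upper[OF E(1) KL]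
  have "internal_direct_sum A (regular_module A) E (K <+>\<^bsub>A\<^esub> L)"
    unfolding internal_direct_sum_def submodule_regular_iff
  proof (intro conjI E(1) KL)
    have T: "lideal A (E <+>\<^bsub>A\<^esub> (K <+>\<^bsub>A\<^esub> L))" by (rule lideal_add[OF E(1) KL])
    have "P \<subseteq> E <+>\<^bsub>A\<^esub> (K <+>\<^bsub>A\<^esub> L)" using lideal_add_least[OF T, of E K] E(3) up by auto
    then have "carrier A \<subseteq> E <+>\<^bsub>A\<^esub> (K <+>\<^bsub>A\<^esub> L)" using lideal_add_least[OF T, of P L] PL(3) up by auto
    then show "E <+>\<^bsub>regular_module A\<^esub> (K <+>\<^bsub>A\<^esub> L) = carrier (regular_module A)"
      using lidealD(1)[OF T] by auto
    have "x = \<zero>" if x: "x \<in> E" "x \<in> K <+>\<^bsub>A\<^esub> L" for x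
    proof -
      obtain k l where kl: "k \<in> K" "l \<in> L" "x = k \<oplus> l" using x by (auto simp: mem_set_add)
      have c: "k \<in> carrier A" "l \<in> carrier A" using lidealD(3)[OF E(2) kl(1)] lidealD(3)[OF PL(2) kl(2)] .
      have "l = x \<ominus> k" using kl(3) c by (simp add: a_comm[of k] add_diff_cancel)
      moreover have "x \<ominus> k \<in> P" using lideal_diff[OF PL(1)] x(1) kl(1) sub by auto
      ultimately have "l = \<zero>" using kl(2) PL(4) by auto
      then have "x = k" using kl(3) c by simp
      then show ?thesis using kl(1) x(1) E(4) by auto
    qed
    then show "E \<inter> (K <+>\<^bsub>A\<^esub> L) = {\<zero>\<^bsub>regular_module A\<^esub>}"
      unfolding regular_module_simps using lidealD(2)[OF E(1)] lidealD(2)[OF KL] by blast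
  qed
  then show ?thesis using that E sub inj by blast
qed

lemma simple_lideal_iff:
  assumes "lideal A S" shows "simple_module A (sub (regular_module A) S) \<longleftrightarrow> covers A S {\<zero>}"
proof -
  interpret left_module A "sub (regular_module A) S" by (rule sub_regular_left_module[OF assms])
  show ?thesis
    unfolding simple_iff_maximal maximal_submodule_def submodule_sub_regular_iff[OF assms] covers_def
    using assms lidealD(2)[OF assms] by (auto simp: lidealD(2))
qed

text \<open>Via \<open>soc_least\<close>, inclusions of \<open>soc\<close> in a left ideal are
  reduced to a single minimal left ideal \<open>S \<subseteq> P\<close>, for which
  \<open>hull\<close> supplies an injective module.\<close>

lemma soc_lideal: "lideal A soc" "soc \<subseteq> P"
  and soc_min: "\<And>S. covers A S {\<zero>} \<Longrightarrow> S \<subseteq> P \<Longrightarrow> S \<subseteq> soc"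
  and soc_least: "\<And>Z. lideal A Z \<Longrightarrow> (\<And>S. covers A S {\<zero>} \<Longrightarrow> S \<subseteq> P \<Longrightarrow> S \<subseteq> Z) \<Longrightarrow> soc \<subseteq> Z"
proof -
  interpret mP: left_module A "sub (regular_module A) P" by (rule sub_regular_left_module[OF PL(1)])
  let ?T = "{S. submodule S A (sub (regular_module A) P) \<and> simple_module A (sub (sub (regular_module A) P) S)}"
  have T: "S \<in> ?T \<longleftrightarrow> covers A S {\<zero>} \<and> S \<subseteq> P" for S
    using submodule_sub_regular_iff[OF PL(1)] simple_lideal_iff[of S] coversD(1)[of S "{\<zero>}"] by auto
  have TP: "\<Union>?T \<subseteq> carrier (sub (regular_module A) P)" using T by auto
  note g = mP.generated_submodule[OF TP, folded socle_def, folded soc_def]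
  show sl: "lideal A soc" "soc \<subseteq> P" using g(1) submodule_sub_regular_iff[OF PL(1)] by auto
  show "S \<subseteq> soc" if "covers A S {\<zero>}" "S \<subseteq> P" for S using g(2) T that by blast
  show "soc \<subseteq> Z" if Z: "lideal A Z" "\<And>S. covers A S {\<zero>} \<Longrightarrow> S \<subseteq> P \<Longrightarrow> S \<subseteq> Z" for Z
  proof -
    have "soc \<subseteq> Z \<inter> P"
      using g(3)[of "Z \<inter> P"] submodule_sub_regular_iff[OF PL(1)] lideal_Int[OF Z(1) PL(1)] Z(2) T by blast
    then show ?thesis by blast
  qed
qed

lemma minimal_image:
  assumes S: "covers A S {\<zero>}" and m: "m \<in> carrier A" and n: "(\<lambda>x. x \<otimes> m) ` S \<noteq> {\<zero>}"
  shows "covers A ((\<lambda>x. x \<otimes> m) ` S) {\<zero>}"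
  unfolding covers_def
proof (intro conjI allI impI)
  note S' = coversD[OF S]
  show l: "lideal A ((\<lambda>x. x \<otimes> m) ` S)" by (rule lideal_image[OF S'(1) m])
  show "{\<zero>} \<subset> (\<lambda>x. x \<otimes> m) ` S" using n lidealD(2)[OF l] by blast
  fix Z assume Z: "lideal A Z \<and> {\<zero>} \<subseteq> Z \<and> Z \<subseteq> (\<lambda>x. x \<otimes> m) ` S"
  have "{x \<in> S. x \<otimes> m \<in> Z} = {\<zero>} \<or> {x \<in> S. x \<otimes> m \<in> Z} = S"
  proof (rule S'(5)[OF lideal_vimage[OF S'(1) m]])
    show "lideal A Z" using Z by blast
    show "{\<zero>} \<subseteq> {x \<in> S. x \<otimes> m \<in> Z}" using Z m lidealD(2)[OF S'(1)] by auto
  qed auto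
  then show "Z = {\<zero>} \<or> Z = (\<lambda>x. x \<otimes> m) ` S"
  proof
    assume 0: "{x \<in> S. x \<otimes> m \<in> Z} = {\<zero>}"
    have "z = \<zero>" if z: "z \<in> Z" for z
    proof -
      obtain x where x: "x \<in> S" "z = x \<otimes> m" using Z z by blast
      then have "x = \<zero>" using 0 z by blast
      then show ?thesis using x m by simp
    qed
    then show ?thesis using Z by blast
  next
    assume "{x \<in> S. x \<otimes> m \<in> Z} = S"
    then show ?thesis using Z by blast
  qed
qed simp

text \<open>For a minimal \<open>S \<subseteq> P\<close> the left ideal \<open>S a\<close> is zero
  or minimal, and \<open>mult_into_P\<close> keeps it inside \<open>P\<close>.\<close>

lemma soc_mult: "x \<in> soc \<Longrightarrow> a \<in> carrier A \<Longrightarrow> x \<otimes> a \<in> soc"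
proof -
  assume x: "x \<in> soc" and a: "a \<in> carrier A"
  have "soc \<subseteq> {x \<in> carrier A. x \<otimes> a \<in> soc}"
  proof (rule soc_least)
    show "lideal A {x \<in> carrier A. x \<otimes> a \<in> soc}" by (rule lideal_vimage[OF lideal_carrier a soc_lideal(1)])
    fix S assume S: "covers A S {\<zero>}" "S \<subseteq> P"
    note S' = coversD[OF S(1)]
    obtain E F where E: "lideal A E" "injective A (sub (regular_module A) E)" "S \<subseteq> E"
      "\<And>Z. lideal A Z \<Longrightarrow> Z \<subseteq> E \<Longrightarrow> Z \<noteq> {\<zero>} \<Longrightarrow> S \<subseteq> Z" using hull[OF S] by metis
    have SP: "(\<lambda>x. x \<otimes> a) ` S \<subseteq> P" using mult_into_P[OF E(1,2) S'(4)[symmetric] E(3,4) a] by blast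
    have "(\<lambda>x. x \<otimes> a) ` S \<subseteq> soc"
    proof (cases "(\<lambda>x. x \<otimes> a) ` S = {\<zero>}")
      case True
      have "{\<zero>} \<subseteq> soc" using lidealD(2)[OF soc_lideal(1)] by simp
      then show ?thesis using True by metis
    qed (use soc_min[OF minimal_image[OF S(1) a] SP] in blast)
    then show "S \<subseteq> {x \<in> carrier A. x \<otimes> a \<in> soc}" using lidealD(3)[OF S'(1)] by blast
  qed
  then show ?thesis using x by blast
qed

lemma soc_ideal: "ideal soc A"
proof (rule idealI)
  show "ring A" by unfold_locales
  have m: "\<ominus> x \<in> soc" if "x \<in> soc" for x using lideal_minus[OF soc_lideal(1) that] .
  show "subgroup soc (add_monoid A)"
    using lidealD[OF soc_lideal(1)] m by (intro subgroup.intro) (auto simp: a_inv_def)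
qed (use soc_mult lidealD(5)[OF soc_lideal(1)] in auto)

text \<open>If a minimal \<open>S \<subseteq> P\<close> does not kill \<open>m\<close>, then
  \<open>y \<mapsto> y m\<close> is injective on the hull \<open>E\<close> of \<open>S\<close>. Its
  image is a nonzero summand of the indecomposable \<open>M\<close>, so \<open>M\<close> is
  isomorphic to the projective-injective \<open>E\<close>.\<close>

lemma soc_annihilates:
  assumes M: "fg_module A M" "indecomposable A M" "\<not> (projective A M \<and> injective A M)"
  shows "annihilates soc M"
proof -
  interpret M: left_module A M using M(1) by (simp add: fg_module_def)
  have "x \<odot>\<^bsub>M\<^esub> m = \<zero>\<^bsub>M\<^esub>" if x: "x \<in> soc" and m: "m \<in> carrier M" for x m
  proof -
    have "soc \<subseteq> {x \<in> carrier A. x \<odot>\<^bsub>M\<^esub> m = \<zero>\<^bsub>M\<^esub>}"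
    proof (rule soc_least)
      show "lideal A {x \<in> carrier A. x \<odot>\<^bsub>M\<^esub> m = \<zero>\<^bsub>M\<^esub>}"
        unfolding lideal_def using m by (auto simp: M.smult_l_distr M.smult_assoc)
      fix S assume S: "covers A S {\<zero>}" "S \<subseteq> P"
      note S' = coversD[OF S(1)]
      obtain E F where E: "lideal A E" "injective A (sub (regular_module A) E)" "S \<subseteq> E"
        "\<And>Z. lideal A Z \<Longrightarrow> Z \<subseteq> E \<Longrightarrow> Z \<noteq> {\<zero>} \<Longrightarrow> S \<subseteq> Z" "internal_direct_sum A (regular_module A) E F"
        using hull[OF S] by metis
      have g: "(\<lambda>y. y \<odot>\<^bsub>M\<^esub> m) \<in> module_hom A (sub (regular_module A) E) M"
        using m lidealD(3)[OF E(1)] by (intro module_homI) (auto simp: M.smult_l_distr M.smult_assoc)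
      show "S \<subseteq> {x \<in> carrier A. x \<odot>\<^bsub>M\<^esub> m = \<zero>\<^bsub>M\<^esub>}"
      proof (rule ccontr)
        assume n: "\<not> ?thesis"
        then have nz: "\<exists>x\<in>S. x \<odot>\<^bsub>M\<^esub> m \<noteq> \<zero>\<^bsub>M\<^esub>" using lidealD(3)[OF S'(1)] by blast
        have inj: "inj_on (\<lambda>y. y \<odot>\<^bsub>M\<^esub> m) E"
          by (rule inj_on_smallest[OF E(1) S'(4)[symmetric] E(4) M.left_module_axioms g nz])
        let ?g = "\<lambda>y. y \<odot>\<^bsub>M\<^esub> m"
        obtain Z where Z: "internal_direct_sum A M (?g ` E) Z"
          using M.injective_split[OF M(1) E(2) g] inj by auto
        have "?g ` E \<noteq> {\<zero>\<^bsub>M\<^esub>}" using nz E(3) by blast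
        then have "Z = {\<zero>\<^bsub>M\<^esub>}" using M(2) Z unfolding indecomposable_def by blast
        then have "?g ` E = carrier M"
          using Z m lidealD(3)[OF E(1)] unfolding internal_direct_sum_def set_eq_iff mem_set_add by (auto simp: image_iff)
        then have iso: "semi_iso A A (sub (regular_module A) E) M (\<lambda>a. a) ?g"
          using image_lideal_iso(2)[OF E(1) g inj M.left_module_axioms] by simp
        obtain \<epsilon> where "\<epsilon> \<in> carrier A" "\<epsilon> \<otimes> \<epsilon> = \<epsilon>" "E = lprinc A \<epsilon>" using summand_idempotent[OF E(5)] by blast
        then have "projective A (sub (regular_module A) E)" using lprinc_projective by blast
        then show False using M(3) projective_iso[OF iso] injective_iso[OF iso E(2)] by blast
      qed
    qed
    then show ?thesis using x by blast
  qed
  then show ?thesis by (auto simp: annihilates_def)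
qed

text \<open>If \<open>S e\<close> is nonzero, right multiplication by \<open>e\<close> is injective
  on the hull \<open>E\<close> of \<open>S\<close>, and its image is a summand of the indecomposable
  \<open>A e\<close>. So it is an isomorphism from \<open>E\<close> to \<open>A e\<close>, and it
  carries the property that \<open>S\<close> lies in every nonzero submodule over to
  \<open>S e\<close>.\<close>

lemma soc_left_smallest:
  assumes e: "primitive A e" and Z: "lideal A Z" "Z \<subseteq> lprinc A e" "Z \<noteq> {\<zero>}" and x: "x \<in> soc"
  shows "x \<otimes> e \<in> Z"
proof -
  note e' = primitiveD[OF e]
  have Le: "lideal A (lprinc A e)" using e' by simp
  have "soc \<subseteq> {x \<in> carrier A. x \<otimes> e \<in> Z}"
  proof (rule soc_least)
    show "lideal A {x \<in> carrier A. x \<otimes> e \<in> Z}" by (rule lideal_vimage[OF lideal_carrier e'(1) Z(1)])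
    fix S assume S: "covers A S {\<zero>}" "S \<subseteq> P"
    note S' = coversD[OF S(1)]
    show "S \<subseteq> {x \<in> carrier A. x \<otimes> e \<in> Z}"
    proof (cases "\<exists>x\<in>S. x \<otimes> e \<noteq> \<zero>")
      case False
      then show ?thesis using lidealD(2)[OF Z(1)] lidealD(3)[OF S'(1)] by auto
    next
      case True
      obtain E F where E: "lideal A E" "injective A (sub (regular_module A) E)" "S \<subseteq> E"
        "\<And>Z. lideal A Z \<Longrightarrow> Z \<subseteq> E \<Longrightarrow> Z \<noteq> {\<zero>} \<Longrightarrow> S \<subseteq> Z" using hull[OF S] by metis
      have mLe: "left_module A (sub (regular_module A) (lprinc A e))" by (rule sub_regular_left_module[OF Le])
      let ?g = "\<lambda>x. x \<otimes> e"
      have g: "?g \<in> module_hom A (sub (regular_module A) E) (sub (regular_module A) (lprinc A e))"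
        using lidealD(3)[OF E(1)] by (intro regular_hom[OF E(1) Le e'(1)] lprincI)
      have inj: "inj_on ?g E"
        by (rule inj_on_smallest[OF E(1) S'(4)[symmetric] E(4) mLe g]) (use True in auto)
      obtain W where W: "internal_direct_sum A (sub (regular_module A) (lprinc A e)) (?g ` E) W"
        using left_module.injective_split[OF mLe lideal_fg[OF Le] E(2) g] inj by auto
      have "?g ` E \<noteq> {\<zero>}" using True E(3) by blast
      then have "W = {\<zero>}" using lprinc_indecomposable[OF e] W unfolding indecomposable_def by auto
      then have gE: "?g ` E = lprinc A e"
        using W e' lidealD(3)[OF E(1)] unfolding internal_direct_sum_def set_eq_iff mem_set_add by (auto simp: image_iff)
      define V where "V = {x \<in> E. x \<otimes> e \<in> Z}"
      have V: "lideal A V" "V \<subseteq> E" unfolding V_def using lideal_vimage[OF E(1) e'(1) Z(1)] by auto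
      obtain z where z: "z \<in> Z" "z \<noteq> \<zero>" using Z(3) lidealD(2)[OF Z(1)] by blast
      obtain y where y: "y \<in> E" "z = y \<otimes> e" using gE Z(2) z(1) by blast
      have "y \<noteq> \<zero>" using z(2) y(2) e' by auto
      moreover have "y \<in> V" using y z unfolding V_def by blast
      ultimately have "S \<subseteq> V" using E(4)[OF V] by blast
      then show ?thesis using lidealD(3)[OF S'(1)] unfolding V_def by blast
    qed
  qed
  then show ?thesis using x by blast
qed

text \<open>\<open>A e\<close> is injective with smallest left ideal \<open>A s\<close>, so
  \<open>mult_into_P\<close> with \<open>m = \<one>\<close> puts \<open>A s\<close> into
  \<open>P\<close>, where it is a minimal left ideal.\<close>

lemma ipair_soc:
  assumes p: "ipair e f s" shows "s \<in> soc"
proof -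
  note p' = ipairD[OF p]
  have S: "covers A (lprinc A s) {\<zero>}" by (rule smallest_covers[OF p'(7,3)])
  have sm: "lprinc A s \<noteq> {\<zero>}" "lprinc A s \<subseteq> lprinc A e"
    "\<And>Z. lideal A Z \<Longrightarrow> Z \<subseteq> lprinc A e \<Longrightarrow> Z \<noteq> {\<zero>} \<Longrightarrow> lprinc A s \<subseteq> Z"
    using p'(7) unfolding smallest_lideal_def by auto
  have Le: "lideal A (lprinc A e)" using p' by simp
  have "x \<in> P" if x: "x \<in> lprinc A s" for x
    using mult_into_P[OF Le ipair_injective[OF p] sm one_closed x] x lidealD(3)[OF lideal_lprinc[OF p'(3)]] by simp
  then have "lprinc A s \<subseteq> soc" using soc_min[OF S] by blast
  then show ?thesis using p'(3) by auto
qed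

text \<open>Two incomparable submodules would produce a pair by \<open>colocal_ipair\<close>, and
  its \<open>s = s \<otimes> e\<close> would be a nonzero element of \<open>soc\<close> not killed
  by \<open>e\<close>.\<close>

lemma soc_left_uniserial:
  assumes e: "primitive A e" and kill: "\<And>x. x \<in> soc \<Longrightarrow> x \<otimes> e = \<zero>"
    and S: "smallest_lideal A S (lprinc A e)"
    and N: "lideal A N" "N \<subseteq> lprinc A e" and K: "lideal A K" "K \<subseteq> lprinc A e"
  shows "N \<subseteq> K \<or> K \<subseteq> N"
proof (rule ccontr)
  assume n: "\<not> ?thesis"
  note e' = primitiveD[OF e]
  have S': "lideal A S" "S \<noteq> {\<zero>}" "S \<subseteq> lprinc A e"
    "\<And>Z. lideal A Z \<Longrightarrow> Z \<subseteq> lprinc A e \<Longrightarrow> Z \<noteq> {\<zero>} \<Longrightarrow> S \<subseteq> Z"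
    using S unfolding smallest_lideal_def by auto
  obtain s0 where s0: "s0 \<in> S" "s0 \<noteq> \<zero>" using S'(2) lidealD(2)[OF S'(1)] by blast
  have s0c: "s0 \<in> carrier A" "s0 \<otimes> e = s0" using s0(1) S'(3) e' by (auto simp: lprinc_idem)
  \<comment> \<open>The partner \<open>f\<close> of \<open>e\<close> is found on the other side of a
    socle element: some primitive idempotent does not kill \<open>s0\<close> from the left.\<close>
  have "\<exists>f. primitive A f \<and> f \<otimes> s0 \<noteq> \<zero>"
  proof (rule ccontr)
    assume "\<not> ?thesis"
    then have "s0 \<in> {\<zero>}" by (intro decomp_left[OF s0c(1)]) auto
    with s0(2) show False by simp
  qed
  then obtain f where f: "primitive A f" "f \<otimes> s0 \<noteq> \<zero>" by blast
  note f' = primitiveD[OF f(1)]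
  define s where "s = f \<otimes> s0"
  have s: "s \<in> carrier A" "f \<otimes> s = s" "s \<otimes> e = s" "s \<noteq> \<zero>" "s \<in> S"
    unfolding s_def using f f' s0c e' lidealD(5)[OF S'(1) f'(1) s0(1)]
    by (auto simp: m_assoc) (simp flip: m_assoc)
  have "smallest_lideal A (lprinc A s) (lprinc A e)"
  proof (rule smallest_lidealI[OF s(1,4)])
    show "lprinc A s \<subseteq> lprinc A e" using lprinc_subset[OF S'(1) s(5)] S'(3) by blast
    show "s \<in> lprinc A y" if y: "y \<in> lprinc A e" "y \<noteq> \<zero>" for y
    proof -
      have yc: "y \<in> carrier A" using y e' by (simp add: lprinc_idem)
      have "lprinc A y \<noteq> {\<zero>}" using y(2) lprinc_self[OF yc] by auto
      then have "S \<subseteq> lprinc A y" using S'(4)[OF lideal_lprinc[OF yc] lprinc_subset[OF _ y(1)]] e' by simp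
      then show ?thesis using s(5) by blast
    qed
  qed (use e' in simp)
  then have "ipair e f s" using colocal_ipair[OF e f(1) s(1,2,3) _ N K] n by blast
  then have "s \<in> soc" by (rule ipair_soc)
  then show False using kill s(3,4) by simp
qed

text \<open>This is not the mirror image of \<open>soc_left_smallest\<close>, because
  \<open>soc\<close> is built from left ideals. Instead, \<open>f \<otimes> (a \<otimes> y)\<close>
  with \<open>y\<close> in a minimal \<open>S\<close> lies in an injective left ideal and is killed
  by the radical, so by the converse of Fuller's theorem it is a right multiple of any nonzero
  element of \<open>f A\<close>.\<close>

lemma soc_right_smallest:
  assumes f: "primitive A f" and Z: "rideal A Z" "Z \<subseteq> rprinc A f" "Z \<noteq> {\<zero>}" and x: "x \<in> soc"
  shows "f \<otimes> x \<in> Z"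
proof -
  interpret op: qring "opposite_ring A" C by (rule qring_opposite)
  note f' = primitiveD[OF f] and Z' = lidealD[OF Z(1), simplified]
  obtain z where z: "z \<in> Z" "z \<noteq> \<zero>" using Z(3) Z'(2) by auto
  have zc: "z \<in> carrier A" "f \<otimes> z = z" using z(1) Z(2) op.lprinc_idem[of f z] f' by auto
  \<comment> \<open>Quantifying over \<open>a\<close> turns the condition into a left ideal, as
    \<open>soc_least\<close> requires; \<open>a = \<one>\<close> is used in the end.\<close>
  have "soc \<subseteq> {x \<in> carrier A. \<forall>a\<in>carrier A. f \<otimes> (a \<otimes> x) \<in> Z}"
  proof (rule soc_least)
    show "lideal A {x \<in> carrier A. \<forall>a\<in>carrier A. f \<otimes> (a \<otimes> x) \<in> Z}"
      unfolding lideal_def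
    proof (intro conjI ballI CollectI)
      fix a x b assume "x \<in> {x \<in> carrier A. \<forall>a\<in>carrier A. f \<otimes> (a \<otimes> x) \<in> Z}" "a \<in> carrier A" "b \<in> carrier A"
      then show "f \<otimes> (b \<otimes> (a \<otimes> x)) \<in> Z" by (auto simp flip: m_assoc[of b a])
    qed (use f' Z'(2,4) in \<open>auto simp: r_distr\<close>)
    fix S assume S: "covers A S {\<zero>}" "S \<subseteq> P"
    note S' = coversD[OF S(1)]
    obtain E F where E: "lideal A E" "injective A (sub (regular_module A) E)" "S \<subseteq> E" using hull[OF S] by metis
    have "f \<otimes> (a \<otimes> y) \<in> Z" if y: "y \<in> S" and a: "a \<in> carrier A" for y a
    proof -
      have yc: "y \<in> carrier A" using lidealD(3)[OF S'(1) y] .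
      have s: "f \<otimes> (a \<otimes> y) \<in> S" using lidealD(5)[OF S'(1)] f' a y by blast
      have "j \<otimes> (f \<otimes> (a \<otimes> y)) = \<zero>" if "j \<in> jac A" for j
        using covers_jac[OF S(1) that s] by simp
      moreover have "f \<otimes> (f \<otimes> (a \<otimes> y)) = f \<otimes> (a \<otimes> y)" using f' a yc by (simp flip: m_assoc)
      ultimately obtain c where "c \<in> carrier A" "f \<otimes> (a \<otimes> y) = z \<otimes> c"
        using injective_right_smallest[OF E(1,2) f _ _ _ zc z(2), of "f \<otimes> (a \<otimes> y)"] s E(3) by blast
      then show ?thesis using Z'(5)[of c z] z(1) by simp
    qed
    then show "S \<subseteq> {x \<in> carrier A. \<forall>a\<in>carrier A. f \<otimes> (a \<otimes> x) \<in> Z}" using lidealD(3)[OF S'(1)] by blast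
  qed
  then have "f \<otimes> (\<one> \<otimes> x) \<in> Z" using x by blast
  then show ?thesis using lidealD(3)[OF soc_lideal(1) x] by simp
qed

text \<open>\<open>colocal_ipair\<close> in the opposite ring yields the pair with both entries
  exchanged; pairs are symmetric, so \<open>ipair_soc\<close> still applies.\<close>

lemma soc_right_uniserial:
  assumes f: "primitive A f" and kill: "\<And>x. x \<in> soc \<Longrightarrow> f \<otimes> x = \<zero>"
    and S: "smallest_lideal (opposite_ring A) S (rprinc A f)"
    and N: "rideal A N" "N \<subseteq> rprinc A f" and K: "rideal A K" "K \<subseteq> rprinc A f"
  shows "N \<subseteq> K \<or> K \<subseteq> N"
proof (rule ccontr)
  assume n: "\<not> ?thesis"
  interpret op: qring "opposite_ring A" C by (rule qring_opposite)
  note f' = primitiveD[OF f]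
  have S': "rideal A S" "S \<noteq> {\<zero>}" "S \<subseteq> rprinc A f"
    "\<And>Z. rideal A Z \<Longrightarrow> Z \<subseteq> rprinc A f \<Longrightarrow> Z \<noteq> {\<zero>} \<Longrightarrow> S \<subseteq> Z"
    using S unfolding smallest_lideal_def by auto
  note SD = lidealD[OF S'(1), simplified]
  obtain s0 where s0: "s0 \<in> S" "s0 \<noteq> \<zero>" using S'(2) SD(2) by blast
  have s0c: "s0 \<in> carrier A" "f \<otimes> s0 = s0" using s0(1) S'(3) op.lprinc_idem[of f s0] f' by auto
  have "\<exists>e. primitive A e \<and> s0 \<otimes> e \<noteq> \<zero>"
  proof (rule ccontr)
    assume "\<not> ?thesis"
    then have "s0 \<in> {\<zero>}" by (intro decomp_right[OF s0c(1)]) auto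
    with s0(2) show False by simp
  qed
  then obtain e where e: "primitive A e" "s0 \<otimes> e \<noteq> \<zero>" by blast
  note e' = primitiveD[OF e(1)]
  define s where "s = s0 \<otimes> e"
  have s: "s \<in> carrier A" "f \<otimes> s = s" "s \<otimes> e = s" "s \<noteq> \<zero>" "s \<in> S"
    unfolding s_def using e e' s0c f' SD(5)[OF e'(1) s0(1)]
    by (auto simp: m_assoc) (simp flip: m_assoc)
  have sm: "smallest_lideal (opposite_ring A) (rprinc A s) (rprinc A f)"
  proof (rule op.smallest_lidealI)
    show "s \<in> carrier (opposite_ring A)" "s \<noteq> \<zero>\<^bsub>opposite_ring A\<^esub>" using s by auto
    show "rprinc A s \<subseteq> rprinc A f" using op.lprinc_subset[OF S'(1) s(5)] S'(3) by blast
    show "s \<in> rprinc A y" if y: "y \<in> rprinc A f" "y \<noteq> \<zero>\<^bsub>opposite_ring A\<^esub>" for y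
    proof -
      have yc: "y \<in> carrier A" using y op.lprinc_idem[of f y] f' by simp
      have "y \<in> rprinc A y" using op.lprinc_self[of y] yc by simp
      then have "rprinc A y \<noteq> {\<zero>}" using y(2) unfolding opposite_ring_simps by blast
      moreover have "rideal A (rprinc A y)" "rprinc A y \<subseteq> rprinc A f"
        using op.lideal_lprinc[of y] op.lprinc_subset[OF op.lideal_lprinc y(1)] yc f' by auto
      ultimately have "S \<subseteq> rprinc A y" using S'(4) by blast
      then show ?thesis using s(5) by blast
    qed
    show "rideal A (rprinc A f)" using op.lideal_lprinc[of f] f' by simp
  qed
  have "op.ipair f e s" using op.colocal_ipair[of f e s N K] f e(1) s sm N K n by simp
  then have "ipair e f s" using qring.ipair_op[OF qring_opposite] by simp
  then have "s \<in> soc" by (rule ipair_soc)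
  then show False using kill s(2,4) by simp
qed

text \<open>Cut into pieces \<open>f \<otimes> x \<otimes> y \<otimes> z \<otimes> e\<close>, each
  of which is zero or completes \<open>(e, f)\<close> to a pair.\<close>

lemma jac_cubed_soc:
  assumes "x \<in> jac A" "y \<in> jac A" "z \<in> jac A" shows "x \<otimes> y \<otimes> z \<in> soc"
proof -
  have c: "x \<in> carrier A" "y \<in> carrier A" "z \<in> carrier A" using assms jac_carrier by auto
  note sl = lidealD[OF soc_lideal(1)]
  show ?thesis
  proof (rule decomp_right[OF _ sl(2,4)])
    fix e assume e: "primitive A e"
    note e' = primitiveD[OF e]
    show "x \<otimes> y \<otimes> z \<otimes> e \<in> soc"
    proof (rule decomp_left[OF _ sl(2,4)])
      fix f assume f: "primitive A f"
      note f' = primitiveD[OF f]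
      have eq: "f \<otimes> (x \<otimes> y \<otimes> z \<otimes> e) = f \<otimes> x \<otimes> y \<otimes> z \<otimes> e" using c e' f' by (simp add: m_assoc)
      show "f \<otimes> (x \<otimes> y \<otimes> z \<otimes> e) \<in> soc"
      proof (cases "f \<otimes> x \<otimes> y \<otimes> z \<otimes> e = \<zero>")
        case True then show ?thesis using eq sl(2) by simp
      next
        case False
        then show ?thesis using eq ipair_soc[OF loewy_ipair[OF e f assms refl False]] by simp
      qed
    qed (use c e' in auto)
  qed (use c in auto)
qed

end

section \<open>Passing to the quotient algebra\<close>

lemma (in semi_epi) smono_image:
  assumes d: "smono A M d"
  shows "smono B X (\<lambda>K. d {x \<in> carrier M. h x \<in> K})"
  unfolding smono_def
proof (intro allI impI)
  fix N K assume NK: "submodule N B X \<and> submodule K B X \<and> N \<subset> K"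
  have "{x \<in> carrier M. h x \<in> N} \<noteq> {x \<in> carrier M. h x \<in> K}"
    using image_vimage[of N] image_vimage[of K] X.submoduleD(1) NK by (metis psubset_eq)
  then show "d {x \<in> carrier M. h x \<in> N} < d {x \<in> carrier M. h x \<in> K}"
    using NK vimage_submodule by (intro smonoD[OF d]) blast+
qed

context ideal
begin

lemma quotient_map: "(\<lambda>a. I +> a) ` carrier R = carrier (R Quot I)" "(\<lambda>a. I +> a) \<in> ring_hom R (R Quot I)"
  "ring (R Quot I)"
  using rcos_ring_hom quotient_is_ring by (auto simp: FactRing_def A_RCOSETS_def')

lemma quotient_map_zero: "a \<in> carrier R \<Longrightarrow> I +> a = \<zero>\<^bsub>R Quot I\<^esub> \<longleftrightarrow> a \<in> I"
  using a_rcos_const a_rcos_self[of a] by (auto simp: FactRing_def)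

lemma lideal_I: "lideal R I"
  using a_Hcarr I_l_closed additive_subgroup.zero_closed[OF additive_subgroup_axioms]
    additive_subgroup.a_closed[OF additive_subgroup_axioms] by (auto simp: lideal_def)

end

lemma pullback_fg:
  assumes X: "fg_module B X" and A: "ring A" and p: "p ` carrier A = carrier B" "p \<in> ring_hom A B"
  shows "fg_module A (pullback p X)"
proof -
  have lX: "left_module B X" using X by (simp add: fg_module_def)
  interpret s: semi_iso A B "pullback p X" X p "\<lambda>x. x" by (rule pullback_iso[OF lX A p])
  obtain S where S: "finite S" "S \<subseteq> carrier X" "generated_submodule B X S = carrier X"
    using X unfolding fg_module_def finitely_generated_def by blast
  have "generated_submodule A (pullback p X) S = carrier X" using s.generated_iso[of S] S by simp
  then have "finitely_generated A (pullback p X)" unfolding finitely_generated_def using S by auto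
  then show ?thesis using s.M by (simp add: fg_module_def)
qed

context qring
begin

text \<open>The injective envelope over \<open>A Quot I\<close> is the submodule \<open>E'\<close>
  of elements of \<open>E\<close> killed by \<open>I\<close>. Its submodules are submodules of
  \<open>E\<close>, so uniseriality and essentiality are inherited.\<close>

lemma uniserial_envelope_quotient:
  fixes M :: "('a, 'm) module" and X :: "('a set, 'n) module"
  assumes I: "ideal I A" and MX: "semi_iso A (A Quot I) M X (\<lambda>a. I +>\<^bsub>A\<^esub> a) h" and env: "uniserial_envelope A M"
  shows "uniserial_envelope (A Quot I) X"
proof -
  interpret I: ideal I A by (rule I)
  let ?B = "A Quot I" and ?p = "\<lambda>a. I +>\<^bsub>A\<^esub> a"
  note p = I.quotient_map
  interpret MX: semi_iso A ?B M X ?p h by (rule MX)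
  obtain E :: "'a cmod" and f where E: "injective A E" "f \<in> module_hom A M E" "inj_on f (carrier M)"
    "\<And>N. submodule N A E \<Longrightarrow> N \<inter> f ` carrier M = {\<zero>\<^bsub>E\<^esub>} \<Longrightarrow> N = {\<zero>\<^bsub>E\<^esub>}" "uniserial A E"
    using env unfolding uniserial_envelope_def injective_envelope_def by blast
  have Efg: "fg_module A E" using E(1) by (simp add: injective_def)
  then interpret E: left_module A E by (simp add: fg_module_def)
  define E' where "E' = {x \<in> carrier E. \<forall>a\<in>I. a \<odot>\<^bsub>E\<^esub> x = \<zero>\<^bsub>E\<^esub>}"
  have Ic: "a \<in> carrier A" if "a \<in> I" for a using that I.a_Hcarr by blast
  have E': "submodule E' A E" unfolding E.submodule_iff E'_def
    using Ic I.I_r_closed by (auto simp: E.smult_r_distr simp flip: E.smult_assoc)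
  have kill: "x \<in> E'" if "x \<in> carrier E" "\<And>a. a \<in> I \<Longrightarrow> a \<odot>\<^bsub>E\<^esub> x = \<zero>\<^bsub>E\<^esub>" for x using that by (simp add: E'_def)
  \<comment> \<open>A coset acts through an arbitrary representative; \<open>sm\<close> shows that
    the choice does not matter, since \<open>I\<close> kills \<open>E'\<close>.\<close>
  define EB :: "('a set, (nat \<Rightarrow> 'a) set) module" where
    "EB = \<lparr>carrier = E', mult = mult E, one = one E, zero = zero E, add = add E,
      smult = (\<lambda>b x. (SOME a. a \<in> carrier A \<and> ?p a = b) \<odot>\<^bsub>E\<^esub> x)\<rparr>"
  have EBs: "carrier EB = E'" "\<zero>\<^bsub>EB\<^esub> = \<zero>\<^bsub>E\<^esub>" "\<And>x y. x \<oplus>\<^bsub>EB\<^esub> y = x \<oplus>\<^bsub>E\<^esub> y" by (simp_all add: EB_def)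
  have sm: "?p a \<odot>\<^bsub>EB\<^esub> x = a \<odot>\<^bsub>E\<^esub> x" if a: "a \<in> carrier A" and x: "x \<in> E'" for a x
  proof -
    define a' where "a' = (SOME a'. a' \<in> carrier A \<and> ?p a' = ?p a)"
    have a': "a' \<in> carrier A" "?p a' = ?p a"
      using someI_ex[of "\<lambda>a'. a' \<in> carrier A \<and> ?p a' = ?p a"] a unfolding a'_def by blast+
    interpret B: ring ?B by (rule p(3))
    have "?p (a' \<ominus> a) \<oplus>\<^bsub>?B\<^esub> ?p a = ?p a"
      using ring_hom_memE(3)[OF p(2), of "a' \<ominus> a" a] a a' by (simp add: diff_add_cancel)
    then have "?p (a' \<ominus> a) = \<zero>\<^bsub>?B\<^esub>"
      using ring_hom_memE(1)[OF p(2)] a a' by simp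
    then have "a' \<ominus> a \<in> I" using I.quotient_map_zero a a' by simp
    then have "(a' \<ominus> a) \<odot>\<^bsub>E\<^esub> x = \<zero>\<^bsub>E\<^esub>" using x by (simp add: E'_def)
    moreover have xc: "x \<in> carrier E" using x by (simp add: E'_def)
    moreover have "a' \<odot>\<^bsub>E\<^esub> x = ((a' \<ominus> a) \<oplus> a) \<odot>\<^bsub>E\<^esub> x" using a a' by (simp add: diff_add_cancel)
    ultimately have "a' \<odot>\<^bsub>E\<^esub> x = a \<odot>\<^bsub>E\<^esub> x" using a a' by (simp add: E.smult_l_distr)
    then show ?thesis by (simp add: EB_def a'_def)
  qed
  have "semi_epi A ?B (sub E E') EB ?p (\<lambda>x. x)"
    using ring_hom_memE[OF p(2)] p
    by (intro left_module_image[OF E.sub_left_module[OF E'] p(3)]) (simp_all add: EBs sm)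
  then interpret EB: semi_iso A ?B "sub E E'" EB ?p "\<lambda>x. x"
    by (intro semi_iso.intro semi_iso_axioms.intro) auto
  obtain dE where dE: "smono A E dE" using fg_smono[OF Efg] by blast
  have "fg_module A (sub E E')" using E.smono_finitely_generated[OF dE E'] E.sub_left_module[OF E'] by (simp add: fg_module_def)
  then have EBfg: "fg_module ?B EB" by (rule EB.fg_image)
  have injEB: "injective ?B EB" unfolding injective_def
  proof (intro conjI allI impI ballI EBfg)
    fix Y Z :: "'a set cmod" and g k
    assume YZ: "fg_module ?B Y \<and> fg_module ?B Z" and g: "g \<in> module_hom ?B Y Z" "inj_on g (carrier Y)"
      and k: "k \<in> module_hom ?B Y EB"
    interpret Y: left_module ?B Y using YZ by (simp add: fg_module_def)
    interpret Z: left_module ?B Z using YZ by (simp add: fg_module_def)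
    have fg: "fg_module A (pullback ?p Y)" "fg_module A (pullback ?p Z)"
      using pullback_fg[OF _ local.ring_axioms p(1,2)] YZ by auto
    have pc: "?p a \<in> carrier ?B" if "a \<in> carrier A" for a using p(1) that by blast
    have g': "g \<in> module_hom A (pullback ?p Y) (pullback ?p Z)"
      using module_homD[OF g(1)] pc by (intro module_homI) auto
    have k': "k \<in> module_hom A (pullback ?p Y) E"
      using module_homD[OF k] pc E.submoduleD(3)[OF E'] sm by (intro module_homI) (auto simp: EBs)
    \<comment> \<open>The extension problem is solved over \<open>A\<close> with values in
      \<open>E\<close>. As \<open>I\<close> kills the module \<open>Z\<close>, the values lie in
      \<open>E'\<close>.\<close>
    obtain l where l: "l \<in> module_hom A (pullback ?p Z) E" "\<forall>y\<in>carrier Y. l (g y) = k y"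
      using injectiveD[OF E(1) fg g' _ k'] g(2) by auto
    note lD = module_homD[OF l(1), simplified]
    have lE: "l z \<in> E'" if z: "z \<in> carrier Z" for z
    proof (rule kill)
      show "l z \<in> carrier E" using lD(1)[OF z] .
      fix a assume a: "a \<in> I"
      have "?p a = \<zero>\<^bsub>?B\<^esub>" using I.quotient_map_zero[OF Ic[OF a]] a by simp
      then have "a \<odot>\<^bsub>E\<^esub> l z = l \<zero>\<^bsub>Z\<^esub>" using lD(3)[OF Ic[OF a] z] z by simp
      moreover have "l \<zero>\<^bsub>Z\<^esub> \<oplus>\<^bsub>E\<^esub> l \<zero>\<^bsub>Z\<^esub> = l \<zero>\<^bsub>Z\<^esub>" using lD(2)[of "\<zero>\<^bsub>Z\<^esub>" "\<zero>\<^bsub>Z\<^esub>"] by simp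
      then have "l \<zero>\<^bsub>Z\<^esub> = \<zero>\<^bsub>E\<^esub>" using lD(1)[of "\<zero>\<^bsub>Z\<^esub>"] E.M.add.r_cancel_one by simp
      ultimately show "a \<odot>\<^bsub>E\<^esub> l z = \<zero>\<^bsub>E\<^esub>" by simp
    qed
    have "l \<in> module_hom ?B Z EB"
    proof (rule module_homI)
      fix b z assume b: "b \<in> carrier ?B" and z: "z \<in> carrier Z"
      obtain a where a: "a \<in> carrier A" "b = ?p a" using b p(1) by blast
      show "l (b \<odot>\<^bsub>Z\<^esub> z) = b \<odot>\<^bsub>EB\<^esub> l z" using lD(3)[OF a(1) z] sm[OF a(1) lE[OF z]] a(2) by simp
    qed (use lE lD in \<open>auto simp: EBs\<close>)
    then show "\<exists>l\<in>module_hom ?B Z EB. \<forall>y\<in>carrier Y. l (g y) = k y" using l(2) by blast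
  qed
  obtain EC :: "'a set cmod" and t where EC: "semi_iso ?B ?B EB EC (\<lambda>b. b) t"
    using cmod_copy[OF EBfg] by metis
  interpret EC: semi_iso ?B ?B EB EC "\<lambda>b. b" t by (rule EC)
  have injEC: "injective ?B EC" by (rule injective_iso[OF EC injEB])
  have uniEC: "uniserial ?B EC"
  proof -
    have "uniserial A (sub E E')" using E(5) unfolding uniserial_def E.submodule_sub_iff[OF E'] by blast
    then show ?thesis using EB.uniserial_iso EC.uniserial_iso by blast
  qed
  let ?h = "inv_into (carrier M) h"
  have hM: "?h y \<in> carrier M" "h (?h y) = y" if "y \<in> carrier X" for y
    using MX.onto that by (auto simp: inv_into_into f_inv_into_f)
  have hh: "?h (h x) = x" if "x \<in> carrier M" for x using MX.inj that by simp
  note fD = module_homD[OF E(2)]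
  have f0: "f \<zero>\<^bsub>M\<^esub> = \<zero>\<^bsub>E\<^esub>"
    using fD(2)[of "\<zero>\<^bsub>M\<^esub>" "\<zero>\<^bsub>M\<^esub>"] fD(1)[of "\<zero>\<^bsub>M\<^esub>"] E.M.add.r_cancel_one by simp
  have fE: "f x \<in> E'" if x: "x \<in> carrier M" for x
  proof (rule kill)
    show "f x \<in> carrier E" using fD(1)[OF x] .
    fix a assume a: "a \<in> I"
    have "?p a = \<zero>\<^bsub>?B\<^esub>" using I.quotient_map_zero[OF Ic[OF a]] a by simp
    then have "a \<odot>\<^bsub>M\<^esub> x \<in> MX.ker" using MX.smult[OF Ic[OF a] x] MX.closed[OF x] Ic[OF a] x by (simp add: MX.ker_def)
    then have "a \<odot>\<^bsub>M\<^esub> x = \<zero>\<^bsub>M\<^esub>" by (simp add: MX.ker_zero)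
    then show "a \<odot>\<^bsub>E\<^esub> f x = \<zero>\<^bsub>E\<^esub>" using fD(3)[OF Ic[OF a] x] f0 by simp
  qed
  have fh: "(\<lambda>y. f (?h y)) \<in> module_hom ?B X EB"
  proof (rule module_homI)
    show "f (?h y) \<in> carrier EB" if "y \<in> carrier X" for y using fE hM that by (simp add: EBs)
    show "f (?h (y \<oplus>\<^bsub>X\<^esub> z)) = f (?h y) \<oplus>\<^bsub>EB\<^esub> f (?h z)" if "y \<in> carrier X" "z \<in> carrier X" for y z
    proof -
      have "h (?h y \<oplus>\<^bsub>M\<^esub> ?h z) = y \<oplus>\<^bsub>X\<^esub> z" using MX.add hM that by simp
      then have "?h (y \<oplus>\<^bsub>X\<^esub> z) = ?h y \<oplus>\<^bsub>M\<^esub> ?h z" using hh[of "?h y \<oplus>\<^bsub>M\<^esub> ?h z"] hM that by simp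
      then show ?thesis using fD(2) hM that by (simp add: EBs)
    qed
    show "f (?h (b \<odot>\<^bsub>X\<^esub> y)) = b \<odot>\<^bsub>EB\<^esub> f (?h y)" if b: "b \<in> carrier ?B" and y: "y \<in> carrier X" for b y
    proof -
      obtain a where a: "a \<in> carrier A" "b = ?p a" using b p(1) by blast
      have "h (a \<odot>\<^bsub>M\<^esub> ?h y) = b \<odot>\<^bsub>X\<^esub> y" using MX.smult hM y a by simp
      then have "?h (b \<odot>\<^bsub>X\<^esub> y) = a \<odot>\<^bsub>M\<^esub> ?h y" using hh[of "a \<odot>\<^bsub>M\<^esub> ?h y"] hM y a by simp
      then show ?thesis using fD(3) hM y a sm[OF a(1) fE] by simp
    qed
  qed
  define F where "F y = t (f (?h y))" for y
  have F: "F \<in> module_hom ?B X EC" unfolding F_def using module_hom_comp[OF fh semi_iso_hom(1)[OF EC]] .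
  have injF: "inj_on F (carrier X)"
  proof (rule inj_onI)
    fix y z assume yz: "y \<in> carrier X" "z \<in> carrier X" "F y = F z"
    then have "f (?h y) = f (?h z)" using EC.inj fE hM unfolding F_def by (simp add: inj_on_eq_iff EBs)
    then have "?h y = ?h z" using E(3) hM yz by (simp add: inj_on_eq_iff)
    then show "y = z" using hM yz by metis
  qed
  have "N = {\<zero>\<^bsub>EC\<^esub>}" if N: "submodule N ?B EC" "N \<inter> F ` carrier X = {\<zero>\<^bsub>EC\<^esub>}" for N
  proof -
    obtain K where K: "submodule K ?B EB" "N = t ` K" using EC.submodule_image_iff N(1) by blast
    then have KA: "submodule K A (sub E E')" using EB.submodule_img[of K] EB.X.submoduleD(1)[OF K(1)] by (simp add: EBs)
    then have KE: "submodule K A E" "K \<subseteq> E'" by (auto simp: E.submodule_sub_iff[OF E'])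
    have "K \<inter> f ` carrier M \<subseteq> {\<zero>\<^bsub>E\<^esub>}"
    proof
      fix y assume y: "y \<in> K \<inter> f ` carrier M"
      then obtain x where x: "x \<in> carrier M" "y = f x" by blast
      have "F (h x) = t y" unfolding F_def using hh[OF x(1)] x(2) by simp
      then have "t y \<in> N \<inter> F ` carrier X" using K(2) y MX.closed[OF x(1)] by (metis IntI IntD1 imageI)
      then have "t y = t \<zero>\<^bsub>EB\<^esub>" using N(2) by simp
      then show "y \<in> {\<zero>\<^bsub>E\<^esub>}" using EC.inj y KE(2) E.submoduleD(2)[OF E'] by (auto simp: inj_on_eq_iff EBs)
    qed
    moreover have "f \<zero>\<^bsub>M\<^esub> \<in> f ` carrier M" by blast
    ultimately have "K \<inter> f ` carrier M = {\<zero>\<^bsub>E\<^esub>}" using E.submoduleD(2)[OF KE(1)] f0 by auto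
    then have "K = {\<zero>\<^bsub>E\<^esub>}" using E(4) KE(1) by blast
    then show ?thesis using K(2) EC.zero by (simp add: EBs)
  qed
  then have "injective_envelope ?B X EC F" unfolding injective_envelope_def using injEC F injF by blast
  then show ?thesis unfolding uniserial_envelope_def using uniEC by blast
qed

end

text \<open>Only \<open>N = 0\<close> is in doubt. Then zero is a maximal submodule, so the kernel
  is zero or everything, and the latter is excluded by \<open>X\<close> being nonzero.\<close>

lemma (in semi_epi) ker_in_maximal:
  assumes least: "\<And>N. submodule N A M \<Longrightarrow> N \<noteq> {\<zero>\<^bsub>M\<^esub>} \<Longrightarrow> ker \<subseteq> N"
    and X0: "carrier X \<noteq> {\<zero>\<^bsub>X\<^esub>}" and N: "maximal_submodule N A M"
  shows "ker \<subseteq> N"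
proof (cases "N = {\<zero>\<^bsub>M\<^esub>}")
  case True
  have "ker = {\<zero>\<^bsub>M\<^esub>} \<or> ker = carrier M"
    using N submodule_ker M.submoduleD(2)[OF submodule_ker] True unfolding maximal_submodule_def by blast
  moreover have "ker \<noteq> carrier M" using X0 image_ker onto by metis
  ultimately show ?thesis using True by simp
qed (use least N in \<open>auto simp: maximal_submodule_def\<close>)

section \<open>Local modules of length at most three\<close>

context left_module
begin

lemma local_largest:
  assumes N: "largest_proper_submodule N A M"
  shows "local_module A M" "radical A M = N"
proof -
  have N': "submodule N A M" "N \<noteq> carrier M" "\<And>K. submodule K A M \<Longrightarrow> K \<noteq> carrier M \<Longrightarrow> K \<subseteq> N"
    using N by (auto simp: largest_proper_submodule_def)
  have max: "maximal_submodule K A M \<longleftrightarrow> K = N" for K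
    using N' unfolding maximal_submodule_def by blast
  show r: "radical A M = N" unfolding radical_def max using submoduleD(1)[OF N'(1)] by blast
  show "local_module A M" unfolding local_module_def top_module_def r using simple_quotient_iff[OF N'(1)] max by simp
qed

lemma colocal_smallest:
  assumes d: "smono A M d" and c: "colocal_module A M"
  shows "smallest_nonzero_submodule (socle A M) A M"
proof -
  let ?T = "{S. submodule S A M \<and> simple_module A (sub M S)}"
  have T: "\<Union>?T \<subseteq> carrier M" using submoduleD(1) by blast
  note g = generated_submodule[OF T, folded socle_def]
  note c' = simple_moduleD[OF c[unfolded colocal_module_def]]
  have "socle A M \<subseteq> K" if K: "submodule K A M" "K \<noteq> {\<zero>\<^bsub>M\<^esub>}" for K
  proof -
    obtain S where S: "submodule S A M" "S \<subseteq> K" "simple_module A (sub M S)" using smono_simple[OF d K] by blast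
    have "S \<subseteq> socle A M" using g(2) S by blast
    then have "submodule S A (sub M (socle A M))" using submodule_sub_iff[OF g(1)] S(1) by blast
    then have "S = {\<zero>\<^bsub>M\<^esub>} \<or> S = socle A M" using c'(3)[of S] by simp
    moreover have "S \<noteq> {\<zero>\<^bsub>M\<^esub>}" using simple_moduleD(2)[OF S(3)] by simp
    ultimately show ?thesis using S(2) by blast
  qed
  then show ?thesis unfolding smallest_nonzero_submodule_def using g(1) c'(2) by simp
qed

text \<open>Incomparable \<open>N\<close> and \<open>K\<close> lie in the radical \<open>R\<close>,
  and \<open>0 \<le> N \<inter> K < N < N + K \<le> R < M\<close> exhausts length three:
  \<open>N\<close> and \<open>K\<close> are simple, independent and span \<open>R\<close>. A simple
  socle would lie in \<open>N \<inter> K\<close>. The bound is relative to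
  \<open>d {\<zero>}\<close> because \<open>d\<close> will be composed with preimages under a map
  that may have a kernel.\<close>

lemma short_local_astride:
  assumes d: "smono A M d" "d (carrier M) \<le> d {\<zero>\<^bsub>M\<^esub>} + 3" and R: "largest_proper_submodule R A M"
    and ind: "indecomposable A M" and n: "\<not> uniserial A M"
  shows "astride_biserial_module A M"
proof -
  have R': "submodule R A M" "R \<noteq> carrier M" "\<And>K. submodule K A M \<Longrightarrow> K \<noteq> carrier M \<Longrightarrow> K \<subseteq> R"
    using R by (auto simp: largest_proper_submodule_def)
  obtain N K where NK: "submodule N A M" "submodule K A M" "\<not> N \<subseteq> K" "\<not> K \<subseteq> N" using n unfolding uniserial_def by blast
  let ?W = "N <+>\<^bsub>M\<^esub> K" and ?Z = "{\<zero>\<^bsub>M\<^esub>}"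
  note W = submodule_add[OF NK(1,2)] and up = submodule_add_upper[OF NK(1,2)] and IN = submodule_Int[OF NK(1,2)]
  have "N \<subseteq> R" "K \<subseteq> R" using R'(3) NK submoduleD(1) by blast+
  then have WR: "?W \<subseteq> R" by (rule submodule_add_least[OF R'(1)])
  have RM: "R \<subset> carrier M" using R'(1,2) submoduleD(1) by blast
  have lt: "d (N \<inter> K) < d N" "d N < d ?W" "d (N \<inter> K) < d K" "d K < d ?W" "d R < d (carrier M)"
  proof -
    have "N \<inter> K \<subset> N" "N \<inter> K \<subset> K" "N \<subset> ?W" "K \<subset> ?W" using NK(3,4) up by blast+
    then show "d (N \<inter> K) < d N" "d N < d ?W" "d (N \<inter> K) < d K" "d K < d ?W" "d R < d (carrier M)"
      using smonoD[OF d(1) IN NK(1)] smonoD[OF d(1) IN NK(2)] smonoD[OF d(1) NK(1) W] smonoD[OF d(1) NK(2) W]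
        smonoD[OF d(1) R'(1) submodule_carrier RM] by blast+
  qed
  have le: "d ?W \<le> d R" "d ?Z \<le> d (N \<inter> K)"
    using smono_le[OF d(1) W R'(1) WR] smono_le[OF d(1) submodule_zero IN] submoduleD(2)[OF IN] by auto
  have eq: "d (N \<inter> K) = d ?Z" "d N = d ?Z + 1" "d K = d ?Z + 1" "d ?W = d R" using lt le d(2) by linarith+
  have NK0: "N \<inter> K = ?Z" using smono_eq[OF d(1) submodule_zero IN] submoduleD(2)[OF IN] eq by auto
  have WR': "?W = R" using smono_eq[OF d(1) W R'(1) WR] eq by simp
  have min: "V = ?Z \<or> V = U" if U: "submodule U A M" "d U = d ?Z + 1" and V: "submodule V A M" "V \<subseteq> U" for U V
  proof (rule disjCI)
    assume "V \<noteq> U"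
    then have "d V < d U" using smonoD[OF d(1) V(1) U(1)] V(2) by blast
    then have "d V \<le> d ?Z" using U(2) by simp
    then show "V = ?Z" using smono_eq[OF d(1) submodule_zero V(1)] submoduleD(2)[OF V(1)] by auto
  qed
  have uni: "uniserial A (sub M U)" if "submodule U A M" "d U = d ?Z + 1" for U
    unfolding uniserial_def submodule_sub_iff[OF that(1)]
    using min[OF that] submoduleD(2) by blast
  have simp: "simple_module A (sub M U)" if U: "submodule U A M" "d U = d ?Z + 1" for U
    unfolding simple_module_def using sub_left_module[OF U(1)] min[OF U] U submodule_sub_iff[OF U(1)] by auto
  have bis: "biserial_module A M" unfolding biserial_module_def
    using ind NK NK0 WR' R uni[OF NK(1) eq(2)] uni[OF NK(2) eq(3)]
    by (intro conjI exI[of _ N] exI[of _ K] disjI1[of "N \<inter> K = ?Z"] disjI2) simp_all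
  have "\<not> colocal_module A M"
  proof
    assume "colocal_module A M"
    then have "smallest_nonzero_submodule (socle A M) A M" by (rule colocal_smallest[OF d(1)])
    moreover have "N \<noteq> ?Z" "K \<noteq> ?Z" using eq by auto
    ultimately have "socle A M \<subseteq> N \<inter> K" "socle A M \<noteq> ?Z" "submodule (socle A M) A M"
      using NK unfolding smallest_nonzero_submodule_def by blast+
    then show False using NK0 submoduleD(2) by blast
  qed
  then show ?thesis unfolding astride_biserial_module_def using bis local_largest(1)[OF R] by blast
qed

end

lemma (in semi_epi) largest_image:
  assumes N: "largest_proper_submodule N A M" and X0: "carrier X \<noteq> {\<zero>\<^bsub>X\<^esub>}"
  shows "largest_proper_submodule (h ` N) B X"
proof -
  have N': "submodule N A M" "N \<noteq> carrier M" "\<And>K. submodule K A M \<Longrightarrow> K \<noteq> carrier M \<Longrightarrow> K \<subseteq> N"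
    using N by (auto simp: largest_proper_submodule_def)
  have "ker \<noteq> carrier M" using X0 image_ker onto by metis
  then have k: "ker \<subseteq> N" using N'(3) submodule_ker by blast
  have "h ` N \<noteq> carrier X" using image_eq_iff[OF N'(1) M.submodule_carrier k ker_carrier] N'(2) onto by simp
  moreover have "K \<subseteq> h ` N" if K: "submodule K B X" "K \<noteq> carrier X" for K
  proof -
    let ?V = "{x \<in> carrier M. h x \<in> K}"
    have "h ` ?V = K" by (rule image_vimage[OF X.submoduleD(1)[OF K(1)]])
    then have "?V \<noteq> carrier M" using K(2) onto by auto
    then show ?thesis using N'(3)[OF vimage_submodule[OF K(1)]] \<open>h ` ?V = K\<close> by blast
  qed
  ultimately show ?thesis unfolding largest_proper_submodule_def using image_submodule[OF N'(1)] by blast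
qed

lemma semi_iso_comp:
  assumes "semi_iso A A L M (\<lambda>a. a) g" "semi_epi A B M X p h"
  shows "semi_epi A B L X p (\<lambda>x. h (g x))"
proof -
  interpret g: semi_iso A A L M "\<lambda>a. a" g by fact
  interpret h: semi_epi A B M X p h by fact
  have "(\<lambda>x. h (g x)) ` carrier L = carrier X" using g.onto h.onto by (metis image_image)
  then show ?thesis using g.M h.X h.p g.closed g.add g.smult h.add h.smult by (intro semi_epi.intro) simp_all
qed

section \<open>Indecomposable projective modules over the quotient\<close>

context qring
begin

text \<open>Length bounds pass to quotients. For condition (2), the radicals of \<open>M\<close> and
  \<open>Q\<close> have isomorphic tops, because the kernel lies even in the radical of
  \<open>radical A M\<close>. The configuration of condition (3) already has length four in
  \<open>Q\<close>, so there the kernel is zero and \<open>Q\<close> is isomorphic to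
  \<open>M\<close>. Uniserial envelopes descend by
  \<open>uniserial_envelope_quotient\<close>.\<close>

lemma quadri_transfer:
  assumes I: "ideal I A" and e: "semi_epi A (A Quot I) M Q (\<lambda>a. I +>\<^bsub>A\<^esub> a) h"
    and least: "\<And>N. submodule N A M \<Longrightarrow> N \<noteq> {\<zero>\<^bsub>M\<^esub>} \<Longrightarrow> semi_epi.ker M Q h \<subseteq> N"
    and Q0: "carrier Q \<noteq> {\<zero>\<^bsub>Q\<^esub>}" and qc: "quadri_condition A M"
  shows "quadri_condition (A Quot I) Q"
proof -
  let ?B = "A Quot I" and ?p = "\<lambda>a. I +>\<^bsub>A\<^esub> a"
  interpret e: semi_epi A ?B M Q ?p h by (rule e)
  define R0 where "R0 = radical A M"
  define RQ where "RQ = radical ?B Q"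
  define T0 where "T0 = top_module A (sub M R0)"
  define TQ where "TQ = top_module ?B (sub Q RQ)"
  note qc' = qc[unfolded quadri_condition_def Let_def, folded R0_def, folded T0_def]
  obtain n where n: "n \<le> 4" "has_length A M n" using qc' by blast
  obtain d where d: "smono A M d" "d (carrier M) \<le> n" using e.M.has_length_smono[OF n(2)] by blast
  define dQ where "dQ K = d {x \<in> carrier M. h x \<in> K}" for K
  have dQ: "smono ?B Q dQ" using e.smono_image[OF d(1)] unfolding dQ_def .
  have R: "RQ = h ` R0" "e.ker \<subseteq> R0"
    unfolding RQ_def R0_def using e.radical_image e.ker_in_maximal[OF least Q0] by blast+
  have sR0: "submodule R0 A M" unfolding R0_def by (rule e.M.submodule_radical)
  have sRQ: "submodule RQ ?B Q" unfolding RQ_def by (rule e.X.submodule_radical)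
  have "dQ (carrier Q) \<le> 4"
    using smono_le[OF d(1) e.vimage_submodule[OF e.X.submodule_carrier] e.M.submodule_carrier] d(2) n(1)
    by (auto simp: dQ_def)
  then have 1: "\<exists>n\<le>4. has_length ?B Q n" using e.X.smono_has_length[OF dQ] le_trans by blast
  have 2: "uniserial_envelope ?B (sub TQ S1) \<or> uniserial_envelope ?B (sub TQ S2)"
    if ds: "internal_direct_sum ?B TQ S1 S2" "simple_module ?B (sub TQ S1)" "simple_module ?B (sub TQ S2)" for S1 S2
  proof -
    interpret r: semi_epi A ?B "sub M R0" "sub Q RQ" ?p h using e.restrict[OF sR0] R(1) by simp
    have rk: "r.ker = e.ker" using R(2) e.ker_carrier e.M.submoduleD(1)[OF sR0] by (auto simp: r.ker_def e.ker_def)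
    \<comment> \<open>Needed for \<open>ker_in_maximal\<close>. If the radical of \<open>Q\<close>
      were zero, its top would be zero and could not have the simple submodule
      \<open>S1\<close>.\<close>
    have RQ0: "carrier (sub Q RQ) \<noteq> {\<zero>\<^bsub>sub Q RQ\<^esub>}"
    proof
      assume z: "carrier (sub Q RQ) = {\<zero>\<^bsub>sub Q RQ\<^esub>}"
      have "carrier TQ = {\<zero>\<^bsub>TQ\<^esub>}"
        unfolding TQ_def top_module_def r.X.quotient_carrier z
        using r.X.quotient_ops(1)[OF r.X.submodule_radical] r.X.submoduleD(2)[OF r.X.submodule_radical]
          r.X.quotient_ops(5)[OF r.X.submodule_radical r.X.M.zero_closed] by simp
      moreover have "submodule S1 ?B TQ" using ds(1) by (simp add: internal_direct_sum_def)
      moreover have "left_module ?B TQ"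
        unfolding TQ_def top_module_def by (rule r.X.quotient_left_module[OF r.X.submodule_radical])
      ultimately have "S1 = {\<zero>\<^bsub>TQ\<^esub>}" using left_module.submoduleD(1,2)[of ?B TQ S1] by auto
      then show False using simple_moduleD(2)[OF ds(2)] by simp
    qed
    \<comment> \<open>Submodules of the radical are submodules of \<open>M\<close>, so the kernel
      lies in every nonzero one, hence in all maximal ones and in the radical of the
      radical.\<close>
    have rl: "r.ker \<subseteq> N" if "submodule N A (sub M R0)" "N \<noteq> {\<zero>\<^bsub>sub M R0\<^esub>}" for N
      using least[of N] that e.M.submodule_sub_iff[OF sR0] rk by simp
    note rad = r.radical_image[OF r.ker_in_maximal[OF rl RQ0]]
    interpret q: semi_iso A ?B T0 TQ ?p "image h"
      using r.quotient[OF r.M.submodule_radical] rad unfolding T0_def TQ_def top_module_def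
      by (auto intro!: semi_iso.intro semi_iso_axioms.intro)
    obtain U1 U2 where U: "S1 = image h ` U1" "S2 = image h ` U2" "submodule U1 A T0" "submodule U2 A T0"
      "internal_direct_sum A T0 U1 U2" using q.direct_sum_ex[OF ds(1)] by blast
    have "simple_module A (sub T0 U1)" "simple_module A (sub T0 U2)"
      using semi_iso.simple_iso[OF q.restrict_iso[OF U(3)]] semi_iso.simple_iso[OF q.restrict_iso[OF U(4)]]
        ds(2,3) U(1,2) by auto
    then have "uniserial_envelope A (sub T0 U1) \<or> uniserial_envelope A (sub T0 U2)" using qc' U(5) by blast
    then show ?thesis
      using uniserial_envelope_quotient[OF I q.restrict_iso[OF U(3)]]
        uniserial_envelope_quotient[OF I q.restrict_iso[OF U(4)]] U(1,2) by blast
  qed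
  have 3: "uniserial_envelope ?B (sub Q S) \<and> uniserial_envelope ?B (sub Q (socle ?B (sub Q K)))"
    if ds: "internal_direct_sum ?B (sub Q RQ) S K" "simple_module ?B (sub Q S)" "uniserial ?B (sub Q K)"
      "has_length ?B (sub Q K) 2" for S K
  proof -
    have SK: "submodule S ?B Q" "submodule K ?B Q" "S \<subseteq> RQ" "K \<subseteq> RQ" "S \<inter> K = {\<zero>\<^bsub>Q\<^esub>}"
      using ds(1) e.X.submodule_sub_iff[OF sRQ] by (auto simp: internal_direct_sum_def)
    \<comment> \<open>In \<open>Q\<close> there is the chain \<open>0 < C 1 < K < RQ < Q\<close>; a
      nonzero kernel would make it a chain of five steps in \<open>M\<close>.\<close>
    have ker0: "e.ker = {\<zero>\<^bsub>M\<^esub>}"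
    proof (rule ccontr)
      assume n0: "e.ker \<noteq> {\<zero>\<^bsub>M\<^esub>}"
      obtain C where C: "C 0 = {\<zero>\<^bsub>Q\<^esub>}" "C 2 = K" "\<forall>i\<le>2. submodule (C i) ?B (sub Q K)"
        "\<forall>i<2. C i \<subseteq> C (Suc i) \<and> simple_module ?B (quotient_module (sub (sub Q K) (C (Suc i))) (C i))"
        using ds(4) unfolding has_length_def by auto
      have Cs: "submodule (C i) ?B Q" if "i \<le> 2" for i using C(3) that e.X.submodule_sub_iff[OF SK(2)] by blast
      have strict: "C i \<subset> C (Suc i)" if i: "i < 2" for i
      proof -
        have s: "submodule (C i) ?B Q" "submodule (C (Suc i)) ?B Q" using Cs i by auto
        interpret c: left_module ?B "sub Q (C (Suc i))" by (rule e.X.sub_left_module[OF s(2)])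
        have "simple_module ?B (quotient_module (sub Q (C (Suc i))) (C i))" using C(4) i by simp
        moreover have "submodule (C i) ?B (sub Q (C (Suc i)))" using e.X.submodule_sub_iff[OF s(2)] s(1) C(4) i by blast
        ultimately have "maximal_submodule (C i) ?B (sub Q (C (Suc i)))" using c.simple_quotient_iff by blast
        then show ?thesis using e.X.maximal_sub_iff[OF s(2)] by blast
      qed
      have "{\<zero>\<^bsub>Q\<^esub>} \<subset> C 1" "C 1 \<subset> K" using strict[of 0] strict[of 1] C(1,2) by (auto simp: numeral_2_eq_2)
      moreover have "K \<subset> RQ"
      proof -
        have "S \<noteq> {\<zero>\<^bsub>Q\<^esub>}" using simple_moduleD(2)[OF ds(2)] by simp
        then have "\<not> S \<subseteq> K" using SK(5) e.X.submoduleD(2)[OF SK(1)] by blast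
        then show ?thesis using SK by blast
      qed
      moreover have "RQ \<subset> carrier Q"
      proof -
        obtain N where "maximal_submodule N ?B Q" using e.X.smono_maximal[OF dQ e.X.submodule_zero] Q0 by metis
        then show ?thesis unfolding RQ_def radical_def maximal_submodule_def
          using e.X.submoduleD(1) by blast
      qed
      ultimately have "dQ {\<zero>\<^bsub>Q\<^esub>} < dQ (C 1)" "dQ (C 1) < dQ K" "dQ K < dQ RQ" "dQ RQ < dQ (carrier Q)"
        using smonoD[OF dQ e.X.submodule_zero Cs[of 1]] smonoD[OF dQ Cs[of 1] SK(2)] smonoD[OF dQ SK(2) sRQ]
          smonoD[OF dQ sRQ e.X.submodule_carrier] by simp_all
      moreover have "dQ {\<zero>\<^bsub>Q\<^esub>} = d e.ker" by (simp add: dQ_def e.ker_def)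
      moreover have "d {\<zero>\<^bsub>M\<^esub>} < d e.ker"
        using smonoD[OF d(1) e.M.submodule_zero e.submodule_ker] n0 e.M.submoduleD(2)[OF e.submodule_ker] by blast
      ultimately show False using \<open>dQ (carrier Q) \<le> 4\<close> by linarith
    qed
    interpret i: semi_iso A ?B M Q ?p h
      using e ker0 e.inj_iff_ker by (intro semi_iso.intro semi_iso_axioms.intro) auto
    interpret r: semi_iso A ?B "sub M R0" "sub Q RQ" ?p h using i.restrict_iso[OF sR0] R(1) by simp
    obtain U V where "S = h ` U" "K = h ` V" "internal_direct_sum A (sub M R0) U V" "submodule U A (sub M R0)"
      "submodule V A (sub M R0)" using r.direct_sum_ex[OF ds(1)] by blast
    then have UV: "S = h ` U" "K = h ` V" "internal_direct_sum A (sub M R0) U V" "submodule U A M" "submodule V A M"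
      using e.M.submodule_sub_iff[OF sR0] by auto
    interpret u: semi_iso A ?B "sub M U" "sub Q S" ?p h using i.restrict_iso[OF UV(4)] UV(1) by simp
    interpret v: semi_iso A ?B "sub M V" "sub Q K" ?p h using i.restrict_iso[OF UV(5)] UV(2) by simp
    have "simple_module A (sub M U)" "uniserial A (sub M V)" "has_length A (sub M V) 2"
      using ds(2,3,4) u.simple_iso v.uniserial_iso v.has_length_iso by auto
    then have env: "uniserial_envelope A (sub M U)" "uniserial_envelope A (sub M (socle A (sub M V)))"
      using qc' UV(3) by blast+
    let ?W = "socle A (sub M V)"
    have "\<Union>{S. submodule S A (sub M V) \<and> simple_module A (sub (sub M V) S)} \<subseteq> carrier (sub M V)"
      using v.M.submoduleD(1) by blast
    then have "submodule ?W A (sub M V)" unfolding socle_def by (rule v.M.generated_submodule(1))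
    then have W: "submodule ?W A M" using e.M.submodule_sub_iff[OF UV(5)] by blast
    have "semi_iso A ?B (sub M ?W) (sub Q (socle ?B (sub Q K))) ?p h"
      using i.restrict_iso[OF W] v.socle_iso by simp
    then show ?thesis
      using uniserial_envelope_quotient[OF I u.semi_iso_axioms env(1)] uniserial_envelope_quotient[OF I _ env(2)] by blast
  qed
  show ?thesis unfolding quadri_condition_def Let_def RQ_def[symmetric] TQ_def[symmetric] using 1 2 3 by blast
qed

text \<open>Idempotents are chosen in \<open>A\<close> from the start: a primitive \<open>e\<close>
  that does not map a chosen element of \<open>Q\<close> into a maximal submodule \<open>N\<close>.
  Write \<open>B\<close> for the quotient ring. The surjection from \<open>B e\<close> to the simple
  \<open>Q/N\<close> lifts to \<open>k : Q \<rightarrow> B e\<close> because \<open>Q\<close> is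
  projective. Once \<open>k\<close> is known to hit the class of \<open>e\<close>, it splits, and
  indecomposability of \<open>Q\<close> makes it an isomorphism. Composed with
  \<open>A e \<rightarrow> B e\<close> this presents \<open>Q\<close> as \<open>A e\<close> modulo
  \<open>I \<inter> A e\<close>.\<close>

lemma projective_cover:
  fixes Q :: "('a set, 'n) module"
  assumes I: "ideal I A" and Q: "indecomposable (A Quot I) Q" "projective (A Quot I) Q"
  shows "\<exists>e g. primitive A e \<and>
    semi_epi A (A Quot I) (sub (regular_module A) (lprinc A e)) Q (\<lambda>a. I +>\<^bsub>A\<^esub> a) g \<and>
    (\<forall>x\<in>lprinc A e. g x = \<zero>\<^bsub>Q\<^esub> \<longleftrightarrow> x \<in> I)"
proof -
  let ?B = "A Quot I" and ?p = "\<lambda>a. I +>\<^bsub>A\<^esub> a"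
  interpret I: ideal I A by (rule I)
  note p = I.quotient_map and ph = ring_hom_memE[OF I.quotient_map(2)]
  interpret B: ring ?B by (rule p(3))
  have Qfg: "fg_module ?B Q" using Q(2) by (simp add: projective_def)
  then interpret Q: left_module ?B Q by (simp add: fg_module_def)
  interpret s: semi_iso A ?B "pullback ?p Q" Q ?p "\<lambda>x. x"
    by (rule pullback_iso[OF Q.left_module_axioms local.ring_axioms p(1,2)])
  obtain d where d: "smono A (pullback ?p Q) d"
    using fg_smono[OF pullback_fg[OF Qfg local.ring_axioms p(1,2)]] by blast
  have Q0: "carrier Q \<noteq> {\<zero>\<^bsub>Q\<^esub>}" using Q(1) by (simp add: indecomposable_def)
  obtain N where N: "maximal_submodule N A (pullback ?p Q)"
    using s.M.smono_maximal[OF d s.M.submodule_zero] Q0 by auto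
  have NA: "submodule N A (pullback ?p Q)" using N by (simp add: maximal_submodule_def)
  have NB: "submodule N ?B Q" "maximal_submodule N ?B Q"
    using s.image_submodule[OF NA] s.maximal_image_iff[OF NA s.ker_sub[OF NA]] N by simp_all
  note ND = Q.submoduleD[OF NB(1)]
  obtain x0 where x0: "x0 \<in> carrier Q" "x0 \<notin> N" using NB(2) ND(1) unfolding maximal_submodule_def by blast
  have pc: "?p a \<in> carrier ?B" if "a \<in> carrier A" for a using ph(1)[OF that] .
  have "\<exists>e. primitive A e \<and> ?p e \<odot>\<^bsub>Q\<^esub> x0 \<notin> N"
  proof (rule ccontr)
    assume n: "\<not> ?thesis"
    have "\<one> \<in> {a \<in> carrier A. ?p a \<odot>\<^bsub>Q\<^esub> x0 \<in> N}"
    proof (rule decomp_right)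
      show "\<zero> \<in> {a \<in> carrier A. ?p a \<odot>\<^bsub>Q\<^esub> x0 \<in> N}"
        using I.quotient_map_zero[of \<zero>] lidealD(2)[OF I.lideal_I] x0 ND(2) by simp
      show "a \<oplus> b \<in> {a \<in> carrier A. ?p a \<odot>\<^bsub>Q\<^esub> x0 \<in> N}"
        if "a \<in> {a \<in> carrier A. ?p a \<odot>\<^bsub>Q\<^esub> x0 \<in> N}" "b \<in> {a \<in> carrier A. ?p a \<odot>\<^bsub>Q\<^esub> x0 \<in> N}" for a b
        using that ph(3) Q.smult_l_distr[OF pc pc x0(1)] ND(4) by simp
      show "\<one> \<otimes> g \<in> {a \<in> carrier A. ?p a \<odot>\<^bsub>Q\<^esub> x0 \<in> N}" if "primitive A g" for g
        using n that primitiveD[OF that] by auto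
    qed simp
    then show False using x0 ph(4) by simp
  qed
  then obtain e where e: "primitive A e" "?p e \<odot>\<^bsub>Q\<^esub> x0 \<notin> N" by blast
  note e' = primitiveD[OF e(1)]
  have pe: "?p e \<in> carrier ?B" "?p e \<otimes>\<^bsub>?B\<^esub> ?p e = ?p e" using pc e' ph(2)[of e e] by auto
  define x where "x = ?p e \<odot>\<^bsub>Q\<^esub> x0"
  have x: "x \<in> carrier Q" "x \<notin> N" "?p e \<odot>\<^bsub>Q\<^esub> x = x"
    using e x0 pe Q.smult_assoc[OF pe(1) pe(1) x0(1)] unfolding x_def by auto
  let ?Y = "sub (regular_module ?B) (lprinc ?B (?p e))"
  let ?T = "quotient_module Q N"
  have Yc: "y \<in> carrier ?B" "y \<otimes>\<^bsub>?B\<^esub> ?p e = y" if "y \<in> lprinc ?B (?p e)" for y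
    using that B.lprinc_idem[OF pe] by auto
  have eY: "?p e \<in> lprinc ?B (?p e)" using pe by simp
  have Yfg: "fg_module ?B ?Y" by (rule B.lprinc_fg[OF pe(1)])
  then interpret Y: left_module ?B ?Y by (simp add: fg_module_def)
  interpret q: semi_epi ?B ?B Q ?T "\<lambda>b. b" "\<lambda>z. N +>\<^bsub>Q\<^esub> z" by (rule Q.quotient_semi_epi(1)[OF NB(1)])
  have Tfg: "fg_module ?B ?T" by (rule q.fg_image[OF Qfg])
  have cyc: "(\<lambda>y. y \<odot>\<^bsub>Q\<^esub> w) \<in> module_hom ?B ?Y Q" if "w \<in> carrier Q" for w
    using Yc that by (intro module_homI) (auto simp: Q.smult_l_distr Q.smult_assoc)
  have qh: "(\<lambda>z. N +>\<^bsub>Q\<^esub> z) \<in> module_hom ?B Q ?T" using q.closed q.add q.smult by (intro module_homI)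
  have q0: "N +>\<^bsub>Q\<^esub> z = \<zero>\<^bsub>?T\<^esub> \<longleftrightarrow> z \<in> N" if "z \<in> carrier Q" for z
    using Q.quotient_ops(1,5)[OF NB(1)] that by simp
  let ?b = "\<lambda>y. N +>\<^bsub>Q\<^esub> (y \<odot>\<^bsub>Q\<^esub> x)"
  have bh: "?b \<in> module_hom ?B ?Y ?T" using module_hom_comp[OF cyc[OF x(1)] qh] .
  have "?b ` carrier ?Y = carrier ?T"
  proof -
    have "simple_module ?B ?T" using Q.simple_quotient_iff[OF NB(1)] NB(2) by simp
    moreover have "submodule (?b ` carrier ?Y) ?B ?T"
      using module_hom_image(1)[OF Y.left_module_axioms q.X bh Y.submodule_carrier] .
    ultimately have "?b ` carrier ?Y = {\<zero>\<^bsub>?T\<^esub>} \<or> ?b ` carrier ?Y = carrier ?T" by (rule simple_moduleD(3))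
    moreover have "?b (?p e) \<in> ?b ` carrier ?Y" using eY by simp
    moreover have "?b (?p e) \<noteq> \<zero>\<^bsub>?T\<^esub>" using q0[OF x(1)] x by simp
    ultimately show ?thesis by blast
  qed
  then obtain k where k: "k \<in> module_hom ?B Q ?Y" "\<forall>z\<in>carrier Q. ?b (k z) = N +>\<^bsub>Q\<^esub> z"
    using projectiveD[OF Q(2) Yfg Tfg bh _ qh] by blast
  note kD = module_homD[OF k(1), simplified]
  obtain b where b: "b \<in> carrier ?B" "k x = b \<otimes>\<^bsub>?B\<^esub> ?p e"
    using kD(1)[OF x(1)] by (rule B.lprincE)
  obtain a0 where "a0 \<in> carrier A" "b = ?p a0" using b(1) unfolding p(1)[symmetric] by (rule imageE)
  with b(2) have "a0 \<in> carrier A" "k x = ?p a0 \<otimes>\<^bsub>?B\<^esub> ?p e" by simp_all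
  then obtain a where a: "a \<in> carrier A" "a \<otimes> e = a" "k x = ?p a"
    using e' ph(2)[of a0 e] by (metis m_assoc m_closed)
  have ax: "?p a \<odot>\<^bsub>Q\<^esub> x \<notin> N" 
  proof -
    have "N +>\<^bsub>Q\<^esub> (?p a \<odot>\<^bsub>Q\<^esub> x) = N +>\<^bsub>Q\<^esub> x" using k(2) x(1) a(3) by metis
    then show ?thesis using q0[OF x(1)] q0[of "?p a \<odot>\<^bsub>Q\<^esub> x"] pc[OF a(1)] x by simp
  qed
  \<comment> \<open>Nakayama's argument. The class of \<open>a\<close> moves \<open>x\<close>
    outside \<open>N\<close>, so together with \<open>N\<close> it generates \<open>Q\<close> and in
    particular \<open>x\<close>. If \<open>a\<close> were radical, this would give
    \<open>(e \<ominus> j) x \<in> N\<close> with \<open>j\<close> radical, and cancelling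
    \<open>e \<ominus> j\<close> would put \<open>x\<close> into \<open>N\<close>.\<close>
  have "a \<notin> jac A"
  proof
    assume aj: "a \<in> jac A"
    define w where "w = ?p a \<odot>\<^bsub>Q\<^esub> x"
    have w: "w \<in> carrier (pullback ?p Q)" using pc[OF a(1)] x(1) by (simp add: w_def)
    let ?S = "{c \<odot>\<^bsub>pullback ?p Q\<^esub> w | c. c \<in> carrier A}"
    have L: "submodule (N <+>\<^bsub>pullback ?p Q\<^esub> ?S) A (pullback ?p Q)"
      by (rule s.M.submodule_add[OF NA s.M.submodule_cyclic[OF w]])
    note up = s.M.submodule_add_upper[OF NA s.M.submodule_cyclic[OF w]]
    have "w \<in> ?S" using w ph(4) by (auto intro!: exI[of _ \<one>])
    then have "N <+>\<^bsub>pullback ?p Q\<^esub> ?S = carrier (pullback ?p Q)"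
      using N L up ax unfolding maximal_submodule_def w_def by blast
    then have "x \<in> N <+>\<^bsub>pullback ?p Q\<^esub> ?S" using x(1) by simp
    then obtain n c where nc: "n \<in> N" "c \<in> carrier A" "x = n \<oplus>\<^bsub>Q\<^esub> ?p c \<odot>\<^bsub>Q\<^esub> w"
      by (auto simp: mem_set_add)
    have nQ: "n \<in> carrier Q" using ND(3)[OF nc(1)] .
    define j where "j = e \<otimes> c \<otimes> a"
    have j: "j \<in> carrier A" "j \<in> jac A" "j \<otimes> e = j" unfolding j_def using e' nc(2) a aj
      by (auto simp: jac_mult m_assoc)
    have ej: "e \<ominus> j \<in> carrier A" "(e \<ominus> j) \<otimes> e = e \<ominus> j" using e' j by (auto simp: minus_distrib)
    have "e \<ominus> j \<notin> jac A"
      using lideal_diffD[OF jac_lideal _ j(2) e'(1)] primitive_not_jac[OF e(1)] by blast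
    then obtain u where u: "u \<in> carrier A" "e = u \<otimes> (e \<ominus> j)" using jac_mem[OF e(1) ej] by (auto elim: lprincE)
    have pj: "?p j \<odot>\<^bsub>Q\<^esub> x = ?p e \<odot>\<^bsub>Q\<^esub> (?p c \<odot>\<^bsub>Q\<^esub> w)"
      unfolding j_def w_def using ph(2) e' nc(2) a(1) pc x(1) by (simp add: Q.smult_assoc)
    have "?p (e \<ominus> j) \<odot>\<^bsub>Q\<^esub> x \<oplus>\<^bsub>Q\<^esub> ?p j \<odot>\<^bsub>Q\<^esub> x = ?p e \<odot>\<^bsub>Q\<^esub> x"
      using Q.smult_l_distr[OF pc pc x(1), of "e \<ominus> j" j] ph(3)[of "e \<ominus> j" j] ej j e' by (simp add: diff_add_cancel)
    also have "\<dots> = ?p e \<odot>\<^bsub>Q\<^esub> n \<oplus>\<^bsub>Q\<^esub> ?p j \<odot>\<^bsub>Q\<^esub> x"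
      unfolding pj using nc nQ pe(1) pc w by (simp flip: Q.smult_r_distr)
    finally have "?p (e \<ominus> j) \<odot>\<^bsub>Q\<^esub> x = ?p e \<odot>\<^bsub>Q\<^esub> n"
      using pc[OF ej(1)] pc[OF j(1)] pe(1) x(1) nQ by (simp add: Q.M.add.right_cancel)
    then have "?p (e \<ominus> j) \<odot>\<^bsub>Q\<^esub> x \<in> N" using ND(5)[OF pe(1) nc(1)] by simp
    then have "?p u \<odot>\<^bsub>Q\<^esub> (?p (e \<ominus> j) \<odot>\<^bsub>Q\<^esub> x) \<in> N" using ND(5) pc[OF u(1)] by blast
    moreover have "?p u \<odot>\<^bsub>Q\<^esub> (?p (e \<ominus> j) \<odot>\<^bsub>Q\<^esub> x) = ?p e \<odot>\<^bsub>Q\<^esub> x"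
      using Q.smult_assoc[OF pc[OF u(1)] pc[OF ej(1)] x(1)] ph(2)[OF u(1) ej(1)] u(2) by simp
    ultimately show False using x by simp
  qed
  then obtain u where u: "u \<in> carrier A" "e = u \<otimes> a" using jac_mem[OF e(1) a(1,2)] by (auto elim: lprincE)
  \<comment> \<open>Since \<open>k x\<close> is the class of \<open>a\<close> and
    \<open>e = u \<otimes> a\<close>, this is a preimage of the class of \<open>e\<close> under
    \<open>k\<close>; multiplication \<open>y \<mapsto> y z\<close> is then a section of
    \<open>k\<close>.\<close>
  define z where "z = ?p e \<odot>\<^bsub>Q\<^esub> (?p u \<odot>\<^bsub>Q\<^esub> x)"
  have z: "z \<in> carrier Q" using pe pc[OF u(1)] x(1) by (simp add: z_def)
  have kz: "k z = ?p e"
  proof -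
    have "k (?p u \<odot>\<^bsub>Q\<^esub> x) = ?p e" using kD(3)[OF pc[OF u(1)] x(1)] a(3) ph(2)[OF u(1) a(1)] u(2) by simp
    then show ?thesis unfolding z_def using kD(3)[OF pe(1)] pc[OF u(1)] x(1) pe(2) by simp
  qed
  have kg: "k (y \<odot>\<^bsub>Q\<^esub> z) = y" if "y \<in> lprinc ?B (?p e)" for y
    using kD(3)[OF Yc(1)[OF that] z] kz Yc(2)[OF that] by simp
  have "internal_direct_sum ?B Q ((\<lambda>y. y \<odot>\<^bsub>Q\<^esub> z) ` carrier ?Y) {w \<in> carrier Q. k w = \<zero>\<^bsub>?Y\<^esub>}"
    using kg by (intro Q.retract_split[OF Y.left_module_axioms cyc[OF z] k(1)]) simp
  moreover have k0: "k \<zero>\<^bsub>Q\<^esub> = \<zero>\<^bsub>?B\<^esub>"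
    using kD(3)[of "\<zero>\<^bsub>?B\<^esub>" "\<zero>\<^bsub>Q\<^esub>"] Yc(1)[OF kD(1)[of "\<zero>\<^bsub>Q\<^esub>"]] by simp
  moreover have "(\<lambda>y. y \<odot>\<^bsub>Q\<^esub> z) ` carrier ?Y \<noteq> {\<zero>\<^bsub>Q\<^esub>}"
  proof
    assume "(\<lambda>y. y \<odot>\<^bsub>Q\<^esub> z) ` carrier ?Y = {\<zero>\<^bsub>Q\<^esub>}"
    then have "?p e \<odot>\<^bsub>Q\<^esub> z = \<zero>\<^bsub>Q\<^esub>" using eY by auto
    then have "?p e = \<zero>\<^bsub>?B\<^esub>" using kg[OF eY] k0 by simp
    then show False using x ND(2) by simp
  qed
  ultimately have "{w \<in> carrier Q. k w = \<zero>\<^bsub>?Y\<^esub>} = {\<zero>\<^bsub>Q\<^esub>}" and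
    sum: "(\<lambda>y. y \<odot>\<^bsub>Q\<^esub> z) ` carrier ?Y <+>\<^bsub>Q\<^esub> {w \<in> carrier Q. k w = \<zero>\<^bsub>?Y\<^esub>} = carrier Q"
    using Q(1) unfolding indecomposable_def internal_direct_sum_def by blast+
  then have onto: "(\<lambda>y. y \<odot>\<^bsub>Q\<^esub> z) ` carrier ?Y = carrier Q"
    using Yc z unfolding set_eq_iff mem_set_add by (auto simp: image_iff)
  define g where "g y = ?p y \<odot>\<^bsub>Q\<^esub> z" for y
  have Ac: "y \<in> carrier A" "y \<otimes> e = y" if "y \<in> lprinc A e" for y using that e' by (auto simp: lprinc_idem)
  have pY: "?p ` lprinc A e = lprinc ?B (?p e)"
  proof -
    have "?p ` lprinc A e = (\<lambda>a. ?p a \<otimes>\<^bsub>?B\<^esub> ?p e) ` carrier A"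
      unfolding lprinc_def image_image using ph(2) e'(1) by (intro image_cong) simp_all
    also have "\<dots> = lprinc ?B (?p e)" unfolding lprinc_def p(1)[symmetric] image_image ..
    finally show ?thesis .
  qed
  have "semi_epi A ?B (sub (regular_module A) (lprinc A e)) Q ?p g"
  proof (intro semi_epi.intro)
    show "left_module A (sub (regular_module A) (lprinc A e))" by (rule sub_regular_left_module) (use e' in simp)
    show "left_module ?B Q" by (rule Q.left_module_axioms)
    show "?p ` carrier A = carrier ?B" by (rule p(1))
    have "g ` lprinc A e = (\<lambda>y. y \<odot>\<^bsub>Q\<^esub> z) ` (?p ` lprinc A e)" unfolding g_def image_image ..
    then show "g ` carrier (sub (regular_module A) (lprinc A e)) = carrier Q" using onto pY by simp
  qed (use Ac ph(2,3) pc z in \<open>auto simp: g_def Q.smult_l_distr Q.smult_assoc\<close>)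
  moreover have "g y = \<zero>\<^bsub>Q\<^esub> \<longleftrightarrow> y \<in> I" if y: "y \<in> lprinc A e" for y
  proof
    assume "g y = \<zero>\<^bsub>Q\<^esub>"
    moreover have "?p y \<in> lprinc ?B (?p e)" using pY y by blast
    ultimately have "?p y = \<zero>\<^bsub>?B\<^esub>" using kg[of "?p y"] k0 by (simp add: g_def)
    then show "y \<in> I" using I.quotient_map_zero Ac[OF y] by blast
  next
    assume "y \<in> I"
    then have "?p y = \<zero>\<^bsub>?B\<^esub>" using I.quotient_map_zero Ac[OF y] by blast
    then show "g y = \<zero>\<^bsub>Q\<^esub>" using z by (simp add: g_def)
  qed
  ultimately show ?thesis using e(1) by blast
qed

text \<open>\<open>least\<close> and \<open>uni\<close> are hypotheses so that the result can be
  applied to \<open>A\<close> and to its opposite, where they have different proofs. Let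
  \<open>Q\<close> be a quotient of \<open>A e\<close>. A nonzero kernel leaves length at most
  three, and \<open>short_local_astride\<close> applies. If the kernel is zero, \<open>Q\<close> is
  isomorphic to \<open>A e\<close>, so it is biserial and local; were it colocal, then, as
  \<open>I e = 0\<close>, \<open>uni\<close> would make it uniserial.\<close>

theorem quotient_projective:
  fixes Q :: "'a set cmod"
  assumes I: "ideal I A"
    and least: "\<And>e Z x. primitive A e \<Longrightarrow> lideal A Z \<Longrightarrow> Z \<subseteq> lprinc A e \<Longrightarrow> Z \<noteq> {\<zero>} \<Longrightarrow> x \<in> I \<Longrightarrow> x \<otimes> e \<in> Z"
    and uni: "\<And>e S N K. primitive A e \<Longrightarrow> (\<And>x. x \<in> I \<Longrightarrow> x \<otimes> e = \<zero>) \<Longrightarrow> smallest_lideal A S (lprinc A e) \<Longrightarrow>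
      lideal A N \<Longrightarrow> N \<subseteq> lprinc A e \<Longrightarrow> lideal A K \<Longrightarrow> K \<subseteq> lprinc A e \<Longrightarrow> N \<subseteq> K \<or> K \<subseteq> N"
    and bis: "\<And>Q :: 'a cmod. indecomposable A Q \<Longrightarrow> projective A Q \<Longrightarrow> \<not> uniserial A Q \<Longrightarrow> biserial_module A Q"
    and quad: "\<And>Q :: 'a cmod. indecomposable A Q \<Longrightarrow> projective A Q \<Longrightarrow> quadri_condition A Q"
    and Q: "indecomposable (A Quot I) Q" "projective (A Quot I) Q"
  shows "quadri_condition (A Quot I) Q" "\<not> uniserial (A Quot I) Q \<Longrightarrow> astride_biserial_module (A Quot I) Q"
proof -
  let ?B = "A Quot I" and ?p = "\<lambda>a. I +>\<^bsub>A\<^esub> a"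
  obtain e g where e: "primitive A e" and g: "semi_epi A ?B (sub (regular_module A) (lprinc A e)) Q ?p g"
    and ker: "\<And>x. x \<in> lprinc A e \<Longrightarrow> g x = \<zero>\<^bsub>Q\<^esub> \<longleftrightarrow> x \<in> I" using projective_cover[OF I Q] by blast
  note e' = primitiveD[OF e]
  have Le: "lideal A (lprinc A e)" using e' by simp
  let ?E = "sub (regular_module A) (lprinc A e)"
  interpret g: semi_epi A ?B ?E Q ?p g by (rule g)
  have gker: "g.ker = lprinc A e \<inter> I" using ker by (auto simp: g.ker_def)
  obtain M :: "'a cmod" and t where t: "semi_iso A A ?E M (\<lambda>a. a) t"
    using cmod_copy[OF lprinc_fg[OF e'(1)]] by metis
  note t' = semi_iso_hom[OF t]
  interpret t: semi_iso A A ?E M "\<lambda>a. a" t by (rule t)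
  let ?t = "inv_into (carrier ?E) t"
  interpret ti: semi_iso A A M ?E "\<lambda>a. a" ?t by (rule t'(5))
  have M: "indecomposable A M" "projective A M"
    using t.indecomposable_iso lprinc_indecomposable[OF e] projective_iso[OF t lprinc_projective[OF e'(1,3)]] by auto
  define h where "h x = g (?t x)" for x
  have h: "semi_epi A ?B M Q ?p h" using semi_iso_comp[OF t'(5) g] unfolding h_def .
  interpret h: semi_epi A ?B M Q ?p h by (rule h)
  have Q0: "carrier Q \<noteq> {\<zero>\<^bsub>Q\<^esub>}" using Q(1) by (simp add: indecomposable_def)
  have least_g: "g.ker \<subseteq> Z" if Z: "lideal A Z" "Z \<subseteq> lprinc A e" "Z \<noteq> {\<zero>}" for Z
  proof
    fix x assume "x \<in> g.ker"
    then have x: "x \<in> I" "x \<otimes> e = x" using gker lprinc_idem[OF e'(1,3)] by auto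
    then show "x \<in> Z" using least[OF e Z x(1)] by simp
  qed
  have hker: "h.ker = {x \<in> carrier M. ?t x \<in> g.ker}" using ti.closed by (auto simp: h.ker_def g.ker_def h_def)
  have least_h: "h.ker \<subseteq> N" if N: "submodule N A M" "N \<noteq> {\<zero>\<^bsub>M\<^esub>}" for N
  proof -
    have "submodule (?t ` N) A ?E" by (rule ti.image_submodule[OF N(1)])
    moreover have "?t ` N \<noteq> {\<zero>\<^bsub>?E\<^esub>}" using ti.img_zero[OF N(1)] N(2) by simp
    ultimately have sub: "g.ker \<subseteq> ?t ` N" using least_g submodule_sub_regular_iff[OF Le] by simp
    show ?thesis
    proof
      fix x assume "x \<in> h.ker"
      then have x: "x \<in> carrier M" "?t x \<in> ?t ` N" using hker sub by auto
      then show "x \<in> N" using ti.image_mem_iff[OF N(1) ti.ker_sub[OF N(1)] x(1)] by blast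
    qed
  qed
  have qM: "quadri_condition A M" by (rule quad[OF M])
  show qc: "quadri_condition ?B Q" by (rule quadri_transfer[OF I h least_h Q0 qM])
  assume n: "\<not> uniserial ?B Q"
  \<comment> \<open>The largest proper submodule of \<open>A e\<close>: by \<open>jac_mem\<close> an
    element outside it generates \<open>A e\<close>. Its image shows that \<open>Q\<close> is
    local.\<close>
  define J where "J = {x \<in> lprinc A e. x \<in> jac A}"
  have "largest_proper_submodule J A ?E" unfolding largest_proper_submodule_def submodule_sub_regular_iff[OF Le]
  proof (intro conjI allI impI)
    show "lideal A J" unfolding J_def using lideal_Int[OF Le jac_lideal] by (simp add: Int_def)
    show "J \<subseteq> lprinc A e" by (auto simp: J_def)
    have "e \<notin> J" "e \<in> lprinc A e" using primitive_not_jac[OF e] e' by (auto simp: J_def)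
    then show "J \<noteq> carrier ?E" by auto
    fix K assume K: "(lideal A K \<and> K \<subseteq> lprinc A e) \<and> K \<noteq> carrier ?E"
    have "e \<notin> K" using K lprinc_subset[of K e] by auto
    then show "K \<subseteq> J" using K jac_mem[OF e] lprinc_subset[of K] lprinc_idem[OF e'(1,3)]
      unfolding J_def by (auto simp: subset_iff)
  qed
  from g.largest_image[OF this Q0] have R: "largest_proper_submodule (g ` J) ?B Q" .
  obtain n where n4: "n \<le> 4" "has_length A M n" using qM unfolding quadri_condition_def Let_def by blast
  obtain d where d: "smono A M d" "d (carrier M) \<le> n" using t.X.has_length_smono[OF n4(2)] by blast
  note dQ = h.smono_image[OF d(1)]
  show "astride_biserial_module ?B Q"
  proof (cases "h.ker = {\<zero>\<^bsub>M\<^esub>}")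
    case False
    have "d {\<zero>\<^bsub>M\<^esub>} < d h.ker"
      using smonoD[OF d(1) t.X.submodule_zero h.submodule_ker] False t.X.submoduleD(2)[OF h.submodule_ker] by blast
    moreover have "{x \<in> carrier M. h x \<in> carrier Q} = carrier M" using h.closed by auto
    ultimately have "d {x \<in> carrier M. h x \<in> carrier Q} \<le> d {x \<in> carrier M. h x \<in> {\<zero>\<^bsub>Q\<^esub>}} + 3"
      using d(2) n4(1) by (simp add: h.ker_def)
    then show ?thesis using g.X.short_local_astride[OF dQ _ R Q(1) n] by blast
  next
    case True
    interpret hi: semi_iso A ?B M Q ?p h
      using h True h.inj_iff_ker by (intro semi_iso.intro semi_iso_axioms.intro) auto
    have gk: "g.ker = {\<zero>}"
    proof -
      have "x = \<zero>" if x: "x \<in> g.ker" for x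
      proof -
        have xE: "x \<in> carrier ?E" using x by (simp add: gker)
        have "t x \<in> h.ker" using hker t.closed[OF xE] t'(3)[OF xE] x by simp
        then have "t x = t \<zero>\<^bsub>?E\<^esub>" using True t.zero by simp
        then show ?thesis using t.inj xE lidealD(2)[OF Le] by (simp add: inj_on_eq_iff)
      qed
      moreover have "\<zero> \<in> g.ker" using g.M.submoduleD(2)[OF g.submodule_ker] by simp
      ultimately show ?thesis by blast
    qed
    interpret gi: semi_iso A ?B ?E Q ?p g
      using g gk g.inj_iff_ker by (intro semi_iso.intro semi_iso_axioms.intro) auto
    have "biserial_module A M" using bis[OF M] n hi.uniserial_iso by blast
    then have "biserial_module ?B Q" by (rule hi.biserial_iso)
    moreover have "local_module ?B Q" by (rule g.X.local_largest(1)[OF R])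
    moreover have "\<not> colocal_module ?B Q"
    proof
      assume "colocal_module ?B Q"
      then have sm: "smallest_nonzero_submodule (socle ?B Q) ?B Q" by (rule g.X.colocal_smallest[OF dQ])
      have "\<Union>{S. submodule S A ?E \<and> simple_module A (sub ?E S)} \<subseteq> carrier ?E" using g.M.submoduleD(1) by blast
      then have s: "submodule (socle A ?E) A ?E" unfolding socle_def by (rule g.M.generated_submodule(1))
      have "smallest_nonzero_submodule (socle A ?E) A ?E" using sm gi.socle_iso gi.smallest_iso[OF s] by simp
      then have "smallest_lideal A (socle A ?E) (lprinc A e)"
        unfolding smallest_nonzero_submodule_def smallest_lideal_def submodule_sub_regular_iff[OF Le] by auto
      moreover have "x \<otimes> e = \<zero>" if "x \<in> I" for x
      proof -
        interpret I: ideal I A by (rule I)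
        have "x \<otimes> e \<in> g.ker" unfolding gker using I.I_r_closed[OF that e'(1)] I.a_Hcarr[OF that] lprincI by blast
        then show ?thesis using gk by blast
      qed
      ultimately have "uniserial A ?E"
        unfolding uniserial_def submodule_sub_regular_iff[OF Le] using uni[OF e] by blast
      then show False using n gi.uniserial_iso by blast
    qed
    ultimately show ?thesis unfolding astride_biserial_module_def by blast
  qed
qed

end

section \<open>Artin algebras\<close>

lemma scalar_left_module:
  assumes "ring R" "ring A" "\<phi> \<in> ring_hom R A"
  shows "left_module R (scalar_module \<phi> A)"
proof -
  interpret R: ring R by fact
  interpret A: ring A by fact
  note h = ring_hom_closed[OF assms(3)] ring_hom_mult[OF assms(3)] ring_hom_add[OF assms(3)] ring_hom_one[OF assms(3)]
  have "abelian_group (scalar_module \<phi> A)"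
    by (rule abelian_groupI) (auto simp: scalar_module_def A.a_ac intro: A.add.l_inv_ex)
  then show ?thesis
    by (intro left_module.intro left_module_axioms.intro R.ring_axioms)
      (auto simp: scalar_module_def h A.l_distr A.r_distr A.m_assoc)
qed

text \<open>Induction on the number of generators: a chain in \<open>Z + Rb\<close> is stationary once its intersections
  with \<open>Z\<close> and the ideals of coefficients of \<open>b\<close> are.\<close>

lemma artinian_dcc:
  fixes X :: "nat \<Rightarrow> 'b set"
  assumes R: "artinian_ring R" and M: "left_module R M" "finitely_generated R M"
    and X: "\<And>n. submodule (X n) R M" "\<And>n. X (Suc n) \<subseteq> X n"
  shows "\<exists>n. X (Suc n) = X n"
proof -
  interpret left_module R M by (rule M(1))
  interpret R: cring R using R by (simp add: artinian_ring_def)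
  have "\<exists>n. \<forall>m\<ge>n. Y m = Y n"
    if "finite S" "S \<subseteq> carrier M" "\<And>n. submodule (Y n) R M" "\<And>n. Y (Suc n) \<subseteq> Y n" "Y 0 \<subseteq> generated_submodule R M S"
    for S and Y :: "nat \<Rightarrow> 'b set"
    using that
  proof (induction S arbitrary: Y rule: finite_induct)
    case empty
    have "Y n = {\<zero>\<^bsub>M\<^esub>}" for n
    proof -
      have "Y n \<subseteq> Y 0" by (rule lift_Suc_antimono_le[of Y]) (use empty.prems(3) in auto)
      then have "Y n \<subseteq> {\<zero>\<^bsub>M\<^esub>}" using empty.prems(4) generated_submodule(3)[OF _ submodule_zero, of "{}"] by blast
      then show ?thesis using submoduleD(2)[OF empty.prems(2)] by blast
    qed
    then show ?case by simp
  next
    case (insert b S)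
    define Z where "Z = generated_submodule R M S"
    have b: "b \<in> carrier M" and S: "S \<subseteq> carrier M" using insert.prems by auto
    have Z: "submodule Z R M" and SZ: "S \<subseteq> Z" unfolding Z_def using generated_submodule[OF S] by auto
    let ?b = "{a \<odot>\<^bsub>M\<^esub> b | a. a \<in> carrier R}"
    have cb: "submodule ?b R M" "b \<in> ?b" using submodule_cyclic[OF b] b by (auto intro!: exI[of _ "\<one>\<^bsub>R\<^esub>"])
    note up = submodule_add_upper[OF Z cb(1)]
    have Y: "Y m \<subseteq> Y n" if "n \<le> m" for n m using lift_Suc_antimono_le[of Y] insert.prems(3) that by blast
    have "generated_submodule R M (insert b S) \<subseteq> Z <+>\<^bsub>M\<^esub> ?b"
      by (rule generated_submodule(3)) (use insert.prems submodule_add[OF Z cb(1)] up SZ cb(2) in auto)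
    then have YZ: "Y n \<subseteq> Z <+>\<^bsub>M\<^esub> ?b" for n using Y[of 0 n] insert.prems(4) by blast
    have "\<exists>n. \<forall>m\<ge>n. Y m \<inter> Z = Y n \<inter> Z"
      by (rule insert.IH[of "\<lambda>n. Y n \<inter> Z"]) (use S Z insert.prems submodule_Int in \<open>auto simp: Z_def\<close>)
    then obtain n1 where n1: "\<And>m. m \<ge> n1 \<Longrightarrow> Y m \<inter> Z = Y n1 \<inter> Z" by blast
    define J where "J n = {a \<in> carrier R. a \<odot>\<^bsub>M\<^esub> b \<in> Y n <+>\<^bsub>M\<^esub> Z}" for n
    have J: "ideal (J n) R" for n
    proof -
      note D = submoduleD[OF submodule_add[OF insert.prems(2)[of n] Z]]
      have "lideal R (J n)" unfolding lideal_def J_def using D b by (auto simp: smult_l_distr smult_assoc)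
      note L = lidealD[OF this]
      have m: "\<ominus>\<^bsub>R\<^esub> x \<in> J n" if "x \<in> J n" for x using A.lideal_minus[OF \<open>lideal R (J n)\<close> that] .
      show ?thesis
      proof (rule idealI)
        show "ring R" by unfold_locales
        show "subgroup (J n) (add_monoid R)" using L m by (intro subgroup.intro) (auto simp: a_inv_def)
        show "a \<otimes>\<^bsub>R\<^esub> x \<in> J n" if "a \<in> J n" "x \<in> carrier R" for a x
          using L(5)[OF that(2,1)] R.m_comm[OF L(3)[OF that(1)] that(2)] by simp
      qed (use L in auto)
    qed
    have "J (Suc n) \<subseteq> J n" for n using insert.prems(3)[of n] by (auto simp: J_def mem_set_add)
    then obtain n2 where n2: "\<And>m. m \<ge> n2 \<Longrightarrow> J m = J n2" using R J unfolding artinian_ring_def by metis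
    have "Y m = Y (max n1 n2)" if m: "m \<ge> max n1 n2" for m
    proof (rule adjoin_eq[OF Z b insert.prems(2) insert.prems(2) Y[OF m] YZ])
      show "Y (max n1 n2) \<inter> Z \<subseteq> Y m" using n1[of m] n1[of "max n1 n2"] m by auto
      show "a \<odot>\<^bsub>M\<^esub> b \<in> Y m <+>\<^bsub>M\<^esub> Z" if "a \<in> carrier R" "a \<odot>\<^bsub>M\<^esub> b \<in> Y (max n1 n2) <+>\<^bsub>M\<^esub> Z" for a
        using n2[of m] n2[of "max n1 n2"] m that by (auto simp: J_def)
    qed
    then show ?case by blast
  qed
  moreover obtain S where "finite S" "S \<subseteq> carrier M" "generated_submodule R M S = carrier M"
    using M(2) unfolding finitely_generated_def by blast
  ultimately have "\<exists>n. \<forall>m\<ge>n. X m = X n" using X submoduleD(1)[OF X(1)[of 0]] by metis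
  then show ?thesis by (meson le_Suc_eq order_refl)
qed

text \<open>Condition (1) is stated for modules of type \<open>cmod\<close>; it reaches
  \<open>A e\<close> through a copy, and \<open>has_length_smono\<close> turns the composition
  series into a length function.\<close>

lemma (in ring) quadri_length:
  assumes quad: "\<And>Q :: 'a cmod. indecomposable R Q \<Longrightarrow> projective R Q \<Longrightarrow> quadri_condition R Q"
    and e: "primitive R e"
  shows "\<exists>d. lmono R (lprinc R e) d \<and> d (lprinc R e) \<le> 4"
proof -
  let ?E = "sub (regular_module R) (lprinc R e)"
  note e' = primitiveD[OF e]
  obtain M :: "'a cmod" and t where t: "semi_iso R R ?E M (\<lambda>a. a) t"
    using cmod_copy[OF lprinc_fg[OF e'(1)]] by metis
  interpret t: semi_iso R R ?E M "\<lambda>a. a" t by (rule t)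
  have "indecomposable R M" "projective R M"
    using t.indecomposable_iso lprinc_indecomposable[OF e] projective_iso[OF t lprinc_projective[OF e'(1,3)]] by auto
  then obtain n where n: "n \<le> 4" "has_length R M n" using quad unfolding quadri_condition_def Let_def by blast
  then have "has_length R ?E n" using t.has_length_iso by simp
  then obtain d where d: "smono R ?E d" "d (lprinc R e) \<le> n" using t.M.has_length_smono by fastforce
  have L: "lideal R (lprinc R e)" using e' by simp
  have "lmono R (lprinc R e) d"
    using d(1) unfolding lmono_def smono_def submodule_sub_regular_iff[OF L] by blast
  then show ?thesis using d n by (meson le_trans)
qed

text \<open>The scalars are the image of the base ring. Scalar submodules are then submodules over
  the base ring, and finite generation over an artinian ring yields the chain condition.\<close>

lemma qring_quadri:
  fixes A :: "('a, 'x) ring_scheme"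
  assumes "artin_algebra R \<phi> A"
    and "\<And>B (Q :: 'a cmod). B \<in> {A, opposite_ring A} \<Longrightarrow> indecomposable B Q \<Longrightarrow> projective B Q \<Longrightarrow> quadri_condition B Q"
  shows "qring A (\<phi> ` carrier R)"
proof -
  have A: "artinian_ring R" "ring A" "\<phi> \<in> ring_hom R A" "finitely_generated R (scalar_module \<phi> A)"
    "\<And>r x. r \<in> carrier R \<Longrightarrow> x \<in> carrier A \<Longrightarrow> \<phi> r \<otimes>\<^bsub>A\<^esub> x = x \<otimes>\<^bsub>A\<^esub> \<phi> r"
    using assms(1) by (auto simp: artin_algebra_def)
  interpret ring A by (rule A(2))
  interpret op: ring "opposite_ring A" by (rule ring_opposite[OF A(2)])
  interpret R: ring R using A(1) by (auto simp: artinian_ring_def cring_def)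
  have M: "left_module R (scalar_module \<phi> A)" by (rule scalar_left_module[OF R.ring_axioms A(2,3)])
  show ?thesis
  proof (intro qring.intro qring_axioms.intro A(2))
    show "\<phi> ` carrier R \<subseteq> carrier A" using ring_hom_closed[OF A(3)] by blast
    show "c \<otimes>\<^bsub>A\<^esub> x = x \<otimes>\<^bsub>A\<^esub> c" if "c \<in> \<phi> ` carrier R" "x \<in> carrier A" for c x using A(5) that by blast
    show "\<exists>n. X (Suc n) = X n"
      if X: "\<And>n. scalar_submodule A (\<phi> ` carrier R) (X n)" "\<And>n. X (Suc n) \<subseteq> X n" for X :: "nat \<Rightarrow> 'a set"
    proof (rule artinian_dcc[OF A(1) M A(4), of X])
      show "submodule (X n) R (scalar_module \<phi> A)" for n
        using X(1)[of n] unfolding left_module.submodule_iff[OF M] scalar_submodule_def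
        by (auto simp: scalar_module_def)
    qed (rule X(2))
    show "\<exists>d. lmono A (lprinc A e) d \<and> d (lprinc A e) \<le> 4" if "primitive A e" for e
      by (rule quadri_length[OF _ that]) (use assms(2) in blast)
    show "\<exists>d. lmono (opposite_ring A) (rprinc A e) d \<and> d (rprinc A e) \<le> 4" if "primitive A e" for e
      by (rule op.quadri_length) (use assms(2) that primitive_opposite in auto)
  qed
qed

text \<open>An equality of records: right modules over the quotient are literally left modules over
  the quotient of the opposite ring, to which \<open>quotient_projective\<close> can be
  applied.\<close>

lemma opposite_quotient: "opposite_ring A Quot I = opposite_ring (A Quot I)"
proof -
  have "rcoset_mult (opposite_ring A) I X Y = rcoset_mult A I Y X" for X Y
    by (auto simp: rcoset_mult_def a_r_coset_def opposite_ring_def r_coset_def)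
  then show ?thesis by (simp add: FactRing_def opposite_ring_def fun_eq_iff A_RCOSETS_def RCOSETS_def r_coset_def
        a_r_coset_def set_add_def set_mult_def)
qed

lemma artin_algebra_quotient:
  assumes A: "artin_algebra R \<phi> A" and I: "ideal I A"
  shows "artin_algebra R (\<lambda>r. I +>\<^bsub>A\<^esub> \<phi> r) (A Quot I)"
proof -
  have A': "artinian_ring R" "ring A" "\<phi> \<in> ring_hom R A" "finitely_generated R (scalar_module \<phi> A)"
    "\<And>r x. r \<in> carrier R \<Longrightarrow> x \<in> carrier A \<Longrightarrow> \<phi> r \<otimes>\<^bsub>A\<^esub> x = x \<otimes>\<^bsub>A\<^esub> \<phi> r"
    using A by (auto simp: artin_algebra_def)
  interpret I: ideal I A by (rule I)
  interpret R: ring R using A'(1) by (auto simp: artinian_ring_def cring_def)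
  note p = I.quotient_map and h = ring_hom_closed[OF A'(3)]
  note ph = ring_hom_mult[OF p(2)] ring_hom_add[OF p(2)]
  have q: "(\<lambda>r. I +>\<^bsub>A\<^esub> \<phi> r) \<in> ring_hom R (A Quot I)"
    using ring_hom_trans[OF A'(3) p(2)] by (simp add: comp_def)
  interpret s: semi_epi R R "scalar_module \<phi> A" "scalar_module (\<lambda>r. I +>\<^bsub>A\<^esub> \<phi> r) (A Quot I)" "\<lambda>a. a" "\<lambda>a. I +>\<^bsub>A\<^esub> a"
    using scalar_left_module[OF R.ring_axioms A'(2,3)] scalar_left_module[OF R.ring_axioms p(3) q] p(1) h
    by (intro semi_epi.intro) (auto simp: scalar_module_def ph)
  have "(I +>\<^bsub>A\<^esub> \<phi> r) \<otimes>\<^bsub>A Quot I\<^esub> y = y \<otimes>\<^bsub>A Quot I\<^esub> (I +>\<^bsub>A\<^esub> \<phi> r)"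
    if r: "r \<in> carrier R" and y: "y \<in> carrier (A Quot I)" for r y
  proof -
    obtain x where "x \<in> carrier A" "y = I +>\<^bsub>A\<^esub> x" using y unfolding p(1)[symmetric] by (rule imageE)
    then show ?thesis using ph(1)[of "\<phi> r" x] ph(1)[of x "\<phi> r"] h[OF r] A'(5)[OF r] by simp
  qed
  then show ?thesis
    using A'(1) p(3) q s.finitely_generated_image[OF A'(4)] by (simp add: artin_algebra_def)
qed

section \<open>The quotient by the socle of the maximal injective summand\<close>

context proj_inj
begin

text \<open>For each primitive \<open>e\<close> outside \<open>soc\<close> the left ideal of all
  \<open>c\<close> with \<open>c \<otimes> e\<close> radical is maximal and contains
  \<open>soc\<close>, so it passes to a maximal left ideal of the quotient. A lift \<open>a\<close>
  of a radical element therefore has \<open>a \<otimes> e\<close> radical for these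
  \<open>e\<close>, while \<open>a \<otimes> e \<in> soc\<close> for the others; together
  \<open>a\<close> lies in \<open>jac A + soc\<close>.\<close>

lemma radical_quotient:
  assumes b: "b \<in> radical (A Quot soc) (regular_module (A Quot soc))"
  shows "\<exists>j\<in>jac A. b = soc +>\<^bsub>A\<^esub> j"
proof -
  interpret I: ideal soc A by (rule soc_ideal)
  let ?B = "A Quot soc" and ?p = "\<lambda>a. soc +>\<^bsub>A\<^esub> a"
  note p = I.quotient_map
  note ph = ring_hom_mult[OF p(2)] ring_hom_add[OF p(2)]
  interpret q: semi_epi A ?B "regular_module A" "regular_module ?B" ?p ?p
    using regular_left_module' regular_left_module[OF p(3)] p(1) by (intro semi_epi.intro) (auto simp: ph)
  obtain a where a: "a \<in> carrier A" "b = ?p a" using b unfolding radical_def regular_module_simps p(1)[symmetric] by auto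
  have qk: "q.ker = soc"
    unfolding q.ker_def regular_module_simps using I.quotient_map_zero I.a_Hcarr by blast
  have L: "lideal A (jac A <+>\<^bsub>A\<^esub> soc)" by (rule lideal_add[OF jac_lideal soc_lideal(1)])
  note up = lideal_add_upper[OF jac_lideal soc_lideal(1)]
  have "a \<in> jac A <+>\<^bsub>A\<^esub> soc"
  proof (rule decomp_right[OF a(1) lidealD(2,4)[OF L]])
    fix e assume e: "primitive A e"
    note e' = primitiveD[OF e]
    show "a \<otimes> e \<in> jac A <+>\<^bsub>A\<^esub> soc"
    proof (cases "e \<in> soc")
      case True
      then show ?thesis using I.I_l_closed a(1) up by blast
    next
      case False
      define N where "N = {c \<in> carrier A. c \<otimes> e \<in> jac A}"
      have unit: "\<exists>u\<in>carrier A. e = u \<otimes> (c \<otimes> e)" if c: "c \<in> carrier A" "c \<otimes> e \<notin> jac A" for c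
        using jac_mem[OF e, of "c \<otimes> e"] c e' by (auto simp: m_assoc elim!: lprincE)
      have N: "lideal A N" unfolding lideal_def N_def using e' lidealD[OF jac_lideal]
        by (auto simp: l_distr m_assoc)
      have kN: "q.ker \<subseteq> N"
      \<comment> \<open>If \<open>x \<otimes> e\<close> were not radical for some
        \<open>x \<in> soc\<close>, then \<open>e\<close> would be a left multiple of
        \<open>x \<otimes> e\<close> and lie in the ideal \<open>soc\<close>.\<close>
      proof
        fix x assume "x \<in> q.ker"
        then have x: "x \<in> soc" "x \<in> carrier A" using qk I.a_Hcarr by auto
        have "x \<otimes> e \<in> jac A"
        proof (rule ccontr)
          assume "x \<otimes> e \<notin> jac A"
          then obtain u where "u \<in> carrier A" "e = u \<otimes> (x \<otimes> e)" using unit x(2) by blast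
          then show False using False I.I_l_closed[OF I.I_r_closed[OF x(1) e'(1)], of u] by simp
        qed
        then show "x \<in> N" using x by (simp add: N_def)
      qed
      have "maximal_submodule N A (regular_module A)" unfolding maximal_submodule_def submodule_regular_iff
      proof (intro conjI allI impI)
        show "lideal A N" by (rule N)
        have "\<one> \<notin> N" using primitive_not_jac[OF e] e' by (simp add: N_def)
        then show "N \<noteq> carrier (regular_module A)" by auto
        fix K assume K: "lideal A K \<and> N \<subseteq> K"
        show "K = N \<or> K = carrier (regular_module A)"
        proof (rule disjCI)
          assume n: "K \<noteq> carrier (regular_module A)"
          have "c \<in> N" if c: "c \<in> K" for c
          proof (rule ccontr)
            assume "c \<notin> N"
            have cc: "c \<in> carrier A" using K lidealD(3)[of A K] c by blast
            then have "c \<otimes> e \<notin> jac A" using \<open>c \<notin> N\<close> by (simp add: N_def)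
            then obtain u where u: "u \<in> carrier A" "e = u \<otimes> (c \<otimes> e)" using unit cc by blast
            have "\<one> \<ominus> u \<otimes> c \<in> N"
            proof -
              have "(\<one> \<ominus> u \<otimes> c) \<otimes> e = e \<ominus> u \<otimes> (c \<otimes> e)" using u(1) cc e' by (simp add: minus_distrib m_assoc)
              also have "\<dots> = \<zero>" using u(2) e' by (simp add: diff_self)
              finally show ?thesis using lidealD(2)[OF jac_lideal] u(1) cc by (simp add: N_def)
            qed
            then have "(\<one> \<ominus> u \<otimes> c) \<oplus> u \<otimes> c \<in> K"
              using K lidealD(4)[of A K] lidealD(5)[of A K u c] u(1) c by blast
            then have "\<one> \<in> K" using u(1) cc by (simp add: diff_add_cancel)
            then have "carrier A \<subseteq> K" using K lidealD(5)[of A K _ \<one>] by (metis r_one subsetI)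
            then show False using n K lidealD(1)[of A K] by auto
          qed
          then show "K = N" using K by blast
        qed
      qed
      then have "maximal_submodule (?p ` N) ?B (regular_module ?B)"
        using q.maximal_image_iff[of N] N kN submodule_regular_iff by simp
      then have "?p a \<in> ?p ` N" using b a(2) unfolding radical_def by blast
      then have "a \<in> N" using q.image_mem_iff[of N a] N kN submodule_regular_iff a(1) by simp
      then show ?thesis using up by (auto simp: N_def)
    qed
  qed
  then obtain j s where js: "j \<in> jac A" "s \<in> soc" "a = j \<oplus> s" by (auto simp: mem_set_add)
  have "?p s = \<zero>\<^bsub>?B\<^esub>" using I.quotient_map_zero js(2) I.a_Hcarr by blast
  then have "?p a = ?p j"
    using js ph(2)[of j s] I.a_Hcarr[OF js(2)] jac_carrier[OF js(1)] ring_hom_closed[OF p(2), of j]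
      ring.ring_simprules(15)[OF p(3)] by simp
  then show ?thesis using js(1) a(2) by blast
qed

lemma radical_cubed_quotient: "radical_cubed_zero (A Quot soc)"
proof -
  interpret I: ideal soc A by (rule soc_ideal)
  let ?B = "A Quot soc" and ?p = "\<lambda>a. soc +>\<^bsub>A\<^esub> a"
  note p = I.quotient_map
  note ph = ring_hom_mult[OF p(2)] ring_hom_add[OF p(2)]
  interpret B: ring ?B by (rule p(3))
  interpret M: left_module ?B "regular_module ?B" by (rule regular_left_module[OF p(3)])
  define J where "J = radical ?B (regular_module ?B)"
  have J0: "\<zero>\<^bsub>?B\<^esub> \<in> J" using M.submoduleD(2)[OF M.submodule_radical] by (simp add: J_def)
  have J: "\<exists>j\<in>jac A. b = ?p j" if "b \<in> J" for b using radical_quotient that by (simp add: J_def)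
  have jc: "j \<in> carrier A" if "j \<in> jac A" for j using that jac_carrier by blast
  \<comment> \<open>Products of ideals are closed under sums, so a lift need not be a single product
    of two radical elements. The property recorded here is additive and is what the third radical
    factor requires, by \<open>jac_cubed_soc\<close>.\<close>
  have J2: "\<exists>c\<in>carrier A. b = ?p c \<and> (\<forall>z\<in>jac A. c \<otimes> z \<in> soc)" if "b \<in> ideal_prod ?B J J" for b
    using that
  proof (induction rule: ideal_prod.induct)
    case (prod i j)
    obtain x y where "x \<in> jac A" "i = ?p x" "y \<in> jac A" "j = ?p y" using J prod by blast
    then show ?case using ph(1)[of x y] jc jac_cubed_soc by (intro bexI[of _ "x \<otimes> y"]) auto
  next
    case (sum s t)
    obtain x y where "x \<in> carrier A" "s = ?p x" "\<forall>z\<in>jac A. x \<otimes> z \<in> soc"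
      "y \<in> carrier A" "t = ?p y" "\<forall>z\<in>jac A. y \<otimes> z \<in> soc" using sum.IH by blast
    then show ?case using ph(2)[of x y] jc lidealD(4)[OF soc_lideal(1)]
      by (intro bexI[of _ "x \<oplus> y"]) (auto simp: l_distr)
  qed
  have "b = \<zero>\<^bsub>?B\<^esub>" if "b \<in> ideal_prod ?B (ideal_prod ?B J J) J" for b
    using that
  proof (induction rule: ideal_prod.induct)
    case (prod i j)
    obtain c where c: "c \<in> carrier A" "i = ?p c" "\<forall>z\<in>jac A. c \<otimes> z \<in> soc" using J2[OF prod(1)] by blast
    obtain z where z: "z \<in> jac A" "j = ?p z" using J[OF prod(2)] by blast
    show ?case using ph(1)[OF c(1) jc[OF z(1)]] c z I.quotient_map_zero[of "c \<otimes> z"] jc[OF z(1)] by simp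
  qed simp
  moreover have "\<zero>\<^bsub>?B\<^esub> \<in> ideal_prod ?B (ideal_prod ?B J J) J"
    using ideal_prod.prod[OF ideal_prod.prod[OF J0 J0, of ?B] J0, of ?B] by simp
  ultimately show ?thesis unfolding radical_cubed_zero_def Let_def J_def[symmetric] by blast
qed

lemma quotient_quadri_string:
  assumes bis: "\<And>B (Q :: 'a cmod). B \<in> {A, opposite_ring A} \<Longrightarrow> indecomposable B Q \<Longrightarrow> projective B Q \<Longrightarrow>
      \<not> uniserial B Q \<Longrightarrow> biserial_module B Q"
    and quad: "\<And>B (Q :: 'a cmod). B \<in> {A, opposite_ring A} \<Longrightarrow> indecomposable B Q \<Longrightarrow> projective B Q \<Longrightarrow>
      quadri_condition B Q"
    and B: "B \<in> {A Quot soc, opposite_ring (A Quot soc)}"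
    and Q: "indecomposable B (Q :: 'a set cmod)" "projective B Q"
  shows "quadri_condition B Q" "\<not> uniserial B Q \<Longrightarrow> astride_biserial_module B Q"
proof -
  interpret op: qring "opposite_ring A" C by (rule qring_opposite)
  have opI: "ideal soc (opposite_ring A)"
  proof (rule idealI)
    interpret I: ideal soc A by (rule soc_ideal)
    show "ring (opposite_ring A)" by unfold_locales
    show "subgroup soc (add_monoid (opposite_ring A))" using I.a_subgroup
      by (simp add: opposite_ring_def)
    show "a \<in> soc \<Longrightarrow> x \<in> carrier (opposite_ring A) \<Longrightarrow> x \<otimes>\<^bsub>opposite_ring A\<^esub> a \<in> soc" for a x
      using I.I_r_closed by simp
    show "a \<in> soc \<Longrightarrow> x \<in> carrier (opposite_ring A) \<Longrightarrow> a \<otimes>\<^bsub>opposite_ring A\<^esub> x \<in> soc" for a x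
      using I.I_l_closed by simp
  qed
  have 1: "quadri_condition B Q \<and> (\<not> uniserial B Q \<longrightarrow> astride_biserial_module B Q)" if B: "B = A Quot soc"
    using quotient_projective[OF soc_ideal soc_left_smallest soc_left_uniserial _ _ Q[unfolded B]] bis quad
    unfolding B by simp
  \<comment> \<open>The right-hand case: the same theorem in the opposite ring, with the right-hand
    facts about \<open>soc\<close> in place of the left-hand ones.\<close>
  have 2: "quadri_condition B Q \<and> (\<not> uniserial B Q \<longrightarrow> astride_biserial_module B Q)" if B: "B = opposite_ring A Quot soc"
    using op.quotient_projective[OF opI _ _ _ _ Q[unfolded B]] soc_right_smallest soc_right_uniserial primitive_opposite bis quad
    unfolding B by simp
  show "quadri_condition B Q" "\<not> uniserial B Q \<Longrightarrow> astride_biserial_module B Q"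
    using 1 2 B unfolding opposite_quotient[symmetric] by auto
qed

end

theorem proposition4p3p2:
  fixes R :: "'r ring" and \<phi> :: "'r \<Rightarrow> 'a" and A :: "'a ring" and P L :: "'a set"
  assumes "quadri_biserial_algebra R \<phi> A"
    and "connected_algebra A"
    and "\<not> simple_algebra A"
    and "internal_direct_sum A (regular_module A) P L"
    and "maximal_injective_summand A P"
  shows "let socP = socle A (sub (regular_module A) P) in
    ideal socP A \<and>
    quadri_string_algebra R (\<lambda>r. socP +>\<^bsub>A\<^esub> \<phi> r) (A Quot socP) \<and>
    radical_cubed_zero (A Quot socP) \<and>
    (\<forall>M :: ('a, 'm) module.
      fg_module A M \<and> indecomposable A M \<and> \<not> (projective A M \<and> injective A M) \<longrightarrow>
      annihilates socP M)"
proof -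
  let ?S = "socle A (sub (regular_module A) P)"
  let ?B = "A Quot ?S"
  have alg: "artin_algebra R \<phi> A"
    and bis: "\<And>B (Q :: 'a cmod). B \<in> {A, opposite_ring A} \<Longrightarrow> indecomposable B Q \<Longrightarrow> projective B Q \<Longrightarrow>
      \<not> uniserial B Q \<Longrightarrow> biserial_module B Q"
    and quad: "\<And>B (Q :: 'a cmod). B \<in> {A, opposite_ring A} \<Longrightarrow> indecomposable B Q \<Longrightarrow> projective B Q \<Longrightarrow>
      quadri_condition B Q"
    using assms(1) unfolding quadri_biserial_algebra_def biserial_algebra_def by blast+
  have "qring A (\<phi> ` carrier R)" by (rule qring_quadri[OF alg]) (rule quad)
  then interpret proj_inj A "\<phi> ` carrier R" P L
    by (intro proj_inj.intro proj_inj_axioms.intro assms(4,5))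
  note str = quotient_quadri_string[OF bis quad, unfolded soc_def]
  have "quadri_string_algebra R (\<lambda>r. ?S +>\<^bsub>A\<^esub> \<phi> r) ?B"
    unfolding quadri_string_algebra_def string_algebra_def
    using artin_algebra_quotient[OF alg soc_ideal[unfolded soc_def]] str by blast
  then show ?thesis
    unfolding Let_def using soc_ideal radical_cubed_quotient soc_annihilates unfolding soc_def by blast
qed

end
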